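(* Let $\mathbb{G}$ be a locally compact quantum group of Kac type such that $\widehat{\mathbb{G}}$ is co-amenable and the left Haar weight $\varphi$ of $\mathbb{G}$ is tracial. Suppose that the net $(\xi_j)_j$ of unit vectors in $L^2(\mathbb{G})$ coming from the definition of co-amenability of $\widehat{\mathbb{G}}$, i.e. satisfying $$\lim_j\big\|\widehat{W}(\xi_j\otimes\xi)-\xi_j\otimes\xi\big\|_{L^2(\mathbb{G})\otimes L^2(\mathbb{G})}=0\quad\text{for every }\xi\in L^2(\mathbb{G}),$$ is chosen such that $(\xi_j)_j\subseteq\mathfrak{n}_\varphi\cap Z(L^\infty(\mathbb{G}))$, where $Z(\cdot)$ denotes the center. Then for any completely bounded representation $\pi:L^1(\mathbb{G})\to B(H_\pi)$ there exists an invertible $T\in B(H_\pi)$ such that (a) $T\circ\pi(\cdot)\circ T^{-1}$ is a $*$-representation, and (b) $\|T\|\,\|T^{-1}\|\le\|\pi\|_{cb}^4$.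
   Context: A locally compact quantum group $\mathbb{G}$ (in the sense of Kustermans-Vaes) is a von Neumann algebra $L^\infty(\mathbb{G})$ with a unital normal coassociative $*$-homomorphism $\Delta:L^\infty(\mathbb{G})\to L^\infty(\mathbb{G})\overline{\otimes}L^\infty(\mathbb{G})$ and left and right Haar weights $\varphi,\psi$. $L^1(\mathbb{G})=L^\infty(\mathbb{G})_*$ is a completely contractive Banach algebra under convolution $w_1\star w_2=(w_1\otimes w_2)\circ\Delta$. $L^2(\mathbb{G})$ is the GNS space of $\varphi$; $\mathfrak{n}_\varphi=\{x\in L^\infty(\mathbb{G}):\varphi(x^*x)<\infty\}$ is regarded as a subspace of $L^2(\mathbb{G})$ via the GNS map $\Lambda_\varphi$. The fundamental unitary $W$ on $L^2(\mathbb{G})\otimes L^2(\mathbb{G})$ is given by $W^*(\Lambda_\varphi(x)\otimes\Lambda_\varphi(y))=(\Lambda_\varphi\otimes\Lambda_\varphi)(\Delta(y)(x\otimes1))$ and satisfies $\Delta(x)=W^*(1\otimes x)W$. The dual quantum group $\widehat{\mathbb{G}}$ acts on the same Hilbert space, with $C_0(\widehat{\mathbb{G}})=\overline{\{(w\otimes\mathrm{id})W:w\in B(L^2(\mathbb{G}))_*\}}^{\|\cdot\|}$, $L^\infty(\widehat{\mathbb{G}})=C_0(\widehat{\mathbb{G}})''$, fundamental unitary $\widehat{W}=\Sigma W^*\Sigma$ ($\Sigma$ being the tensor flip) and coproduct $\widehat\Delta(x)=\widehat{W}^*(1\otimes x)\widehat{W}$. $\widehat{\mathbb{G}}$ is co-amenable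 if $C_0(\widehat{\mathbb{G}})$ has a co-unit state $\widehat\epsilon$, i.e. $(\mathrm{id}\otimes\widehat\epsilon)\widehat\Delta=\mathrm{id}_{C_0(\widehat{\mathbb{G}})}$; equivalently, if there is a net of unit vectors $(\xi_j)_j\subseteq L^2(\mathbb{G})$ with $\|\widehat{W}(\xi_j\otimes\xi)-\xi_j\otimes\xi\|\to0$ for every $\xi\in L^2(\mathbb{G})$. $\mathbb{G}$ is of Kac type if its scaling group is trivial and $R\sigma_t=\sigma_{-t}R$, where $R$ is the unitary antipode and $(\sigma_t)_t$ is the modular automorphism group of $\varphi$. Let $S$ be the antipode. $L^1_\sharp(\mathbb{G})$ is the norm-dense subalgebra of those $w\in L^1(\mathbb{G})$ for which there is $w^\sharp\in L^1(\mathbb{G})$ with $\langle w^\sharp,x\rangle=\overline{\langle w,S(x)^*\rangle}$ for all $x\in\mathcal{D}(S)$. A representation $\pi:L^1(\mathbb{G})\to B(H_\pi)$ is an algebra homomorphism ($H_\pi$ a Hilbert space); it is a $*$-representation if its restriction to $L^1_\sharp(\mathbb{G})$ is $*$-preserving.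
   Formalization: The representation π is additionally assumed nondegenerate (the span of π(L^1(G))H_π is dense in H_π); without this the claim fails, e.g. for π = 0 on a nonzero H_π, where the bound in (b) would read ‖T‖‖T^{-1}‖ ≤ 0. *)

theory Defs
  imports "HOL-Analysis.Analysis" "HOL-Library.Nonpos_Ints"
begin

text \<open>Complex Hilbert spaces; the inner product is linear in the second argument.\<close>

class chilbert = banach +
  fixes scaleC :: "complex \<Rightarrow> 'a \<Rightarrow> 'a" (infixr "*\<^sub>C" 75)
    and cinner :: "'a \<Rightarrow> 'a \<Rightarrow> complex"
  assumes scaleC_add_right: "c *\<^sub>C (x + y) = c *\<^sub>C x + c *\<^sub>C y"
    and scaleC_add_left: "(c + d) *\<^sub>C x = c *\<^sub>C x + d *\<^sub>C x"
    and scaleC_scaleC: "c *\<^sub>C d *\<^sub>C x = (c * d) *\<^sub>C x"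
    and scaleR_scaleC: "r *\<^sub>R x = complex_of_real r *\<^sub>C x"
    and cinner_commute: "cinner x y = cnj (cinner y x)"
    and cinner_add_right: "cinner x (y + z) = cinner x y + cinner x z"
    and cinner_scaleC_right: "cinner x (c *\<^sub>C y) = c * cinner x y"
    and norm_eq_sqrt_cinner: "norm x = sqrt (Re (cinner x x))"

lemma cinner_add_left: "cinner (x + y) z = cinner x z + cinner y z"
  by (metis cinner_add_right cinner_commute complex_cnj_add)

lemma cinner_scaleC_left: "cinner (c *\<^sub>C x) y = cnj c * cinner x y"
  by (metis cinner_commute cinner_scaleC_right complex_cnj_mult)

lemma cinner_scaleR_right: "cinner x (r *\<^sub>R y) = of_real r * cinner x y"
  by (simp add: scaleR_scaleC cinner_scaleC_right)

lemma cinner_scaleR_left: "cinner (r *\<^sub>R x) y = of_real r * cinner x y"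
  by (simp add: scaleR_scaleC cinner_scaleC_left)

lemma cinner_zero_right [simp]: "cinner x 0 = 0"
  using cinner_scaleR_right[of x 0 0] by simp

lemma cinner_zero_left [simp]: "cinner 0 x = 0"
  using cinner_scaleR_left[of 0 0 x] by simp

lemma cinner_minus_right: "cinner x (- y) = - cinner x y"
  using cinner_scaleR_right[of x "-1" y] by simp

lemma cinner_diff_right: "cinner x (y - z) = cinner x y - cinner x z"
  using cinner_add_right[of x y "- z"] by (simp add: cinner_minus_right)

lemma cinner_diff_left: "cinner (x - y) z = cinner x z - cinner y z"
  by (metis cinner_diff_right cinner_commute complex_cnj_diff)

lemma cinner_sum_right: "cinner x (sum f A) = (\<Sum>i\<in>A. cinner x (f i))"
  by (induction A rule: infinite_finite_induct) (simp_all add: cinner_add_right)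

lemma cinner_sum_left: "cinner (sum f A) x = (\<Sum>i\<in>A. cinner (f i) x)"
  by (induction A rule: infinite_finite_induct) (simp_all add: cinner_add_left)

lemma cinner_self: "cinner x x = of_real ((norm x)\<^sup>2)"
proof -
  have "0 \<le> sqrt (Re (cinner x x))" by (metis norm_eq_sqrt_cinner norm_ge_zero)
  then have "(norm x)\<^sup>2 = Re (cinner x x)" by (simp add: norm_eq_sqrt_cinner)
  moreover have "Im (cinner x x) = 0"
    by (metis cinner_commute cnj.simps(2) neg_equal_zero)
  ultimately show ?thesis by (simp add: complex_eq_iff)
qed

lemma cinner_self_eq_0: "cinner x x = 0 \<longleftrightarrow> x = 0"
  by (simp add: cinner_self)

lemma cmod_cinner_le: "cmod (cinner x y) \<le> norm x * norm y"
proof (cases "y = 0")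
  case False
  define c where "c = cinner y x / of_real ((norm y)\<^sup>2)"
  have y: "norm y \<noteq> 0" using False by simp
  have "cinner (x - c *\<^sub>C y) (x - c *\<^sub>C y)
      = cinner x x - c * cinner x y - cnj c * cinner y x + cnj c * c * cinner y y"
    by (simp add: cinner_diff_left cinner_diff_right cinner_scaleC_left cinner_scaleC_right
        algebra_simps)
  also have "\<dots> = of_real ((norm x)\<^sup>2) - of_real ((cmod (cinner x y))\<^sup>2 / (norm y)\<^sup>2)"
  proof -
    have "c * cinner y y = cinner y x"
      using y by (simp add: c_def cinner_self)
    then have "cnj c * c * cinner y y = cnj c * cinner y x"
      by (simp add: mult.assoc)
    moreover have "c * cinner x y = of_real ((cmod (cinner x y))\<^sup>2 / (norm y)\<^sup>2)"
      unfolding c_def of_real_divide complex_norm_square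
      by (simp add: mult.commute cinner_commute[of y x])
    ultimately show ?thesis unfolding cinner_self[of x] by simp
  qed
  finally have "of_real ((norm (x - c *\<^sub>C y))\<^sup>2)
      = (of_real ((norm x)\<^sup>2 - (cmod (cinner x y))\<^sup>2 / (norm y)\<^sup>2) :: complex)"
    by (simp add: cinner_self)
  then have "(norm (x - c *\<^sub>C y))\<^sup>2 = (norm x)\<^sup>2 - (cmod (cinner x y))\<^sup>2 / (norm y)\<^sup>2"
    using of_real_eq_iff by blast
  then have "(cmod (cinner x y))\<^sup>2 / (norm y)\<^sup>2 \<le> (norm x)\<^sup>2"
    by (metis diff_ge_0_iff_ge zero_le_power2)
  then have "(cmod (cinner x y))\<^sup>2 \<le> (norm x * norm y)\<^sup>2"
    using y by (simp add: pos_divide_le_eq power_mult_distrib)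
  then show ?thesis by (rule power2_le_imp_le) simp
qed simp

lemma bounded_linear_cinner_right: "bounded_linear (cinner (x :: 'a :: chilbert))"
  by (rule bounded_linear_intro[where K = "norm x"])
    (use cmod_cinner_le[of x] in \<open>auto simp: cinner_add_right cinner_scaleR_right scaleR_conv_of_real mult.commute\<close>)

definition orthonormal :: "'a::chilbert set \<Rightarrow> bool" where
  "orthonormal B \<longleftrightarrow> (\<forall>e\<in>B. \<forall>f\<in>B. cinner e f = (if e = f then 1 else 0))"

definition is_onb :: "'a::chilbert set \<Rightarrow> bool" where
  "is_onb B \<longleftrightarrow> orthonormal B \<and> (\<forall>x. (\<forall>e\<in>B. cinner e x = 0) \<longrightarrow> x = 0)"

definition onb :: "'a::chilbert set" where
  "onb = (SOME B. is_onb B)"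

lemma is_onb_onb: "is_onb (onb :: 'a::chilbert set)"
proof -
  let ?A = "{B :: 'a set. orthonormal B}"
  have "\<exists>M\<in>?A. \<forall>X\<in>?A. M \<subseteq> X \<longrightarrow> X = M"
  proof (rule subset_Zorn_nonempty)
    show "?A \<noteq> {}" by (auto simp: orthonormal_def intro!: exI[of _ "{}"])
    fix C assume "C \<noteq> {}" and C: "subset.chain ?A C"
    show "\<Union> C \<in> ?A"
      unfolding mem_Collect_eq orthonormal_def
    proof (intro ballI)
      fix e f assume "e \<in> \<Union> C" "f \<in> \<Union> C"
      then obtain E F where EF: "E \<in> C" "F \<in> C" "e \<in> E" "f \<in> F" by auto
      then have "E \<subseteq> F \<or> F \<subseteq> E" using C unfolding subset_chain_def by blast
      then obtain G where "G \<in> C" "e \<in> G" "f \<in> G" using EF by auto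
      then show "cinner e f = (if e = f then 1 else 0)"
        using C unfolding subset_chain_def orthonormal_def by blast
    qed
  qed
  then obtain B :: "'a set" where B: "orthonormal B"
    and max: "\<And>X. orthonormal X \<Longrightarrow> B \<subseteq> X \<Longrightarrow> X = B" by auto
  have "is_onb B" unfolding is_onb_def
  proof (intro conjI allI impI B)
    fix x assume x: "\<forall>e\<in>B. cinner e x = 0"
    show "x = 0"
    proof (rule ccontr)
      assume nz: "x \<noteq> 0"
      define u where "u = (1 / norm x) *\<^sub>R x"
      have u1: "cinner u u = 1"
        using nz by (simp add: u_def cinner_scaleR_left cinner_scaleR_right cinner_self
            power2_eq_square)
      have u0: "cinner e u = 0" "cinner u e = 0" if "e \<in> B" for e
        using that x cinner_commute[of x e]
        by (auto simp: u_def cinner_scaleR_left cinner_scaleR_right)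
      have "orthonormal (insert u B)"
        using B u1 u0 unfolding orthonormal_def by (metis insert_iff)
      then have "u \<in> B" using max[of "insert u B"] by auto
      then show False using u0 u1 by force
    qed
  qed
  then show ?thesis unfolding onb_def by (rule someI)
qed

lemma bessel:
  assumes "orthonormal B" "finite F" "F \<subseteq> B"
  shows "(\<Sum>e\<in>F. (cmod (cinner e x))\<^sup>2) \<le> (norm x)\<^sup>2"
proof -
  define y where "y = (\<Sum>e\<in>F. cinner e x *\<^sub>C e)"
  have o: "cinner e f = (if e = f then 1 else 0)" if "e \<in> F" "f \<in> F" for e f
    using assms that unfolding orthonormal_def by blast
  have ey: "cinner e y = cinner e x" if "e \<in> F" for e
    using that assms(2) by (simp add: y_def cinner_sum_right cinner_scaleC_right o if_distrib cong: if_cong sum.cong)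
  have yx: "cinner y x = of_real (\<Sum>e\<in>F. (cmod (cinner e x))\<^sup>2)"
    by (simp add: y_def cinner_sum_left cinner_scaleC_left complex_norm_square mult.commute del: of_real_power)
  have yy: "cinner y y = of_real (\<Sum>e\<in>F. (cmod (cinner e x))\<^sup>2)"
    by (subst y_def) (simp add: cinner_sum_left cinner_scaleC_left ey complex_norm_square mult.commute del: of_real_power)
  have "cinner (x - y) (x - y) = of_real ((norm x)\<^sup>2 - (\<Sum>e\<in>F. (cmod (cinner e x))\<^sup>2))"
    using cinner_commute[of x y] by (simp add: cinner_diff_left cinner_diff_right yx yy cinner_self[of x])
  then have "(norm (x - y))\<^sup>2 = (norm x)\<^sup>2 - (\<Sum>e\<in>F. (cmod (cinner e x))\<^sup>2)"
    unfolding cinner_self of_real_eq_iff .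
  then show ?thesis by (metis diff_ge_0_iff_ge zero_le_power2)
qed

lemma parseval:
  fixes x y :: "'a::chilbert"
  assumes "is_onb B"
  shows "((\<lambda>e. cnj (cinner e x) * cinner e y) has_sum cinner x y) B"
proof -
  have B: "orthonormal B" using assms unfolding is_onb_def by blast
  have ps: "(norm (\<Sum>e\<in>F. cinner e y *\<^sub>C e))\<^sup>2 = (\<Sum>e\<in>F. (cmod (cinner e y))\<^sup>2)"
    if "finite F" "F \<subseteq> B" for F
  proof -
    have o: "cinner e f = (if e = f then 1 else 0)" if "e \<in> F" "f \<in> F" for e f
      using B \<open>F \<subseteq> B\<close> that unfolding orthonormal_def by blast
    have "cinner (\<Sum>e\<in>F. cinner e y *\<^sub>C e) (\<Sum>e\<in>F. cinner e y *\<^sub>C e)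
      = of_real (\<Sum>e\<in>F. (cmod (cinner e y))\<^sup>2)"
      using \<open>finite F\<close>
      by (simp add: cinner_sum_left cinner_sum_right cinner_scaleC_left cinner_scaleC_right o
          if_distrib complex_norm_square mult.commute del: of_real_power cong: if_cong sum.cong)
    then show ?thesis unfolding cinner_self of_real_eq_iff .
  qed
  have sq: "(\<lambda>e. (cmod (cinner e y))\<^sup>2) summable_on B"
    by (rule nonneg_bdd_above_summable_on) (auto intro!: bdd_aboveI2[where M = "(norm y)\<^sup>2"] bessel[OF B])
  have "(\<lambda>e. cinner e y *\<^sub>C e) summable_on B"
  proof -
    have "\<exists>P. eventually P (finite_subsets_at_top B) \<and>
        (\<forall>F F'. P F \<and> P F' \<longrightarrow> dist (\<Sum>e\<in>F. cinner e y *\<^sub>C e) (\<Sum>e\<in>F'. cinner e y *\<^sub>C e) < \<epsilon>)"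
      if "\<epsilon> > 0" for \<epsilon>
    proof -
      let ?g = "\<lambda>e. (cmod (cinner e y))\<^sup>2"
      have "\<epsilon>\<^sup>2/8 > 0" using that by simp
      with sq obtain F0 where F0: "finite F0" "F0 \<subseteq> B" "dist (sum ?g F0) (infsum ?g B) \<le> \<epsilon>\<^sup>2/8"
        using has_sum_finite_approximation[OF has_sum_infsum[OF sq]] by metis
      let ?P = "\<lambda>F. finite F \<and> F0 \<subseteq> F \<and> F \<subseteq> B"
      have near: "norm ((\<Sum>e\<in>F. cinner e y *\<^sub>C e) - (\<Sum>e\<in>F0. cinner e y *\<^sub>C e)) < \<epsilon> / 2" if "?P F" for F
      proof -
        have "(\<Sum>e\<in>F. cinner e y *\<^sub>C e) - (\<Sum>e\<in>F0. cinner e y *\<^sub>C e) = (\<Sum>e\<in>F - F0. cinner e y *\<^sub>C e)"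
          using that by (simp add: sum_diff)
        moreover have "(norm (\<Sum>e\<in>F - F0. cinner e y *\<^sub>C e))\<^sup>2 = sum ?g F - sum ?g F0"
          using that by (subst ps) (auto simp: sum_diff)
        moreover have "sum ?g F \<le> infsum ?g B" by (rule finite_sum_le_infsum[OF sq]) (use that in auto)
        ultimately have "(norm ((\<Sum>e\<in>F. cinner e y *\<^sub>C e) - (\<Sum>e\<in>F0. cinner e y *\<^sub>C e)))\<^sup>2 \<le> \<epsilon>\<^sup>2/8"
          using F0(3) unfolding dist_real_def by (simp only:)
        also have "\<dots> < (\<epsilon>/2)\<^sup>2" using \<open>\<epsilon> > 0\<close> by (simp add: power_divide)
        finally show ?thesis by (rule power_less_imp_less_base) (use \<open>\<epsilon> > 0\<close> in simp)
      qed
      have "dist (\<Sum>e\<in>F. cinner e y *\<^sub>C e) (\<Sum>e\<in>F'. cinner e y *\<^sub>C e) < \<epsilon>" if "?P F" "?P F'" for F F'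
        by (rule dist_triangle_half_l[where y = "\<Sum>e\<in>F0. cinner e y *\<^sub>C e"])
          (unfold dist_norm, rule near[OF that(1)], rule near[OF that(2)])
      moreover have "eventually ?P (finite_subsets_at_top B)"
        unfolding eventually_finite_subsets_at_top using F0 by (intro exI[of _ F0]) auto
      ultimately show ?thesis by (intro exI[of _ ?P] conjI allI impI) (assumption, elim conjE, simp)
    qed
    then have "cauchy_filter (filtermap (sum (\<lambda>e. cinner e y *\<^sub>C e)) (finite_subsets_at_top B))"
      by (simp add: cauchy_filter_metric_filtermap)
    moreover have "complete (UNIV :: 'a set)"
      by (meson Cauchy_convergent UNIV_I complete_def convergent_def)
    ultimately obtain L where "(sum (\<lambda>e. cinner e y *\<^sub>C e) \<longlongrightarrow> L) (finite_subsets_at_top B)"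
      using complete_uniform[where S = UNIV] by (force simp add: filterlim_def)
    then show ?thesis unfolding summable_on_def has_sum_def by blast
  qed
  then obtain z where z: "((\<lambda>e. cinner e y *\<^sub>C e) has_sum z) B" unfolding summable_on_def by blast
  have iz: "((\<lambda>e. cinner e y * cinner u e) has_sum cinner u z) B" for u
    using has_sum_bounded_linear[OF bounded_linear_cinner_right z] by (simp add: cinner_scaleC_right)
  have "cinner f (y - z) = 0" if "f \<in> B" for f
  proof -
    have "((\<lambda>e. cinner e y * cinner f e) has_sum cinner f y) B"
      by (rule has_sum_finite_neutralI[of "{f}"]) (use that B in \<open>auto simp: orthonormal_def\<close>)
    then have "cinner f z = cinner f y" using iz has_sum_unique by blast
    then show ?thesis by (simp add: cinner_diff_right)
  qed
  then have "y = z" using assms unfolding is_onb_def by (metis eq_iff_diff_eq_0)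
  with iz[of x] show ?thesis
    by (metis (no_types, lifting) cinner_commute has_sum_cong mult.commute)
qed

definition ell2 :: "('i \<Rightarrow> complex) \<Rightarrow> bool" where
  "ell2 f \<longleftrightarrow> (\<lambda>i. (cmod (f i))\<^sup>2) summable_on UNIV"

lemma ell2_bound: "ell2 f \<Longrightarrow> finite S \<Longrightarrow> L2_set (\<lambda>i. cmod (f i)) S \<le> sqrt (\<Sum>\<^sub>\<infinity>i. (cmod (f i))\<^sup>2)"
  unfolding ell2_def L2_set_def by (auto intro: finite_sum_le_infsum)

lemma
  assumes "\<And>S. finite S \<Longrightarrow> L2_set (\<lambda>i. cmod (f i)) S \<le> C"
  shows ell2I: "ell2 f" and ell2_norm_le: "sqrt (\<Sum>\<^sub>\<infinity>i. (cmod (f i))\<^sup>2) \<le> C"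
proof -
  have C: "C \<ge> 0" using assms[of "{}"] by simp
  have *: "(\<Sum>i\<in>S. (cmod (f i))\<^sup>2) \<le> C\<^sup>2" if "finite S" for S
    using assms[OF that] C unfolding L2_set_def by (metis real_sqrt_le_iff real_sqrt_abs abs_of_nonneg)
  show e: "ell2 f" unfolding ell2_def
    by (rule nonneg_bdd_above_summable_on) (auto intro!: bdd_aboveI2[where M = "C\<^sup>2"] *)
  show "sqrt (\<Sum>\<^sub>\<infinity>i. (cmod (f i))\<^sup>2) \<le> C"
    using infsum_le_finite_sums[OF e[unfolded ell2_def], of "C\<^sup>2"] * C by (metis real_sqrt_abs abs_of_nonneg real_sqrt_le_iff)
qed

lemma ell2_add_aux:
  assumes "ell2 f" "ell2 g" "finite S"
  shows "L2_set (\<lambda>i. cmod (f i + g i)) S \<le> sqrt (\<Sum>\<^sub>\<infinity>i. (cmod (f i))\<^sup>2) + sqrt (\<Sum>\<^sub>\<infinity>i. (cmod (g i))\<^sup>2)"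
proof -
  have "L2_set (\<lambda>i. cmod (f i + g i)) S \<le> L2_set (\<lambda>i. cmod (f i) + cmod (g i)) S"
    by (rule L2_set_mono) (auto intro: norm_triangle_ineq)
  also have "\<dots> \<le> L2_set (\<lambda>i. cmod (f i)) S + L2_set (\<lambda>i. cmod (g i)) S"
    by (rule L2_set_triangle_ineq)
  also have "\<dots> \<le> sqrt (\<Sum>\<^sub>\<infinity>i. (cmod (f i))\<^sup>2) + sqrt (\<Sum>\<^sub>\<infinity>i. (cmod (g i))\<^sup>2)"
    using ell2_bound assms by (intro add_mono) auto
  finally show ?thesis .
qed

lemma ell2_add: "ell2 f \<Longrightarrow> ell2 g \<Longrightarrow> ell2 (\<lambda>i. f i + g i)"
  by (rule ell2I, rule ell2_add_aux)

lemma ell2_scale: "ell2 f \<Longrightarrow> ell2 (\<lambda>i. c * f i)"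
  unfolding ell2_def by (simp add: norm_mult power_mult_distrib summable_on_cmult_right)

lemma ell2_uminus: "ell2 f \<Longrightarrow> ell2 (\<lambda>i. - f i)"
  unfolding ell2_def by simp

lemma ell2_diff: "ell2 f \<Longrightarrow> ell2 g \<Longrightarrow> ell2 (\<lambda>i. f i - g i)"
  using ell2_add[OF _ ell2_uminus, of f g] by simp

lemma ell2_mult_summable:
  assumes "ell2 f" "ell2 g"
  shows "(\<lambda>i. cnj (f i) * g i) summable_on UNIV"
proof -
  have "(\<lambda>i. norm (cnj (f i) * g i)) summable_on UNIV"
  proof (rule Infinite_Sum.abs_summable_on_comparison_test')
    show "(\<lambda>i. (cmod (f i))\<^sup>2 + (cmod (g i))\<^sup>2) summable_on UNIV"
      using assms unfolding ell2_def by (rule summable_on_add)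
    show "norm (cnj (f i) * g i) \<le> (cmod (f i))\<^sup>2 + (cmod (g i))\<^sup>2" for i
    proof -
      have "2 * (cmod (f i) * cmod (g i)) \<le> (cmod (f i))\<^sup>2 + (cmod (g i))\<^sup>2"
        using sum_squares_bound[of "cmod (f i)" "cmod (g i)"] by simp
      moreover have "0 \<le> cmod (f i) * cmod (g i)" by simp
      ultimately have "cmod (f i) * cmod (g i) \<le> (cmod (f i))\<^sup>2 + (cmod (g i))\<^sup>2" by linarith
      then show ?thesis by (simp add: norm_mult)
    qed
  qed
  then show ?thesis by (rule abs_summable_summable)
qed

text \<open>The Hilbert space tensor product, realised through square-summable coordinates with respect to
  chosen orthonormal bases. The choice is immaterial: \<open>htens_bilinear\<close>, \<open>cinner_htens\<close> and
  \<open>htens_total\<close> below characterise the tensor product up to unitary isomorphism.\<close>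

typedef (overloaded) ('a::chilbert, 'b::chilbert) htensor =
  "{f :: 'a \<times> 'b \<Rightarrow> complex. ell2 f \<and> (\<forall>p. p \<notin> onb \<times> onb \<longrightarrow> f p = 0)}"
  morphisms hcoeff Abs_htensor
  by (rule exI[of _ "\<lambda>_. 0"]) (simp add: ell2_def)

setup_lifting type_definition_htensor

lemma hcoeff_ell2: "ell2 (hcoeff x)" and hcoeff_outside: "p \<notin> onb \<times> onb \<Longrightarrow> hcoeff x p = 0"
  using hcoeff[of x] by blast+

instantiation htensor :: (chilbert, chilbert) real_normed_vector
begin

lift_definition zero_htensor :: "('a, 'b) htensor" is "\<lambda>_. 0" by (simp add: ell2_def)
lift_definition plus_htensor :: "('a, 'b) htensor \<Rightarrow> ('a, 'b) htensor \<Rightarrow> ('a, 'b) htensor"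
  is "\<lambda>f g p. f p + g p" by (simp add: ell2_add)
lift_definition uminus_htensor :: "('a, 'b) htensor \<Rightarrow> ('a, 'b) htensor"
  is "\<lambda>f p. - f p" by (simp add: ell2_uminus)
lift_definition minus_htensor :: "('a, 'b) htensor \<Rightarrow> ('a, 'b) htensor \<Rightarrow> ('a, 'b) htensor"
  is "\<lambda>f g p. f p - g p" by (simp add: ell2_diff)
lift_definition scaleR_htensor :: "real \<Rightarrow> ('a, 'b) htensor \<Rightarrow> ('a, 'b) htensor"
  is "\<lambda>r f p. of_real r * f p" by (simp add: ell2_scale)
lift_definition norm_htensor :: "('a, 'b) htensor \<Rightarrow> real"
  is "\<lambda>f. sqrt (\<Sum>\<^sub>\<infinity>p. (cmod (f p))\<^sup>2)" .
definition sgn_htensor :: "('a, 'b) htensor \<Rightarrow> ('a, 'b) htensor" where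
  "sgn_htensor x = inverse (norm x) *\<^sub>R x"
definition dist_htensor :: "('a, 'b) htensor \<Rightarrow> ('a, 'b) htensor \<Rightarrow> real" where
  "dist_htensor x y = norm (x - y)"
definition uniformity_htensor :: "(('a, 'b) htensor \<times> ('a, 'b) htensor) filter" where
  "uniformity_htensor = (INF e\<in>{0<..}. principal {(x, y). dist x y < e})"
definition open_htensor :: "('a, 'b) htensor set \<Rightarrow> bool" where
  "open_htensor U \<longleftrightarrow> (\<forall>x\<in>U. \<forall>\<^sub>F (x', y) in uniformity. x' = x \<longrightarrow> y \<in> U)"

instance
proof
  fix x y z :: "('a, 'b) htensor" and r s :: real
  show "x + y + z = x + (y + z)" "x + y = y + x" "0 + x = x" "- x + x = 0" "x - y = x + - y"
    by (transfer; simp add: add_ac)+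
  show "r *\<^sub>R (x + y) = r *\<^sub>R x + r *\<^sub>R y" "(r + s) *\<^sub>R x = r *\<^sub>R x + s *\<^sub>R x"
    "r *\<^sub>R s *\<^sub>R x = (r * s) *\<^sub>R x" "1 *\<^sub>R x = x"
    by (transfer; simp add: algebra_simps)+
  show "sgn x = inverse (norm x) *\<^sub>R x" "dist x y = norm (x - y)"
    "uniformity = (INF e\<in>{0<..}. principal {(x :: ('a, 'b) htensor, y). dist x y < e})"
    by (simp_all add: sgn_htensor_def dist_htensor_def uniformity_htensor_def)
  show "open U \<longleftrightarrow> (\<forall>x\<in>U. \<forall>\<^sub>F (x', y) in uniformity. x' = x \<longrightarrow> y \<in> U)" for U :: "('a, 'b) htensor set"
    by (simp add: open_htensor_def)
  show "norm x = 0 \<longleftrightarrow> x = 0"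
  proof transfer
    fix f :: "'a \<times> 'b \<Rightarrow> complex" assume "ell2 f \<and> (\<forall>p. p \<notin> onb \<times> onb \<longrightarrow> f p = 0)"
    then have f: "ell2 f" by simp
    show "(sqrt (\<Sum>\<^sub>\<infinity>p. (cmod (f p))\<^sup>2) = 0) = (f = (\<lambda>_. 0))"
    proof
      assume *: "sqrt (\<Sum>\<^sub>\<infinity>p. (cmod (f p))\<^sup>2) = 0"
      show "f = (\<lambda>_. 0)"
      proof
        fix p show "f p = 0" using ell2_bound[OF f, of "{p}"] * by simp
      qed
    qed simp
  qed
  show "norm (x + y) \<le> norm x + norm y"
    by transfer (auto intro!: ell2_norm_le ell2_add_aux)
  show "norm (r *\<^sub>R x) = \<bar>r\<bar> * norm x"
    by transfer (simp add: norm_mult power_mult_distrib infsum_cmult_right' real_sqrt_mult)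
qed

end

instance htensor :: (chilbert, chilbert) banach
proof
  fix X :: "nat \<Rightarrow> ('a, 'b) htensor"
  assume "Cauchy X"
  then have Cau: "\<exists>N. \<forall>m\<ge>N. \<forall>n\<ge>N. norm (X m - X n) < e" if "e > 0" for e
    using that unfolding Cauchy_def dist_htensor_def by blast
  have fin: "L2_set (\<lambda>p. cmod (hcoeff x p - hcoeff y p)) S \<le> norm (x - y)"
    if "finite S" for S and x y :: "('a, 'b) htensor"
    using that ell2_bound[OF hcoeff_ell2[of "x - y"]] by (simp add: minus_htensor.rep_eq norm_htensor.rep_eq)
  have "convergent (\<lambda>n. hcoeff (X n) p)" for p
  proof -
    have "Cauchy (\<lambda>n. hcoeff (X n) p)"
      unfolding Cauchy_def
    proof (intro allI impI)
      fix e :: real assume "e > 0"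
      with Cau obtain N where "\<forall>m\<ge>N. \<forall>n\<ge>N. norm (X m - X n) < e" by blast
      moreover have "dist (hcoeff (X m) p) (hcoeff (X n) p) \<le> norm (X m - X n)" for m n
        using fin[of "{p}" "X m" "X n"] by (simp add: dist_norm)
      ultimately show "\<exists>N. \<forall>m\<ge>N. \<forall>n\<ge>N. dist (hcoeff (X m) p) (hcoeff (X n) p) < e"
        by (meson le_less_trans)
    qed
    then show ?thesis by (rule Cauchy_convergent)
  qed
  then obtain f where f: "(\<lambda>n. hcoeff (X n) p) \<longlonglongrightarrow> f p" for p
    unfolding convergent_def by metis
  have f0: "f p = 0" if "p \<notin> onb \<times> onb" for p
    using f[of p] hcoeff_outside[OF that] by (simp add: LIMSEQ_const_iff)
  have close: "L2_set (\<lambda>p. cmod (hcoeff (X m) p - f p)) S \<le> e"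
    if "finite S" and "\<forall>n\<ge>N. norm (X m - X n) < e" for S m N e
  proof (rule tendsto_upperbound)
    show "(\<lambda>n. L2_set (\<lambda>p. cmod (hcoeff (X m) p - hcoeff (X n) p)) S)
        \<longlonglongrightarrow> L2_set (\<lambda>p. cmod (hcoeff (X m) p - f p)) S"
      unfolding L2_set_def by (intro tendsto_intros f)
    show "\<forall>\<^sub>F n in sequentially. L2_set (\<lambda>p. cmod (hcoeff (X m) p - hcoeff (X n) p)) S \<le> e"
      unfolding eventually_sequentially using fin[OF \<open>finite S\<close>] that(2) by (meson less_imp_le order_trans)
  qed simp
  obtain N1 where N1: "\<forall>m\<ge>N1. \<forall>n\<ge>N1. norm (X m - X n) < 1" using Cau[of 1] by auto
  have "ell2 (\<lambda>p. hcoeff (X N1) p - f p)"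
    by (rule ell2I[where C = 1], rule close[where N = N1]) (use N1 in auto)
  then have "ell2 f" using ell2_diff[OF hcoeff_ell2[of "X N1"], of "\<lambda>p. hcoeff (X N1) p - f p"] by simp
  then obtain L where L: "hcoeff L = f"
    using f0 Abs_htensor_inverse[of f] by auto
  have "X \<longlonglongrightarrow> L"
  proof (rule metric_LIMSEQ_I)
    fix e :: real assume "e > 0"
    then obtain N where N: "\<forall>m\<ge>N. \<forall>n\<ge>N. norm (X m - X n) < e / 2" using Cau[of "e/2"] by auto
    have "norm (X m - L) \<le> e / 2" if "m \<ge> N" for m
      unfolding norm_htensor.rep_eq minus_htensor.rep_eq L
      by (rule ell2_norm_le, rule close[where N = N]) (use N that in auto)
    moreover have "e / 2 < e" using \<open>e > 0\<close> by simp
    ultimately have "\<forall>n\<ge>N. dist (X n) L < e"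
      unfolding dist_htensor_def by (meson le_less_trans)
    then show "\<exists>N. \<forall>n\<ge>N. dist (X n) L < e" ..
  qed
  then show "convergent X" unfolding convergent_def by blast
qed

instantiation htensor :: (chilbert, chilbert) chilbert
begin

lift_definition scaleC_htensor :: "complex \<Rightarrow> ('a, 'b) htensor \<Rightarrow> ('a, 'b) htensor"
  is "\<lambda>c f p. c * f p" by (simp add: ell2_scale)
lift_definition cinner_htensor :: "('a, 'b) htensor \<Rightarrow> ('a, 'b) htensor \<Rightarrow> complex"
  is "\<lambda>f g. \<Sum>\<^sub>\<infinity>p. cnj (f p) * g p" .

instance
proof
  fix x y z :: "('a, 'b) htensor" and r :: real and c d :: complex
  show "c *\<^sub>C (x + y) = c *\<^sub>C x + c *\<^sub>C y" "(c + d) *\<^sub>C x = c *\<^sub>C x + d *\<^sub>C x"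
    "c *\<^sub>C d *\<^sub>C x = (c * d) *\<^sub>C x"
    by (transfer; simp add: algebra_simps)+
  show "r *\<^sub>R x = complex_of_real r *\<^sub>C x"
    by (transfer; simp)
  show "cinner x y = cnj (cinner y x)"
    by transfer (simp add: mult.commute flip: infsum_cnj)
  show "cinner x (y + z) = cinner x y + cinner x z"
    by transfer (simp add: distrib_left infsum_add ell2_mult_summable)
  show "cinner x (c *\<^sub>C y) = c * cinner x y"
    by transfer (simp add: mult.left_commute infsum_cmult_right')
  show "norm x = sqrt (Re (cinner x x))"
  proof transfer
    fix f :: "'a \<times> 'b \<Rightarrow> complex" assume "ell2 f \<and> (\<forall>p. p \<notin> onb \<times> onb \<longrightarrow> f p = 0)"
    then have f: "(\<lambda>p. (cmod (f p))\<^sup>2) summable_on UNIV" by (simp add: ell2_def)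
    have "(\<Sum>\<^sub>\<infinity>p. cnj (f p) * f p) = (\<Sum>\<^sub>\<infinity>p. of_real ((cmod (f p))\<^sup>2))"
      by (simp add: complex_norm_square mult.commute del: of_real_power)
    also have "\<dots> = of_real (\<Sum>\<^sub>\<infinity>p. (cmod (f p))\<^sup>2)"
      by (rule infsumI, rule has_sum_bounded_linear[OF bounded_linear_of_real has_sum_infsum[OF f]])
    finally show "sqrt (\<Sum>\<^sub>\<infinity>p. (cmod (f p))\<^sup>2) = sqrt (Re (\<Sum>\<^sub>\<infinity>p. cnj (f p) * f p))" by simp
  qed
qed

end

lemma onb_ell2_has_sum:
  fixes x y :: "'a::chilbert"
  shows "((\<lambda>e. if e \<in> onb then cnj (cinner e x) * cinner e y else 0) has_sum cinner x y) UNIV"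
proof -
  have "((\<lambda>e. if e \<in> onb then cnj (cinner e x) * cinner e y else 0) has_sum cinner x y) UNIV
      \<longleftrightarrow> ((\<lambda>e. cnj (cinner e x) * cinner e y) has_sum cinner x y) onb"
    by (rule has_sum_cong_neutral) auto
  then show ?thesis using parseval[OF is_onb_onb, of x y] by blast
qed

definition tcoeff :: "'a::chilbert \<Rightarrow> 'b::chilbert \<Rightarrow> 'a \<times> 'b \<Rightarrow> complex" where
  "tcoeff a b = (\<lambda>(e, f). if e \<in> onb \<and> f \<in> onb then cinner e a * cinner f b else 0)"

lemma tcoeff_ell2: "ell2 (tcoeff a b)"
proof (rule ell2I)
  fix S :: "('a \<times> 'b) set" assume S: "finite S"
  define E F where "E = fst ` S \<inter> onb" and "F = snd ` S \<inter> onb"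
  have fin: "finite E" "finite F" using S by (auto simp: E_def F_def)
  have B: "orthonormal (onb :: 'a set)" "orthonormal (onb :: 'b set)"
    using is_onb_onb unfolding is_onb_def by blast+
  have "(\<Sum>p\<in>S. (cmod (tcoeff a b p))\<^sup>2) = (\<Sum>p\<in>S \<inter> E \<times> F. (cmod (tcoeff a b p))\<^sup>2)"
  proof (rule sum.mono_neutral_right[OF S])
    show "\<forall>p\<in>S - S \<inter> E \<times> F. (cmod (tcoeff a b p))\<^sup>2 = 0"
    proof
      fix p assume p: "p \<in> S - S \<inter> E \<times> F"
      obtain e f where ef: "p = (e, f)" by (cases p)
      have "e \<in> fst ` S" "f \<in> snd ` S"
        using p image_eqI[of e fst "(e, f)" S] image_eqI[of f snd "(e, f)" S] unfolding ef by auto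
      then have "\<not> (e \<in> onb \<and> f \<in> onb)" using p ef unfolding E_def F_def by blast
      then have "tcoeff a b p = 0" unfolding ef tcoeff_def prod.case by (rule if_not_P)
      then show "(cmod (tcoeff a b p))\<^sup>2 = 0" by simp
    qed
  qed auto
  also have "\<dots> \<le> (\<Sum>p\<in>E \<times> F. (cmod (tcoeff a b p))\<^sup>2)"
    using fin by (intro sum_mono2) auto
  also have "\<dots> = (\<Sum>(e, f)\<in>E \<times> F. (cmod (cinner e a))\<^sup>2 * (cmod (cinner f b))\<^sup>2)"
    by (rule sum.cong) (auto simp: tcoeff_def E_def F_def norm_mult power_mult_distrib)
  also have "\<dots> = (\<Sum>e\<in>E. (cmod (cinner e a))\<^sup>2) * (\<Sum>f\<in>F. (cmod (cinner f b))\<^sup>2)"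
    by (simp add: sum_product sum.cartesian_product)
  also have "\<dots> \<le> (norm a)\<^sup>2 * (norm b)\<^sup>2"
    using fin by (intro mult_mono bessel[OF B(1)] bessel[OF B(2)] sum_nonneg) (auto simp: E_def F_def)
  finally show "L2_set (\<lambda>p. cmod (tcoeff a b p)) S \<le> norm a * norm b"
    unfolding L2_set_def by (metis power_mult_distrib real_sqrt_le_iff real_sqrt_abs abs_of_nonneg mult_nonneg_nonneg norm_ge_zero)
qed

lift_definition htens :: "'a::chilbert \<Rightarrow> 'b::chilbert \<Rightarrow> ('a, 'b) htensor" (infixr "\<otimes>\<^sub>h" 75)
  is tcoeff
  by (auto simp: tcoeff_ell2) (auto simp: tcoeff_def)

lemma htens_bilinear:
  "(a + a') \<otimes>\<^sub>h b = a \<otimes>\<^sub>h b + a' \<otimes>\<^sub>h b" "a \<otimes>\<^sub>h (b + b') = a \<otimes>\<^sub>h b + a \<otimes>\<^sub>h b'"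
  "(c *\<^sub>C a) \<otimes>\<^sub>h b = c *\<^sub>C (a \<otimes>\<^sub>h b)" "a \<otimes>\<^sub>h (c *\<^sub>C b) = c *\<^sub>C (a \<otimes>\<^sub>h b)"
  by (transfer; auto simp: tcoeff_def cinner_add_right cinner_scaleC_right algebra_simps fun_eq_iff)+

lemma cinner_htens: "cinner (a \<otimes>\<^sub>h b) (a' \<otimes>\<^sub>h b') = cinner a a' * cinner b b'"
proof transfer
  fix a a' :: 'a and b b' :: 'b
  let ?g = "\<lambda>e. if e \<in> onb then cnj (cinner e a) * cinner e a' else 0"
  let ?h = "\<lambda>e. if e \<in> onb then cnj (cinner e b) * cinner e b' else 0"
  have eq: "cnj (tcoeff a b (e, f)) * tcoeff a' b' (e, f) = ?g e * ?h f" for e f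
    by (simp add: tcoeff_def)
  have "(\<Sum>\<^sub>\<infinity>p. cnj (tcoeff a b p) * tcoeff a' b' p)
      = (\<Sum>\<^sub>\<infinity>e. \<Sum>\<^sub>\<infinity>f. cnj (tcoeff a b (e, f)) * tcoeff a' b' (e, f))"
    using infsum_Sigma_banach[of "\<lambda>p. cnj (tcoeff a b p) * tcoeff a' b' p" UNIV "\<lambda>_. UNIV"]
      ell2_mult_summable[OF tcoeff_ell2 tcoeff_ell2, of a b a' b'] by simp
  also have "\<dots> = (\<Sum>\<^sub>\<infinity>e. ?g e) * (\<Sum>\<^sub>\<infinity>f. ?h f)"
    unfolding eq by (simp only: infsum_cmult_right' infsum_cmult_left')
  also have "\<dots> = cinner a a' * cinner b b'"
    using onb_ell2_has_sum[of a a'] onb_ell2_has_sum[of b b'] by (simp add: infsumI)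
  finally show "(\<Sum>\<^sub>\<infinity>p. cnj (tcoeff a b p) * tcoeff a' b' p) = cinner a a' * cinner b b'" .
qed

lemma htens_total:
  fixes x :: "('a::chilbert, 'b::chilbert) htensor"
  assumes "\<And>a b. cinner (a \<otimes>\<^sub>h b) x = 0"
  shows "x = 0"
proof -
  have "hcoeff x p = 0" for p
  proof (cases "p \<in> onb \<times> onb")
    case True
    obtain e f where p: "p = (e, f)" by (cases p)
    have "e \<in> onb" "f \<in> onb" using True unfolding p by (simp_all only: mem_Times_iff fst_conv snd_conv)
    have B: "orthonormal (onb :: 'a set)" "orthonormal (onb :: 'b set)"
      using is_onb_onb unfolding is_onb_def by blast+
    have t: "tcoeff e f q = (if q = p then 1 else 0)" for q
    proof (cases q)
      case (Pair e' f')
      show ?thesis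
      proof (cases "e' \<in> onb \<and> f' \<in> onb")
        case True
        then have "cinner e' e = (if e' = e then 1 else 0)" "cinner f' f = (if f' = f then 1 else 0)"
          using B \<open>e \<in> onb\<close> \<open>f \<in> onb\<close> unfolding orthonormal_def by simp_all
        with True show ?thesis unfolding p Pair tcoeff_def prod.case by (simp only: if_True prod.inject) simp
      next
        case False
        then have "(e', f') \<noteq> (e, f)" using \<open>e \<in> onb\<close> \<open>f \<in> onb\<close> by auto
        with False show ?thesis unfolding p Pair tcoeff_def prod.case by (simp only: if_not_P if_False)
      qed
    qed
    have "cinner (e \<otimes>\<^sub>h f) x = hcoeff x p"
      unfolding cinner_htensor.rep_eq htens.rep_eq t
      by (rule infsumI, rule has_sum_finite_neutralI[of "{p}"]) auto
    then show ?thesis using assms by simp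
  qed (rule hcoeff_outside)
  then have "hcoeff x = hcoeff 0" unfolding zero_htensor.rep_eq by (rule ext)
  then show ?thesis unfolding hcoeff_inject .
qed

text \<open>Library operators are only real-linear, so complex linearity is carried as a carrier set.\<close>

definition Bop :: "('a::chilbert \<Rightarrow>\<^sub>L 'b::chilbert) set" where
  "Bop = {A :: 'a \<Rightarrow>\<^sub>L 'b. \<forall>c x. A (c *\<^sub>C x) = c *\<^sub>C A x}"

definition scaleC_op :: "complex \<Rightarrow> ('a::chilbert \<Rightarrow>\<^sub>L 'b::chilbert) \<Rightarrow> 'a \<Rightarrow>\<^sub>L 'b" (infixr "*\<^sub>B" 75) where
  "c *\<^sub>B A = Blinfun (\<lambda>x. c *\<^sub>C A x)"

definition adj :: "('a::chilbert \<Rightarrow>\<^sub>L 'b::chilbert) \<Rightarrow> 'b \<Rightarrow>\<^sub>L 'a" where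
  "adj A = (THE B :: 'b \<Rightarrow>\<^sub>L 'a. B \<in> Bop \<and> (\<forall>x y. cinner (A x) y = cinner x (B y)))"

definition clinear_on ::
  "('a::chilbert \<Rightarrow>\<^sub>L 'b::chilbert) set \<Rightarrow> (complex \<Rightarrow> 'c \<Rightarrow> 'c) \<Rightarrow> (('a \<Rightarrow>\<^sub>L 'b) \<Rightarrow> 'c::plus) \<Rightarrow> bool" where
  "clinear_on M s f \<longleftrightarrow>
     (\<forall>x\<in>M. \<forall>y\<in>M. f (x + y) = f x + f y) \<and> (\<forall>c. \<forall>x\<in>M. f (c *\<^sub>B x) = s c (f x))"

definition commutant :: "('a::chilbert \<Rightarrow>\<^sub>L 'a) set \<Rightarrow> ('a \<Rightarrow>\<^sub>L 'a) set" where
  "commutant S = {A \<in> Bop. \<forall>B\<in>S. A o\<^sub>L B = B o\<^sub>L A}"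

definition von_neumann_algebra :: "('a::chilbert \<Rightarrow>\<^sub>L 'a) set \<Rightarrow> bool" where
  "von_neumann_algebra M \<longleftrightarrow>
     M \<subseteq> Bop \<and> (\<forall>x\<in>M. adj x \<in> M) \<and> commutant (commutant M) = M"

definition center :: "('a::chilbert \<Rightarrow>\<^sub>L 'a) set \<Rightarrow> ('a \<Rightarrow>\<^sub>L 'a) set" where
  "center M = M \<inter> commutant M"

definition pos :: "('a::chilbert \<Rightarrow>\<^sub>L 'a) set \<Rightarrow> ('a \<Rightarrow>\<^sub>L 'a) set" where
  "pos M = {x \<in> M. \<forall>u. cinner u (x u) \<in> \<real>\<^sub>\<ge>\<^sub>0}"

definition sigma_weak :: "('a::chilbert \<Rightarrow>\<^sub>L 'a) topology" where
  "sigma_weak = topology_generated_by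
     {{x \<in> Bop. (\<Sum>n. cinner (\<eta> n) (x (\<xi> n))) \<in> U} | \<xi> \<eta> U.
        summable (\<lambda>n. (norm (\<xi> n))\<^sup>2) \<and> summable (\<lambda>n. (norm (\<eta> n))\<^sup>2) \<and> open U}"

text \<open>A functional on \<open>M\<close> is represented by its extension by \<open>0\<close> to all operators, so that
  functionals that agree on \<open>M\<close> are equal.\<close>

definition predual :: "('a::chilbert \<Rightarrow>\<^sub>L 'a) set \<Rightarrow> (('a \<Rightarrow>\<^sub>L 'a) \<Rightarrow> complex) set" where
  "predual M = {w. clinear_on M (*) w \<and> continuous_map (subtopology sigma_weak M) euclidean w
                 \<and> (\<forall>x. x \<notin> M \<longrightarrow> w x = 0)}"

definition predual_pos :: "('a::chilbert \<Rightarrow>\<^sub>L 'a) set \<Rightarrow> (('a \<Rightarrow>\<^sub>L 'a) \<Rightarrow> complex) set" where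
  "predual_pos M = {w \<in> predual M. \<forall>x\<in>pos M. w x \<in> \<real>\<^sub>\<ge>\<^sub>0}"

definition star_hom :: "('a::chilbert \<Rightarrow>\<^sub>L 'a) set \<Rightarrow> ('b::chilbert \<Rightarrow>\<^sub>L 'b) set
    \<Rightarrow> (('a \<Rightarrow>\<^sub>L 'a) \<Rightarrow> ('b \<Rightarrow>\<^sub>L 'b)) \<Rightarrow> bool" where
  "star_hom M N f \<longleftrightarrow> f ` M \<subseteq> N \<and> clinear_on M (*\<^sub>B) f \<and>
     (\<forall>x\<in>M. \<forall>y\<in>M. f (x o\<^sub>L y) = f x o\<^sub>L f y) \<and> (\<forall>x\<in>M. f (adj x) = adj (f x))"

definition op_tensor :: "('a::chilbert \<Rightarrow>\<^sub>L 'c::chilbert) \<Rightarrow> ('b::chilbert \<Rightarrow>\<^sub>L 'd::chilbert)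
    \<Rightarrow> ('a, 'b) htensor \<Rightarrow>\<^sub>L ('c, 'd) htensor" (infixr "\<otimes>\<^sub>o" 75) where
  "A \<otimes>\<^sub>o B = (THE C :: ('a, 'b) htensor \<Rightarrow>\<^sub>L ('c, 'd) htensor. C \<in> Bop \<and> (\<forall>u v. C (u \<otimes>\<^sub>h v) = A u \<otimes>\<^sub>h B v))"

definition flip :: "('a::chilbert, 'b::chilbert) htensor \<Rightarrow>\<^sub>L ('b, 'a) htensor" where
  "flip = (THE C :: ('a, 'b) htensor \<Rightarrow>\<^sub>L ('b, 'a) htensor. C \<in> Bop \<and> (\<forall>u v. C (u \<otimes>\<^sub>h v) = v \<otimes>\<^sub>h u))"

definition assoc_op :: "(('a::chilbert, 'b::chilbert) htensor, 'c::chilbert) htensor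
    \<Rightarrow>\<^sub>L ('a, ('b, 'c) htensor) htensor" where
  "assoc_op = (THE C :: (('a, 'b) htensor, 'c) htensor \<Rightarrow>\<^sub>L ('a, ('b, 'c) htensor) htensor.
     C \<in> Bop \<and> (\<forall>u v w. C ((u \<otimes>\<^sub>h v) \<otimes>\<^sub>h w) = u \<otimes>\<^sub>h (v \<otimes>\<^sub>h w)))"

definition vn_tensor :: "('a::chilbert \<Rightarrow>\<^sub>L 'a) set \<Rightarrow> ('b::chilbert \<Rightarrow>\<^sub>L 'b) set
    \<Rightarrow> (('a, 'b) htensor \<Rightarrow>\<^sub>L ('a, 'b) htensor) set" where
  "vn_tensor M N = commutant (commutant {x \<otimes>\<^sub>o y | x y. x \<in> M \<and> y \<in> N})"

text \<open>With \<open>\<omega>\<^sub>u\<^sub>v(x) = \<langle>v, x u\<rangle>\<close>: \<open>vslice_left v u X = (\<omega>\<^sub>u\<^sub>v \<otimes> id)(X)\<close> and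
  \<open>vslice_right v u X = (id \<otimes> \<omega>\<^sub>u\<^sub>v)(X)\<close>.\<close>

definition vslice_left :: "'a::chilbert \<Rightarrow> 'a \<Rightarrow> (('a, 'b::chilbert) htensor \<Rightarrow>\<^sub>L ('a, 'b) htensor)
    \<Rightarrow> 'b \<Rightarrow>\<^sub>L 'b" where
  "vslice_left v u X =
     (THE y :: 'b \<Rightarrow>\<^sub>L 'b. y \<in> Bop \<and> (\<forall>a b. cinner b (y a) = cinner (v \<otimes>\<^sub>h b) (X (u \<otimes>\<^sub>h a))))"

definition vslice_right :: "'b::chilbert \<Rightarrow> 'b \<Rightarrow> (('a::chilbert, 'b) htensor \<Rightarrow>\<^sub>L ('a, 'b) htensor)
    \<Rightarrow> 'a \<Rightarrow>\<^sub>L 'a" where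
  "vslice_right v u X =
     (THE y :: 'a \<Rightarrow>\<^sub>L 'a. y \<in> Bop \<and> (\<forall>a b. cinner b (y a) = cinner (b \<otimes>\<^sub>h v) (X (a \<otimes>\<^sub>h u))))"

text \<open>The slices \<open>(\<omega> \<otimes> id)(X)\<close> and \<open>(id \<otimes> \<omega>)(X)\<close> are determined by testing the remaining leg
  against vector functionals; \<open>\<omega>\<close> need only be defined on the vector slices of \<open>X\<close>.\<close>

definition slice_left :: "(('a::chilbert \<Rightarrow>\<^sub>L 'a) \<Rightarrow> complex)
    \<Rightarrow> (('a, 'b::chilbert) htensor \<Rightarrow>\<^sub>L ('a, 'b) htensor) \<Rightarrow> 'b \<Rightarrow>\<^sub>L 'b" where
  "slice_left \<omega> X =
     (THE y :: 'b \<Rightarrow>\<^sub>L 'b. y \<in> Bop \<and> (\<forall>u v. cinner v (y u) = \<omega> (vslice_right v u X)))"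

definition slice_right :: "(('b::chilbert \<Rightarrow>\<^sub>L 'b) \<Rightarrow> complex)
    \<Rightarrow> (('a::chilbert, 'b) htensor \<Rightarrow>\<^sub>L ('a, 'b) htensor) \<Rightarrow> 'a \<Rightarrow>\<^sub>L 'a" where
  "slice_right \<omega> X =
     (THE y :: 'a \<Rightarrow>\<^sub>L 'a. y \<in> Bop \<and> (\<forall>u v. cinner v (y u) = \<omega> (vslice_left v u X)))"

text \<open>\<open>(\<Phi> \<otimes> id)(X)\<close> and \<open>(id \<otimes> \<Phi>)(X)\<close> for a normal map \<open>\<Phi>\<close>.\<close>

definition amplify_left :: "(('a::chilbert \<Rightarrow>\<^sub>L 'a) \<Rightarrow> ('b::chilbert \<Rightarrow>\<^sub>L 'b))
    \<Rightarrow> (('a, 'c::chilbert) htensor \<Rightarrow>\<^sub>L ('a, 'c) htensor)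
    \<Rightarrow> ('b, 'c) htensor \<Rightarrow>\<^sub>L ('b, 'c) htensor" where
  "amplify_left \<Phi> X =
     (THE Y. Y \<in> Bop \<and> (\<forall>u v. vslice_right v u Y = \<Phi> (vslice_right v u X)))"

definition amplify_right :: "(('a::chilbert \<Rightarrow>\<^sub>L 'a) \<Rightarrow> ('b::chilbert \<Rightarrow>\<^sub>L 'b))
    \<Rightarrow> (('c::chilbert, 'a) htensor \<Rightarrow>\<^sub>L ('c, 'a) htensor)
    \<Rightarrow> ('c, 'b) htensor \<Rightarrow>\<^sub>L ('c, 'b) htensor" where
  "amplify_right \<Phi> X =
     (THE Y. Y \<in> Bop \<and> (\<forall>u v. vslice_left v u Y = \<Phi> (vslice_left v u X)))"

definition n_weight :: "('a::chilbert \<Rightarrow>\<^sub>L 'a) set \<Rightarrow> (('a \<Rightarrow>\<^sub>L 'a) \<Rightarrow> ennreal) \<Rightarrow> ('a \<Rightarrow>\<^sub>L 'a) set" where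
  "n_weight M \<phi> = {x \<in> M. \<phi> (adj x o\<^sub>L x) < \<infinity>}"

definition weight :: "('a::chilbert \<Rightarrow>\<^sub>L 'a) set \<Rightarrow> (('a \<Rightarrow>\<^sub>L 'a) \<Rightarrow> ennreal) \<Rightarrow> bool" where
  "weight M \<phi> \<longleftrightarrow>
     (\<forall>x\<in>pos M. \<forall>y\<in>pos M. \<phi> (x + y) = \<phi> x + \<phi> y) \<and>
     (\<forall>x\<in>pos M. \<forall>r\<ge>0. \<phi> (r *\<^sub>R x) = ennreal r * \<phi> x)"

definition faithful_weight :: "('a::chilbert \<Rightarrow>\<^sub>L 'a) set \<Rightarrow> (('a \<Rightarrow>\<^sub>L 'a) \<Rightarrow> ennreal) \<Rightarrow> bool" where
  "faithful_weight M \<phi> \<longleftrightarrow> (\<forall>x\<in>pos M. \<phi> x = 0 \<longrightarrow> x = 0)"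

definition semifinite_weight :: "('a::chilbert \<Rightarrow>\<^sub>L 'a) set \<Rightarrow> (('a \<Rightarrow>\<^sub>L 'a) \<Rightarrow> ennreal) \<Rightarrow> bool" where
  "semifinite_weight M \<phi> \<longleftrightarrow> M \<subseteq> sigma_weak closure_of n_weight M \<phi>"

definition op_le :: "('a::chilbert \<Rightarrow>\<^sub>L 'a) \<Rightarrow> ('a \<Rightarrow>\<^sub>L 'a) \<Rightarrow> bool" where
  "op_le x y \<longleftrightarrow> y - x \<in> pos Bop"

definition normal_weight :: "('a::chilbert \<Rightarrow>\<^sub>L 'a) set \<Rightarrow> (('a \<Rightarrow>\<^sub>L 'a) \<Rightarrow> ennreal) \<Rightarrow> bool" where
  "normal_weight M \<phi> \<longleftrightarrow>
     (\<forall>D x. D \<noteq> {} \<and> D \<subseteq> pos M \<and> (\<forall>d\<in>D. \<forall>e\<in>D. \<exists>f\<in>D. op_le d f \<and> op_le e f) \<and>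
        x \<in> pos M \<and> (\<forall>d\<in>D. op_le d x) \<and> (\<forall>y\<in>pos M. (\<forall>d\<in>D. op_le d y) \<longrightarrow> op_le x y)
        \<longrightarrow> \<phi> x = (SUP d\<in>D. \<phi> d))"

definition nsf_weight :: "('a::chilbert \<Rightarrow>\<^sub>L 'a) set \<Rightarrow> (('a \<Rightarrow>\<^sub>L 'a) \<Rightarrow> ennreal) \<Rightarrow> bool" where
  "nsf_weight M \<phi> \<longleftrightarrow>
     weight M \<phi> \<and> normal_weight M \<phi> \<and> semifinite_weight M \<phi> \<and> faithful_weight M \<phi>"

definition tracial :: "('a::chilbert \<Rightarrow>\<^sub>L 'a) set \<Rightarrow> (('a \<Rightarrow>\<^sub>L 'a) \<Rightarrow> ennreal) \<Rightarrow> bool" where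
  "tracial M \<phi> \<longleftrightarrow> (\<forall>x\<in>M. \<phi> (adj x o\<^sub>L x) = \<phi> (x o\<^sub>L adj x))"

text \<open>\<open>M\<close> acts on the GNS space of \<open>\<phi>\<close>. The norm identity is the polarised form of
  \<open>\<phi>(y\<^sup>* x) = \<langle>\<Lambda> y, \<Lambda> x\<rangle>\<close> (inner products are conjugate-linear in the first argument).\<close>

definition gns_map :: "('a::chilbert \<Rightarrow>\<^sub>L 'a) set \<Rightarrow> (('a \<Rightarrow>\<^sub>L 'a) \<Rightarrow> ennreal)
    \<Rightarrow> (('a \<Rightarrow>\<^sub>L 'a) \<Rightarrow> 'a) \<Rightarrow> bool" where
  "gns_map M \<phi> \<Lambda> \<longleftrightarrow>
     clinear_on (n_weight M \<phi>) (*\<^sub>C) \<Lambda> \<and>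
     (\<forall>x\<in>n_weight M \<phi>. ennreal ((norm (\<Lambda> x))\<^sup>2) = \<phi> (adj x o\<^sub>L x)) \<and>
     (\<forall>a\<in>M. \<forall>x\<in>n_weight M \<phi>. \<Lambda> (a o\<^sub>L x) = a (\<Lambda> x)) \<and>
     closure (\<Lambda> ` n_weight M \<phi>) = UNIV"

text \<open>Graph of \<open>\<Lambda> \<otimes> \<Lambda>\<close>, the GNS map of \<open>\<phi> \<otimes> \<phi>\<close>: the algebraic tensor product of \<open>\<Lambda>\<close> with itself
  is a core for it in the sigma-strong-* / norm topology. The closure of a linear subspace is the
  same for the sigma-weak topology. The real span used here is already a complex subspace.\<close>

definition gns_tensor_graph :: "('a::chilbert \<Rightarrow>\<^sub>L 'a) set \<Rightarrow> (('a \<Rightarrow>\<^sub>L 'a) \<Rightarrow> ennreal)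
    \<Rightarrow> (('a \<Rightarrow>\<^sub>L 'a) \<Rightarrow> 'a)
    \<Rightarrow> ((('a, 'a) htensor \<Rightarrow>\<^sub>L ('a, 'a) htensor) \<times> ('a, 'a) htensor) set" where
  "gns_tensor_graph M \<phi> \<Lambda> = prod_topology sigma_weak euclidean closure_of
     span {(x \<otimes>\<^sub>o y, \<Lambda> x \<otimes>\<^sub>h \<Lambda> y) | x y. x \<in> n_weight M \<phi> \<and> y \<in> n_weight M \<phi>}"

definition coassociative :: "('a::chilbert \<Rightarrow>\<^sub>L 'a) set
    \<Rightarrow> (('a \<Rightarrow>\<^sub>L 'a) \<Rightarrow> ('a, 'a) htensor \<Rightarrow>\<^sub>L ('a, 'a) htensor) \<Rightarrow> bool" where
  "coassociative M \<Delta> \<longleftrightarrow>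
     (\<forall>x\<in>M. assoc_op o\<^sub>L amplify_left \<Delta> (\<Delta> x) = amplify_right \<Delta> (\<Delta> x) o\<^sub>L assoc_op)"

definition left_invariant :: "('a::chilbert \<Rightarrow>\<^sub>L 'a) set
    \<Rightarrow> (('a \<Rightarrow>\<^sub>L 'a) \<Rightarrow> ('a, 'a) htensor \<Rightarrow>\<^sub>L ('a, 'a) htensor)
    \<Rightarrow> (('a \<Rightarrow>\<^sub>L 'a) \<Rightarrow> ennreal) \<Rightarrow> bool" where
  "left_invariant M \<Delta> \<phi> \<longleftrightarrow> (\<forall>\<omega>\<in>predual_pos M. \<forall>x\<in>pos M. \<phi> x < \<infinity> \<longrightarrow>
     \<phi> (slice_left \<omega> (\<Delta> x)) = \<phi> x * ennreal (Re (\<omega> id_blinfun)))"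

definition right_invariant :: "('a::chilbert \<Rightarrow>\<^sub>L 'a) set
    \<Rightarrow> (('a \<Rightarrow>\<^sub>L 'a) \<Rightarrow> ('a, 'a) htensor \<Rightarrow>\<^sub>L ('a, 'a) htensor)
    \<Rightarrow> (('a \<Rightarrow>\<^sub>L 'a) \<Rightarrow> ennreal) \<Rightarrow> bool" where
  "right_invariant M \<Delta> \<psi> \<longleftrightarrow> (\<forall>\<omega>\<in>predual_pos M. \<forall>x\<in>pos M. \<psi> x < \<infinity> \<longrightarrow>
     \<psi> (slice_right \<omega> (\<Delta> x)) = \<psi> x * ennreal (Re (\<omega> id_blinfun)))"

definition lc_quantum_group :: "('a::chilbert \<Rightarrow>\<^sub>L 'a) set
    \<Rightarrow> (('a \<Rightarrow>\<^sub>L 'a) \<Rightarrow> ('a, 'a) htensor \<Rightarrow>\<^sub>L ('a, 'a) htensor)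
    \<Rightarrow> (('a \<Rightarrow>\<^sub>L 'a) \<Rightarrow> ennreal) \<Rightarrow> (('a \<Rightarrow>\<^sub>L 'a) \<Rightarrow> ennreal) \<Rightarrow> bool" where
  "lc_quantum_group M \<Delta> \<phi> \<psi> \<longleftrightarrow>
     von_neumann_algebra M \<and>
     star_hom M (vn_tensor M M) \<Delta> \<and> \<Delta> id_blinfun = id_blinfun \<and>
     continuous_map (subtopology sigma_weak M) sigma_weak \<Delta> \<and>
     coassociative M \<Delta> \<and>
     nsf_weight M \<phi> \<and> left_invariant M \<Delta> \<phi> \<and>
     nsf_weight M \<psi> \<and> right_invariant M \<Delta> \<psi>"

definition unitary_op :: "('a::chilbert \<Rightarrow>\<^sub>L 'a) \<Rightarrow> bool" where
  "unitary_op U \<longleftrightarrow> U \<in> Bop \<and> adj U o\<^sub>L U = id_blinfun \<and> U o\<^sub>L adj U = id_blinfun"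

definition fundamental_unitary :: "('a::chilbert \<Rightarrow>\<^sub>L 'a) set
    \<Rightarrow> (('a \<Rightarrow>\<^sub>L 'a) \<Rightarrow> ('a, 'a) htensor \<Rightarrow>\<^sub>L ('a, 'a) htensor)
    \<Rightarrow> (('a \<Rightarrow>\<^sub>L 'a) \<Rightarrow> ennreal) \<Rightarrow> (('a \<Rightarrow>\<^sub>L 'a) \<Rightarrow> 'a)
    \<Rightarrow> (('a, 'a) htensor \<Rightarrow>\<^sub>L ('a, 'a) htensor) \<Rightarrow> bool" where
  "fundamental_unitary M \<Delta> \<phi> \<Lambda> W \<longleftrightarrow> unitary_op W \<and>
     (\<forall>x\<in>n_weight M \<phi>. \<forall>y\<in>n_weight M \<phi>.
        (\<Delta> y o\<^sub>L (x \<otimes>\<^sub>o id_blinfun), adj W (\<Lambda> x \<otimes>\<^sub>h \<Lambda> y)) \<in> gns_tensor_graph M \<phi> \<Lambda>)"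

definition convolution :: "('a::chilbert \<Rightarrow>\<^sub>L 'a) set
    \<Rightarrow> (('a \<Rightarrow>\<^sub>L 'a) \<Rightarrow> ('a, 'a) htensor \<Rightarrow>\<^sub>L ('a, 'a) htensor)
    \<Rightarrow> (('a \<Rightarrow>\<^sub>L 'a) \<Rightarrow> complex) \<Rightarrow> (('a \<Rightarrow>\<^sub>L 'a) \<Rightarrow> complex) \<Rightarrow> ('a \<Rightarrow>\<^sub>L 'a) \<Rightarrow> complex" where
  "convolution M \<Delta> w1 w2 = (\<lambda>x. if x \<in> M then w1 (slice_right w2 (\<Delta> x)) else 0)"

definition dual_unitary :: "(('a::chilbert, 'a) htensor \<Rightarrow>\<^sub>L ('a, 'a) htensor)
    \<Rightarrow> ('a, 'a) htensor \<Rightarrow>\<^sub>L ('a, 'a) htensor" where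
  "dual_unitary W = flip o\<^sub>L adj W o\<^sub>L flip"

definition dual_C0 :: "(('a::chilbert, 'a) htensor \<Rightarrow>\<^sub>L ('a, 'a) htensor) \<Rightarrow> ('a \<Rightarrow>\<^sub>L 'a) set" where
  "dual_C0 W = closure {slice_left w W | w. w \<in> predual Bop}"

definition dual_coproduct :: "(('a::chilbert, 'a) htensor \<Rightarrow>\<^sub>L ('a, 'a) htensor)
    \<Rightarrow> ('a \<Rightarrow>\<^sub>L 'a) \<Rightarrow> ('a, 'a) htensor \<Rightarrow>\<^sub>L ('a, 'a) htensor" where
  "dual_coproduct W x = adj (dual_unitary W) o\<^sub>L (id_blinfun \<otimes>\<^sub>o x) o\<^sub>L dual_unitary W"

definition state_on :: "('a::chilbert \<Rightarrow>\<^sub>L 'a) set \<Rightarrow> (('a \<Rightarrow>\<^sub>L 'a) \<Rightarrow> complex) \<Rightarrow> bool" where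
  "state_on A \<epsilon> \<longleftrightarrow> clinear_on A (*) \<epsilon> \<and> (\<forall>x\<in>A. \<epsilon> (adj x o\<^sub>L x) \<in> \<real>\<^sub>\<ge>\<^sub>0) \<and>
     (\<forall>x\<in>A. cmod (\<epsilon> x) \<le> norm x) \<and> (\<forall>r<1. \<exists>x\<in>A. norm x \<le> 1 \<and> r < cmod (\<epsilon> x))"

definition dual_coamenable :: "(('a::chilbert, 'a) htensor \<Rightarrow>\<^sub>L ('a, 'a) htensor) \<Rightarrow> bool" where
  "dual_coamenable W \<longleftrightarrow> (\<exists>\<epsilon>. state_on (dual_C0 W) \<epsilon> \<and>
     (\<forall>x\<in>dual_C0 W. slice_right \<epsilon> (dual_coproduct W x) = x))"

definition one_parameter_group :: "('a::chilbert \<Rightarrow>\<^sub>L 'a) set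
    \<Rightarrow> (real \<Rightarrow> ('a \<Rightarrow>\<^sub>L 'a) \<Rightarrow> 'a \<Rightarrow>\<^sub>L 'a) \<Rightarrow> bool" where
  "one_parameter_group M \<tau> \<longleftrightarrow>
     (\<forall>t. star_hom M M (\<tau> t) \<and> bij_betw (\<tau> t) M M) \<and>
     (\<forall>x\<in>M. \<tau> 0 x = x) \<and> (\<forall>s t. \<forall>x\<in>M. \<tau> (s + t) x = \<tau> s (\<tau> t x)) \<and>
     (\<forall>x\<in>M. continuous_map euclidean sigma_weak (\<lambda>t. \<tau> t x))"

text \<open>The KMS condition: \<open>F(t) = \<phi>(\<sigma>\<^sub>t(x) y)\<close> and \<open>F(t + \<i>) = \<phi>(y \<sigma>\<^sub>t(x))\<close>, where the values of
  (the linear extension of) \<open>\<phi>\<close> are written as \<open>\<phi>(b\<^sup>* a) = \<langle>\<Lambda> b, \<Lambda> a\<rangle>\<close>. The group is unique.\<close>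

definition modular_group :: "('a::chilbert \<Rightarrow>\<^sub>L 'a) set \<Rightarrow> (('a \<Rightarrow>\<^sub>L 'a) \<Rightarrow> ennreal)
    \<Rightarrow> (('a \<Rightarrow>\<^sub>L 'a) \<Rightarrow> 'a) \<Rightarrow> (real \<Rightarrow> ('a \<Rightarrow>\<^sub>L 'a) \<Rightarrow> 'a \<Rightarrow>\<^sub>L 'a) \<Rightarrow> bool" where
  "modular_group M \<phi> \<Lambda> \<sigma> \<longleftrightarrow>
     one_parameter_group M \<sigma> \<and> (\<forall>t. \<forall>x\<in>pos M. \<phi> (\<sigma> t x) = \<phi> x) \<and>
     (\<forall>x y. {x, adj x, y, adj y} \<subseteq> n_weight M \<phi> \<longrightarrow>
        (\<exists>F :: complex \<Rightarrow> complex.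
           continuous_on {z. 0 \<le> Im z \<and> Im z \<le> 1} F \<and> bounded (F ` {z. 0 \<le> Im z \<and> Im z \<le> 1}) \<and>
           F holomorphic_on {z. 0 < Im z \<and> Im z < 1} \<and>
           (\<forall>t. F (of_real t) = cinner (\<Lambda> (adj (\<sigma> t x))) (\<Lambda> y)) \<and>
           (\<forall>t. F (of_real t + \<i>) = cinner (\<Lambda> (adj y)) (\<Lambda> (\<sigma> t x)))))"

text \<open>Graph of the antipode: the closed operator with \<open>S((id \<otimes> w)(W)) = (id \<otimes> w)(W\<^sup>*)\<close> for which these
  elements form a sigma-strong-* core (again the sigma-weak closure of the subspace is the same).\<close>

definition antipode :: "(('a::chilbert, 'a) htensor \<Rightarrow>\<^sub>L ('a, 'a) htensor)
    \<Rightarrow> (('a \<Rightarrow>\<^sub>L 'a) \<times> ('a \<Rightarrow>\<^sub>L 'a)) set" where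
  "antipode W = prod_topology sigma_weak sigma_weak closure_of
     {(slice_right w W, slice_right w (adj W)) | w. w \<in> predual Bop}"

text \<open>Graph of the analytic continuation of \<open>\<tau>\<close> to \<open>-\<i>/2\<close>.\<close>

definition analytic_ext :: "('a::chilbert \<Rightarrow>\<^sub>L 'a) set \<Rightarrow> (real \<Rightarrow> ('a \<Rightarrow>\<^sub>L 'a) \<Rightarrow> 'a \<Rightarrow>\<^sub>L 'a)
    \<Rightarrow> (('a \<Rightarrow>\<^sub>L 'a) \<times> ('a \<Rightarrow>\<^sub>L 'a)) set" where
  "analytic_ext M \<tau> = {(x, y). x \<in> M \<and> (\<exists>f :: complex \<Rightarrow> 'a \<Rightarrow>\<^sub>L 'a.
      f ` {z. -1/2 \<le> Im z \<and> Im z \<le> 0} \<subseteq> M \<and>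
      continuous_map (top_of_set {z. -1/2 \<le> Im z \<and> Im z \<le> 0}) sigma_weak f \<and>
      (\<forall>w\<in>predual M. (\<lambda>z. w (f z)) holomorphic_on {z. -1/2 < Im z \<and> Im z < 0}) \<and>
      (\<forall>t. f (of_real t) = \<tau> t x) \<and> f (- \<i> / 2) = y)}"

text \<open>\<open>S = R \<tau>\<^sub>-\<^sub>i\<^sub>/\<^sub>2\<close>, which determines the unitary antipode \<open>R\<close> and the scaling group \<open>\<tau>\<close>.\<close>

definition antipode_polar :: "('a::chilbert \<Rightarrow>\<^sub>L 'a) set
    \<Rightarrow> (('a, 'a) htensor \<Rightarrow>\<^sub>L ('a, 'a) htensor)
    \<Rightarrow> (('a \<Rightarrow>\<^sub>L 'a) \<Rightarrow> 'a \<Rightarrow>\<^sub>L 'a) \<Rightarrow> (real \<Rightarrow> ('a \<Rightarrow>\<^sub>L 'a) \<Rightarrow> 'a \<Rightarrow>\<^sub>L 'a) \<Rightarrow> bool" where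
  "antipode_polar M W R \<tau> \<longleftrightarrow>
     R ` M \<subseteq> M \<and> clinear_on M (*\<^sub>B) R \<and> (\<forall>x\<in>M. \<forall>y\<in>M. R (x o\<^sub>L y) = R y o\<^sub>L R x) \<and>
     (\<forall>x\<in>M. R (adj x) = adj (R x)) \<and> (\<forall>x\<in>M. R (R x) = x) \<and>
     one_parameter_group M \<tau> \<and> (\<forall>t. \<forall>x\<in>M. R (\<tau> t x) = \<tau> t (R x)) \<and>
     antipode W = {(x, R y) | x y. (x, y) \<in> analytic_ext M \<tau>}"

text \<open>\<open>\<sigma>\<close>, \<open>R\<close> and \<open>\<tau>\<close> always exist and are unique on \<open>M\<close>.\<close>

definition kac_type :: "('a::chilbert \<Rightarrow>\<^sub>L 'a) set \<Rightarrow> (('a \<Rightarrow>\<^sub>L 'a) \<Rightarrow> ennreal)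
    \<Rightarrow> (('a \<Rightarrow>\<^sub>L 'a) \<Rightarrow> 'a) \<Rightarrow> (('a, 'a) htensor \<Rightarrow>\<^sub>L ('a, 'a) htensor) \<Rightarrow> bool" where
  "kac_type M \<phi> \<Lambda> W \<longleftrightarrow> (\<exists>\<sigma> R \<tau>.
     modular_group M \<phi> \<Lambda> \<sigma> \<and> antipode_polar M W R \<tau> \<and>
     (\<forall>t. \<forall>x\<in>M. \<tau> t x = x) \<and> (\<forall>t. \<forall>x\<in>M. R (\<sigma> t x) = \<sigma> (- t) (R x)))"

definition L1_representation :: "('a::chilbert \<Rightarrow>\<^sub>L 'a) set
    \<Rightarrow> (('a \<Rightarrow>\<^sub>L 'a) \<Rightarrow> ('a, 'a) htensor \<Rightarrow>\<^sub>L ('a, 'a) htensor)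
    \<Rightarrow> ((('a \<Rightarrow>\<^sub>L 'a) \<Rightarrow> complex) \<Rightarrow> 'k::chilbert \<Rightarrow>\<^sub>L 'k) \<Rightarrow> bool" where
  "L1_representation M \<Delta> \<pi> \<longleftrightarrow> \<pi> ` predual M \<subseteq> Bop \<and>
     (\<forall>w1\<in>predual M. \<forall>w2\<in>predual M. \<pi> (\<lambda>x. w1 x + w2 x) = \<pi> w1 + \<pi> w2) \<and>
     (\<forall>c. \<forall>w\<in>predual M. \<pi> (\<lambda>x. c * w x) = c *\<^sub>B \<pi> w) \<and>
     (\<forall>w1\<in>predual M. \<forall>w2\<in>predual M. \<pi> (convolution M \<Delta> w1 w2) = \<pi> w1 o\<^sub>L \<pi> w2)"

text \<open>\<open>\<pi>(L\<^sup>1)H\<close> is linearly dense (its real span is a complex subspace). Homomorphisms that violate this cannot satisfy a bound of the form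
  \<open>\<parallel>T\<parallel> \<parallel>T\<^sup>-\<^sup>1\<parallel> \<le> \<parallel>\<pi>\<parallel>\<^sub>c\<^sub>b\<^sup>4\<close>: for the trivial group, take \<open>\<pi>(1) = 0\<close>, or
  \<open>\<pi>(1)\<close> a non-self-adjoint idempotent of norm close to \<open>1\<close>.\<close>

definition nondegenerate :: "('a::chilbert \<Rightarrow>\<^sub>L 'a) set
    \<Rightarrow> ((('a \<Rightarrow>\<^sub>L 'a) \<Rightarrow> complex) \<Rightarrow> 'k::chilbert \<Rightarrow>\<^sub>L 'k) \<Rightarrow> bool" where
  "nondegenerate M \<pi> \<longleftrightarrow> closure (span {\<pi> w \<xi> | w \<xi>. w \<in> predual M}) = UNIV"

definition is_sharp :: "('a::chilbert \<Rightarrow>\<^sub>L 'a) set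
    \<Rightarrow> (('a, 'a) htensor \<Rightarrow>\<^sub>L ('a, 'a) htensor)
    \<Rightarrow> (('a \<Rightarrow>\<^sub>L 'a) \<Rightarrow> complex) \<Rightarrow> (('a \<Rightarrow>\<^sub>L 'a) \<Rightarrow> complex) \<Rightarrow> bool" where
  "is_sharp M W w w' \<longleftrightarrow> w \<in> predual M \<and> w' \<in> predual M \<and>
     (\<forall>(x, y)\<in>antipode W. w' x = cnj (w (adj y)))"

definition star_representation :: "('a::chilbert \<Rightarrow>\<^sub>L 'a) set
    \<Rightarrow> (('a \<Rightarrow>\<^sub>L 'a) \<Rightarrow> ('a, 'a) htensor \<Rightarrow>\<^sub>L ('a, 'a) htensor)
    \<Rightarrow> (('a, 'a) htensor \<Rightarrow>\<^sub>L ('a, 'a) htensor)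
    \<Rightarrow> ((('a \<Rightarrow>\<^sub>L 'a) \<Rightarrow> complex) \<Rightarrow> 'k::chilbert \<Rightarrow>\<^sub>L 'k) \<Rightarrow> bool" where
  "star_representation M \<Delta> W \<pi> \<longleftrightarrow> L1_representation M \<Delta> \<pi> \<and>
     (\<forall>w w'. is_sharp M W w w' \<longrightarrow> \<pi> w' = adj (\<pi> w))"

text \<open>Norm of a finite matrix of linear maps, acting between Hilbert direct sums.\<close>

definition mat_norm :: "'i set \<Rightarrow> ('i \<Rightarrow> 'i \<Rightarrow> 'a::real_normed_vector \<Rightarrow> 'b::real_normed_vector) \<Rightarrow> real" where
  "mat_norm I X = Inf {C. 0 \<le> C \<and> (\<forall>\<xi>. L2_set (\<lambda>i. norm (\<Sum>j\<in>I. X i j (\<xi> j))) I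
                                        \<le> C * L2_set (\<lambda>j. norm (\<xi> j)) I)}"

text \<open>The norm of \<open>M\<^sub>n(M\<^sub>*)\<close> as the set of normal completely bounded maps \<open>M \<rightarrow> M\<^sub>n\<close>:
  the supremum of \<open>\<parallel>[w\<^sub>i\<^sub>j(x\<^sub>k\<^sub>l)]\<parallel>\<close> over all \<open>m\<close> and all \<open>x\<close> in the unit ball of \<open>M\<^sub>m(M)\<close>.\<close>

definition predual_mat_norm :: "('a::chilbert \<Rightarrow>\<^sub>L 'a) set \<Rightarrow> nat
    \<Rightarrow> (nat \<Rightarrow> nat \<Rightarrow> ('a \<Rightarrow>\<^sub>L 'a) \<Rightarrow> complex) \<Rightarrow> real" where
  "predual_mat_norm M n w =
     Sup {mat_norm ({..<n} \<times> {..<m}) (\<lambda>(i, k) (j, l) z. w i j (x k l) * z) | (m :: nat) x.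
            (\<forall>k<m. \<forall>l<m. x k l \<in> M) \<and> mat_norm {..<m} (\<lambda>k l. blinfun_apply (x k l)) \<le> 1}"

definition cb_bounds :: "('a::chilbert \<Rightarrow>\<^sub>L 'a) set
    \<Rightarrow> ((('a \<Rightarrow>\<^sub>L 'a) \<Rightarrow> complex) \<Rightarrow> 'k::chilbert \<Rightarrow>\<^sub>L 'k) \<Rightarrow> real set" where
  "cb_bounds M \<pi> = {C. 0 \<le> C \<and> (\<forall>n w. (\<forall>i<n. \<forall>j<n. w i j \<in> predual M) \<longrightarrow>
     mat_norm {..<n} (\<lambda>i j. blinfun_apply (\<pi> (w i j))) \<le> C * predual_mat_norm M n w)}"

definition completely_bounded :: "('a::chilbert \<Rightarrow>\<^sub>L 'a) set
    \<Rightarrow> ((('a \<Rightarrow>\<^sub>L 'a) \<Rightarrow> complex) \<Rightarrow> 'k::chilbert \<Rightarrow>\<^sub>L 'k) \<Rightarrow> bool" where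
  "completely_bounded M \<pi> \<longleftrightarrow> cb_bounds M \<pi> \<noteq> {}"

definition cb_norm :: "('a::chilbert \<Rightarrow>\<^sub>L 'a) set
    \<Rightarrow> ((('a \<Rightarrow>\<^sub>L 'a) \<Rightarrow> complex) \<Rightarrow> 'k::chilbert \<Rightarrow>\<^sub>L 'k) \<Rightarrow> real" where
  "cb_norm M \<pi> = Inf (cb_bounds M \<pi>)"

end

theory Submission
  imports Defs "HOL-Complex_Analysis.Conformal_Mappings"
begin

text \<open>A completely bounded representation \<open>\<pi>\<close> has matrix coefficients \<open>V\<^bsub>\<alpha>\<gamma>\<^esub> \<in> M\<close> with
  \<open>w(V\<^bsub>\<alpha>\<gamma>\<^esub>) = \<langle>\<alpha>, \<pi>(w)\<gamma>\<rangle>\<close>, whose rows and columns are bounded by \<open>C = \<parallel>\<pi>\<parallel>\<^sub>c\<^sub>b\<close>.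
  Averaging against the net, \<open>\<langle>\<alpha>, Q\<beta>\<rangle> = lim\<^sub>j \<Sum>\<^sub>k \<langle>V\<^bsub>\<alpha>k\<^esub>\<^sup>* \<xi>\<^sub>j, V\<^bsub>\<beta>k\<^esub>\<^sup>* \<xi>\<^sub>j\<rangle>\<close> defines an operator \<open>Q \<le> C\<^sup>2\<close>,
  and the invariance of the net gives \<open>\<pi>(w) Q = Q \<pi>(w\<^sup>\<sharp>)\<^sup>*\<close>; hence \<open>T = Q\<^sup>-\<^sup>1\<^sup>/\<^sup>2\<close> conjugates \<open>\<pi>\<close> to a
  \<open>*\<close>-representation. For the lower bound, the vector states of central \<open>\<xi>\<^sub>j\<close> are traces because \<open>\<phi>\<close>
  is one, and the antipode \<open>S\<close> is a \<open>*\<close>-antiautomorphism by the Kac condition. So the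
  Cauchy-Schwarz inequality applied to the antipode axiom \<open>\<Sum>\<^sub>k V\<^bsub>\<alpha>k\<^esub> S(V\<^bsub>k\<beta>\<^esub>) = \<langle>\<alpha>, \<beta>\<rangle> 1\<close> yields \<open>|\<langle>\<alpha>, \<beta>\<rangle>| \<le> \<langle>\<alpha>, Q\<alpha>\<rangle>\<^sup>1\<^sup>/\<^sup>2 C \<parallel>\<beta>\<parallel>\<close>,
  that is \<open>Q \<ge> C\<^sup>-\<^sup>2\<close>. This gives \<open>\<parallel>T\<parallel> \<parallel>T\<^sup>-\<^sup>1\<parallel> \<le> C\<^sup>2\<close>, and \<open>C \<ge> 1\<close> unless the space is trivial.\<close>

section \<open>Complex Hilbert spaces\<close>

text \<open>The delicate point is order. \<open>R\<close> reverses products, so it carries the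
  column bound "sum of \<open>adj Z Z\<close> at most \<open>B^2\<close>" to "sum of
  \<open>R Z adj (R Z)\<close> at most \<open>B^2\<close>", while Cauchy-Schwarz needs the sum of
  the squared norms of \<open>R Z \<xi>\<close>, the opposite order. The trace property of the
  vector state exchanges the two. The antipode axiom is an infinite sum, and \<open>R\<close> is
  handled through order alone. So the axiom is proved for \<open>\<beta> = \<pi> w \<gamma>\<close>
  with a vector functional \<open>w\<close>, where the coefficients at \<open>\<beta>\<close> are
  explicit in \<open>W\<close> and can be cut off. Nondegeneracy makes such \<open>\<beta>\<close>
  total, and the resulting inequality is closed. The commutation of \<open>Q\<close> with
  \<open>\<pi>\<close> arises as follows: moving \<open>\<pi> w\<close> into the form produces the
  vector \<open>W (\<eta> \<otimes> \<xi>)\<close>; replacing it by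
  \<open>\<eta> \<otimes> \<xi>\<close> leaves a form that sees \<open>w\<close> only on slices of
  \<open>W\<close>, where the antipode just swaps indices and takes adjoints. The averages converge
  only along a finer filter; this suffices, as all properties asked of \<open>Q\<close> survive
  limits.\<close>

lemma norm_scaleC: "norm (c *\<^sub>C x) = cmod c * norm (x :: 'a::chilbert)"
proof -
  have "cinner (c *\<^sub>C x) (c *\<^sub>C x) = (cnj c * c) * cinner x x"
    by (simp add: cinner_scaleC_left cinner_scaleC_right)
  also have "cnj c * c = of_real ((cmod c)\<^sup>2)"
    by (metis complex_norm_square mult.commute of_real_power)
  finally have "of_real ((norm (c *\<^sub>C x))\<^sup>2) = (of_real ((cmod c * norm x)\<^sup>2) :: complex)"
    unfolding cinner_self by (simp add: power_mult_distrib)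
  then have "(norm (c *\<^sub>C x))\<^sup>2 = (cmod c * norm x)\<^sup>2"
    unfolding of_real_eq_iff .
  then show ?thesis by (simp add: power2_eq_iff_nonneg)
qed

lemma scaleC_simps [simp]:
  "(0::complex) *\<^sub>C x = 0" "c *\<^sub>C (0 :: 'a::chilbert) = 0" "1 *\<^sub>C x = x" "(-1) *\<^sub>C x = - x"
  using scaleR_scaleC[of 0 x] scaleR_scaleC[of 1 x] scaleR_scaleC[of "-1" x] norm_scaleC[of c "0::'a"]
  by auto

lemma scaleC_minus_right: "c *\<^sub>C (- x) = - (c *\<^sub>C (x :: 'a::chilbert))"
  by (metis scaleC_scaleC mult.commute scaleC_simps(4))

lemma scaleC_diff_right: "c *\<^sub>C (x - y) = c *\<^sub>C x - c *\<^sub>C (y :: 'a::chilbert)"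
  by (metis diff_conv_add_uminus scaleC_add_right scaleC_minus_right)

lemma bounded_linear_scaleC_right: "bounded_linear (\<lambda>x :: 'a::chilbert. c *\<^sub>C x)"
  by (rule bounded_linear_intro[where K = "cmod c"])
    (auto simp: scaleC_add_right norm_scaleC scaleR_scaleC scaleC_scaleC mult.commute)

lemma tendsto_cinner [tendsto_intros]:
  assumes "(f \<longlongrightarrow> (x :: 'a::chilbert)) F" "(g \<longlongrightarrow> y) F"
  shows "((\<lambda>i. cinner (f i) (g i)) \<longlongrightarrow> cinner x y) F"
proof -
  have "bounded_bilinear (cinner :: 'a \<Rightarrow> 'a \<Rightarrow> complex)"
    by standard (auto simp: cinner_add_left cinner_add_right cinner_scaleR_left cinner_scaleR_right
        scaleR_conv_of_real intro!: exI[of _ 1] cmod_cinner_le)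
  then show ?thesis using assms by (rule bounded_bilinear.tendsto)
qed

lemma continuous_on_cinner [continuous_intros]:
  assumes "continuous_on S f" "continuous_on S g"
  shows "continuous_on S (\<lambda>z. cinner (f z) (g z :: 'a::chilbert))"
  using assms unfolding continuous_on_def by (auto intro: tendsto_cinner)

lemma cinner_ext_right: "(\<And>u. cinner u x = cinner u y) \<Longrightarrow> x = (y :: 'a::chilbert)"
  by (metis cinner_diff_right cinner_self_eq_0 eq_iff_diff_eq_0)

lemma cinner_ext_left: "(\<And>u. cinner x u = cinner y u) \<Longrightarrow> x = (y :: 'a::chilbert)"
  by (metis cinner_diff_left cinner_self_eq_0 eq_iff_diff_eq_0)

lemma norm_le_cinner:
  assumes "\<And>u. cmod (cinner u x) \<le> C * norm u" "0 \<le> C"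
  shows "norm (x :: 'a::chilbert) \<le> C"
proof -
  have "norm x * norm x \<le> C * norm x"
    using assms(1)[of x] by (simp add: cinner_self norm_power norm_mult power2_eq_square)
  with assms(2) show ?thesis by (metis mult_right_le_imp_le norm_ge_zero order_le_less)
qed

lemma norm_diff_sq:
  "(norm (x - y))\<^sup>2 = (norm x)\<^sup>2 + (norm y)\<^sup>2 - 2 * Re (cinner x (y :: 'a::chilbert))"
proof -
  have "of_real ((norm (x - y))\<^sup>2) = cinner (x - y) (x - y)" by (simp add: cinner_self)
  also have "\<dots> = of_real ((norm x)\<^sup>2) + of_real ((norm y)\<^sup>2) - (cinner x y + cnj (cinner x y))"
    unfolding cinner_self[symmetric]
    by (simp add: cinner_diff_left cinner_diff_right cinner_commute[of y x, symmetric])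
  also have "\<dots> = of_real ((norm x)\<^sup>2 + (norm y)\<^sup>2 - 2 * Re (cinner x y))"
    by (simp add: complex_add_cnj)
  finally show ?thesis unfolding of_real_eq_iff .
qed

lemma norm_add_sq:
  "(norm (x + y))\<^sup>2 = (norm x)\<^sup>2 + (norm y)\<^sup>2 + 2 * Re (cinner x (y :: 'a::chilbert))"
  using norm_diff_sq[of x "- y"] by (simp add: cinner_minus_right)

text \<open>The representing vector minimises \<open>\<parallel>u\<parallel>\<^sup>2 - 2 Re b\<close> over the graph; working with the graph
  instead of a functional avoids a separate well-definedness argument.\<close>

lemma riesz_graph:
  fixes G :: "('a::chilbert \<times> complex) set"
  assumes zero: "(0, 0) \<in> G"
    and add: "\<And>u b v c. (u, b) \<in> G \<Longrightarrow> (v, c) \<in> G \<Longrightarrow> (u + v, b + c) \<in> G"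
    and scale: "\<And>t u b. (u, b) \<in> G \<Longrightarrow> (t *\<^sub>C u, t * b) \<in> G"
    and bound: "\<And>u b. (u, b) \<in> G \<Longrightarrow> cmod b \<le> C * norm u"
    and C: "0 \<le> C"
  obtains v where "\<And>u b. (u, b) \<in> G \<Longrightarrow> cinner v u = b" "norm v \<le> C" "v \<in> closure (fst ` G)"
proof -
  define J where "J = (\<lambda>p :: 'a \<times> complex. (norm (fst p))\<^sup>2 - 2 * Re (snd p))"
  have J_ge: "- C\<^sup>2 \<le> J p" if "p \<in> G" for p
  proof -
    have "Re (snd p) \<le> C * norm (fst p)"
      using bound[of "fst p" "snd p"] that complex_Re_le_cmod order_trans by fastforce
    moreover have "2 * (C * norm (fst p)) \<le> C\<^sup>2 + (norm (fst p))\<^sup>2"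
      using sum_squares_bound[of C "norm (fst p)"] by simp
    ultimately show ?thesis unfolding J_def by linarith
  qed
  define m where "m = Inf (J ` G)"
  have bdd: "bdd_below (J ` G)" using J_ge by (auto intro!: bdd_belowI2)
  have m_le: "m \<le> J p" if "p \<in> G" for p unfolding m_def by (rule cINF_lower[OF bdd that])
  have "\<exists>p\<in>G. J p < m + 1 / Suc n" for n
  proof -
    have "Inf (J ` G) < m + 1 / Suc n" unfolding m_def by simp
    then show ?thesis using cINF_less_iff[OF _ bdd] zero by blast
  qed
  then obtain p where pG: "\<And>n. p n \<in> G" and pm: "\<And>n. J (p n) < m + 1 / Suc n" by metis
  define x where "x n = fst (p n)" for n
  \<comment> \<open>The midpoint of two points of \<open>G\<close> is again in \<open>G\<close>, so
    \<open>J\<close> is at least \<open>m\<close> there; by the parallelogram law the squared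
    distance is controlled by how far \<open>J (p i)\<close> and \<open>J (p j)\<close> exceed the
    infimum.\<close>
  have par: "(norm (x i - x j))\<^sup>2 \<le> 2 * (1 / Suc i + 1 / Suc j)" for i j
  proof -
    define q where "q = ((1/2) *\<^sub>C (x i + x j), (1/2) * (snd (p i) + snd (p j)))"
    have "q \<in> G" unfolding q_def x_def using scale[OF add] pG by (metis prod.collapse)
    then have "m \<le> J q" by (rule m_le)
    have "(norm (x i + x j))\<^sup>2 + (norm (x i - x j))\<^sup>2 = 2 * (norm (x i))\<^sup>2 + 2 * (norm (x j))\<^sup>2"
      unfolding norm_add_sq norm_diff_sq by simp
    moreover have "J q = (norm (x i + x j))\<^sup>2 / 4 - (Re (snd (p i)) + Re (snd (p j)))"
      unfolding J_def q_def
      by (simp add: norm_scaleC power_divide norm_divide power_mult_distrib field_simps)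
    ultimately have "(norm (x i - x j))\<^sup>2 = 2 * J (p i) + 2 * J (p j) - 4 * J q"
      unfolding J_def x_def by (simp add: field_simps)
    then show ?thesis using \<open>m \<le> J q\<close> pm[of i] pm[of j] by argo
  qed
  have "Cauchy x"
    unfolding Cauchy_def
  proof (intro allI impI)
    fix e :: real assume e: "0 < e"
    obtain N :: nat where N: "4 / e\<^sup>2 < real N" using reals_Archimedean2 by blast
    have "dist (x i) (x j) < e" if ij: "i \<ge> N" "j \<ge> N" for i j
    proof -
      have N0: "0 < real N" using N e by (smt (verit) divide_pos_pos zero_less_power)
      have "1 / real (Suc k) < e\<^sup>2 / 4" if "k \<ge> N" for k
      proof -
        have "1 / real (Suc k) < 1 / real N" using that N0 by (simp add: frac_less2)
        also have "\<dots> < e\<^sup>2 / 4" using N N0 e by (simp add: field_simps)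
        finally show ?thesis .
      qed
      from this[OF ij(1)] this[OF ij(2)] par[of i j]
      have "(norm (x i - x j))\<^sup>2 < e\<^sup>2" by argo
      then show ?thesis unfolding dist_norm using e by (meson less_imp_le power_less_imp_less_base)
    qed
    then show "\<exists>N. \<forall>m\<ge>N. \<forall>n\<ge>N. dist (x m) (x n) < e" by blast
  qed
  then obtain v where v: "x \<longlonglongrightarrow> v" using Cauchy_convergent convergent_def by blast
  have inv: "(\<lambda>n. 1 / real (Suc n)) \<longlonglongrightarrow> 0" using LIMSEQ_inverse_real_of_nat by (simp add: inverse_eq_divide)
  have eq: "cinner v u = b" if ub: "(u, b) \<in> G" for u b
  proof -
    \<comment> \<open>First variation: \<open>p n\<close> nearly minimises \<open>J\<close>, so
      moving it by \<open>t\<close> times \<open>(u, b)\<close> cannot lower \<open>J\<close> by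
      more than \<open>1 / Suc n\<close>; then \<open>n\<close> tends to infinity.\<close>
    have ge: "0 \<le> 2 * Re (t * (cinner v u - b)) + (norm (t *\<^sub>C u))\<^sup>2" for t
    proof -
      have step: "0 \<le> 1 / Suc n + (2 * Re (t * (cinner (x n) u - b)) + (norm (t *\<^sub>C u))\<^sup>2)" for n
      proof -
        have "(x n + t *\<^sub>C u, snd (p n) + t * b) \<in> G"
          unfolding x_def using add[OF _ scale[OF ub]] pG by simp
        then have "m \<le> J (x n + t *\<^sub>C u, snd (p n) + t * b)" by (rule m_le)
        also have "\<dots> = J (p n) + (2 * Re (t * (cinner (x n) u - b)) + (norm (t *\<^sub>C u))\<^sup>2)"
          unfolding J_def norm_add_sq fst_conv snd_conv
          by (simp add: cinner_scaleC_right algebra_simps x_def)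
        finally show ?thesis using pm[of n] by linarith
      qed
      have "(\<lambda>n. 1 / Suc n + (2 * Re (t * (cinner (x n) u - b)) + (norm (t *\<^sub>C u))\<^sup>2))
          \<longlonglongrightarrow> 0 + (2 * Re (t * (cinner v u - b)) + (norm (t *\<^sub>C u))\<^sup>2)"
        by (intro tendsto_intros inv v)
      from LIMSEQ_le_const[OF this, of 0] step show ?thesis by (metis add_0)
    qed
    define d where "d = cinner v u - b"
    show ?thesis
    proof (rule ccontr)
      assume "cinner v u \<noteq> b"
      then have d: "cmod d > 0" by (simp add: d_def)
      \<comment> \<open>With \<open>t = - r * cnj d\<close> the linear term is
        \<open>-2 r |d|^2\<close>, and as \<open>r * (norm u)\<^sup>2 < 1\<close> the quadratic term
        stays below \<open>r |d|^2\<close>.\<close>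
      define r where "r = 1 / ((norm u)\<^sup>2 + 1)"
      have "0 < (norm u)\<^sup>2 + 1" by (rule add_nonneg_pos) auto
      then have r: "r > 0" "r * (norm u)\<^sup>2 < 1" unfolding r_def by (auto simp: field_simps)
      have "0 \<le> 2 * Re ((- of_real r * cnj d) * d) + (norm ((- of_real r * cnj d) *\<^sub>C u))\<^sup>2"
        unfolding d_def by (rule ge)
      also have "(- of_real r * cnj d) * d = of_real (- r * (cmod d)\<^sup>2)"
        by (simp add: complex_norm_square mult.commute mult.left_commute del: of_real_power)
      also have "(norm ((- of_real r * cnj d) *\<^sub>C u))\<^sup>2 = r * (r * (norm u)\<^sup>2) * (cmod d)\<^sup>2"
        using r by (simp add: norm_scaleC norm_mult power_mult_distrib power2_eq_square)
      also have "2 * Re (complex_of_real (- r * (cmod d)\<^sup>2)) + r * (r * (norm u)\<^sup>2) * (cmod d)\<^sup>2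
          = r * (cmod d)\<^sup>2 * (r * (norm u)\<^sup>2 - 2)"
        by (simp add: algebra_simps)
      finally have "0 \<le> r * (cmod d)\<^sup>2 * (r * (norm u)\<^sup>2 - 2)" .
      moreover have "r * (cmod d)\<^sup>2 * (r * (norm u)\<^sup>2 - 2) < 0"
        using r d by (intro mult_pos_neg) auto
      ultimately show False by simp
    qed
  qed
  have mem: "v \<in> closure (fst ` G)"
    unfolding closure_sequential using v pG by (intro exI[of _ x]) (auto simp: x_def)
  have "norm v \<le> C"
  proof (cases "v = 0")
    case False
    have "(\<lambda>n. cmod (cinner v (x n))) \<longlonglongrightarrow> cmod (cinner v v)" by (intro tendsto_intros v)
    moreover have "(\<lambda>n. C * norm (x n)) \<longlonglongrightarrow> C * norm v" by (intro tendsto_intros v)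
    moreover have "cmod (cinner v (x n)) \<le> C * norm (x n)" for n
      using eq[of "x n" "snd (p n)"] bound[of "x n" "snd (p n)"] pG[of n] by (simp add: x_def)
    ultimately have "cmod (cinner v v) \<le> C * norm v" by (meson LIMSEQ_le)
    then show ?thesis using False by (simp add: cinner_self norm_power norm_mult power2_eq_square)
  qed (use C in simp)
  with eq mem that show ?thesis by blast
qed

text \<open>Projection argument: representing the functional \<open>cinner x\<close> on
  \<open>D\<close> by \<open>riesz_graph\<close> yields a vector in the closure of \<open>D\<close>
  whose difference from \<open>x\<close> is orthogonal to \<open>D\<close>, hence zero.\<close>

lemma dense_if_orthogonal_zero:
  fixes D :: "'a::chilbert set"
  assumes "0 \<in> D" "\<And>x y. x \<in> D \<Longrightarrow> y \<in> D \<Longrightarrow> x + y \<in> D" "\<And>c x. x \<in> D \<Longrightarrow> c *\<^sub>C x \<in> D"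
    and orth: "\<And>v. (\<And>d. d \<in> D \<Longrightarrow> cinner v d = 0) \<Longrightarrow> v = 0"
  shows "closure D = UNIV"
proof -
  have "x \<in> closure D" for x
  proof (rule riesz_graph[of "(\<lambda>d. (d, cinner x d)) ` D" "norm x"])
    fix v assume v: "\<And>u b. (u, b) \<in> (\<lambda>d. (d, cinner x d)) ` D \<Longrightarrow> cinner v u = b"
      and mem: "v \<in> closure (fst ` (\<lambda>d. (d, cinner x d)) ` D)"
    have "v - x = 0" by (rule orth) (use v in \<open>auto simp: cinner_diff_left\<close>)
    then show ?thesis using mem by (simp add: image_image)
  qed (use assms cmod_cinner_le[of x] in \<open>auto simp: image_iff cinner_add_right cinner_scaleC_right\<close>)
  then show ?thesis by blast
qed

lemma riesz:
  assumes "\<And>x y. f (x + y) = f x + f y" "\<And>c x. f (c *\<^sub>C x) = c * f x"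
    and "\<And>x. cmod (f x) \<le> C * norm x" "0 \<le> C"
  obtains v :: "'a::chilbert" where "\<And>x. cinner v x = f x" "norm v \<le> C"
proof (rule riesz_graph[of "range (\<lambda>x. (x, f x))" C])
  have "f 0 = 0" using assms(3)[of 0] by simp
  then show "(0, 0) \<in> range (\<lambda>x. (x, f x))" by (auto simp: image_iff)
  fix v assume "\<And>u b. (u, b) \<in> range (\<lambda>x. (x, f x)) \<Longrightarrow> cinner v u = b" "norm v \<le> C"
  then show thesis using that[of v] by blast
qed (use assms in auto)

section \<open>Operators on Hilbert spaces\<close>

lemma blinfun_eq_iff: "A = B \<longleftrightarrow> (\<forall>x. blinfun_apply A x = blinfun_apply B x)"
  by (auto intro: blinfun_eqI)

lemma blinfun_compose_assoc: "(A o\<^sub>L B) o\<^sub>L D = A o\<^sub>L (B o\<^sub>L D)"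
  by (rule blinfun_eqI) simp

lemma blinfun_compose_id: "A o\<^sub>L id_blinfun = A" "id_blinfun o\<^sub>L A = A"
  by (rule blinfun_eqI, simp)+

lemma Bop_apply: "A \<in> Bop \<Longrightarrow> A (c *\<^sub>C x) = c *\<^sub>C A x"
  unfolding Bop_def by blast

lemma bounded_form_op:
  fixes b :: "'b::chilbert \<Rightarrow> 'a::chilbert \<Rightarrow> complex"
  assumes "\<And>u u' v. b (u + u') v = b u v + b u' v" "\<And>c u v. b (c *\<^sub>C u) v = cnj c * b u v"
    and "\<And>u v v'. b u (v + v') = b u v + b u v'" "\<And>c u v. b u (c *\<^sub>C v) = c * b u v"
    and bound: "\<And>u v. cmod (b u v) \<le> C * norm u * norm v" and C: "0 \<le> C"
  obtains A where "A \<in> Bop" "\<And>u v. cinner u (blinfun_apply A v) = b u v" "norm A \<le> C"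
proof -
  have "\<exists>w. (\<forall>u. cinner u w = b u v) \<and> norm w \<le> C * norm v" for v
  proof -
    obtain w where w: "\<And>u. cinner w u = cnj (b u v)" "norm w \<le> C * norm v"
      by (rule riesz[of "\<lambda>u. cnj (b u v)" "C * norm v"])
        (use assms bound[of _ v] in \<open>auto simp: mult.commute mult.left_commute\<close>)
    have "cinner u w = b u v" for u using w(1)[of u] by (metis cinner_commute complex_cnj_cnj)
    with w(2) show ?thesis by blast
  qed
  then obtain f where f: "\<And>u v. cinner u (f v) = b u v" and fn: "\<And>v. norm (f v) \<le> C * norm v"
    by metis
  have bl: "bounded_linear f"
  proof (rule bounded_linear_intro[where K = C])
    show "f (x + y) = f x + f y" for x y by (rule cinner_ext_right) (simp add: f assms cinner_add_right)
    show "f (r *\<^sub>R x) = r *\<^sub>R f x" for r x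
      by (rule cinner_ext_right) (simp add: f assms cinner_scaleR_right scaleR_scaleC cinner_scaleC_right)
    show "norm (f x) \<le> norm x * C" for x using fn[of x] by (simp add: mult.commute)
  qed
  have ap: "blinfun_apply (Blinfun f) = f" by (rule bounded_linear_Blinfun_apply[OF bl])
  have "Blinfun f (c *\<^sub>C x) = c *\<^sub>C Blinfun f x" for c x
    unfolding ap by (rule cinner_ext_right) (simp add: f assms cinner_scaleC_right)
  then have "Blinfun f \<in> Bop" unfolding Bop_def by blast
  moreover have "norm (Blinfun f) \<le> C" using fn by (intro norm_blinfun_bound C) (simp add: ap)
  ultimately show thesis using that f ap by metis
qed

lemma cinner_ext_op:
  fixes A B :: "'a::chilbert \<Rightarrow>\<^sub>L 'b::chilbert"
  shows "(\<And>u v. cinner u (A v) = cinner u (B v)) \<Longrightarrow> A = B"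
  by (rule blinfun_eqI, rule cinner_ext_right)

lemma adjI:
  fixes A :: "'a::chilbert \<Rightarrow>\<^sub>L 'b::chilbert"
  assumes "B \<in> Bop" "\<And>x y. cinner (A x) y = cinner x (B y)"
  shows "adj A = B"
  unfolding adj_def using assms by (intro the_equality) (auto intro!: cinner_ext_op)

lemma adj_exists:
  fixes A :: "'a::chilbert \<Rightarrow>\<^sub>L 'b::chilbert"
  assumes "A \<in> Bop"
  shows adj_Bop: "adj A \<in> Bop" and cinner_adj_right: "cinner x (adj A y) = cinner (A x) y"
    and norm_adj_le: "norm (adj A) \<le> norm A"
proof -
  obtain B where B: "B \<in> Bop" "\<And>u v. cinner u (B v) = cinner (A u) v" "norm B \<le> norm A"
  proof (rule bounded_form_op[of "\<lambda>u v. cinner (A u) v" "norm A"])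
    show "cmod (cinner (A u) v) \<le> norm A * norm u * norm v" for u v
      by (rule order_trans[OF cmod_cinner_le]) (simp add: mult_right_mono norm_blinfun)
  qed (use assms in \<open>auto simp: blinfun.add_right Bop_apply cinner_add_left cinner_add_right
      cinner_scaleC_left cinner_scaleC_right\<close>)
  then have "adj A = B" by (intro adjI) auto
  with B show "adj A \<in> Bop" "cinner x (adj A y) = cinner (A x) y" "norm (adj A) \<le> norm A" by auto
qed

lemma cinner_adj_left: "A \<in> Bop \<Longrightarrow> cinner (adj A x) y = cinner x (A y)"
  by (metis cinner_adj_right cinner_commute)

lemma adj_adj: "A \<in> Bop \<Longrightarrow> adj (adj A) = A"
  by (rule adjI) (auto simp: cinner_adj_left)

lemma norm_adj: "A \<in> Bop \<Longrightarrow> norm (adj A) = norm A"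
  by (metis adj_Bop adj_adj norm_adj_le order_antisym)

lemma scaleC_op_apply [simp]: "(c *\<^sub>B A) x = c *\<^sub>C (A x :: 'b::chilbert)"
proof -
  have "bounded_linear (\<lambda>x. c *\<^sub>C A x)"
    by (rule bounded_linear_compose[OF bounded_linear_scaleC_right blinfun.bounded_linear_right])
  then show ?thesis unfolding scaleC_op_def by (simp add: bounded_linear_Blinfun_apply)
qed

lemma Bop_intros [intro, simp]:
  "id_blinfun \<in> Bop" "0 \<in> Bop" "A \<in> Bop \<Longrightarrow> B \<in> Bop \<Longrightarrow> A + B \<in> Bop"
  "A \<in> Bop \<Longrightarrow> B \<in> Bop \<Longrightarrow> A - B \<in> Bop" "A \<in> Bop \<Longrightarrow> r *\<^sub>R A \<in> Bop" "A \<in> Bop \<Longrightarrow> - A \<in> Bop"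
  "A \<in> Bop \<Longrightarrow> c *\<^sub>B A \<in> Bop" "D \<in> Bop \<Longrightarrow> E \<in> Bop \<Longrightarrow> D o\<^sub>L E \<in> Bop" "A \<in> Bop \<Longrightarrow> adj A \<in> Bop"
  by (auto simp: Bop_def blinfun.add_left blinfun.diff_left blinfun.scaleR_left blinfun.minus_left
      scaleC_add_right scaleC_diff_right scaleR_scaleC scaleC_scaleC mult.commute scaleC_minus_right
      intro: adj_exists(1)[unfolded Bop_def, simplified, rule_format])

lemma adj_id [simp]: "adj id_blinfun = id_blinfun"
  by (rule adjI) auto

lemma adj_compose: "A \<in> Bop \<Longrightarrow> B \<in> Bop \<Longrightarrow> adj (A o\<^sub>L B) = adj B o\<^sub>L adj A"
  by (rule adjI) (auto simp: cinner_adj_right)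

lemma adj_add: "A \<in> Bop \<Longrightarrow> B \<in> Bop \<Longrightarrow> adj (A + B) = adj A + adj B"
  by (rule adjI) (auto simp: cinner_adj_right blinfun.add_left cinner_add_left cinner_add_right)

lemma adj_diff: "A \<in> Bop \<Longrightarrow> B \<in> Bop \<Longrightarrow> adj (A - B) = adj A - adj B"
  by (rule adjI) (auto simp: cinner_adj_right blinfun.diff_left cinner_diff_left cinner_diff_right)

lemma adj_scaleR: "A \<in> Bop \<Longrightarrow> adj (r *\<^sub>R A) = r *\<^sub>R adj A"
  by (rule adjI) (auto simp: cinner_adj_right blinfun.scaleR_left cinner_scaleR_left cinner_scaleR_right)

lemma adj_scaleC: "A \<in> Bop \<Longrightarrow> adj (c *\<^sub>B A) = cnj c *\<^sub>B adj A"
  by (rule adjI) (auto simp: cinner_adj_right cinner_scaleC_left cinner_scaleC_right)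

lemma closed_Bop: "closed (Bop :: ('a::chilbert \<Rightarrow>\<^sub>L 'b::chilbert) set)"
proof -
  have "closed {A :: 'a \<Rightarrow>\<^sub>L 'b. A (c *\<^sub>C x) = c *\<^sub>C A x}" for c x
    by (intro closed_Collect_eq continuous_intros
        continuous_on_compose2[OF linear_continuous_on[OF bounded_linear_scaleC_right]]) auto
  then show ?thesis unfolding Bop_def by (intro closed_Collect_all)
qed

text \<open>Polarisation with the two vectors \<open>u + v\<close> and
  \<open>u + \<i> *\<^sub>C v\<close>.\<close>

lemma sesquilinear_zero:
  fixes b :: "'a::chilbert \<Rightarrow> 'a \<Rightarrow> complex"
  assumes "\<And>u u' v. b (u + u') v = b u v + b u' v" "\<And>c u v. b (c *\<^sub>C u) v = cnj c * b u v"
    and "\<And>u v v'. b u (v + v') = b u v + b u v'" "\<And>c u v. b u (c *\<^sub>C v) = c * b u v"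
    and z: "\<And>u. b u u = 0"
  shows "b u v = 0"
proof -
  have 1: "b u v + b v u = 0" for u v using z[of "u + v"] z[of u] z[of v] by (simp add: assms(1-4) add.commute)
  have "\<i> * b u v - \<i> * b v u = 0" using 1[of u "\<i> *\<^sub>C v"] by (simp add: assms(1-4))
  then have "b u v = b v u" by simp
  with 1[of u v] show ?thesis by simp
qed

lemma op_eqI_quadratic:
  fixes A B :: "'a::chilbert \<Rightarrow>\<^sub>L 'a"
  assumes "A \<in> Bop" "B \<in> Bop" "\<And>u. cinner u (A u) = cinner u (B u)"
  shows "A = B"
proof (rule cinner_ext_op)
  fix u v
  have "cinner u ((A - B) v) = 0"
    by (rule sesquilinear_zero[of "\<lambda>u v. cinner u ((A - B) v)"])
      (use assms in \<open>auto simp: blinfun.add_right blinfun.diff_left Bop_apply cinner_add_left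
        cinner_add_right cinner_scaleC_left cinner_scaleC_right cinner_diff_right algebra_simps\<close>)
  then show "cinner u (A v) = cinner u (B v)" by (simp add: blinfun.diff_left cinner_diff_right)
qed

lemma pos_Bop_iff: "A \<in> pos Bop \<longleftrightarrow> A \<in> Bop \<and> (\<forall>u. Im (cinner u (A u)) = 0 \<and> 0 \<le> Re (cinner u (A u)))"
  unfolding pos_def by (auto simp: complex_nonneg_Reals_iff)

lemma adj_pos: "A \<in> pos Bop \<Longrightarrow> adj A = A"
proof (rule op_eqI_quadratic)
  assume A: "A \<in> pos Bop"
  then show "cinner u (adj A u) = cinner u (A u)" for u
    unfolding pos_Bop_iff using cinner_commute[of "A u" u]
    by (simp add: cinner_adj_right complex_eq_iff)
qed (auto simp: pos_Bop_iff)

lemma pos_cauchy_schwarz: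
  assumes A: "A \<in> pos Bop"
  shows "(cmod (cinner u (A v)))\<^sup>2 \<le> Re (cinner u (A u)) * Re (cinner v (A v))"
proof -
  define a c d where "a = Re (cinner u (A u))" and "c = Re (cinner v (A v))" and "d = cinner u (A v)"
  have AB: "A \<in> Bop" and nonneg: "0 \<le> Re (cinner w (A w))" for w
    using A unfolding pos_Bop_iff by auto
  have dc: "cinner v (A u) = cnj d"
    using cinner_adj_right[OF AB, of v u] adj_pos[OF A] cinner_commute[of "A v" u] by (simp add: d_def)
  \<comment> \<open>Positivity at \<open>u + t *\<^sub>C v\<close> with
    \<open>t = - s * cnj d\<close>, which makes the cross terms real. Below,
    \<open>s = 1 / c\<close> is used, and for \<open>c = 0\<close> a value of \<open>s\<close> that
    would force \<open>0 \<le> - a - 2\<close>.\<close>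
  have quad: "0 \<le> a - 2 * s * (cmod d)\<^sup>2 + s\<^sup>2 * (cmod d)\<^sup>2 * c" for s :: real
  proof -
    define t where "t = - of_real s * cnj d"
    have "cinner (u + t *\<^sub>C v) (A (u + t *\<^sub>C v))
        = cinner u (A u) + (t * d + cnj t * cnj d) + cnj t * t * cinner v (A v)"
      using AB dc by (simp add: blinfun.add_right Bop_apply cinner_add_left cinner_add_right
          cinner_scaleC_left cinner_scaleC_right d_def algebra_simps)
    also have "t * d = of_real (- s * (cmod d)\<^sup>2)"
      unfolding t_def of_real_mult complex_norm_square by (simp add: mult.commute)
    also have "cnj t * cnj d = of_real (- s * (cmod d)\<^sup>2)"
      unfolding t_def of_real_mult complex_norm_square by (simp add: mult.commute)
    also have "cnj t * t = of_real (s\<^sup>2 * (cmod d)\<^sup>2)"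
      unfolding t_def of_real_mult complex_norm_square by (simp add: power2_eq_square)
    finally have "Re (cinner (u + t *\<^sub>C v) (A (u + t *\<^sub>C v)))
        = a - 2 * s * (cmod d)\<^sup>2 + s\<^sup>2 * (cmod d)\<^sup>2 * c"
      by (simp add: a_def c_def)
    then show ?thesis using nonneg[of "u + t *\<^sub>C v"] by simp
  qed
  have ac: "0 \<le> a" "0 \<le> c" using nonneg unfolding a_def c_def by auto
  have "(cmod d)\<^sup>2 \<le> a * c"
  proof (cases "c = 0")
    case True
    have "(cmod d)\<^sup>2 = 0"
    proof (rule ccontr)
      assume nz: "(cmod d)\<^sup>2 \<noteq> 0"
      have "0 \<le> a - 2 * ((a + 1) / (cmod d)\<^sup>2) * (cmod d)\<^sup>2"
        using quad[of "(a + 1) / (cmod d)\<^sup>2"] True by simp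
      also have "2 * ((a + 1) / (cmod d)\<^sup>2) * (cmod d)\<^sup>2 = 2 * (a + 1)" using nz by simp
      finally show False using ac by simp
    qed
    with True show ?thesis by simp
  next
    case False
    then have "0 < c" using ac by simp
    then have "0 \<le> a - (cmod d)\<^sup>2 / c" using quad[of "1 / c"] by (simp add: field_simps power2_eq_square)
    then show ?thesis using \<open>0 < c\<close> by (simp add: field_simps)
  qed
  then show ?thesis unfolding a_def c_def d_def .
qed

text \<open>Cauchy-Schwarz for the form of \<open>A\<close> bounds all matrix elements by diagonal
  ones. In this way form estimates become norm estimates such as \<open>norm X < 1\<close>, which
  the square root needs.\<close>

lemma norm_pos_le:
  assumes A: "A \<in> pos Bop" and r: "0 \<le> r" "\<And>u. Re (cinner u (A u)) \<le> r * (norm u)\<^sup>2"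
  shows "norm A \<le> r"
proof (rule norm_blinfun_bound[OF r(1)])
  fix v
  show "norm (A v) \<le> r * norm v"
  proof (rule norm_le_cinner)
    fix u
    have "(cmod (cinner u (A v)))\<^sup>2 \<le> Re (cinner u (A u)) * Re (cinner v (A v))"
      by (rule pos_cauchy_schwarz[OF A])
    also have "\<dots> \<le> (r * (norm u)\<^sup>2) * (r * (norm v)\<^sup>2)"
      using r A unfolding pos_Bop_iff by (intro mult_mono) auto
    also have "\<dots> = (r * norm v * norm u)\<^sup>2" by (simp add: power2_eq_square)
    finally show "cmod (cinner u (A v)) \<le> r * norm v * norm u"
      by (rule power2_le_imp_le) (use r in auto)
  qed (use r in auto)
qed

text \<open>The square root of \<open>1 - X\<close> is \<open>1 - Y\<close> with \<open>Y = (X + Y\<^sup>2) / 2\<close>, a contraction on a small ball.\<close>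

lemma sqrt_one_minus:
  fixes X :: "'a::chilbert \<Rightarrow>\<^sub>L 'a"
  assumes M: "M \<subseteq> Bop" "closed M" "0 \<in> M"
    and alg: "\<And>x y. x \<in> M \<Longrightarrow> y \<in> M \<Longrightarrow> x + y \<in> M" "\<And>r x. x \<in> M \<Longrightarrow> r *\<^sub>R x \<in> M"
      "\<And>x y. x \<in> M \<Longrightarrow> y \<in> M \<Longrightarrow> x o\<^sub>L y \<in> M"
    and X: "X \<in> M" "adj X = X" "norm X < 1"
  obtains Y where "Y \<in> M" "adj Y = Y" "(id_blinfun - Y) o\<^sub>L (id_blinfun - Y) = id_blinfun - X"
proof -
  \<comment> \<open>The radius satisfies \<open>norm X + 1 = 2 * s\<close>; with
    \<open>s\<^sup>2 \<le> 1\<close> this gives the bound that keeps \<open>f\<close> inside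
    \<open>S\<close>. The same \<open>s\<close> is the contraction constant.\<close>
  define s where "s = (1 + norm X) / 2"
  have s01: "0 \<le> s" "s < 1" "norm X + 1 = 2 * s" unfolding s_def using X(3) by (auto intro: add_nonneg_nonneg)
  then have s: "0 \<le> s" "s < 1" "norm X + s\<^sup>2 \<le> 2 * s" using power_le_one[of s 2] by auto
  define S where "S = {Y \<in> M. adj Y = Y \<and> norm Y \<le> s}"
  define f where "f Y = (1/2) *\<^sub>R (X + (Y o\<^sub>L Y))" for Y :: "'a \<Rightarrow>\<^sub>L 'a"
  have SB: "Y \<in> Bop" if "Y \<in> S" for Y using that M unfolding S_def by blast
  have "closed S"
    unfolding closed_sequential_limits
  proof (intro allI impI, elim conjE)
    fix Z Y assume Z: "\<forall>n. Z n \<in> S" "Z \<longlonglongrightarrow> Y"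
    have YM: "Y \<in> M" using Z M(2) unfolding S_def closed_sequential_limits by blast
    have "norm Y \<le> s" by (rule LIMSEQ_le_const2[OF tendsto_norm[OF Z(2)]]) (use Z in \<open>auto simp: S_def\<close>)
    moreover have "adj Y = Y"
    proof (rule adjI)
      fix x y
      have "(\<lambda>n. cinner (Z n x) y) \<longlonglongrightarrow> cinner (Y x) y"
        by (intro tendsto_intros blinfun.tendsto Z(2))
      moreover have "(\<lambda>n. cinner x (Z n y)) \<longlonglongrightarrow> cinner x (Y y)"
        by (intro tendsto_intros blinfun.tendsto Z(2))
      moreover have "cinner (Z n x) y = cinner x (Z n y)" for n
        using Z(1) SB cinner_adj_right[of "Z n" x y] unfolding S_def by auto
      ultimately show "cinner (Y x) y = cinner x (Y y)" using LIMSEQ_unique by force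
    qed (use YM M in auto)
    ultimately show "Y \<in> S" using YM unfolding S_def by blast
  qed
  have "\<exists>!Y\<in>S. f Y = Y"
  proof (rule Banach_fix[where c = s])
    show "complete S" using \<open>closed S\<close> by (simp add: complete_eq_closed)
    show "S \<noteq> {}" using M(3) s adjI[of "0 :: 'a \<Rightarrow>\<^sub>L 'a" 0] unfolding S_def by auto
    show "f ` S \<subseteq> S"
    proof clarify
      fix Y assume Y: "Y \<in> S"
      have YB: "Y \<in> Bop" "X \<in> Bop" "adj Y = Y" "norm Y \<le> s" "Y \<in> M" using SB[OF Y] Y X(1) M unfolding S_def by auto
      have "norm (Y o\<^sub>L Y) \<le> s * s"
        by (rule order_trans[OF norm_blinfun_compose]) (use YB s in \<open>auto intro: mult_mono\<close>)
      then have "norm (X + (Y o\<^sub>L Y)) \<le> norm X + s * s" using norm_triangle_ineq[of X "Y o\<^sub>L Y"] by linarith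
      then have "norm (f Y) \<le> s" using s unfolding f_def by (simp add: power2_eq_square)
      moreover have "adj (f Y) = f Y" unfolding f_def using YB X
        by (simp add: adj_scaleR adj_add adj_compose)
      ultimately show "f Y \<in> S" unfolding S_def f_def using alg X YB by simp
    qed
    show "dist (f x) (f y) \<le> s * dist x y" if "x \<in> S" "y \<in> S" for x y
    proof -
      have "f x - f y = (1/2) *\<^sub>R ((x o\<^sub>L (x - y)) + ((x - y) o\<^sub>L y))"
        unfolding f_def by (rule blinfun_eqI) (simp add: blinfun.add_left blinfun.scaleR_left
            blinfun.diff_left blinfun.diff_right scaleR_diff_right[symmetric])
      moreover have "norm (x o\<^sub>L (x - y)) \<le> s * norm (x - y)" "norm ((x - y) o\<^sub>L y) \<le> norm (x - y) * s"
        using that s unfolding S_def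
        by (auto intro!: order_trans[OF norm_blinfun_compose] mult_mono)
      moreover note norm_triangle_ineq[of "x o\<^sub>L (x - y)" "(x - y) o\<^sub>L y"]
      ultimately show ?thesis by (simp add: dist_norm mult.commute)
    qed
  qed (use s in auto)
  then obtain Y where Y: "Y \<in> S" "f Y = Y" by blast
  have "2 *\<^sub>R f Y = X + (Y o\<^sub>L Y)" unfolding f_def by simp
  then have "2 *\<^sub>R Y = X + (Y o\<^sub>L Y)" using Y(2) by simp
  then have eq: "2 *\<^sub>R Y x = X x + Y (Y x)" for x
    by (metis blinfun.add_left blinfun.scaleR_left blinfun_apply_blinfun_compose)
  have "(id_blinfun - Y) o\<^sub>L (id_blinfun - Y) = id_blinfun - X"
    by (rule blinfun_eqI) (use eq in \<open>simp add: blinfun.diff_left blinfun.diff_right scaleR_2 algebra_simps\<close>)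
  then show thesis using that Y unfolding S_def by blast
qed

section \<open>Tensor products\<close>

text \<open>For each \<open>y\<close> the functional sending \<open>u\<close> to
  \<open>cinner y b\<close> is represented by a vector \<open>f y\<close>, so \<open>f\<close> is
  the adjoint of the wanted operator. Single-valuedness of the graph is taken care of by the
  bound.\<close>

lemma graph_op:
  fixes G :: "('a::chilbert \<times> 'b::chilbert) set"
  assumes zero: "(0, 0) \<in> G"
    and add: "\<And>u b v c. (u, b) \<in> G \<Longrightarrow> (v, c) \<in> G \<Longrightarrow> (u + v, b + c) \<in> G"
    and scale: "\<And>t u b. (u, b) \<in> G \<Longrightarrow> (t *\<^sub>C u, t *\<^sub>C b) \<in> G"
    and bound: "\<And>u b. (u, b) \<in> G \<Longrightarrow> norm b \<le> C * norm u"
    and C: "0 \<le> C" and dense: "closure (fst ` G) = UNIV"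
  obtains A where "A \<in> Bop" "\<And>u b. (u, b) \<in> G \<Longrightarrow> blinfun_apply A u = b" "norm A \<le> C"
proof -
  have "\<exists>v. (\<forall>(u, b)\<in>G. cinner v u = cinner y b) \<and> norm v \<le> C * norm y" for y
  proof (rule riesz_graph[of "(\<lambda>(u, b). (u, cinner y b)) ` G" "C * norm y"])
    show "(0, 0) \<in> (\<lambda>(u, b). (u, cinner y b)) ` G" using zero by force
    show "(u + v, b + c) \<in> (\<lambda>(u, b). (u, cinner y b)) ` G"
      if "(u, b) \<in> (\<lambda>(u, b). (u, cinner y b)) ` G" "(v, c) \<in> (\<lambda>(u, b). (u, cinner y b)) ` G" for u b v c
      using that add by (force simp: cinner_add_right)
    show "(t *\<^sub>C u, t * b) \<in> (\<lambda>(u, b). (u, cinner y b)) ` G"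
      if "(u, b) \<in> (\<lambda>(u, b). (u, cinner y b)) ` G" for u b t
      using that scale by (force simp: cinner_scaleC_right)
    show "cmod b \<le> C * norm y * norm u" if ub: "(u, b) \<in> (\<lambda>(u, b). (u, cinner y b)) ` G" for u b
    proof -
      obtain k where k: "(u, k) \<in> G" "b = cinner y k" using ub by auto
      have "cmod b \<le> norm y * norm k" unfolding k by (rule cmod_cinner_le)
      also have "\<dots> \<le> norm y * (C * norm u)" by (intro mult_left_mono bound k) auto
      finally show ?thesis by (simp add: mult_ac)
    qed
  next
    fix v assume "\<And>u b. (u, b) \<in> (\<lambda>(u, b). (u, cinner y b)) ` G \<Longrightarrow> cinner v u = b" "norm v \<le> C * norm y"
    then show ?thesis by (intro exI[of _ v]) force
  qed (use C in auto)
  then obtain f where f: "\<And>y u b. (u, b) \<in> G \<Longrightarrow> cinner (f y) u = cinner y b"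
    and fn: "\<And>y. norm (f y) \<le> C * norm y" by (metis (mono_tags, lifting) case_prod_conv)
  have ext: "x = y" if "\<And>u b. (u, b) \<in> G \<Longrightarrow> cinner x u = cinner y u" for x y
  proof -
    have "closed {u. cinner x u = cinner y u}" by (intro closed_Collect_eq continuous_intros)
    moreover have "fst ` G \<subseteq> {u. cinner x u = cinner y u}" using that by auto
    ultimately have "closure (fst ` G) \<subseteq> {u. cinner x u = cinner y u}" by (rule closure_minimal[rotated])
    then show ?thesis using dense by (intro cinner_ext_left) blast
  qed
  have fadd: "f (y + z) = f y + f z" for y z by (rule ext) (simp add: f cinner_add_left)
  have fscale: "f (c *\<^sub>C y) = c *\<^sub>C f y" for c y by (rule ext) (simp add: f cinner_scaleC_left)
  obtain A :: "'a \<Rightarrow>\<^sub>L 'b" where A: "A \<in> Bop" "\<And>u v. cinner u (A v) = cinner (f u) v" "norm A \<le> C"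
  proof (rule bounded_form_op[of "\<lambda>u v. cinner (f u) v" C])
    show "cmod (cinner (f u) v) \<le> C * norm u * norm v" for u v
      by (rule order_trans[OF cmod_cinner_le]) (simp add: mult_right_mono fn)
  qed (use C in \<open>auto simp: fadd fscale cinner_add_left cinner_add_right cinner_scaleC_left cinner_scaleC_right\<close>)
  have "A u = b" if "(u, b) \<in> G" for u b
    by (rule cinner_ext_right) (simp add: A f[OF that])
  with A that show thesis by blast
qed

lemma norm_htens: "norm (a \<otimes>\<^sub>h b) = norm a * norm b"
proof -
  have "of_real ((norm (a \<otimes>\<^sub>h b))\<^sup>2) = (of_real ((norm a * norm b)\<^sup>2) :: complex)"
    unfolding cinner_self[symmetric] cinner_htens by (simp add: cinner_self power_mult_distrib)
  then have "(norm (a \<otimes>\<^sub>h b))\<^sup>2 = (norm a * norm b)\<^sup>2" unfolding of_real_eq_iff .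
  then show ?thesis by (simp add: power2_eq_iff_nonneg)
qed

lemma bounded_bilinear_htens: "bounded_bilinear (\<otimes>\<^sub>h)"
  by standard (auto simp: htens_bilinear scaleR_scaleC norm_htens intro!: exI[of _ 1])

lemmas htens_zero_left [simp] = bounded_bilinear.zero_left[OF bounded_bilinear_htens]
  and htens_zero_right [simp] = bounded_bilinear.zero_right[OF bounded_bilinear_htens]
  and tendsto_htens [tendsto_intros] = bounded_bilinear.tendsto[OF bounded_bilinear_htens]
  and continuous_on_htens [continuous_intros] = bounded_bilinear.continuous_on[OF bounded_bilinear_htens]

lemma span_scaleC:
  assumes "\<And>c x. x \<in> S \<Longrightarrow> c *\<^sub>C x \<in> S" "x \<in> span S"
  shows "c *\<^sub>C (x :: 'a::chilbert) \<in> span S"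
  using assms(2)
proof (induction rule: span_induct_alt)
  case (step r x y)
  have "c *\<^sub>C r *\<^sub>R x = r *\<^sub>R c *\<^sub>C x" by (simp add: scaleR_scaleC scaleC_scaleC mult.commute)
  then show ?case using step assms(1)[of x c]
    by (simp add: scaleC_add_right span_add span_mul span_base)
qed (simp add: span_zero)

lemma span_htens_dense: "closure (span (range (\<lambda>(a, b). a \<otimes>\<^sub>h b))) = (UNIV :: ('a::chilbert, 'b::chilbert) htensor set)"
proof (rule dense_if_orthogonal_zero)
  show "c *\<^sub>C x \<in> span (range (\<lambda>(a, b). a \<otimes>\<^sub>h b))"
    if "x \<in> span (range (\<lambda>(a, b). a \<otimes>\<^sub>h b))" for c and x :: "('a, 'b) htensor"
    by (rule span_scaleC[OF _ that]) (force simp flip: htens_bilinear)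
  fix v :: "('a, 'b) htensor"
  assume v: "\<And>d. d \<in> span (range (\<lambda>(a, b). a \<otimes>\<^sub>h b)) \<Longrightarrow> cinner v d = 0"
  show "v = 0"
  proof (rule htens_total)
    fix a b
    have "cinner v (a \<otimes>\<^sub>h b) = 0" by (rule v, rule span_base) auto
    then show "cinner (a \<otimes>\<^sub>h b) v = 0" by (metis cinner_commute complex_cnj_zero)
  qed
qed (auto intro: span_zero span_add)

lemma bounded_linear_eq_htens:
  assumes "bounded_linear f" "bounded_linear g" "\<And>a b. f (a \<otimes>\<^sub>h b) = g (a \<otimes>\<^sub>h b)"
  shows "f = g"
proof
  fix x
  interpret f: bounded_linear f by fact
  interpret g: bounded_linear g by fact
  have "closed {x. f x = g x}"
    by (intro closed_Collect_eq linear_continuous_on assms)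
  moreover have "f x = g x" if "x \<in> span (range (\<lambda>(a, b). a \<otimes>\<^sub>h b))" for x
    using that by (rule span_induct) (auto simp: subspace_def f.add g.add f.scaleR g.scaleR f.zero g.zero assms(3))
  ultimately have "closure (span (range (\<lambda>(a, b). a \<otimes>\<^sub>h b))) \<subseteq> {x. f x = g x}"
    by (intro closure_minimal) auto
  then show "f x = g x" unfolding span_htens_dense by blast
qed

lemma op_eqI_htens:
  fixes A B :: "('a::chilbert, 'b::chilbert) htensor \<Rightarrow>\<^sub>L 'c::real_normed_vector"
  assumes "\<And>a b. A (a \<otimes>\<^sub>h b) = B (a \<otimes>\<^sub>h b)"
  shows "A = B"
  using bounded_linear_eq_htens[OF blinfun.bounded_linear_right blinfun.bounded_linear_right assms]
  by (simp add: blinfun_apply_inject)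

text \<open>The contraction of the first leg with \<open>e\<close>, a coordinate of the tensor with
  values in the second space. Amplifications \<open>id_blinfun \<otimes>\<^sub>o A\<close> act on
  these coordinates one by one.\<close>

definition lcontr :: "'a::chilbert \<Rightarrow> ('a, 'b::chilbert) htensor \<Rightarrow> 'b" where
  "lcontr e t = (THE v. \<forall>w. cinner w v = cinner (e \<otimes>\<^sub>h w) t)"

lemma
  shows cinner_lcontr: "cinner w (lcontr e t) = cinner (e \<otimes>\<^sub>h w) t"
    and norm_lcontr: "norm (lcontr e t) \<le> norm e * norm t"
proof -
  obtain v where v: "\<And>w. cinner v w = cnj (cinner (e \<otimes>\<^sub>h w) t)" "norm v \<le> norm e * norm t"
  proof (rule riesz[of "\<lambda>w. cnj (cinner (e \<otimes>\<^sub>h w) t)" "norm e * norm t"])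
    show "cmod (cnj (cinner (e \<otimes>\<^sub>h x) t)) \<le> norm e * norm t * norm x" for x
      using cmod_cinner_le[of "e \<otimes>\<^sub>h x" t] by (simp add: norm_htens mult_ac)
  qed (auto simp: htens_bilinear cinner_add_left cinner_scaleC_left)
  then have *: "\<forall>w. cinner w v = cinner (e \<otimes>\<^sub>h w) t" by (metis cinner_commute complex_cnj_cnj)
  have "lcontr e t = v" unfolding lcontr_def
  proof (rule the_equality, rule *)
    fix x assume "\<forall>w. cinner w x = cinner (e \<otimes>\<^sub>h w) t"
    with * show "x = v" by (intro cinner_ext_right) metis
  qed
  with * v(2) show "cinner w (lcontr e t) = cinner (e \<otimes>\<^sub>h w) t" "norm (lcontr e t) \<le> norm e * norm t" by auto
qed

lemma cinner_lcontr_left: "cinner (lcontr e t) w = cinner t (e \<otimes>\<^sub>h w)"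
  by (metis cinner_commute cinner_lcontr)

lemma lcontr_linear:
  "lcontr e (s + t) = lcontr e s + lcontr e t" "lcontr e (c *\<^sub>C t) = c *\<^sub>C lcontr e t"
  "lcontr e (s - t) = lcontr e s - lcontr e t"
  by (rule cinner_ext_right, simp add: cinner_lcontr cinner_add_right cinner_scaleC_right cinner_diff_right)+

lemma lcontr_htens: "lcontr e (a \<otimes>\<^sub>h b) = cinner e a *\<^sub>C b"
  by (rule cinner_ext_right) (simp add: cinner_lcontr cinner_htens cinner_scaleC_right)

lemma is_onb_htens:
  "is_onb ((\<lambda>(e, f). e \<otimes>\<^sub>h f) ` (onb \<times> onb :: ('a::chilbert \<times> 'b::chilbert) set))"
proof -
  have B: "orthonormal (onb :: 'a set)" "orthonormal (onb :: 'b set)"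
    "\<And>x :: 'a. (\<forall>e\<in>onb. cinner e x = 0) \<Longrightarrow> x = 0" "\<And>x :: 'b. (\<forall>e\<in>onb. cinner e x = 0) \<Longrightarrow> x = 0"
    using is_onb_onb unfolding is_onb_def by blast+
  have "cinner (e \<otimes>\<^sub>h f) (e' \<otimes>\<^sub>h f') = (if e \<otimes>\<^sub>h f = e' \<otimes>\<^sub>h f' then 1 else 0)"
    if "e \<in> onb" "e' \<in> onb" "f \<in> onb" "f' \<in> onb" for e e' :: 'a and f f' :: 'b
  proof -
    have 1: "cinner e e' = (if e = e' then 1 else 0)" "cinner f f' = (if f = f' then 1 else 0)"
      "cinner e e = 1" "cinner f f = 1"
      using B(1,2) that unfolding orthonormal_def by auto
    have "(e = e' \<and> f = f') = (e \<otimes>\<^sub>h f = e' \<otimes>\<^sub>h f')"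
      using 1 cinner_htens[of e f e f] cinner_htens[of e f e' f'] by (metis mult_1 mult_zero_left mult_zero_right zero_neq_one)
    then show ?thesis unfolding cinner_htens 1 by auto
  qed
  moreover have "x = 0" if x: "\<And>e f. e \<in> onb \<Longrightarrow> f \<in> onb \<Longrightarrow> cinner (e \<otimes>\<^sub>h f) x = 0" for x :: "('a, 'b) htensor"
  proof (rule htens_total)
    fix a b
    have 1: "lcontr e x = 0" if "e \<in> onb" for e by (rule B(4)) (simp add: cinner_lcontr x that)
    have 2: "cinner (e \<otimes>\<^sub>h b) x = 0" if "e \<in> onb" for e
      using 1[OF that] cinner_lcontr[of b e x] by simp
    obtain v where v: "\<And>w. cinner v w = cnj (cinner (w \<otimes>\<^sub>h b) x)"
    proof (rule riesz[of "\<lambda>w. cnj (cinner (w \<otimes>\<^sub>h b) x)" "norm b * norm x"])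
      show "cmod (cnj (cinner (w \<otimes>\<^sub>h b) x)) \<le> norm b * norm x * norm w" for w
        using cmod_cinner_le[of "w \<otimes>\<^sub>h b" x] by (simp add: norm_htens mult_ac)
    qed (auto simp: htens_bilinear cinner_add_left cinner_scaleC_left)
    have "v = 0" by (rule B(3)) (metis 2 v cinner_commute complex_cnj_zero)
    then show "cinner (a \<otimes>\<^sub>h b) x = 0" using v[of a] by simp
  qed
  ultimately show ?thesis unfolding is_onb_def orthonormal_def by (auto simp: ball_Un)
qed

text \<open>Parseval for the product basis, with the sum over the second leg carried out
  first.\<close>

lemma parseval_lcontr:
  fixes s t :: "('a::chilbert, 'b::chilbert) htensor"
  shows "((\<lambda>e. cinner (lcontr e s) (lcontr e t)) has_sum cinner s t) onb"
proof -
  have B: "orthonormal (onb :: 'a set)" "orthonormal (onb :: 'b set)"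
    using is_onb_onb unfolding is_onb_def by blast+
  have inj: "inj_on (\<lambda>(e, f). e \<otimes>\<^sub>h f) (onb \<times> onb :: ('a \<times> 'b) set)"
  proof (rule inj_onI, clarsimp)
    fix e e' :: 'a and f f' :: 'b
    assume *: "e \<in> onb" "e' \<in> onb" "f \<in> onb" "f' \<in> onb" "e \<otimes>\<^sub>h f = e' \<otimes>\<^sub>h f'"
    have "cinner e e' * cinner f f' = cinner e e * cinner f f"
      unfolding cinner_htens[symmetric] *(5) ..
    then show "e = e' \<and> f = f'"
      using B *(1-4) unfolding orthonormal_def by (metis mult_1 mult_zero_left mult_zero_right zero_neq_one)
  qed
  have "((\<lambda>p. cnj (cinner (fst p \<otimes>\<^sub>h snd p) s) * cinner (fst p \<otimes>\<^sub>h snd p) t) has_sum cinner s t) (onb \<times> onb)"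
    using parseval[OF is_onb_htens, of s t] unfolding has_sum_reindex[OF inj]
    by (simp add: comp_def case_prod_unfold)
  then show ?thesis
  proof (rule has_sum_SigmaD[where B = "\<lambda>_. onb"])
    fix e :: 'a
    show "((\<lambda>f. cnj (cinner (fst (e, f) \<otimes>\<^sub>h snd (e, f)) s) * cinner (fst (e, f) \<otimes>\<^sub>h snd (e, f)) t)
        has_sum cinner (lcontr e s) (lcontr e t)) onb"
      using parseval[OF is_onb_onb, of "lcontr e s" "lcontr e t"] by (simp add: cinner_lcontr)
  qed
qed

lemma has_sum_norm_lcontr: "((\<lambda>e. (norm (lcontr e t))\<^sup>2) has_sum (norm t)\<^sup>2) onb"
  using has_sum_Re[OF parseval_lcontr[of t t]] by (simp add: cinner_self del: of_real_power)

lemma sum_lcontr_le: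
  assumes "finite F" "F \<subseteq> onb"
  shows "(\<Sum>e\<in>F. (norm (lcontr e t))\<^sup>2) \<le> (norm t)\<^sup>2"
  by (rule finite_sum_le_has_sum[OF has_sum_norm_lcontr assms]) simp

lemma has_sum_finite_sum:
  fixes f :: "'i \<Rightarrow> 'e \<Rightarrow> 'b::topological_comm_monoid_add"
  assumes "finite F" "\<And>k. k \<in> F \<Longrightarrow> (f k has_sum s k) A"
  shows "((\<lambda>e. \<Sum>k\<in>F. f k e) has_sum (\<Sum>k\<in>F. s k)) A"
  using assms by (induction F rule: finite_induct) (auto intro!: has_sum_add has_sum_0)

text \<open>The factor \<open>K\<close> serves sums whose terms are not inner products but are
  bounded by products of norms, as in \<open>q_twisted\<close>. The square sums are controlled
  through finite partial sums, the form in which the row and column estimates arise.\<close>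

lemma sums_cauchy_schwarz:
  fixes t :: "'i \<Rightarrow> complex"
  assumes t: "\<And>k. k \<in> S \<Longrightarrow> cmod (t k) \<le> K * (norm (a k) * norm (b k))" and K: "0 \<le> K"
    and A: "\<And>F. finite F \<Longrightarrow> F \<subseteq> S \<Longrightarrow> (\<Sum>k\<in>F. (norm (a k))\<^sup>2) \<le> A\<^sup>2"
    and B: "\<And>F. finite F \<Longrightarrow> F \<subseteq> S \<Longrightarrow> (\<Sum>k\<in>F. (norm (b k))\<^sup>2) \<le> B\<^sup>2" and "0 \<le> A" "0 \<le> B"
  shows "t summable_on S" "cmod (\<Sum>\<^sub>\<infinity>k\<in>S. t k) \<le> K * (A * B)"
proof -
  have fin: "(\<Sum>k\<in>F. cmod (t k)) \<le> K * (A * B)" if "finite F" "F \<subseteq> S" for F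
  proof -
    have "(\<Sum>k\<in>F. cmod (t k)) \<le> K * (\<Sum>k\<in>F. \<bar>norm (a k)\<bar> * \<bar>norm (b k)\<bar>)"
      unfolding sum_distrib_left using t that(2) by (intro sum_mono) auto
    also have "\<dots> \<le> K * (L2_set (\<lambda>k. norm (a k)) F * L2_set (\<lambda>k. norm (b k)) F)"
      by (intro mult_left_mono L2_set_mult_ineq K)
    also have "\<dots> \<le> K * (A * B)"
      unfolding L2_set_def using assms that
      by (intro mult_left_mono mult_mono) (auto intro!: real_le_lsqrt sum_nonneg)
    finally show ?thesis .
  qed
  then have abs: "(\<lambda>k. cmod (t k)) summable_on S"
    by (intro nonneg_bdd_above_summable_on) (auto intro!: bdd_aboveI2)
  then show "t summable_on S" by (rule abs_summable_summable)
  have "cmod (\<Sum>\<^sub>\<infinity>k\<in>S. t k) \<le> (\<Sum>\<^sub>\<infinity>k\<in>S. cmod (t k))" by (rule norm_infsum_bound[OF abs])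
  also have "\<dots> \<le> K * (A * B)" using fin by (rule infsum_le_finite_sums[OF abs])
  finally show "cmod (\<Sum>\<^sub>\<infinity>k\<in>S. t k) \<le> K * (A * B)" .
qed

lemma cinner_sums_cauchy_schwarz:
  assumes "\<And>F. finite F \<Longrightarrow> F \<subseteq> S \<Longrightarrow> (\<Sum>k\<in>F. (norm (a k))\<^sup>2) \<le> A\<^sup>2"
    and "\<And>F. finite F \<Longrightarrow> F \<subseteq> S \<Longrightarrow> (\<Sum>k\<in>F. (norm (b k))\<^sup>2) \<le> B\<^sup>2" and "0 \<le> A" "0 \<le> B"
  shows "(\<lambda>k. cinner (a k) (b k)) summable_on S" "cmod (\<Sum>\<^sub>\<infinity>k\<in>S. cinner (a k) (b k)) \<le> A * B"
  using sums_cauchy_schwarz[OF _ zero_le_one assms, of S "\<lambda>k. cinner (a k) (b k)"] cmod_cinner_le by auto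

text \<open>\<open>op_tensor\<close> is a definite description, so the amplification has to be
  constructed: it acts as \<open>A\<close> in every coordinate \<open>lcontr e\<close>, and the
  series of matrix elements converges by Cauchy-Schwarz.\<close>

lemma id_tensor:
  fixes A :: "'b::chilbert \<Rightarrow>\<^sub>L 'd::chilbert"
  assumes A: "A \<in> Bop"
  shows id_tensor_Bop: "(id_blinfun :: 'a::chilbert \<Rightarrow>\<^sub>L 'a) \<otimes>\<^sub>o A \<in> Bop"
    and id_tensor_apply: "((id_blinfun :: 'a \<Rightarrow>\<^sub>L 'a) \<otimes>\<^sub>o A) (u \<otimes>\<^sub>h v) = u \<otimes>\<^sub>h A v"
    and norm_id_tensor: "norm ((id_blinfun :: 'a \<Rightarrow>\<^sub>L 'a) \<otimes>\<^sub>o A) \<le> norm A"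
proof -
  define b where "b s t = (\<Sum>\<^sub>\<infinity>e\<in>onb. cinner (lcontr e s) (A (lcontr e t)))"
    for s :: "('a, 'd) htensor" and t :: "('a, 'b) htensor"
  have A_le: "(\<Sum>e\<in>F. (norm (A (lcontr e t)))\<^sup>2) \<le> (norm A * norm t)\<^sup>2"
    if "finite F" "F \<subseteq> onb" for F and t :: "('a, 'b) htensor"
  proof -
    have "(\<Sum>e\<in>F. (norm (A (lcontr e t)))\<^sup>2) \<le> (\<Sum>e\<in>F. (norm A)\<^sup>2 * (norm (lcontr e t))\<^sup>2)"
      by (intro sum_mono) (simp add: power_mult_distrib[symmetric] power_mono norm_blinfun)
    also have "\<dots> \<le> (norm A)\<^sup>2 * (norm t)\<^sup>2"
      unfolding sum_distrib_left[symmetric] by (intro mult_left_mono sum_lcontr_le that) auto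
    finally show ?thesis by (simp add: power_mult_distrib)
  qed
  note cs = cinner_sums_cauchy_schwarz[OF sum_lcontr_le A_le]
  have sm: "(\<lambda>e. cinner (lcontr e s) (A (lcontr e t))) summable_on onb"
    and bd: "cmod (b s t) \<le> norm A * norm s * norm t" for s :: "('a, 'd) htensor" and t
    using cs[of onb s t] unfolding b_def by (auto simp: mult_ac)
  obtain C :: "('a, 'b) htensor \<Rightarrow>\<^sub>L ('a, 'd) htensor" where
    C: "C \<in> Bop" "\<And>s t. cinner s (C t) = b s t" "norm C \<le> norm A"
    by (rule bounded_form_op[of b "norm A"])
      (use bd in \<open>auto simp: b_def lcontr_linear blinfun.add_right Bop_apply[OF A] cinner_add_left cinner_add_right
        cinner_scaleC_left cinner_scaleC_right infsum_add sm infsum_cmult_right\<close>)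
  have ap: "C (u \<otimes>\<^sub>h v) = u \<otimes>\<^sub>h A v" for u v
  proof (rule cinner_ext_right)
    fix s
    have "((\<lambda>e. cinner (lcontr e s) (A (lcontr e (u \<otimes>\<^sub>h v)))) has_sum cinner s (u \<otimes>\<^sub>h A v)) onb"
      using parseval_lcontr[of s "u \<otimes>\<^sub>h A v"] by (simp add: lcontr_htens Bop_apply[OF A])
    then show "cinner s (C (u \<otimes>\<^sub>h v)) = cinner s (u \<otimes>\<^sub>h A v)"
      unfolding C b_def by (rule infsumI)
  qed
  have "id_blinfun \<otimes>\<^sub>o A = C" unfolding op_tensor_def
    by (rule the_equality) (auto simp: ap C(1) intro!: op_eqI_htens)
  with C ap show "(id_blinfun :: 'a \<Rightarrow>\<^sub>L 'a) \<otimes>\<^sub>o A \<in> Bop" "((id_blinfun :: 'a \<Rightarrow>\<^sub>L 'a) \<otimes>\<^sub>o A) (u \<otimes>\<^sub>h v) = u \<otimes>\<^sub>h A v"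
    "norm ((id_blinfun :: 'a \<Rightarrow>\<^sub>L 'a) \<otimes>\<^sub>o A) \<le> norm A" by auto
qed

lemma bounded_linear_lcontr: "bounded_linear (lcontr e)"
  by (rule bounded_linear_intro[where K = "norm e"])
    (auto simp: lcontr_linear scaleR_scaleC norm_lcontr mult.commute)

lemma lcontr_id_tensor:
  assumes "A \<in> Bop"
  shows "lcontr e ((id_blinfun \<otimes>\<^sub>o A) t) = A (lcontr e t)"
proof -
  have "(\<lambda>t. lcontr e ((id_blinfun \<otimes>\<^sub>o A) t)) = (\<lambda>t. A (lcontr e t))"
    by (rule bounded_linear_eq_htens)
      (auto intro!: bounded_linear_compose[OF bounded_linear_lcontr] bounded_linear_lcontr
        bounded_linear_compose[OF blinfun.bounded_linear_right] blinfun.bounded_linear_right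
        simp: id_tensor_apply assms lcontr_htens Bop_apply)
  then show ?thesis by (rule fun_cong)
qed

lemma has_sum_id_tensor:
  assumes "A \<in> Bop"
  shows "((\<lambda>e. cinner (lcontr e s) (A (lcontr e t))) has_sum cinner s ((id_blinfun \<otimes>\<^sub>o A) t)) onb"
  using parseval_lcontr[of s "(id_blinfun \<otimes>\<^sub>o A) t"] by (simp add: lcontr_id_tensor assms)

lemma adj_id_tensor:
  assumes A: "A \<in> Bop"
  shows "adj (id_blinfun \<otimes>\<^sub>o A) = id_blinfun \<otimes>\<^sub>o adj A"
proof (rule adjI)
  fix s t
  show "cinner ((id_blinfun \<otimes>\<^sub>o A) s) t = cinner s ((id_blinfun \<otimes>\<^sub>o adj A) t)"
    using parseval_lcontr[of "(id_blinfun \<otimes>\<^sub>o A) s" t] parseval_lcontr[of s "(id_blinfun \<otimes>\<^sub>o adj A) t"] A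
    by (simp add: lcontr_id_tensor cinner_adj_right) (rule has_sum_unique)
qed (use A in \<open>auto intro: id_tensor_Bop\<close>)

text \<open>The flip preserves inner products of elementary tensors. This spreads to the span of the
  pairs, one argument at a time, so that the span is an isometric graph with dense domain and
  \<open>graph_op\<close> applies.\<close>

lemma flip:
  fixes a :: "'a::chilbert" and b :: "'b::chilbert"
  shows flip_Bop: "(flip :: ('a, 'b) htensor \<Rightarrow>\<^sub>L ('b, 'a) htensor) \<in> Bop"
    and flip_htens: "flip (a \<otimes>\<^sub>h b) = b \<otimes>\<^sub>h a"
proof -
  define S where "S = range (\<lambda>(a :: 'a, b :: 'b). (a \<otimes>\<^sub>h b, b \<otimes>\<^sub>h a))"
  have gen: "cinner (fst p) (fst q) = cinner (snd p) (snd q)" if "p \<in> span S" "q \<in> span S" for p q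
  proof -
    have "cinner (fst p) (fst q) = cinner (snd p) (snd q)" if q: "q \<in> S" for q
      using \<open>p \<in> span S\<close>
    proof (rule span_induct)
      show "subspace {p. cinner (fst p) (fst q) = cinner (snd p) (snd q)}"
        by (auto simp: subspace_def cinner_add_left cinner_scaleR_left)
    qed (use q in \<open>auto simp: S_def cinner_htens\<close>)
    note base = this
    show ?thesis
      using \<open>q \<in> span S\<close>
    proof (rule span_induct)
      show "subspace {q. cinner (fst p) (fst q) = cinner (snd p) (snd q)}"
        by (auto simp: subspace_def cinner_add_right cinner_scaleR_right)
    qed (rule base)
  qed
  have scale: "(c *\<^sub>C u, c *\<^sub>C b) \<in> span S" if "(u, b) \<in> span S" for c u b
  proof -
    have "(c *\<^sub>C fst p, c *\<^sub>C snd p) \<in> span S" if "p \<in> span S" for p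
      using that
    proof (rule span_induct)
      show "subspace {p. (c *\<^sub>C fst p, c *\<^sub>C snd p) \<in> span S}"
        unfolding subspace_def mem_Collect_eq
      proof (intro conjI allI impI ballI)
        show "(c *\<^sub>C fst (0 :: ('a, 'b) htensor \<times> ('b, 'a) htensor), c *\<^sub>C snd (0 :: ('a, 'b) htensor \<times> ('b, 'a) htensor)) \<in> span S"
          using span_zero[of S] by (simp add: zero_prod_def)
      next
        fix p q assume "p \<in> {p. (c *\<^sub>C fst p, c *\<^sub>C snd p) \<in> span S}" "q \<in> {p. (c *\<^sub>C fst p, c *\<^sub>C snd p) \<in> span S}"
        then show "(c *\<^sub>C fst (p + q), c *\<^sub>C snd (p + q)) \<in> span S"
          using span_add[of "(c *\<^sub>C fst p, c *\<^sub>C snd p)" S "(c *\<^sub>C fst q, c *\<^sub>C snd q)"]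
          by (simp add: scaleC_add_right)
      next
        fix r :: real and p assume "p \<in> {p. (c *\<^sub>C fst p, c *\<^sub>C snd p) \<in> span S}"
        then have "r *\<^sub>R (c *\<^sub>C fst p, c *\<^sub>C snd p) \<in> span S" by (intro span_scale) simp
        then show "(c *\<^sub>C fst (r *\<^sub>R p), c *\<^sub>C snd (r *\<^sub>R p)) \<in> span S"
          by (simp add: scaleR_scaleC scaleC_scaleC mult.commute)
      qed
      show "(c *\<^sub>C fst p, c *\<^sub>C snd p) \<in> span S" if pS: "p \<in> S" for p
      proof (rule span_base)
        obtain a b where "p = (a \<otimes>\<^sub>h b, b \<otimes>\<^sub>h a)" using pS by (auto simp: S_def)
        then have "(c *\<^sub>C fst p, c *\<^sub>C snd p) = ((c *\<^sub>C a) \<otimes>\<^sub>h b, b \<otimes>\<^sub>h (c *\<^sub>C a))"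
          by (simp add: htens_bilinear)
        then show "(c *\<^sub>C fst p, c *\<^sub>C snd p) \<in> S" by (auto simp: S_def)
      qed
    qed
    from this[OF that] show ?thesis by simp
  qed
  have dense: "closure (fst ` span S) = UNIV"
  proof -
    have "fst ` span S = span (fst ` S)"
      by (rule linear_span_image[symmetric]) (simp add: bounded_linear.linear bounded_linear_fst)
    also have "fst ` S = range (\<lambda>(a, b). a \<otimes>\<^sub>h b)" by (force simp: S_def image_iff)
    finally show ?thesis by (simp add: span_htens_dense)
  qed
  obtain C :: "('a, 'b) htensor \<Rightarrow>\<^sub>L ('b, 'a) htensor" where C: "C \<in> Bop" "\<And>u b. (u, b) \<in> span S \<Longrightarrow> C u = b"
  proof (rule graph_op[of "span S" 1])
    show "(0, 0) \<in> span S" using span_zero[of S] by (simp add: zero_prod_def)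
    show "(u + v, b + c) \<in> span S" if "(u, b) \<in> span S" "(v, c) \<in> span S" for u b v c
      using span_add[OF that] by simp
    show "norm b \<le> 1 * norm u" if "(u, b) \<in> span S" for u b
      using gen[OF that that] by (simp add: norm_eq_sqrt_cinner)
  qed (use scale dense in auto)
  have ap: "C (u \<otimes>\<^sub>h v) = v \<otimes>\<^sub>h u" for u v by (rule C(2), rule span_base) (auto simp: S_def)
  have "flip = C" unfolding flip_def
    by (rule the_equality) (auto simp: ap C(1) intro!: op_eqI_htens)
  with C ap show "(flip :: ('a, 'b) htensor \<Rightarrow>\<^sub>L ('b, 'a) htensor) \<in> Bop"
    "flip (a \<otimes>\<^sub>h b) = b \<otimes>\<^sub>h a" by auto
qed

lemma cinner_flip:
  fixes s t :: "('a::chilbert, 'b::chilbert) htensor"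
  shows "cinner (flip s) (flip t) = cinner s t"
proof -
  let ?f = "flip :: ('a, 'b) htensor \<Rightarrow>\<^sub>L ('b, 'a) htensor"
  have 1: "adj ?f o\<^sub>L ?f = id_blinfun"
  proof (rule op_eqI_htens, rule cinner_ext_right)
    fix a b and x :: "('a, 'b) htensor"
    have "(\<lambda>x. cnj (cinner x ((adj ?f o\<^sub>L ?f) (a \<otimes>\<^sub>h b)))) = (\<lambda>x. cnj (cinner x (a \<otimes>\<^sub>h b)))"
      by (rule bounded_linear_eq_htens)
        (auto simp: cinner_commute[symmetric] cinner_adj_left cinner_adj_right flip_Bop flip_htens
          cinner_htens intro!: bounded_linear_cinner_right
          bounded_linear_compose[OF bounded_linear_cinner_right blinfun.bounded_linear_right])
    from fun_cong[OF this, of x] show "cinner x ((adj ?f o\<^sub>L ?f) (a \<otimes>\<^sub>h b)) = cinner x (id_blinfun (a \<otimes>\<^sub>h b))"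
      by simp
  qed
  have "cinner s ((adj ?f o\<^sub>L ?f) t) = cinner (?f s) (?f t)" by (simp add: cinner_adj_right flip_Bop)
  then show ?thesis unfolding 1 by simp
qed

lemma norm_flip: "norm (flip t) = norm t"
  by (simp add: norm_eq_sqrt_cinner cinner_flip)

lemma op_tensor:
  fixes A :: "'a::chilbert \<Rightarrow>\<^sub>L 'c::chilbert" and B :: "'b::chilbert \<Rightarrow>\<^sub>L 'd::chilbert"
  assumes "A \<in> Bop" "B \<in> Bop"
  shows op_tensor_Bop: "A \<otimes>\<^sub>o B \<in> Bop" and op_tensor_apply: "(A \<otimes>\<^sub>o B) (u \<otimes>\<^sub>h v) = A u \<otimes>\<^sub>h B v"
proof -
  \<comment> \<open>Amplifying on the first leg is amplifying on the second one between two
    flips.\<close>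
  define C where "C = flip o\<^sub>L (id_blinfun \<otimes>\<^sub>o A) o\<^sub>L flip o\<^sub>L ((id_blinfun :: 'a \<Rightarrow>\<^sub>L 'a) \<otimes>\<^sub>o B)"
  have C: "C \<in> Bop" unfolding C_def using assms by (auto intro: flip_Bop id_tensor_Bop)
  have ap: "C (u \<otimes>\<^sub>h v) = A u \<otimes>\<^sub>h B v" for u v
    unfolding C_def using assms by (simp add: id_tensor_apply flip_htens)
  have "A \<otimes>\<^sub>o B = C" unfolding op_tensor_def
    by (rule the_equality) (auto simp: ap C(1) intro!: op_eqI_htens)
  with C ap show "A \<otimes>\<^sub>o B \<in> Bop" "(A \<otimes>\<^sub>o B) (u \<otimes>\<^sub>h v) = A u \<otimes>\<^sub>h B v" by auto
qed

section \<open>Von Neumann algebras and their preduals\<close>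

lemma
  assumes X: "X \<in> Bop"
  shows vslice_right_Bop: "vslice_right v u X \<in> Bop"
    and cinner_vslice_right: "cinner b (vslice_right v u X a) = cinner (b \<otimes>\<^sub>h v) (X (a \<otimes>\<^sub>h u))"
    and norm_vslice_right: "norm (vslice_right v u X) \<le> norm X * norm v * norm u"
proof -
  obtain y where y: "y \<in> Bop" "\<And>b a. cinner b (blinfun_apply y a) = cinner (b \<otimes>\<^sub>h v) (X (a \<otimes>\<^sub>h u))"
    "norm y \<le> norm X * norm v * norm u"
  proof (rule bounded_form_op[of "\<lambda>b a. cinner (b \<otimes>\<^sub>h v) (X (a \<otimes>\<^sub>h u))" "norm X * norm v * norm u"])
    fix b a
    have "cmod (cinner (b \<otimes>\<^sub>h v) (X (a \<otimes>\<^sub>h u))) \<le> norm (b \<otimes>\<^sub>h v) * (norm X * norm (a \<otimes>\<^sub>h u))"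
      by (intro order_trans[OF cmod_cinner_le] mult_left_mono norm_blinfun) auto
    then show "cmod (cinner (b \<otimes>\<^sub>h v) (X (a \<otimes>\<^sub>h u))) \<le> norm X * norm v * norm u * norm b * norm a"
      by (simp add: norm_htens mult_ac)
  qed (auto simp: htens_bilinear blinfun.add_right Bop_apply[OF X] cinner_add_left cinner_add_right
      cinner_scaleC_left cinner_scaleC_right)
  have "vslice_right v u X = y" unfolding vslice_right_def
    by (rule the_equality) (auto simp: y(1,2) intro!: cinner_ext_op)
  with y show "vslice_right v u X \<in> Bop"
    "cinner b (vslice_right v u X a) = cinner (b \<otimes>\<^sub>h v) (X (a \<otimes>\<^sub>h u))"
    "norm (vslice_right v u X) \<le> norm X * norm v * norm u" by auto
qed

lemma
  assumes X: "X \<in> Bop"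
  shows vslice_left_Bop: "vslice_left v u X \<in> Bop"
    and cinner_vslice_left: "cinner b (vslice_left v u X a) = cinner (v \<otimes>\<^sub>h b) (X (u \<otimes>\<^sub>h a))"
proof -
  obtain y where y: "y \<in> Bop" "\<And>b a. cinner b (blinfun_apply y a) = cinner (v \<otimes>\<^sub>h b) (X (u \<otimes>\<^sub>h a))"
  proof (rule bounded_form_op[of "\<lambda>b a. cinner (v \<otimes>\<^sub>h b) (X (u \<otimes>\<^sub>h a))" "norm X * norm v * norm u"])
    fix b a
    have "cmod (cinner (v \<otimes>\<^sub>h b) (X (u \<otimes>\<^sub>h a))) \<le> norm (v \<otimes>\<^sub>h b) * (norm X * norm (u \<otimes>\<^sub>h a))"
      by (intro order_trans[OF cmod_cinner_le] mult_left_mono norm_blinfun) auto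
    then show "cmod (cinner (v \<otimes>\<^sub>h b) (X (u \<otimes>\<^sub>h a))) \<le> norm X * norm v * norm u * norm b * norm a"
      by (simp add: norm_htens mult_ac)
  qed (auto simp: htens_bilinear blinfun.add_right Bop_apply[OF X] cinner_add_left cinner_add_right
      cinner_scaleC_left cinner_scaleC_right)
  have "vslice_left v u X = y" unfolding vslice_left_def
    by (rule the_equality) (auto simp: y(1,2) intro!: cinner_ext_op)
  with y show "vslice_left v u X \<in> Bop"
    "cinner b (vslice_left v u X a) = cinner (v \<otimes>\<^sub>h b) (X (u \<otimes>\<^sub>h a))" by auto
qed

lemma vslice_right_adj: "X \<in> Bop \<Longrightarrow> vslice_right v u (adj X) = adj (vslice_right u v X)"
  by (rule adjI[symmetric])
    (auto simp: vslice_right_Bop cinner_vslice_right cinner_adj_right cinner_adj_left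
      cinner_commute[of "vslice_right u v X _"] cinner_commute[of "X _"])

lemma commutant_props:
  shows "commutant S \<subseteq> Bop" "closed (commutant S)" "0 \<in> commutant S"
    "A \<in> commutant S \<Longrightarrow> B \<in> commutant S \<Longrightarrow> A + B \<in> commutant S"
    "A \<in> commutant S \<Longrightarrow> B \<in> commutant S \<Longrightarrow> A - B \<in> commutant S"
    "A \<in> commutant S \<Longrightarrow> B \<in> commutant S \<Longrightarrow> A o\<^sub>L B \<in> commutant S"
    "A \<in> commutant S \<Longrightarrow> r *\<^sub>R A \<in> commutant S"
    "id_blinfun \<in> commutant S"
proof -
  have "closed {A. A o\<^sub>L B = B o\<^sub>L A}" for B :: "'a \<Rightarrow>\<^sub>L 'a"
    by (intro closed_Collect_eq continuous_intros)
  then have "closed (Bop \<inter> (\<Inter>B\<in>S. {A. A o\<^sub>L B = B o\<^sub>L A}))"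
    by (intro closed_Int closed_INT closed_Bop ballI)
  moreover have "Bop \<inter> (\<Inter>B\<in>S. {A. A o\<^sub>L B = B o\<^sub>L A}) = commutant S"
    unfolding commutant_def by auto
  ultimately show "closed (commutant S)" by simp
qed (auto simp: commutant_def blinfun.add_left blinfun.add_right blinfun.diff_left blinfun.diff_right
    blinfun.scaleR_left blinfun.scaleR_right blinfun_eq_iff blinfun.zero_right)

lemma commutant_scaleC:
  assumes "S \<subseteq> Bop" "A \<in> commutant S"
  shows "c *\<^sub>B A \<in> commutant S"
  using assms unfolding commutant_def by (fastforce simp: blinfun_eq_iff Bop_apply)

locale vna =
  fixes M :: "('a::chilbert \<Rightarrow>\<^sub>L 'a) set"
  assumes vna: "von_neumann_algebra M"
begin

lemma M_Bop: "x \<in> M \<Longrightarrow> x \<in> Bop" and M_adj: "x \<in> M \<Longrightarrow> adj x \<in> M" and bicommutant: "commutant (commutant M) = M"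
  using vna unfolding von_neumann_algebra_def by auto

lemma M_closed:
  shows M_subset_Bop: "M \<subseteq> Bop" and closed_M: "closed M" and M_zero: "0 \<in> M" and M_id: "id_blinfun \<in> M"
    and M_add: "x \<in> M \<Longrightarrow> y \<in> M \<Longrightarrow> x + y \<in> M" and M_diff: "x \<in> M \<Longrightarrow> y \<in> M \<Longrightarrow> x - y \<in> M"
    and M_compose: "x \<in> M \<Longrightarrow> y \<in> M \<Longrightarrow> x o\<^sub>L y \<in> M" and M_scaleR: "x \<in> M \<Longrightarrow> r *\<^sub>R x \<in> M"
    and M_scaleC: "x \<in> M \<Longrightarrow> c *\<^sub>B x \<in> M"
  using commutant_props[where S = "commutant M"] commutant_scaleC[where S = "commutant M" and c = c, OF commutant_props(1)]
  unfolding bicommutant by auto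

lemma M_sum: "(\<And>i. i \<in> I \<Longrightarrow> f i \<in> M) \<Longrightarrow> sum f I \<in> M"
  by (induction I rule: infinite_finite_induct) (auto intro: M_add M_zero)

lemma M_I:
  assumes "x \<in> Bop" "\<And>y. y \<in> commutant M \<Longrightarrow> x o\<^sub>L y = y o\<^sub>L x"
  shows "x \<in> M"
proof -
  have "x \<in> commutant (commutant M)" using assms unfolding commutant_def[of "commutant M"] by simp
  then show ?thesis unfolding bicommutant .
qed

lemma commutant_M: "y \<in> commutant M \<Longrightarrow> x \<in> M \<Longrightarrow> y (x u) = x (y u)"
  unfolding commutant_def by (auto simp: blinfun_eq_iff)

lemma commutant_adj:
  assumes "y \<in> commutant M"
  shows "adj y \<in> commutant M"
proof -
  have y: "y \<in> Bop" using assms unfolding commutant_def by simp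
  have "adj y o\<^sub>L x = x o\<^sub>L adj y" if "x \<in> M" for x
  proof -
    have "y o\<^sub>L adj x = adj x o\<^sub>L y" using assms M_adj[OF that] unfolding commutant_def by auto
    then have "adj (adj x o\<^sub>L y) = adj (y o\<^sub>L adj x)" by simp
    then show ?thesis using y M_Bop[OF that] by (simp add: adj_compose adj_adj)
  qed
  then show ?thesis using y unfolding commutant_def by auto
qed

lemma pos_adj_compose: "x \<in> M \<Longrightarrow> adj x o\<^sub>L x \<in> pos M"
  unfolding pos_def by (auto intro: M_compose M_adj simp: cinner_adj_right M_Bop cinner_self complex_nonneg_Reals_iff)

lemma vn_tensor_commute:
  assumes X: "X \<in> vn_tensor M M" and y: "y \<in> commutant M" and z: "z \<in> commutant M"
  shows "(y \<otimes>\<^sub>o z) (X t) = X ((y \<otimes>\<^sub>o z) t)"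
proof -
  let ?G = "{x \<otimes>\<^sub>o y | x y. x \<in> M \<and> y \<in> M}"
  have yz: "y \<in> Bop" "z \<in> Bop" using y z commutant_props(1) by auto
  have "y \<otimes>\<^sub>o z \<in> commutant ?G"
    unfolding commutant_def
  proof (intro CollectI conjI ballI)
    show "y \<otimes>\<^sub>o z \<in> Bop" using yz by (rule op_tensor_Bop)
    fix B assume "B \<in> ?G"
    then obtain a b where B: "B = a \<otimes>\<^sub>o b" "a \<in> M" "b \<in> M" by auto
    show "(y \<otimes>\<^sub>o z) o\<^sub>L B = B o\<^sub>L (y \<otimes>\<^sub>o z)"
      using yz B y z by (intro op_eqI_htens) (simp add: op_tensor_apply M_Bop commutant_M)
  qed
  then show ?thesis
    using X unfolding vn_tensor_def commutant_def[of "commutant ?G"] by (auto simp: blinfun_eq_iff)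
qed

text \<open>\<open>X\<close> commutes with \<open>id_blinfun \<otimes>\<^sub>o y\<close> and
  \<open>y \<otimes>\<^sub>o id_blinfun\<close> for \<open>y\<close> in the commutant of
  \<open>M\<close>. Slicing off the other leg leaves commutation with \<open>y\<close>, and the
  bicommutant property puts the slice into \<open>M\<close>.\<close>

lemma vn_tensor_slices:
  assumes X: "X \<in> vn_tensor M M"
  shows vn_tensor_Bop: "X \<in> Bop" and vslice_left_M: "vslice_left v u X \<in> M"
    and vslice_right_M: "vslice_right v u X \<in> M"
proof -
  show XB: "X \<in> Bop" using X unfolding vn_tensor_def commutant_def by auto
  note com = vn_tensor_commute[OF X]
  have id': "id_blinfun \<in> commutant M" by (rule commutant_props)
  show "vslice_left v u X \<in> M"
  proof (rule M_I[OF vslice_left_Bop[OF XB]])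
    fix y assume y: "y \<in> commutant M"
    then have yB: "y \<in> Bop" using commutant_props(1) by auto
    show "vslice_left v u X o\<^sub>L y = y o\<^sub>L vslice_left v u X"
    proof (rule cinner_ext_op)
      fix b a
      have "cinner b ((vslice_left v u X o\<^sub>L y) a) = cinner (v \<otimes>\<^sub>h b) (X ((id_blinfun \<otimes>\<^sub>o y) (u \<otimes>\<^sub>h a)))"
        using XB yB by (simp add: cinner_vslice_left op_tensor_apply)
      also have "\<dots> = cinner (v \<otimes>\<^sub>h b) ((id_blinfun \<otimes>\<^sub>o y) (X (u \<otimes>\<^sub>h a)))"
        using com[OF id' y] by simp
      also have "\<dots> = cinner b ((y o\<^sub>L vslice_left v u X) a)"
        using XB yB by (simp add: cinner_vslice_left cinner_adj_left[symmetric] adj_id_tensor id_tensor_Bop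
            op_tensor_apply)
      finally show "cinner b ((vslice_left v u X o\<^sub>L y) a) = cinner b ((y o\<^sub>L vslice_left v u X) a)" .
    qed
  qed
  show "vslice_right v u X \<in> M"
  proof (rule M_I[OF vslice_right_Bop[OF XB]])
    fix y assume y: "y \<in> commutant M"
    then have yB: "y \<in> Bop" using commutant_props(1) by auto
    show "vslice_right v u X o\<^sub>L y = y o\<^sub>L vslice_right v u X"
    proof (rule cinner_ext_op)
      fix b a
      have adj: "adj (y \<otimes>\<^sub>o id_blinfun) = adj y \<otimes>\<^sub>o (id_blinfun :: 'a \<Rightarrow>\<^sub>L 'a)"
      proof (rule adjI)
        fix s t :: "('a, 'a) htensor"
        have 1: "(\<lambda>s. cnj (cinner ((y \<otimes>\<^sub>o id_blinfun) s) (a \<otimes>\<^sub>h b))) = (\<lambda>s. cnj (cinner s (adj y a \<otimes>\<^sub>h b)))" for a b :: 'a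
          by (rule bounded_linear_eq_htens)
            (auto simp: cinner_commute[symmetric] op_tensor_apply yB cinner_htens cinner_adj_left intro!:
              bounded_linear_cinner_right
              bounded_linear_compose[OF bounded_linear_cinner_right blinfun.bounded_linear_right])
        have "(\<lambda>t. cinner ((y \<otimes>\<^sub>o id_blinfun) s) t) = (\<lambda>t. cinner s ((adj y \<otimes>\<^sub>o id_blinfun) t))"
          by (rule bounded_linear_eq_htens)
            (use fun_cong[OF 1, of s] in \<open>auto simp: op_tensor_apply yB intro!: bounded_linear_cinner_right
              bounded_linear_compose[OF bounded_linear_cinner_right blinfun.bounded_linear_right]\<close>)
        then show "cinner ((y \<otimes>\<^sub>o id_blinfun) s) t = cinner s ((adj y \<otimes>\<^sub>o id_blinfun) t)" by (rule fun_cong)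
      qed (use yB in \<open>auto intro: op_tensor_Bop\<close>)
      have "cinner b ((vslice_right v u X o\<^sub>L y) a) = cinner (b \<otimes>\<^sub>h v) (X ((y \<otimes>\<^sub>o id_blinfun) (a \<otimes>\<^sub>h u)))"
        using XB yB by (simp add: cinner_vslice_right op_tensor_apply)
      also have "\<dots> = cinner (b \<otimes>\<^sub>h v) ((y \<otimes>\<^sub>o id_blinfun) (X (a \<otimes>\<^sub>h u)))"
        using com[OF y id'] by simp
      also have "\<dots> = cinner b ((y o\<^sub>L vslice_right v u X) a)"
        using XB yB by (simp add: cinner_vslice_right cinner_adj_left[symmetric] adj op_tensor_Bop
            op_tensor_apply)
      finally show "cinner b ((vslice_right v u X o\<^sub>L y) a) = cinner b ((y o\<^sub>L vslice_right v u X) a)" .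
    qed
  qed
qed

text \<open>Elements of the predual vanish outside \<open>M\<close>, hence the cut-off.\<close>

definition tf :: "(nat \<Rightarrow> 'a) \<Rightarrow> (nat \<Rightarrow> 'a) \<Rightarrow> ('a \<Rightarrow>\<^sub>L 'a) \<Rightarrow> complex" where
  "tf \<mu> \<nu> = (\<lambda>x. if x \<in> M then \<Sum>n. cinner (\<mu> n) (x (\<nu> n)) else 0)"

definition vf :: "'a \<Rightarrow> 'a \<Rightarrow> ('a \<Rightarrow>\<^sub>L 'a) \<Rightarrow> complex" where
  "vf u v = (\<lambda>x. if x \<in> M then cinner u (x v) else 0)"

end

lemma sq_summable_finite_sums:
  fixes \<mu> :: "nat \<Rightarrow> 'a::chilbert"
  assumes "summable (\<lambda>n. (norm (\<mu> n))\<^sup>2)" "finite F"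
  shows "(\<Sum>n\<in>F. (norm (\<mu> n))\<^sup>2) \<le> (sqrt (\<Sum>n. (norm (\<mu> n))\<^sup>2))\<^sup>2"
  using sum_le_suminf[OF assms] suminf_nonneg[OF assms(1)] by simp

lemma trace_sum:
  fixes \<mu> :: "nat \<Rightarrow> 'b::chilbert" and \<nu> :: "nat \<Rightarrow> 'a::chilbert" and x :: "'a \<Rightarrow>\<^sub>L 'b"
  assumes \<mu>: "summable (\<lambda>n. (norm (\<mu> n))\<^sup>2)" and \<nu>: "summable (\<lambda>n. (norm (\<nu> n))\<^sup>2)"
  shows trace_sum_sums: "(\<lambda>n. cinner (\<mu> n) (x (\<nu> n))) sums (\<Sum>n. cinner (\<mu> n) (x (\<nu> n)))"
    and trace_sum_bound: "cmod (\<Sum>n. cinner (\<mu> n) (x (\<nu> n)))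
      \<le> norm x * (sqrt (\<Sum>n. (norm (\<mu> n))\<^sup>2) * sqrt (\<Sum>n. (norm (\<nu> n))\<^sup>2))"
proof -
  let ?A = "sqrt (\<Sum>n. (norm (\<mu> n))\<^sup>2)" and ?B = "sqrt (\<Sum>n. (norm (\<nu> n))\<^sup>2)"
  have B: "(\<Sum>n\<in>F. (norm (x (\<nu> n)))\<^sup>2) \<le> (norm x * ?B)\<^sup>2" if "finite F" for F
  proof -
    have "(\<Sum>n\<in>F. (norm (x (\<nu> n)))\<^sup>2) \<le> (\<Sum>n\<in>F. (norm x)\<^sup>2 * (norm (\<nu> n))\<^sup>2)"
      by (intro sum_mono) (simp add: power_mult_distrib[symmetric] power_mono norm_blinfun)
    also have "\<dots> \<le> (norm x)\<^sup>2 * ?B\<^sup>2"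
      unfolding sum_distrib_left[symmetric] by (intro mult_left_mono sq_summable_finite_sums \<nu> that) auto
    finally show ?thesis by (simp add: power_mult_distrib)
  qed
  note cs = cinner_sums_cauchy_schwarz[of UNIV \<mu> ?A "\<lambda>n. x (\<nu> n)" "norm x * ?B",
      OF sq_summable_finite_sums[OF \<mu>] B]
  have 0: "0 \<le> ?A" "0 \<le> norm x * ?B" using \<mu> \<nu> by (auto intro!: suminf_nonneg mult_nonneg_nonneg)
  have sm: "(\<lambda>n. cinner (\<mu> n) (x (\<nu> n))) summable_on UNIV"
    and bd: "cmod (\<Sum>\<^sub>\<infinity>n. cinner (\<mu> n) (x (\<nu> n))) \<le> ?A * (norm x * ?B)"
    using cs 0 by auto
  from has_sum_infsum[OF sm] have s: "(\<lambda>n. cinner (\<mu> n) (x (\<nu> n))) sums (\<Sum>\<^sub>\<infinity>n. cinner (\<mu> n) (x (\<nu> n)))"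
    by (rule has_sum_imp_sums)
  then have eq: "(\<Sum>n. cinner (\<mu> n) (x (\<nu> n))) = (\<Sum>\<^sub>\<infinity>n. cinner (\<mu> n) (x (\<nu> n)))" by (rule sums_unique[symmetric])
  show "(\<lambda>n. cinner (\<mu> n) (x (\<nu> n))) sums (\<Sum>n. cinner (\<mu> n) (x (\<nu> n)))" unfolding eq by (rule s)
  show "cmod (\<Sum>n. cinner (\<mu> n) (x (\<nu> n))) \<le> norm x * (?A * ?B)"
    using bd unfolding eq by (simp add: mult_ac)
qed

section \<open>The sigma-weak topology and normal functionals\<close>

lemma openin_sigma_weak_basic:
  assumes "summable (\<lambda>n. (norm (\<nu> n))\<^sup>2)" "summable (\<lambda>n. (norm (\<mu> n))\<^sup>2)" "open U"
  shows "openin sigma_weak {x \<in> Bop. (\<Sum>n. cinner (\<mu> n) (blinfun_apply x (\<nu> n))) \<in> U}"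
  unfolding sigma_weak_def by (rule topology_generated_by_Basis) (use assms in blast)

lemma topspace_sigma_weak: "topspace (sigma_weak :: ('a::chilbert \<Rightarrow>\<^sub>L 'a) topology) = Bop"
proof
  show "topspace (sigma_weak :: ('a \<Rightarrow>\<^sub>L 'a) topology) \<subseteq> Bop"
    unfolding sigma_weak_def topology_generated_by_topspace by auto
  have "openin sigma_weak {x \<in> Bop. (\<Sum>n. cinner ((\<lambda>_. 0 :: 'a) n) (blinfun_apply x ((\<lambda>_. 0) n))) \<in> UNIV}"
    by (rule openin_sigma_weak_basic) auto
  then show "Bop \<subseteq> topspace (sigma_weak :: ('a \<Rightarrow>\<^sub>L 'a) topology)"
    using openin_subset by fastforce
qed

lemma continuous_map_trace:
  assumes "summable (\<lambda>n. (norm (\<mu> n))\<^sup>2)" "summable (\<lambda>n. (norm (\<nu> n))\<^sup>2)"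
  shows "continuous_map sigma_weak euclidean (\<lambda>x. \<Sum>n. cinner (\<mu> n) (blinfun_apply x (\<nu> n :: 'a::chilbert)))"
  unfolding continuous_map_def topspace_sigma_weak
  using openin_sigma_weak_basic[OF assms(2,1)] by auto

lemma single_sequence:
  shows summable_single: "summable (\<lambda>n. (norm (if n = 0 then v else (0 :: 'a::chilbert)))\<^sup>2)"
    and suminf_single_cinner: "(\<Sum>n. cinner (if n = 0 then u else 0) (blinfun_apply x (if n = 0 then v else (0 :: 'a)))) = cinner u (blinfun_apply x v)"
proof -
  show "summable (\<lambda>n. (norm (if n = 0 then v else (0 :: 'a)))\<^sup>2)"
    by (rule summable_finite[of "{0}"]) auto
  have "(\<Sum>n. cinner (if n = 0 then u else 0) (blinfun_apply x (if n = 0 then v else (0 :: 'a))))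
      = (\<Sum>n\<in>{0 :: nat}. cinner (if n = 0 then u else 0) (x (if n = 0 then v else (0 :: 'a))))"
    by (rule suminf_finite) auto
  then show "(\<Sum>n. cinner (if n = 0 then u else 0) (blinfun_apply x (if n = 0 then v else (0 :: 'a)))) = cinner u (x v)" by simp
qed

lemma continuous_map_vector: "continuous_map sigma_weak euclidean (\<lambda>x. cinner u (blinfun_apply x (v :: 'a::chilbert)))"
  using continuous_map_trace[OF summable_single summable_single, of u v]
  unfolding suminf_single_cinner[of u _ v] .

context vna
begin

lemma tf_predual:
  assumes \<mu>: "summable (\<lambda>n. (norm (\<mu> n))\<^sup>2)" and \<nu>: "summable (\<lambda>n. (norm (\<nu> n))\<^sup>2)"
  shows "tf \<mu> \<nu> \<in> predual M"
  unfolding predual_def mem_Collect_eq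
proof (intro conjI)
  note s = trace_sum_sums[OF \<mu> \<nu>]
  show "clinear_on M (*) (tf \<mu> \<nu>)"
    unfolding clinear_on_def tf_def
    using sums_unique[OF sums_add[OF s s]] sums_unique[OF sums_mult[OF s]]
    by (auto simp: M_add M_scaleC blinfun.add_left cinner_add_right cinner_scaleC_right)
  have "continuous_map (subtopology sigma_weak M) euclidean (\<lambda>x. \<Sum>n. cinner (\<mu> n) (blinfun_apply x (\<nu> n)))"
    by (rule continuous_map_from_subtopology[OF continuous_map_trace[OF \<mu> \<nu>]])
  then show "continuous_map (subtopology sigma_weak M) euclidean (tf \<mu> \<nu>)"
    by (rule continuous_map_eq) (simp add: tf_def)
qed (simp add: tf_def)

lemma vf_tf: "vf u v = tf (\<lambda>n. if n = 0 then u else 0) (\<lambda>n. if n = 0 then v else 0)"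
  unfolding vf_def tf_def suminf_single_cinner ..

lemma vf_predual: "vf u v \<in> predual M"
  unfolding vf_tf by (intro tf_predual summable_single)

end

text \<open>Induction on \<open>n\<close>: if some \<open>y\<close> is killed by the first
  \<open>n\<close> functionals but not by the last, a multiple of the last one is subtracted from
  \<open>w\<close>; otherwise the last one contributes nothing. Addition and scaling are parameters
  so that operators with \<open>*\<^sub>B\<close> are covered.\<close>

lemma finite_functionals_kernel:
  fixes w :: "'v \<Rightarrow> complex" and f :: "nat \<Rightarrow> 'v \<Rightarrow> complex"
    and add :: "'v \<Rightarrow> 'v \<Rightarrow> 'v" and sc :: "complex \<Rightarrow> 'v \<Rightarrow> 'v"
  assumes V: "\<And>x y. x \<in> V \<Longrightarrow> y \<in> V \<Longrightarrow> add x y \<in> V" "\<And>c x. x \<in> V \<Longrightarrow> sc c x \<in> V" "z \<in> V"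
    and lin_w: "\<And>x y. x \<in> V \<Longrightarrow> y \<in> V \<Longrightarrow> w (add x y) = w x + w y" "\<And>c x. x \<in> V \<Longrightarrow> w (sc c x) = c * w x"
    and lin_f: "\<And>i x y. x \<in> V \<Longrightarrow> y \<in> V \<Longrightarrow> f i (add x y) = f i x + f i y" "\<And>i c x. x \<in> V \<Longrightarrow> f i (sc c x) = c * f i x"
    and ker: "\<And>x. x \<in> V \<Longrightarrow> (\<And>i. i < n \<Longrightarrow> f i x = 0) \<Longrightarrow> w x = 0"
  obtains c where "\<And>x. x \<in> V \<Longrightarrow> w x = (\<Sum>i<n. c i * f i x)"
proof -
  have "\<exists>c. \<forall>x\<in>V. w x = (\<Sum>i<n. c i * f i x)"
    using lin_w ker
  proof (induction n arbitrary: w)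
    case 0
    then show ?case by simp
  next
    case (Suc n)
    show ?case
    proof (cases "\<exists>y\<in>V. (\<forall>i<n. f i y = 0) \<and> f n y \<noteq> 0")
      case True
      then obtain y where y: "y \<in> V" "\<And>i. i < n \<Longrightarrow> f i y = 0" "f n y \<noteq> 0" by blast
      define d where "d = w y / f n y"
      have "\<exists>c. \<forall>x\<in>V. w x - d * f n x = (\<Sum>i<n. c i * f i x)"
      proof (rule Suc.IH)
        fix x assume x: "x \<in> V" "\<And>i. i < n \<Longrightarrow> f i x = 0"
        define t where "t = add x (sc (- (f n x / f n y)) y)"
        have "t \<in> V" unfolding t_def using V x y by blast
        moreover have "f i t = 0" if "i < Suc n" for i
          unfolding t_def using V x y that by (cases "i = n") (auto simp: lin_f)
        ultimately have "w t = 0" using Suc.prems(3) by blast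
        then show "w x - d * f n x = 0"
          unfolding t_def d_def using V x y Suc.prems by simp
      qed (use Suc.prems lin_f in \<open>auto simp: algebra_simps\<close>)
      then obtain c where c: "\<forall>x\<in>V. w x - d * f n x = (\<Sum>i<n. c i * f i x)" by blast
      have "w x = (\<Sum>i<Suc n. (c(n := d)) i * f i x)" if "x \<in> V" for x
      proof -
        have "(\<Sum>i<n. (c(n := d)) i * f i x) = (\<Sum>i<n. c i * f i x)" by (rule sum.cong) auto
        then show ?thesis using c that by (simp add: algebra_simps)
      qed
      then show ?thesis by blast
    next
      case False
      then have "\<exists>c. \<forall>x\<in>V. w x = (\<Sum>i<n. c i * f i x)"
      proof (intro Suc.IH)
        fix x assume x: "x \<in> V" "\<And>i. i < n \<Longrightarrow> f i x = 0"
        with False have "f i x = 0" if "i < Suc n" for i using that by (cases "i = n") auto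
        with x(1) show "w x = 0" by (rule Suc.prems(3))
      qed (use Suc.prems in auto)
      then obtain c where c: "\<forall>x\<in>V. w x = (\<Sum>i<n. c i * f i x)" by blast
      have "w x = (\<Sum>i<Suc n. (c(n := 0)) i * f i x)" if "x \<in> V" for x
      proof -
        have "(\<Sum>i<n. (c(n := 0)) i * f i x) = (\<Sum>i<n. c i * f i x)" by (rule sum.cong) auto
        then show ?thesis using c that by simp
      qed
      then show ?thesis by blast
    qed
  qed
  then show thesis using that by blast
qed

text \<open>Induction over the generation of the topology. An intersection concatenates the two
  lists of functionals and takes the smaller tolerance; for a union, one member that contains 0
  suffices.\<close>

lemma sigma_weak_nhd_zero:
  assumes "openin sigma_weak (T :: ('a::chilbert \<Rightarrow>\<^sub>L 'a) set)" "0 \<in> T"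
  shows "\<exists>n \<mu> \<nu> \<epsilon>. 0 < \<epsilon> \<and> (\<forall>i<n. summable (\<lambda>k. (norm (\<mu> i k :: 'a))\<^sup>2) \<and> summable (\<lambda>k. (norm (\<nu> i k :: 'a))\<^sup>2)) \<and>
     {x \<in> Bop. \<forall>i<n::nat. cmod (\<Sum>k. cinner (\<mu> i k) (blinfun_apply x (\<nu> i k))) < \<epsilon>} \<subseteq> T"
proof -
  let ?S = "{{x \<in> Bop. (\<Sum>n. cinner (\<eta> n) (blinfun_apply x (\<xi> n))) \<in> U} | (\<xi> :: nat \<Rightarrow> 'a) (\<eta> :: nat \<Rightarrow> 'a) U.
        summable (\<lambda>n. (norm (\<xi> n))\<^sup>2) \<and> summable (\<lambda>n. (norm (\<eta> n))\<^sup>2) \<and> open U}"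
  have "generate_topology_on ?S T"
    using assms(1) unfolding sigma_weak_def openin_topology_generated_by_iff .
  then show ?thesis using assms(2)
  proof (induction rule: generate_topology_on.induct)
    case (Int A B)
    then obtain n \<mu> \<nu> \<epsilon> m \<mu>' \<nu>' \<epsilon>' where 1: "0 < \<epsilon>" "0 < \<epsilon>'"
      "\<forall>i<n. summable (\<lambda>k. (norm (\<mu> i k :: 'a))\<^sup>2) \<and> summable (\<lambda>k. (norm (\<nu> i k :: 'a))\<^sup>2)"
      "\<forall>i<m. summable (\<lambda>k. (norm (\<mu>' i k :: 'a))\<^sup>2) \<and> summable (\<lambda>k. (norm (\<nu>' i k :: 'a))\<^sup>2)"
      "{x \<in> Bop. \<forall>i<n::nat. cmod (\<Sum>k. cinner (\<mu> i k) (blinfun_apply x (\<nu> i k))) < \<epsilon>} \<subseteq> A"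
      "{x \<in> Bop. \<forall>i<m::nat. cmod (\<Sum>k. cinner (\<mu>' i k) (blinfun_apply x (\<nu>' i k))) < \<epsilon>'} \<subseteq> B"
      by auto
    define \<mu>2 \<nu>2 where "\<mu>2 i = (if i < n then \<mu> i else \<mu>' (i - n))" and "\<nu>2 i = (if i < n then \<nu> i else \<nu>' (i - n))" for i
    have "x \<in> A \<inter> B" if "x \<in> Bop" and x: "\<And>i. i < n + m \<Longrightarrow> cmod (\<Sum>k. cinner (\<mu>2 i k) (blinfun_apply x (\<nu>2 i k))) < min \<epsilon> \<epsilon>'" for x
    proof -
      have "cmod (\<Sum>k. cinner (\<mu> i k) (blinfun_apply x (\<nu> i k))) < \<epsilon>" if "i < n" for i
        using x[of i] that unfolding \<mu>2_def \<nu>2_def by simp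
      moreover have "cmod (\<Sum>k. cinner (\<mu>' i k) (blinfun_apply x (\<nu>' i k))) < \<epsilon>'" if "i < m" for i
        using x[of "n + i"] that unfolding \<mu>2_def \<nu>2_def by simp
      ultimately show ?thesis using 1(5,6) \<open>x \<in> Bop\<close> by blast
    qed
    then show ?case using 1(1-4)
      by (intro exI[of _ "n + m"] exI[of _ \<mu>2] exI[of _ \<nu>2] exI[of _ "min \<epsilon> \<epsilon>'"])
        (auto simp: \<mu>2_def \<nu>2_def)
  next
    case (UN K)
    then obtain k where k: "k \<in> K" "0 \<in> k" by blast
    from UN.IH[OF this] show ?case using k(1) by (meson Union_upper order_trans)
  next
    case (Basis s)
    then obtain \<xi> \<eta> U where s: "s = {x \<in> Bop. (\<Sum>n. cinner (\<eta> n) (blinfun_apply x (\<xi> n))) \<in> U}"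
      "summable (\<lambda>n. (norm (\<xi> n :: 'a))\<^sup>2)" "summable (\<lambda>n. (norm (\<eta> n :: 'a))\<^sup>2)" "open U" by blast
    have "0 \<in> U" using Basis(2) unfolding s by simp
    then obtain \<epsilon> where "0 < \<epsilon>" "ball 0 \<epsilon> \<subseteq> U" using \<open>open U\<close> open_contains_ball by blast
    then show ?case using s
      by (intro exI[of _ 1] exI[of _ "\<lambda>_. \<eta>"] exI[of _ "\<lambda>_. \<xi>"] exI[of _ \<epsilon>]) (auto simp: subset_eq dist_norm)
  qed auto
qed

text \<open>A sigma-weakly continuous functional is bounded by 1 on a basic neighbourhood of 0,
  hence vanishes on the common kernel of finitely many trace functionals and is a combination of
  them. A finite combination serves as well as a single series, since the properties derived from it
  are linear in the functional.\<close>

lemma (in vna) predual_finite_sum: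
  assumes "w \<in> predual M"
  obtains n :: nat and c \<mu> \<nu> where "\<And>i. summable (\<lambda>k. (norm (\<mu> i k :: 'a))\<^sup>2)"
    "\<And>i. summable (\<lambda>k. (norm (\<nu> i k :: 'a))\<^sup>2)" "w = (\<lambda>x. \<Sum>i<n. c i * tf (\<mu> i) (\<nu> i) x)"
proof -
  have lin: "\<And>x y. x \<in> M \<Longrightarrow> y \<in> M \<Longrightarrow> w (x + y) = w x + w y" "\<And>c x. x \<in> M \<Longrightarrow> w (c *\<^sub>B x) = c * w x"
    and cont: "continuous_map (subtopology sigma_weak M) euclidean w" and out: "\<And>x. x \<notin> M \<Longrightarrow> w x = 0"
    using assms unfolding predual_def clinear_on_def by auto
  have topM: "topspace (subtopology sigma_weak M) = M"
    using M_subset_Bop by (auto simp: topspace_subtopology topspace_sigma_weak)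
  have "openin (subtopology sigma_weak M) {x \<in> M. w x \<in> ball 0 1}"
    using cont unfolding continuous_map_def topM by (meson open_ball open_openin)
  then obtain T where T: "openin sigma_weak T" "{x \<in> M. w x \<in> ball 0 1} = T \<inter> M"
    unfolding openin_subtopology by blast
  have "0 *\<^sub>B 0 = (0 :: 'a \<Rightarrow>\<^sub>L 'a)" by (rule blinfun_eqI) simp
  then have "w 0 = 0" using lin(2)[OF M_zero, of 0] by simp
  then have "0 \<in> {x \<in> M. w x \<in> ball 0 1}" using M_zero by simp
  then have "0 \<in> T" unfolding T(2) by blast
  from sigma_weak_nhd_zero[OF T(1) this] obtain n :: nat and \<mu>0 \<nu>0 and \<epsilon> where nhd: "0 < \<epsilon>"
    "\<forall>i<n. summable (\<lambda>k. (norm (\<mu>0 i k :: 'a))\<^sup>2) \<and> summable (\<lambda>k. (norm (\<nu>0 i k :: 'a))\<^sup>2)"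
    "{x \<in> Bop. \<forall>i<n. cmod (\<Sum>k. cinner (\<mu>0 i k) (blinfun_apply x (\<nu>0 i k))) < \<epsilon>} \<subseteq> T"
    by blast
  \<comment> \<open>Beyond \<open>n\<close> the sequences are set to 0, so that summability holds
    for every index.\<close>
  define \<mu> \<nu> where "\<mu> i = (if i < n then \<mu>0 i else (\<lambda>_. 0))" and "\<nu> i = (if i < n then \<nu>0 i else (\<lambda>_. 0))" for i
  have sm: "summable (\<lambda>k. (norm (\<mu> i k))\<^sup>2)" "summable (\<lambda>k. (norm (\<nu> i k))\<^sup>2)" for i
    using nhd(2) unfolding \<mu>_def \<nu>_def by auto
  have tfp: "tf (\<mu> i) (\<nu> i) \<in> predual M" for i by (intro tf_predual sm)
  obtain c where c: "\<And>x. x \<in> M \<Longrightarrow> w x = (\<Sum>i<n. c i * tf (\<mu> i) (\<nu> i) x)"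
  proof (rule finite_functionals_kernel[of M "(+)" "\<lambda>c x. c *\<^sub>B x" 0 w "\<lambda>i. tf (\<mu> i) (\<nu> i)" n])
    fix x assume x: "x \<in> M" "\<And>i. i < n \<Longrightarrow> tf (\<mu> i) (\<nu> i) x = 0"
    \<comment> \<open>All real multiples of \<open>x\<close> stay in the neighbourhood, because the
      functionals that define it vanish on them; a nonzero value of \<open>w\<close> could then be
      scaled up to modulus 1.\<close>
    have small: "cmod (w (complex_of_real r *\<^sub>B x)) < 1" for r
    proof -
      define y where "y = complex_of_real r *\<^sub>B x"
      have y: "y \<in> M" unfolding y_def using x(1) by (rule M_scaleC)
      have 0: "tf (\<mu> i) (\<nu> i) y = 0" if "i < n" for i
        using tfp[of i] x that unfolding predual_def clinear_on_def y_def by simp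
      have "cmod (\<Sum>k. cinner (\<mu>0 i k) (y (\<nu>0 i k))) < \<epsilon>" if "i < n" for i
      proof -
        have "(\<Sum>k. cinner (\<mu>0 i k) (y (\<nu>0 i k))) = tf (\<mu> i) (\<nu> i) y"
          using that y by (simp add: tf_def \<mu>_def \<nu>_def)
        then show ?thesis using 0[OF that] nhd(1) by simp
      qed
      then have "y \<in> T" using nhd(3) y M_Bop by blast
      then have "y \<in> {x \<in> M. w x \<in> ball 0 1}" unfolding T(2) using y by blast
      then show ?thesis unfolding y_def by (simp add: dist_norm)
    qed
    show "w x = 0"
    proof (rule ccontr)
      assume "w x \<noteq> 0"
      then show False using small[of "1 / cmod (w x)"] lin(2)[OF x(1)] by (simp add: norm_mult norm_divide)
    qed
  qed (use tfp lin M_add M_scaleC M_zero in \<open>auto simp: predual_def clinear_on_def\<close>)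
  have "w = (\<lambda>x. \<Sum>i<n. c i * tf (\<mu> i) (\<nu> i) x)"
  proof
    fix x show "w x = (\<Sum>i<n. c i * tf (\<mu> i) (\<nu> i) x)"
      using c out by (cases "x \<in> M") (auto simp: tf_def)
  qed
  with sm that show thesis by blast
qed

section \<open>Norms of matrices of operators and of functionals\<close>

lemma mat_norm_le:
  assumes "0 \<le> K" "\<And>\<xi>. L2_set (\<lambda>i. norm (\<Sum>j\<in>I. X i j (\<xi> j))) I \<le> K * L2_set (\<lambda>j. norm (\<xi> j)) I"
  shows "mat_norm I X \<le> K"
  unfolding mat_norm_def by (rule cInf_lower) (use assms in \<open>auto intro!: bdd_belowI[of _ 0]\<close>)

text \<open>\<open>mat_norm\<close> is an infimum, which carries information only if some bound
  exists: the sum of all entry norms is one. By approximation the infimum is then a bound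
  itself.\<close>

lemma mat_norm_blinfun:
  fixes X :: "'i \<Rightarrow> 'i \<Rightarrow> 'a::real_normed_vector \<Rightarrow>\<^sub>L 'b::real_normed_vector"
  assumes "finite I"
  shows "L2_set (\<lambda>i. norm (\<Sum>j\<in>I. X i j (\<xi> j))) I
    \<le> mat_norm I (\<lambda>i j. blinfun_apply (X i j)) * L2_set (\<lambda>j. norm (\<xi> j)) I"
proof -
  let ?S = "{C. 0 \<le> C \<and> (\<forall>\<xi>. L2_set (\<lambda>i. norm (\<Sum>j\<in>I. X i j (\<xi> j))) I \<le> C * L2_set (\<lambda>j. norm (\<xi> j)) I)}"
  have "(\<Sum>i\<in>I. \<Sum>j\<in>I. norm (X i j)) \<in> ?S"
  proof (intro CollectI conjI allI)
    fix \<xi>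
    have "L2_set (\<lambda>i. norm (\<Sum>j\<in>I. X i j (\<xi> j))) I \<le> (\<Sum>i\<in>I. norm (\<Sum>j\<in>I. X i j (\<xi> j)))"
      by (rule L2_set_le_sum) simp
    also have "\<dots> \<le> (\<Sum>i\<in>I. \<Sum>j\<in>I. norm (X i j) * L2_set (\<lambda>j. norm (\<xi> j)) I)"
    proof (intro sum_mono order_trans[OF norm_sum])
      fix i j assume "j \<in> I"
      then have "norm (\<xi> j) \<le> L2_set (\<lambda>j. norm (\<xi> j)) I" by (rule member_le_L2_set[OF assms])
      then show "norm (X i j (\<xi> j)) \<le> norm (X i j) * L2_set (\<lambda>j. norm (\<xi> j)) I"
        by (meson mult_left_mono norm_blinfun norm_ge_zero order_trans)
    qed
    finally show "L2_set (\<lambda>i. norm (\<Sum>j\<in>I. X i j (\<xi> j))) I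
        \<le> (\<Sum>i\<in>I. \<Sum>j\<in>I. norm (X i j)) * L2_set (\<lambda>j. norm (\<xi> j)) I"
      by (simp add: sum_distrib_right)
  qed (intro sum_nonneg norm_ge_zero)
  then have ne: "?S \<noteq> {}" by blast
  have "L2_set (\<lambda>i. norm (\<Sum>j\<in>I. X i j (\<xi> j))) I \<le> (Inf ?S + \<epsilon>) * L2_set (\<lambda>j. norm (\<xi> j)) I" if \<epsilon>: "0 < \<epsilon>" for \<epsilon>
  proof -
    obtain C where "C \<in> ?S" "C < Inf ?S + \<epsilon>"
      using cInf_lessD[OF ne, of "Inf ?S + \<epsilon>"] \<epsilon> by auto
    then show ?thesis by (auto intro!: mult_right_mono order_trans[OF _ mult_right_mono[of C "Inf ?S + \<epsilon>"]])
  qed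
  then have "L2_set (\<lambda>i. norm (\<Sum>j\<in>I. X i j (\<xi> j))) I \<le> Inf ?S * L2_set (\<lambda>j. norm (\<xi> j)) I + \<epsilon>" if "0 < \<epsilon>" for \<epsilon>
  proof -
    define N where "N = L2_set (\<lambda>j. norm (\<xi> j)) I"
    have N: "0 \<le> N" unfolding N_def by simp
    \<comment> \<open>The denominator \<open>N + 1\<close> keeps the error below
      \<open>\<epsilon>\<close> even when \<open>N = 0\<close>.\<close>
    have "L2_set (\<lambda>i. norm (\<Sum>j\<in>I. X i j (\<xi> j))) I \<le> (Inf ?S + \<epsilon> / (N + 1)) * N"
      unfolding N_def using that
      by (intro \<open>\<And>\<epsilon>. 0 < \<epsilon> \<Longrightarrow> _ \<le> (Inf ?S + \<epsilon>) * L2_set (\<lambda>j. norm (\<xi> j)) I\<close>) (simp add: add_nonneg_pos)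
    also have "\<dots> \<le> Inf ?S * N + \<epsilon>" using N that by (simp add: distrib_right field_simps)
    finally show ?thesis unfolding N_def .
  qed
  then show ?thesis unfolding mat_norm_def by (rule field_le_epsilon)
qed

lemma predual_mat_norm_le:
  fixes M :: "('a::chilbert \<Rightarrow>\<^sub>L 'a) set"
  assumes "0 \<le> K"
    and *: "\<And>(m :: nat) x c. (\<And>k l. k < m \<Longrightarrow> l < m \<Longrightarrow> x k l \<in> M) \<Longrightarrow>
      (\<And>\<xi>. L2_set (\<lambda>k. norm (\<Sum>l<m. blinfun_apply (x k l) (\<xi> l))) {..<m} \<le> L2_set (\<lambda>l. norm (\<xi> l)) {..<m}) \<Longrightarrow>
      (\<Sum>k<m. \<Sum>i<n. (cmod (\<Sum>j<n. \<Sum>l<m. w i j (x k l) * c j l))\<^sup>2) \<le> K\<^sup>2 * (\<Sum>l<m. \<Sum>j<n. (cmod (c j l))\<^sup>2)"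
  shows "predual_mat_norm M n w \<le> K"
  unfolding predual_mat_norm_def
proof (rule cSup_least)
  \<comment> \<open>The case \<open>m = 0\<close> shows that the supremum is taken over a nonempty
    set.\<close>
  have "mat_norm {..<0::nat} (\<lambda>k l. blinfun_apply (0 :: 'a \<Rightarrow>\<^sub>L 'a)) \<le> 1" by (rule mat_norm_le) auto
  then show "{mat_norm ({..<n} \<times> {..<m}) (\<lambda>(i, k) (j, l) z. w i j (x k l) * z) | (m :: nat) x.
      (\<forall>k<m. \<forall>l<m. x k l \<in> M) \<and> mat_norm {..<m} (\<lambda>k l. blinfun_apply (x k l)) \<le> 1} \<noteq> {}"
    by (auto intro!: exI[of _ "0 :: nat"] exI[of _ "\<lambda>_ _. 0"])
next
  fix t assume "t \<in> {mat_norm ({..<n} \<times> {..<m}) (\<lambda>(i, k) (j, l) z. w i j (x k l) * z) | (m :: nat) x.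
      (\<forall>k<m. \<forall>l<m. x k l \<in> M) \<and> mat_norm {..<m} (\<lambda>k l. blinfun_apply (x k l)) \<le> 1}"
  then show "t \<le> K"
  proof (elim CollectE exE conjE)
    fix m :: nat and x
    assume t: "t = mat_norm ({..<n} \<times> {..<m}) (\<lambda>(i, k) (j, l) z. w i j (x k l) * z)"
      and xM': "\<forall>k<m. \<forall>l<m. x k l \<in> M" and x1: "mat_norm {..<m} (\<lambda>k l. blinfun_apply (x k l)) \<le> 1"
    have xM: "\<And>k l. k < m \<Longrightarrow> l < m \<Longrightarrow> x k l \<in> M" using xM' by blast
    have contr: "L2_set (\<lambda>k. norm (\<Sum>l<m. blinfun_apply (x k l) (\<xi> l))) {..<m} \<le> L2_set (\<lambda>l. norm (\<xi> l)) {..<m}" for \<xi>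
      using mat_norm_blinfun[of "{..<m}" x \<xi>] mult_right_mono[OF x1, of "L2_set (\<lambda>l. norm (\<xi> l)) {..<m}"] by simp
    show "t \<le> K" unfolding t
  proof (rule mat_norm_le[OF assms(1)])
    fix \<xi> :: "nat \<times> nat \<Rightarrow> complex"
    let ?P = "{..<n} \<times> {..<m}"
    let ?f = "\<lambda>p. norm (\<Sum>q\<in>?P. (case p of (i, k) \<Rightarrow> \<lambda>(j, l) z. w i j (x k l) * z) q (\<xi> q))"
    have "(\<Sum>p\<in>?P. (?f p)\<^sup>2) = (\<Sum>i<n. \<Sum>k<m. (cmod (\<Sum>j<n. \<Sum>l<m. w i j (x k l) * \<xi> (j, l)))\<^sup>2)"
      unfolding sum.cartesian_product by (intro sum.cong refl) (auto simp: case_prod_unfold)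
    also have "\<dots> = (\<Sum>k<m. \<Sum>i<n. (cmod (\<Sum>j<n. \<Sum>l<m. w i j (x k l) * \<xi> (j, l)))\<^sup>2)"
      by (rule sum.swap)
    also have "\<dots> \<le> K\<^sup>2 * (\<Sum>l<m. \<Sum>j<n. (cmod (\<xi> (j, l)))\<^sup>2)"
      by (rule *[OF xM contr])
    also have "(\<Sum>l<m. \<Sum>j<n. (cmod (\<xi> (j, l)))\<^sup>2) = (\<Sum>p\<in>?P. (cmod (\<xi> p))\<^sup>2)"
      by (subst sum.swap) (simp add: sum.cartesian_product case_prod_unfold)
    finally have "sqrt (\<Sum>p\<in>?P. (?f p)\<^sup>2) \<le> sqrt (K\<^sup>2 * (\<Sum>p\<in>?P. (cmod (\<xi> p))\<^sup>2))" by (rule real_sqrt_le_mono)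
    then show "L2_set ?f ?P \<le> K * L2_set (\<lambda>j. norm (\<xi> j)) ?P"
      using assms(1) unfolding L2_set_def by (simp add: real_sqrt_mult)
  qed
  qed
qed

section \<open>Completely bounded representations\<close>

lemma tail_tendsto_0:
  fixes f :: "nat \<Rightarrow> real"
  assumes "summable f"
  shows "(\<lambda>N. \<Sum>n. f (n + N)) \<longlonglongrightarrow> 0"
proof -
  have "(\<lambda>N. suminf f - (\<Sum>n<N. f n)) \<longlonglongrightarrow> suminf f - suminf f"
    by (intro tendsto_intros summable_LIMSEQ assms)
  then show ?thesis using suminf_minus_initial_segment[OF assms] by simp
qed

lemma L2_set_mono_iff: "L2_set f A \<le> L2_set g A \<longleftrightarrow> (\<Sum>i\<in>A. (f i)\<^sup>2) \<le> (\<Sum>i\<in>A. (g i)\<^sup>2)"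
  unfolding L2_set_def by simp

context vna
begin

lemma vf_linear:
  "vf (u + u') v = (\<lambda>x. vf u v x + vf u' v x)" "vf (c *\<^sub>C u) v = (\<lambda>x. cnj c * vf u v x)"
  "vf u (v + v') = (\<lambda>x. vf u v x + vf u v' x)" "vf u (c *\<^sub>C v) = (\<lambda>x. c * vf u v x)"
  by (auto simp: vf_def fun_eq_iff cinner_add_left cinner_add_right cinner_scaleC_left
      cinner_scaleC_right blinfun.add_right Bop_apply M_Bop)

lemma predual_add: "w \<in> predual M \<Longrightarrow> w' \<in> predual M \<Longrightarrow> (\<lambda>x. w x + w' x) \<in> predual M"
  unfolding predual_def clinear_on_def by (auto simp: algebra_simps intro: continuous_map_add)

lemma predual_scale: "w \<in> predual M \<Longrightarrow> (\<lambda>x. c * w x) \<in> predual M"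
proof -
  assume w: "w \<in> predual M"
  have "continuous_map euclidean euclidean (\<lambda>z :: complex. c * z)"
    by (simp add: continuous_map_iff_continuous2 continuous_intros)
  then have "continuous_map (subtopology sigma_weak M) euclidean ((\<lambda>z. c * z) \<circ> w)"
    using w unfolding predual_def by (intro continuous_map_compose[of _ euclidean]) auto
  then show ?thesis
    using w unfolding predual_def clinear_on_def by (auto simp: algebra_simps comp_def)
qed

lemma predual_zero: "(\<lambda>x. 0) \<in> predual M"
  unfolding predual_def clinear_on_def by auto

lemma predual_sum: "(\<And>i. i \<in> I \<Longrightarrow> f i \<in> predual M) \<Longrightarrow> (\<lambda>x. \<Sum>i\<in>I. f i x) \<in> predual M"
  by (induction I rule: infinite_finite_induct) (auto intro: predual_zero predual_add)

lemma tf_split: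
  assumes \<mu>: "summable (\<lambda>n. (norm (\<mu> n))\<^sup>2)" and \<nu>: "summable (\<lambda>n. (norm (\<nu> n))\<^sup>2)"
  shows "tf \<mu> \<nu> = (\<lambda>x. (\<Sum>n<N. vf (\<mu> n) (\<nu> n) x) + tf (\<lambda>n. \<mu> (n + N)) (\<lambda>n. \<nu> (n + N)) x)"
  unfolding tf_def vf_def fun_eq_iff
  using suminf_split_initial_segment[OF sums_summable[OF trace_sum_sums[OF \<mu> \<nu>]], of _ N]
  by (auto simp: add.commute)

end

locale cb_rep = vna M for M :: "('a::chilbert \<Rightarrow>\<^sub>L 'a) set" +
  fixes \<Delta> :: "('a \<Rightarrow>\<^sub>L 'a) \<Rightarrow> ('a, 'a) htensor \<Rightarrow>\<^sub>L ('a, 'a) htensor"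
    and \<pi> :: "(('a \<Rightarrow>\<^sub>L 'a) \<Rightarrow> complex) \<Rightarrow> 'k::chilbert \<Rightarrow>\<^sub>L 'k" and C :: real
  assumes rep: "L1_representation M \<Delta> \<pi>" and cb: "C \<in> cb_bounds M \<pi>"
begin

lemma C_nonneg: "0 \<le> C"
  using cb unfolding cb_bounds_def by simp

lemma pi_Bop: "w \<in> predual M \<Longrightarrow> \<pi> w \<in> Bop"
  and pi_add: "w \<in> predual M \<Longrightarrow> w' \<in> predual M \<Longrightarrow> \<pi> (\<lambda>x. w x + w' x) = \<pi> w + \<pi> w'"
  and pi_scale: "w \<in> predual M \<Longrightarrow> \<pi> (\<lambda>x. c * w x) = c *\<^sub>B \<pi> w"
  and pi_convolution: "w \<in> predual M \<Longrightarrow> w' \<in> predual M \<Longrightarrow> \<pi> (convolution M \<Delta> w w') = \<pi> w o\<^sub>L \<pi> w'"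
  using rep unfolding L1_representation_def by auto

lemma pi_zero: "\<pi> (\<lambda>x. 0) = 0"
  using pi_scale[OF predual_zero, of 0] by (simp add: blinfun_eq_iff)

lemma pi_sum: "(\<And>i. i \<in> I \<Longrightarrow> f i \<in> predual M) \<Longrightarrow> \<pi> (\<lambda>x. \<Sum>i\<in>I. f i x) = (\<Sum>i\<in>I. \<pi> (f i))"
  by (induction I rule: infinite_finite_induct) (auto simp: pi_zero pi_add predual_sum)

lemma cb_bound:
  assumes w: "\<And>i j. i < n \<Longrightarrow> j < n \<Longrightarrow> w i j \<in> predual M" and K: "predual_mat_norm M n w \<le> K"
  shows "L2_set (\<lambda>i. norm (\<Sum>j<n. \<pi> (w i j) (\<gamma> j))) {..<n} \<le> C * K * L2_set (\<lambda>j. norm (\<gamma> j)) {..<n}"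
proof -
  have "mat_norm {..<n} (\<lambda>i j. blinfun_apply (\<pi> (w i j))) \<le> C * predual_mat_norm M n w"
    using cb w unfolding cb_bounds_def by blast
  also have "\<dots> \<le> C * K" using K C_nonneg by (rule mult_left_mono)
  finally show ?thesis
    using mat_norm_blinfun[of "{..<n}" "\<lambda>i j. \<pi> (w i j)" \<gamma>]
      mult_right_mono[of "mat_norm {..<n} (\<lambda>i j. blinfun_apply (\<pi> (w i j)))" "C * K" "L2_set (\<lambda>j. norm (\<gamma> j)) {..<n}"]
    by simp
qed

text \<open>The matrix of functionals \<open>vf (\<eta> i) (\<zeta> j)\<close> evaluated at
  \<open>x\<close> is \<open>x\<close> between an analysis operator of norm at most \<open>A\<close>
  and a synthesis operator of norm at most \<open>B\<close>, so its norm over the predual is at most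
  \<open>A * B\<close>. An orthonormal system on one side and a single vector on the other give the
  column and row estimates.\<close>

lemma frame_bound:
  fixes n :: nat
  assumes AB: "0 \<le> A" "0 \<le> B"
    and A: "\<And>y. (\<Sum>i<n. (cmod (cinner (\<eta> i) y))\<^sup>2) \<le> A\<^sup>2 * (norm y)\<^sup>2"
    and B: "\<And>c. (norm (\<Sum>j<n. c j *\<^sub>C \<zeta> j))\<^sup>2 \<le> B\<^sup>2 * (\<Sum>j<n. (cmod (c j))\<^sup>2)"
  shows "L2_set (\<lambda>i. norm (\<Sum>j<n. \<pi> (vf (\<eta> i) (\<zeta> j)) (\<gamma> j))) {..<n} \<le> C * (A * B) * L2_set (\<lambda>j. norm (\<gamma> j)) {..<n}"
proof (rule cb_bound[where w = "\<lambda>i j. vf (\<eta> i) (\<zeta> j)"])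
  show "predual_mat_norm M n (\<lambda>i j. vf (\<eta> i) (\<zeta> j)) \<le> A * B"
  proof (rule predual_mat_norm_le)
    fix m :: nat and x and c :: "nat \<Rightarrow> nat \<Rightarrow> complex"
    assume xM: "\<And>k l. k < m \<Longrightarrow> l < m \<Longrightarrow> x k l \<in> M"
      and contr: "\<And>\<xi>. L2_set (\<lambda>k. norm (\<Sum>l<m. blinfun_apply (x k l) (\<xi> l))) {..<m} \<le> L2_set (\<lambda>l. norm (\<xi> l)) {..<m}"
    define z where "z l = (\<Sum>j<n. c j l *\<^sub>C \<zeta> j)" for l
    define y where "y k = (\<Sum>l<m. x k l (z l))" for k
    have eq: "(\<Sum>j<n. \<Sum>l<m. vf (\<eta> i) (\<zeta> j) (x k l) * c j l) = cinner (\<eta> i) (y k)" if "k < m" for i k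
    proof -
      have "cinner (\<eta> i) (y k) = (\<Sum>l<m. \<Sum>j<n. vf (\<eta> i) (\<zeta> j) (x k l) * c j l)"
        unfolding y_def z_def cinner_sum_right blinfun.sum_right
        by (intro sum.cong refl) (use that xM in \<open>simp add: Bop_apply M_Bop cinner_scaleC_right vf_def mult.commute\<close>)
      then show ?thesis by (subst sum.swap) simp
    qed
    have "(\<Sum>k<m. \<Sum>i<n. (cmod (\<Sum>j<n. \<Sum>l<m. vf (\<eta> i) (\<zeta> j) (x k l) * c j l))\<^sup>2)
        = (\<Sum>k<m. \<Sum>i<n. (cmod (cinner (\<eta> i) (y k)))\<^sup>2)"
      by (intro sum.cong refl) (simp add: eq)
    also have "\<dots> \<le> (\<Sum>k<m. A\<^sup>2 * (norm (y k))\<^sup>2)" by (intro sum_mono A)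
    also have "\<dots> \<le> A\<^sup>2 * (\<Sum>l<m. (norm (z l))\<^sup>2)"
      unfolding sum_distrib_left[symmetric] using L2_set_mono_iff[THEN iffD1, OF contr[of z]]
      by (intro mult_left_mono) (auto simp: y_def)
    also have "\<dots> \<le> A\<^sup>2 * (\<Sum>l<m. B\<^sup>2 * (\<Sum>j<n. (cmod (c j l))\<^sup>2))"
      unfolding z_def by (intro mult_left_mono sum_mono B) auto
    finally show "(\<Sum>k<m. \<Sum>i<n. (cmod (\<Sum>j<n. \<Sum>l<m. vf (\<eta> i) (\<zeta> j) (x k l) * c j l))\<^sup>2)
        \<le> (A * B)\<^sup>2 * (\<Sum>l<m. \<Sum>j<n. (cmod (c j l))\<^sup>2)"
      by (simp add: sum_distrib_left power_mult_distrib mult.assoc)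
  qed (use AB in auto)
qed (rule vf_predual)

text \<open>The case \<open>n = 1\<close> of complete boundedness. Even for one functional
  \<open>predual_mat_norm\<close> takes a supremum over matrices \<open>x\<close> of every size, so
  the estimate is matricial: contractivity of \<open>x\<close> is applied to the vectors
  \<open>c 0 l *\<^sub>C \<nu> n\<close> for each \<open>n\<close> separately, and the results are
  summed.\<close>

lemma norm_pi_tf:
  assumes \<mu>: "summable (\<lambda>n. (norm (\<mu> n))\<^sup>2)" and \<nu>: "summable (\<lambda>n. (norm (\<nu> n))\<^sup>2)"
  shows "norm (\<pi> (tf \<mu> \<nu>)) \<le> C * (sqrt (\<Sum>n. (norm (\<mu> n))\<^sup>2) * sqrt (\<Sum>n. (norm (\<nu> n))\<^sup>2))"
proof -
  define A B where "A = sqrt (\<Sum>n. (norm (\<mu> n))\<^sup>2)" and "B = sqrt (\<Sum>n. (norm (\<nu> n))\<^sup>2)"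
  have AB: "0 \<le> A" "0 \<le> B" unfolding A_def B_def using \<mu> \<nu> by (auto intro!: suminf_nonneg)
  have mat: "predual_mat_norm M 1 (\<lambda>_ _. tf \<mu> \<nu>) \<le> A * B"
  proof (rule predual_mat_norm_le)
    fix m :: nat and x and c :: "nat \<Rightarrow> nat \<Rightarrow> complex"
    assume xM: "\<And>k l. k < m \<Longrightarrow> l < m \<Longrightarrow> x k l \<in> M"
      and contr: "\<And>\<xi>. L2_set (\<lambda>k. norm (\<Sum>l<m. blinfun_apply (x k l) (\<xi> l))) {..<m} \<le> L2_set (\<lambda>l. norm (\<xi> l)) {..<m}"
    define c0 where "c0 = (\<Sum>l<m. (cmod (c 0 l))\<^sup>2)"
    define y where "y k n = (\<Sum>l<m. x k l (c 0 l *\<^sub>C \<nu> n))" for k n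
    have lim: "(\<lambda>N. \<Sum>n<N. cinner (\<mu> n) (y k n)) \<longlonglongrightarrow> (\<Sum>l<m. tf \<mu> \<nu> (x k l) * c 0 l)" if "k < m" for k
    proof -
      have "(\<lambda>n. \<Sum>l<m. cinner (\<mu> n) (x k l (\<nu> n)) * c 0 l) sums (\<Sum>l<m. tf \<mu> \<nu> (x k l) * c 0 l)"
      proof (intro sums_sum sums_mult2)
        fix l assume "l \<in> {..<m}"
        then show "(\<lambda>n. cinner (\<mu> n) (x k l (\<nu> n))) sums tf \<mu> \<nu> (x k l)"
          using trace_sum_sums[OF \<mu> \<nu>, of "x k l"] xM that by (simp add: tf_def)
      qed
      moreover have "(\<Sum>l<m. cinner (\<mu> n) (x k l (\<nu> n)) * c 0 l) = cinner (\<mu> n) (y k n)" for n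
        unfolding y_def cinner_sum_right
        by (intro sum.cong refl) (use that xM in \<open>simp add: Bop_apply M_Bop cinner_scaleC_right mult.commute\<close>)
      ultimately show ?thesis unfolding sums_def by simp
    qed
    have fin: "(\<Sum>k<m. (cmod (\<Sum>n<N. cinner (\<mu> n) (y k n)))\<^sup>2) \<le> (A * B)\<^sup>2 * c0" for N
    proof -
      have "(\<Sum>k<m. (cmod (\<Sum>n<N. cinner (\<mu> n) (y k n)))\<^sup>2) \<le> (\<Sum>k<m. A\<^sup>2 * (\<Sum>n<N. (norm (y k n))\<^sup>2))"
      proof (rule sum_mono)
        fix k
        have "cmod (\<Sum>n<N. cinner (\<mu> n) (y k n)) \<le> (\<Sum>n<N. \<bar>norm (\<mu> n)\<bar> * \<bar>norm (y k n)\<bar>)"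
          by (rule order_trans[OF norm_sum]) (simp add: sum_mono cmod_cinner_le)
        also have "\<dots> \<le> L2_set (\<lambda>n. norm (\<mu> n)) {..<N} * L2_set (\<lambda>n. norm (y k n)) {..<N}"
          by (rule L2_set_mult_ineq)
        also have "\<dots> \<le> A * L2_set (\<lambda>n. norm (y k n)) {..<N}"
          unfolding A_def L2_set_def
          by (intro mult_right_mono real_sqrt_le_mono sum_le_suminf \<mu>) (auto intro: sum_nonneg)
        finally have "(cmod (\<Sum>n<N. cinner (\<mu> n) (y k n)))\<^sup>2 \<le> (A * L2_set (\<lambda>n. norm (y k n)) {..<N})\<^sup>2"
          by (rule power_mono) simp
        then show "(cmod (\<Sum>n<N. cinner (\<mu> n) (y k n)))\<^sup>2 \<le> A\<^sup>2 * (\<Sum>n<N. (norm (y k n))\<^sup>2)"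
          unfolding L2_set_def by (simp add: power_mult_distrib sum_nonneg)
      qed
      also have "\<dots> = A\<^sup>2 * (\<Sum>n<N. \<Sum>k<m. (norm (y k n))\<^sup>2)"
        unfolding sum_distrib_left[symmetric] by (subst sum.swap) simp
      also have "\<dots> \<le> A\<^sup>2 * (\<Sum>n<N. (norm (\<nu> n))\<^sup>2 * c0)"
      proof (intro mult_left_mono sum_mono)
        fix n
        have "(\<Sum>k<m. (norm (y k n))\<^sup>2) \<le> (\<Sum>l<m. (norm (c 0 l *\<^sub>C \<nu> n))\<^sup>2)"
          unfolding y_def by (rule L2_set_mono_iff[THEN iffD1, OF contr[of "\<lambda>l. c 0 l *\<^sub>C \<nu> n"]])
        then show "(\<Sum>k<m. (norm (y k n))\<^sup>2) \<le> (norm (\<nu> n))\<^sup>2 * c0"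
          by (simp add: norm_scaleC power_mult_distrib c0_def sum_distrib_left mult.commute)
      qed auto
      also have "\<dots> \<le> A\<^sup>2 * (B\<^sup>2 * c0)"
        unfolding sum_distrib_right[symmetric] B_def c0_def
        by (intro mult_left_mono mult_right_mono sq_summable_finite_sums \<nu>) (auto intro: sum_nonneg)
      finally show ?thesis by (simp add: power_mult_distrib mult.assoc)
    qed
    have "(\<lambda>N. \<Sum>k<m. (cmod (\<Sum>n<N. cinner (\<mu> n) (y k n)))\<^sup>2) \<longlonglongrightarrow> (\<Sum>k<m. (cmod (\<Sum>l<m. tf \<mu> \<nu> (x k l) * c 0 l))\<^sup>2)"
      by (intro tendsto_intros lim) auto
    then have "(\<Sum>k<m. (cmod (\<Sum>l<m. tf \<mu> \<nu> (x k l) * c 0 l))\<^sup>2) \<le> (A * B)\<^sup>2 * c0"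
      by (rule LIMSEQ_le_const2) (use fin in auto)
    moreover have "{..<1::nat} = {0}" by auto
    ultimately show "(\<Sum>k<m. \<Sum>i<(1::nat). (cmod (\<Sum>j<1. \<Sum>l<m. tf \<mu> \<nu> (x k l) * c j l))\<^sup>2)
        \<le> (A * B)\<^sup>2 * (\<Sum>l<m. \<Sum>j<1. (cmod (c j l))\<^sup>2)"
      by (simp add: c0_def)
  qed (use AB in auto)
  show ?thesis
  proof (rule norm_blinfun_bound)
    fix \<gamma>
    show "norm (\<pi> (tf \<mu> \<nu>) \<gamma>) \<le> C * (sqrt (\<Sum>n. (norm (\<mu> n))\<^sup>2) * sqrt (\<Sum>n. (norm (\<nu> n))\<^sup>2)) * norm \<gamma>"
      using cb_bound[OF tf_predual[OF \<mu> \<nu>] mat, of "\<lambda>_. \<gamma>"] by (simp add: A_def B_def L2_set_def)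
  qed (use AB C_nonneg in \<open>auto simp: A_def[symmetric] B_def[symmetric]\<close>)
qed

lemma norm_pi_vf: "norm (\<pi> (vf u v)) \<le> C * (norm u * norm v)"
proof -
  have s: "(\<Sum>n. (norm (if n = 0 then u else (0 :: 'a)))\<^sup>2) = (norm u)\<^sup>2" for u
    using suminf_finite[of "{0 :: nat}" "\<lambda>n. (norm (if n = 0 then u else 0))\<^sup>2"] by simp
  show ?thesis using norm_pi_tf[OF summable_single summable_single, of u v] unfolding s vf_tf by simp
qed

text \<open>Tails of a trace functional are trace functionals, and by \<open>norm_pi_tf\<close>
  their images vanish in the limit.\<close>

lemma pi_tf_tendsto:
  assumes \<mu>: "summable (\<lambda>n. (norm (\<mu> n))\<^sup>2)" and \<nu>: "summable (\<lambda>n. (norm (\<nu> n))\<^sup>2)"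
  shows "(\<lambda>N. \<Sum>n<N. \<pi> (vf (\<mu> n) (\<nu> n))) \<longlonglongrightarrow> \<pi> (tf \<mu> \<nu>)"
proof -
  let ?t = "\<lambda>N. tf (\<lambda>n. \<mu> (n + N)) (\<lambda>n. \<nu> (n + N))"
  have sm: "summable (\<lambda>n. (norm (\<mu> (n + N)))\<^sup>2)" "summable (\<lambda>n. (norm (\<nu> (n + N)))\<^sup>2)" for N
    using \<mu> \<nu> by (auto intro: summable_ignore_initial_segment)
  have eq: "\<pi> (tf \<mu> \<nu>) = (\<Sum>n<N. \<pi> (vf (\<mu> n) (\<nu> n))) + \<pi> (?t N)" for N
    by (subst tf_split[OF \<mu> \<nu>, of N])
      (simp add: pi_add pi_sum predual_sum vf_predual tf_predual[OF sm])
  have "(\<lambda>N. \<pi> (?t N)) \<longlonglongrightarrow> 0"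
  proof (rule Lim_null_comparison)
    show "\<forall>\<^sub>F N in sequentially. norm (\<pi> (?t N))
        \<le> C * (sqrt (\<Sum>n. (norm (\<mu> (n + N)))\<^sup>2) * sqrt (\<Sum>n. (norm (\<nu> (n + N)))\<^sup>2))"
      by (intro always_eventually allI norm_pi_tf sm)
    have "(\<lambda>N. C * (sqrt (\<Sum>n. (norm (\<mu> (n + N)))\<^sup>2) * sqrt (\<Sum>n. (norm (\<nu> (n + N)))\<^sup>2))) \<longlonglongrightarrow> C * (sqrt 0 * sqrt 0)"
      by (intro tendsto_intros tail_tendsto_0 \<mu> \<nu>)
    then show "(\<lambda>N. C * (sqrt (\<Sum>n. (norm (\<mu> (n + N)))\<^sup>2) * sqrt (\<Sum>n. (norm (\<nu> (n + N)))\<^sup>2))) \<longlonglongrightarrow> 0"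
      by simp
  qed
  then have "(\<lambda>N. \<pi> (tf \<mu> \<nu>) - \<pi> (?t N)) \<longlonglongrightarrow> \<pi> (tf \<mu> \<nu>) - 0" by (intro tendsto_intros)
  moreover have "\<pi> (tf \<mu> \<nu>) - \<pi> (?t N) = (\<Sum>n<N. \<pi> (vf (\<mu> n) (\<nu> n)))" for N using eq[of N] by simp
  ultimately show ?thesis by simp
qed

end

section \<open>Rows and columns of the matrix coefficients\<close>

lemma sum_onb_le:
  fixes f :: "'i \<Rightarrow> 'c::chilbert"
  assumes "finite F" "\<And>E. finite E \<Longrightarrow> E \<subseteq> onb \<Longrightarrow> (\<Sum>e\<in>E. \<Sum>k\<in>F. (cmod (cinner e (f k)))\<^sup>2) \<le> B"
  shows "(\<Sum>k\<in>F. (norm (f k))\<^sup>2) \<le> B"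
proof -
  have "((\<lambda>e. (cmod (cinner e x))\<^sup>2) has_sum (norm x)\<^sup>2) onb" for x :: 'c
  proof -
    have "((\<lambda>e. cnj (cinner e x) * cinner e x) has_sum cinner x x) onb" by (rule parseval[OF is_onb_onb])
    from has_sum_Re[OF this] show ?thesis
      by (simp add: cinner_self complex_norm_square[symmetric] mult.commute del: of_real_power)
  qed
  note hs = this
  have "((\<lambda>e. \<Sum>k\<in>F. (cmod (cinner e (f k)))\<^sup>2) has_sum (\<Sum>k\<in>F. (norm (f k))\<^sup>2)) onb"
    by (rule has_sum_finite_sum[OF assms(1) hs])
  then show ?thesis by (rule has_sum_le_finite_sums) (use assms in auto)
qed

context cb_rep
begin

text \<open>In \<open>frame_bound\<close> the left system is orthonormal here, so
  \<open>A = 1\<close> by Bessel, and the right one is the single vector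
  \<open>\<zeta>\<close>.\<close>

lemma column_bound:
  assumes "finite E" "E \<subseteq> onb"
  shows "(\<Sum>e\<in>E. (norm (\<pi> (vf e \<zeta>) \<gamma>))\<^sup>2) \<le> (C * norm \<zeta> * norm \<gamma>)\<^sup>2"
proof (cases "E = {}")
  case False
  define n where "n = card E"
  obtain h where h: "bij_betw h {..<n} E"
    using ex_bij_betw_nat_finite[OF assms(1)] unfolding n_def atLeast0LessThan by blast
  have n: "0 < n" using False assms(1) by (simp add: n_def card_gt_0_iff)
  have on: "orthonormal (onb :: 'a set)" using is_onb_onb unfolding is_onb_def by blast
  \<comment> \<open>The complete bound speaks of square matrices, so the column is completed by
    zeros.\<close>
  define \<zeta>' \<gamma>' where "\<zeta>' j = (if j = 0 then \<zeta> else 0)" and "\<gamma>' j = (if j = 0 then \<gamma> else 0)" for j :: nat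
  have single: "(\<Sum>j<n. if j = 0 then t else 0) = t" for t :: "'b::comm_monoid_add"
    using n by (simp add: sum.delta)
  have "L2_set (\<lambda>i. norm (\<Sum>j<n. \<pi> (vf (h i) (\<zeta>' j)) (\<gamma>' j))) {..<n}
      \<le> C * (1 * norm \<zeta>) * L2_set (\<lambda>j. norm (\<gamma>' j)) {..<n}"
  proof (rule frame_bound)
    fix y
    have "(\<Sum>i<n. (cmod (cinner (h i) y))\<^sup>2) = (\<Sum>e\<in>E. (cmod (cinner e y))\<^sup>2)"
      by (rule sum.reindex_bij_betw[OF h])
    then show "(\<Sum>i<n. (cmod (cinner (h i) y))\<^sup>2) \<le> 1\<^sup>2 * (norm y)\<^sup>2"
      using bessel[OF on assms] by simp
  next
    fix c :: "nat \<Rightarrow> complex"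
    have "(\<Sum>j<n. c j *\<^sub>C \<zeta>' j) = (\<Sum>j<n. if j = 0 then c 0 *\<^sub>C \<zeta> else 0)"
      by (rule sum.cong) (auto simp: \<zeta>'_def)
    also have "\<dots> = c 0 *\<^sub>C \<zeta>" by (rule single)
    finally have "(norm (\<Sum>j<n. c j *\<^sub>C \<zeta>' j))\<^sup>2 = (norm \<zeta>)\<^sup>2 * (cmod (c 0))\<^sup>2"
      by (simp add: norm_scaleC power_mult_distrib mult.commute)
    also have "\<dots> \<le> (norm \<zeta>)\<^sup>2 * (\<Sum>j<n. (cmod (c j))\<^sup>2)"
      using n by (intro mult_left_mono member_le_sum) auto
    finally show "(norm (\<Sum>j<n. c j *\<^sub>C \<zeta>' j))\<^sup>2 \<le> (norm \<zeta>)\<^sup>2 * (\<Sum>j<n. (cmod (c j))\<^sup>2)" .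
  qed auto
  also have "L2_set (\<lambda>j. norm (\<gamma>' j)) {..<n} = norm \<gamma>"
  proof -
    have "(\<Sum>j<n. (norm (\<gamma>' j))\<^sup>2) = (\<Sum>j<n. if j = 0 then (norm \<gamma>)\<^sup>2 else 0)"
      by (rule sum.cong) (auto simp: \<gamma>'_def)
    then show ?thesis unfolding L2_set_def single by simp
  qed
  also have "(\<lambda>i. norm (\<Sum>j<n. \<pi> (vf (h i) (\<zeta>' j)) (\<gamma>' j))) = (\<lambda>i. norm (\<pi> (vf (h i) \<zeta>) \<gamma>))"
  proof
    fix i
    have "(\<Sum>j<n. \<pi> (vf (h i) (\<zeta>' j)) (\<gamma>' j)) = (\<Sum>j<n. if j = 0 then \<pi> (vf (h i) \<zeta>) \<gamma> else 0)"
      by (rule sum.cong) (auto simp: \<zeta>'_def \<gamma>'_def blinfun.zero_right)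
    then show "norm (\<Sum>j<n. \<pi> (vf (h i) (\<zeta>' j)) (\<gamma>' j)) = norm (\<pi> (vf (h i) \<zeta>) \<gamma>)"
      unfolding single by simp
  qed
  finally have le: "L2_set (\<lambda>i. norm (\<pi> (vf (h i) \<zeta>) \<gamma>)) {..<n} \<le> C * norm \<zeta> * norm \<gamma>" by simp
  have "(\<Sum>e\<in>E. (norm (\<pi> (vf e \<zeta>) \<gamma>))\<^sup>2) = (\<Sum>i<n. (norm (\<pi> (vf (h i) \<zeta>) \<gamma>))\<^sup>2)"
    by (rule sum.reindex_bij_betw[OF h, symmetric])
  also have "\<dots> = (L2_set (\<lambda>i. norm (\<pi> (vf (h i) \<zeta>) \<gamma>)) {..<n})\<^sup>2"
    unfolding L2_set_def by (simp add: sum_nonneg)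
  also have "\<dots> \<le> (C * norm \<zeta> * norm \<gamma>)\<^sup>2" using le by (rule power_mono) simp
  finally show ?thesis .
qed simp

text \<open>Now the right system is orthonormal. The row is applied to its own adjoint vectors
  \<open>\<gamma> j\<close>, whose square sum \<open>S\<^sup>2\<close> is thereby bounded by a
  constant times \<open>S\<close>; dividing by \<open>S\<close> gives the claim.\<close>

lemma row_bound:
  assumes "finite E" "E \<subseteq> onb"
  shows "(\<Sum>e\<in>E. (norm (adj (\<pi> (vf \<eta> e)) \<alpha>))\<^sup>2) \<le> (C * norm \<eta> * norm \<alpha>)\<^sup>2"
proof (cases "E = {}")
  case False
  define n where "n = card E"
  obtain h where h: "bij_betw h {..<n} E"
    using ex_bij_betw_nat_finite[OF assms(1)] unfolding n_def atLeast0LessThan by blast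
  have n: "0 < n" using False assms(1) by (simp add: n_def card_gt_0_iff)
  have on: "orthonormal (onb :: 'a set)" using is_onb_onb unfolding is_onb_def by blast
  define \<eta>' where "\<eta>' j = (if j = 0 then \<eta> else 0)" for j :: nat
  have single: "(\<Sum>j<n. if j = 0 then t else 0) = t" for t :: "'b::comm_monoid_add"
    using n by (simp add: sum.delta)
  define \<gamma> where "\<gamma> j = adj (\<pi> (vf \<eta> (h j))) \<alpha>" for j
  define S where "S = L2_set (\<lambda>j. norm (\<gamma> j)) {..<n}"
  have S: "0 \<le> S" "S\<^sup>2 = (\<Sum>j<n. (norm (\<gamma> j))\<^sup>2)" unfolding S_def L2_set_def by (simp_all add: sum_nonneg)
  have "L2_set (\<lambda>i. norm (\<Sum>j<n. \<pi> (vf (\<eta>' i) (h j)) (\<gamma> j))) {..<n} \<le> C * (norm \<eta> * 1) * S"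
    unfolding S_def
  proof (rule frame_bound)
    fix y
    have "(\<Sum>i<n. (cmod (cinner (\<eta>' i) y))\<^sup>2) = (\<Sum>i<n. if i = 0 then (cmod (cinner \<eta> y))\<^sup>2 else 0)"
      by (rule sum.cong) (auto simp: \<eta>'_def)
    also have "\<dots> = (cmod (cinner \<eta> y))\<^sup>2" by (rule single)
    also have "\<dots> \<le> (norm \<eta> * norm y)\<^sup>2" by (intro power_mono cmod_cinner_le) auto
    finally show "(\<Sum>i<n. (cmod (cinner (\<eta>' i) y))\<^sup>2) \<le> (norm \<eta>)\<^sup>2 * (norm y)\<^sup>2" by (simp add: power_mult_distrib)
  next
    fix c :: "nat \<Rightarrow> complex"
    have o: "cinner (h i) (h j) = (if i = j then 1 else 0)" if "i < n" "j < n" for i j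
      using on h that assms(2) unfolding orthonormal_def bij_betw_def inj_on_def by (metis imageI lessThan_iff subsetD)
    have "cinner (\<Sum>j<n. c j *\<^sub>C h j) (\<Sum>j<n. c j *\<^sub>C h j) = (\<Sum>i<n. \<Sum>j<n. cnj (c i) * (c j * cinner (h i) (h j)))"
      by (simp add: cinner_sum_left cinner_sum_right cinner_scaleC_left cinner_scaleC_right sum_distrib_left)
        (subst sum.swap, simp add: mult.left_commute)
    also have "\<dots> = (\<Sum>i<n. \<Sum>j<n. if j = i then cnj (c i) * c i else 0)"
      by (intro sum.cong refl) (auto simp: o)
    also have "\<dots> = of_real (\<Sum>i<n. (cmod (c i))\<^sup>2)"
      by (simp add: sum.delta complex_norm_square mult.commute del: of_real_power)
    finally have "(norm (\<Sum>j<n. c j *\<^sub>C h j))\<^sup>2 = (\<Sum>i<n. (cmod (c i))\<^sup>2)"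
      unfolding cinner_self of_real_eq_iff .
    then show "(norm (\<Sum>j<n. c j *\<^sub>C h j))\<^sup>2 \<le> 1\<^sup>2 * (\<Sum>j<n. (cmod (c j))\<^sup>2)" by simp
  qed auto
  moreover have "norm (\<Sum>j<n. \<pi> (vf \<eta> (h j)) (\<gamma> j)) \<le> L2_set (\<lambda>i. norm (\<Sum>j<n. \<pi> (vf (\<eta>' i) (h j)) (\<gamma> j))) {..<n}"
    using member_le_L2_set[of "{..<n}" 0 "\<lambda>i. norm (\<Sum>j<n. \<pi> (vf (\<eta>' i) (h j)) (\<gamma> j))"] n by (simp add: \<eta>'_def)
  ultimately have 1: "norm (\<Sum>j<n. \<pi> (vf \<eta> (h j)) (\<gamma> j)) \<le> C * norm \<eta> * S" by simp
  have "of_real (S\<^sup>2) = (\<Sum>j<n. cinner (\<gamma> j) (\<gamma> j))" unfolding S(2) by (simp add: cinner_self)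
  also have "\<dots> = cinner \<alpha> (\<Sum>j<n. \<pi> (vf \<eta> (h j)) (\<gamma> j))"
    unfolding cinner_sum_right by (rule sum.cong) (simp_all add: \<gamma>_def cinner_adj_left pi_Bop vf_predual)
  finally have "S\<^sup>2 \<le> norm \<alpha> * norm (\<Sum>j<n. \<pi> (vf \<eta> (h j)) (\<gamma> j))"
    using cmod_cinner_le[of \<alpha> "\<Sum>j<n. \<pi> (vf \<eta> (h j)) (\<gamma> j)"] by (metis abs_of_nonneg norm_of_real zero_le_power2)
  also have "\<dots> \<le> norm \<alpha> * (C * norm \<eta> * S)" by (intro mult_left_mono 1) auto
  finally have "S * S \<le> (C * norm \<eta> * norm \<alpha>) * S" by (simp add: power2_eq_square mult_ac)
  then have "S \<le> C * norm \<eta> * norm \<alpha>"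
    using S(1) C_nonneg by (cases "S = 0") (auto simp: mult_le_cancel_right)
  then have "S\<^sup>2 \<le> (C * norm \<eta> * norm \<alpha>)\<^sup>2" using S(1) by (intro power_mono)
  moreover have "(\<Sum>e\<in>E. (norm (adj (\<pi> (vf \<eta> e)) \<alpha>))\<^sup>2) = S\<^sup>2"
    unfolding S(2) \<gamma>_def by (rule sum.reindex_bij_betw[OF h, symmetric])
  ultimately show ?thesis by simp
qed simp

definition V :: "'k \<Rightarrow> 'k \<Rightarrow> 'a \<Rightarrow>\<^sub>L 'a" where
  "V \<alpha> \<gamma> = (THE A. A \<in> Bop \<and> (\<forall>u v. cinner u (blinfun_apply A v) = cinner \<alpha> (\<pi> (vf u v) \<gamma>)))"

lemma
  shows V_Bop: "V \<alpha> \<gamma> \<in> Bop" and cinner_V: "cinner u (V \<alpha> \<gamma> v) = cinner \<alpha> (\<pi> (vf u v) \<gamma>)"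
proof -
  obtain A where A: "A \<in> Bop" "\<And>u v. cinner u (blinfun_apply A v) = cinner \<alpha> (\<pi> (vf u v) \<gamma>)"
    "norm A \<le> C * norm \<alpha> * norm \<gamma>"
  proof (rule bounded_form_op[of "\<lambda>u v. cinner \<alpha> (\<pi> (vf u v) \<gamma>)" "C * norm \<alpha> * norm \<gamma>"])
    fix u v
    have "cmod (cinner \<alpha> (\<pi> (vf u v) \<gamma>)) \<le> norm \<alpha> * (norm (\<pi> (vf u v)) * norm \<gamma>)"
      by (intro order_trans[OF cmod_cinner_le] mult_left_mono norm_blinfun) auto
    also have "\<dots> \<le> norm \<alpha> * ((C * (norm u * norm v)) * norm \<gamma>)"
      by (intro mult_left_mono mult_right_mono norm_pi_vf) auto
    finally show "cmod (cinner \<alpha> (\<pi> (vf u v) \<gamma>)) \<le> C * norm \<alpha> * norm \<gamma> * norm u * norm v" by (simp add: mult_ac)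
  qed (use C_nonneg in \<open>auto simp: vf_linear pi_add pi_scale vf_predual blinfun.add_left cinner_add_right cinner_scaleC_right\<close>)
  have "V \<alpha> \<gamma> = A" unfolding V_def
    by (rule the_equality) (auto simp: A(1,2) intro!: cinner_ext_op)
  with A show "V \<alpha> \<gamma> \<in> Bop" "cinner u (V \<alpha> \<gamma> v) = cinner \<alpha> (\<pi> (vf u v) \<gamma>)" by auto
qed

text \<open>For \<open>y\<close> in the commutant the functionals \<open>vf u (y v)\<close> and
  \<open>vf (adj y u) v\<close> agree on \<open>M\<close>, so the matrix elements of the two
  compositions with \<open>y\<close> coincide.\<close>

lemma V_M: "V \<alpha> \<gamma> \<in> M"
proof (rule M_I[OF V_Bop], rule cinner_ext_op)
  fix y u v assume y: "y \<in> commutant M"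
  then have yB: "y \<in> Bop" using commutant_props(1) by auto
  have "vf u (y v) = vf (adj y u) v"
    unfolding vf_def using yB y by (auto simp: fun_eq_iff cinner_adj_left commutant_M)
  then show "cinner u ((V \<alpha> \<gamma> o\<^sub>L y) v) = cinner u ((y o\<^sub>L V \<alpha> \<gamma>) v)"
    using yB by (simp add: cinner_V cinner_adj_left[symmetric])
qed

lemma V_linear: "V \<alpha> (\<gamma> + \<gamma>') = V \<alpha> \<gamma> + V \<alpha> \<gamma>'" "V \<alpha> (\<gamma> - \<gamma>') = V \<alpha> \<gamma> - V \<alpha> \<gamma>'"
  "V (\<alpha> + \<alpha>') \<gamma> = V \<alpha> \<gamma> + V \<alpha>' \<gamma>" "V (c *\<^sub>C \<alpha>) \<gamma> = cnj c *\<^sub>B V \<alpha> \<gamma>" "V \<alpha> (c *\<^sub>C \<gamma>) = c *\<^sub>B V \<alpha> \<gamma>"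
  "V \<alpha> 0 = 0"
  by (rule cinner_ext_op; simp add: cinner_V blinfun.add_left blinfun.add_right blinfun.diff_left
      blinfun.diff_right cinner_add_left cinner_add_right cinner_diff_right cinner_scaleC_left
      cinner_scaleC_right blinfun.zero_right Bop_apply pi_Bop vf_predual)+

text \<open>\<open>V\<close> is defined by vector functionals only; norm convergence of the images
  extends its defining property to trace functionals.\<close>

lemma V_tf_tendsto:
  assumes \<mu>: "summable (\<lambda>n. (norm (\<mu> n))\<^sup>2)" and \<nu>: "summable (\<lambda>n. (norm (\<nu> n))\<^sup>2)"
  shows "cinner \<alpha> (\<pi> (tf \<mu> \<nu>) \<gamma>) = (\<Sum>n. cinner (\<mu> n) (V \<alpha> \<gamma> (\<nu> n)))"
proof -
  have "(\<lambda>N. cinner \<alpha> ((\<Sum>n<N. \<pi> (vf (\<mu> n) (\<nu> n))) \<gamma>)) \<longlonglongrightarrow> cinner \<alpha> (\<pi> (tf \<mu> \<nu>) \<gamma>)"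
    by (intro tendsto_intros blinfun.tendsto pi_tf_tendsto \<mu> \<nu>)
  moreover have "cinner \<alpha> ((\<Sum>n<N. \<pi> (vf (\<mu> n) (\<nu> n))) \<gamma>) = (\<Sum>n<N. cinner (\<mu> n) (V \<alpha> \<gamma> (\<nu> n)))" for N
    by (simp add: blinfun.sum_left cinner_sum_right cinner_V)
  ultimately have "(\<lambda>n. cinner (\<mu> n) (V \<alpha> \<gamma> (\<nu> n))) sums cinner \<alpha> (\<pi> (tf \<mu> \<nu>) \<gamma>)"
    unfolding sums_def by simp
  then show ?thesis by (rule sums_unique)
qed

text \<open>Expanding in a basis of the space of \<open>M\<close> exchanges the indices: up to
  conjugation \<open>cinner e (adj (V \<alpha> k) \<xi>)\<close> is the coordinate at
  \<open>k\<close> of \<open>adj (\<pi> (vf \<xi> e)) \<alpha>\<close>. Bessel disposes of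
  \<open>k\<close> and \<open>row_bound\<close> of \<open>e\<close>.\<close>

lemma V_row:
  assumes "finite F" "F \<subseteq> onb"
  shows "(\<Sum>k\<in>F. (norm (adj (V \<alpha> k) \<xi>))\<^sup>2) \<le> (C * norm \<alpha> * norm \<xi>)\<^sup>2"
proof (rule sum_onb_le[OF assms(1)])
  fix E :: "'a set" assume E: "finite E" "E \<subseteq> onb"
  have on: "orthonormal (onb :: 'k set)" using is_onb_onb unfolding is_onb_def by blast
  have "cmod (cinner e (adj (V \<alpha> k) \<xi>)) = cmod (cinner k (adj (\<pi> (vf \<xi> e)) \<alpha>))" for e k
  proof -
    have "cinner e (adj (V \<alpha> k) \<xi>) = cnj (cinner \<alpha> (\<pi> (vf \<xi> e) k))"
      by (simp add: cinner_adj_right V_Bop flip: cinner_V cinner_commute)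
    then show ?thesis by (simp add: cinner_adj_right pi_Bop vf_predual cinner_commute[of \<alpha>])
  qed
  then have "(\<Sum>e\<in>E. \<Sum>k\<in>F. (cmod (cinner e (adj (V \<alpha> k) \<xi>)))\<^sup>2)
      \<le> (\<Sum>e\<in>E. (norm (adj (\<pi> (vf \<xi> e)) \<alpha>))\<^sup>2)"
    using bessel[OF on assms] by (intro sum_mono) simp
  also have "\<dots> \<le> (C * norm \<xi> * norm \<alpha>)\<^sup>2" by (rule row_bound[OF E])
  finally show "(\<Sum>e\<in>E. \<Sum>k\<in>F. (cmod (cinner e (adj (V \<alpha> k) \<xi>)))\<^sup>2) \<le> (C * norm \<alpha> * norm \<xi>)\<^sup>2"
    by (simp add: mult_ac)
qed

lemma V_column:
  assumes "finite F" "F \<subseteq> onb"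
  shows "(\<Sum>k\<in>F. (norm (V k \<gamma> \<xi>))\<^sup>2) \<le> (C * norm \<gamma> * norm \<xi>)\<^sup>2"
proof (rule sum_onb_le[OF assms(1)])
  fix E :: "'a set" assume E: "finite E" "E \<subseteq> onb"
  have on: "orthonormal (onb :: 'k set)" using is_onb_onb unfolding is_onb_def by blast
  have "(\<Sum>e\<in>E. \<Sum>k\<in>F. (cmod (cinner e (V k \<gamma> \<xi>)))\<^sup>2) \<le> (\<Sum>e\<in>E. (norm (\<pi> (vf e \<xi>) \<gamma>))\<^sup>2)"
    using bessel[OF on assms] by (intro sum_mono) (simp add: cinner_V)
  also have "\<dots> \<le> (C * norm \<xi> * norm \<gamma>)\<^sup>2" by (rule column_bound[OF E])
  finally show "(\<Sum>e\<in>E. \<Sum>k\<in>F. (cmod (cinner e (V k \<gamma> \<xi>)))\<^sup>2) \<le> (C * norm \<gamma> * norm \<xi>)\<^sup>2"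
    by (simp add: mult_ac)
qed

end

section \<open>Tracial weights\<close>

lemma dense_eq:
  fixes f g :: "'a::topological_space \<Rightarrow> 'b::t2_space"
  assumes "closure D = UNIV" "continuous_on UNIV f" "continuous_on UNIV g" "\<And>x. x \<in> D \<Longrightarrow> f x = g x"
  shows "f x = g x"
proof -
  have "closed {x. f x = g x}" by (rule closed_Collect_eq[OF assms(2,3)])
  then have "closure D \<subseteq> {x. f x = g x}" by (intro closure_minimal) (use assms(4) in auto)
  then show ?thesis using assms(1) by blast
qed

lemma dense_eq_htens:
  assumes D: "closure D = UNIV" "closure E = UNIV"
    and f: "bounded_linear f" "bounded_linear g" and eq: "\<And>a b. a \<in> D \<Longrightarrow> b \<in> E \<Longrightarrow> f (a \<otimes>\<^sub>h b) = g (a \<otimes>\<^sub>h b)"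
  shows "f = g"
proof (rule bounded_linear_eq_htens[OF f])
  fix a b
  have c: "continuous_on UNIV (\<lambda>a. f (a \<otimes>\<^sub>h b))" "continuous_on UNIV (\<lambda>a. g (a \<otimes>\<^sub>h b))"
    "continuous_on UNIV (\<lambda>b. f (a \<otimes>\<^sub>h b))" "continuous_on UNIV (\<lambda>b. g (a \<otimes>\<^sub>h b))" for a b
    by (intro bounded_linear.continuous_on[OF f(1)] bounded_linear.continuous_on[OF f(2)]
        continuous_on_htens continuous_on_id continuous_on_const)+
  have "f (a \<otimes>\<^sub>h b) = g (a \<otimes>\<^sub>h b)" if "b \<in> E" for a b
    by (rule dense_eq[OF D(1) c(1,2)]) (use eq that in blast)
  then show "f (a \<otimes>\<^sub>h b) = g (a \<otimes>\<^sub>h b)" by (rule dense_eq[OF D(2) c(3,4)])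
qed

locale tracial_gns = vna M for M :: "('a::chilbert \<Rightarrow>\<^sub>L 'a) set" +
  fixes \<phi> :: "('a \<Rightarrow>\<^sub>L 'a) \<Rightarrow> ennreal" and \<Lambda> :: "('a \<Rightarrow>\<^sub>L 'a) \<Rightarrow> 'a"
  assumes weight: "weight M \<phi>" and semifinite: "semifinite_weight M \<phi>"
    and tracial: "tracial M \<phi>" and gns: "gns_map M \<phi> \<Lambda>"
begin

abbreviation "\<nn> \<equiv> n_weight M \<phi>"

lemma n_M: "x \<in> \<nn> \<Longrightarrow> x \<in> M"
  unfolding n_weight_def by simp

lemma weight_mono:
  assumes "x \<in> pos M" "y \<in> pos M" "\<And>u. Re (cinner u (x u)) \<le> Re (cinner u (y u))"
  shows "\<phi> x \<le> \<phi> y"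
proof -
  have "y - x \<in> pos M"
    using assms unfolding pos_def
    by (auto simp: M_diff blinfun.diff_left cinner_diff_right complex_nonneg_Reals_iff)
  then have "\<phi> (x + (y - x)) = \<phi> x + \<phi> (y - x)" using weight assms(1) unfolding weight_def by blast
  then show ?thesis by simp
qed

lemma cinner_adj_compose: "x \<in> M \<Longrightarrow> cinner u ((adj x o\<^sub>L x) v) = cinner (x u) (x v)"
  by (simp add: cinner_adj_right M_Bop)

lemma n_adj: "x \<in> \<nn> \<Longrightarrow> adj x \<in> \<nn>"
  using tracial unfolding n_weight_def tracial_def by (auto simp: M_adj adj_adj M_Bop)

lemma pos_scaleR: "x \<in> pos M \<Longrightarrow> 0 \<le> r \<Longrightarrow> r *\<^sub>R x \<in> pos M"
  unfolding pos_def by (auto simp: M_scaleR blinfun.scaleR_left cinner_scaleR_right complex_nonneg_Reals_iff)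

lemma pos_add: "x \<in> pos M \<Longrightarrow> y \<in> pos M \<Longrightarrow> x + y \<in> pos M"
  unfolding pos_def by (auto simp: M_add blinfun.add_left cinner_add_right complex_nonneg_Reals_iff)

lemma n_mult_left:
  assumes a: "a \<in> M" and x: "x \<in> \<nn>"
  shows "a o\<^sub>L x \<in> \<nn>"
proof -
  let ?y = "(norm a)\<^sup>2 *\<^sub>R (adj x o\<^sub>L x)"
  have ax: "a o\<^sub>L x \<in> M" by (rule M_compose[OF a n_M[OF x]])
  have p: "adj x o\<^sub>L x \<in> pos M" by (intro pos_adj_compose n_M x)
  have "\<phi> (adj (a o\<^sub>L x) o\<^sub>L (a o\<^sub>L x)) \<le> \<phi> ?y"
  proof (rule weight_mono)
    fix u
    have "(norm (a (x u)))\<^sup>2 \<le> (norm a * norm (x u))\<^sup>2" by (intro power_mono norm_blinfun) auto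
    then show "Re (cinner u ((adj (a o\<^sub>L x) o\<^sub>L (a o\<^sub>L x)) u)) \<le> Re (cinner u (?y u))"
      unfolding blinfun.scaleR_left cinner_scaleR_right cinner_adj_compose[OF ax] cinner_adj_compose[OF n_M[OF x]]
      by (simp add: cinner_self power_mult_distrib del: of_real_power)
  qed (auto intro!: pos_adj_compose pos_scaleR ax p)
  also have "\<phi> ?y = ennreal ((norm a)\<^sup>2) * \<phi> (adj x o\<^sub>L x)"
    using weight p unfolding weight_def by simp
  also have "\<dots> < \<infinity>" using x unfolding n_weight_def by (simp add: ennreal_mult_less_top)
  finally show ?thesis using ax unfolding n_weight_def by simp
qed

text \<open>The left ideal of a weight is stable under adjoints when the weight is a trace, hence
  two-sided.\<close>

lemma n_mult_right:
  assumes "x \<in> \<nn>" "b \<in> M"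
  shows "x o\<^sub>L b \<in> \<nn>"
proof -
  have "adj (adj b o\<^sub>L adj x) \<in> \<nn>" by (intro n_adj n_mult_left M_adj assms)
  then show ?thesis using assms by (simp add: adj_compose adj_adj M_Bop n_M)
qed

lemma n_add:
  assumes "x \<in> \<nn>" "y \<in> \<nn>"
  shows "x + y \<in> \<nn>"
proof -
  let ?z = "2 *\<^sub>R (adj x o\<^sub>L x) + 2 *\<^sub>R (adj y o\<^sub>L y)"
  have xy: "x \<in> M" "y \<in> M" "x + y \<in> M" using assms n_M M_add by auto
  have p: "adj x o\<^sub>L x \<in> pos M" "adj y o\<^sub>L y \<in> pos M" by (intro pos_adj_compose xy)+
  have "\<phi> (adj (x + y) o\<^sub>L (x + y)) \<le> \<phi> ?z"
  proof (rule weight_mono)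
    fix u
    have "(norm (x u + y u))\<^sup>2 \<le> 2 * (norm (x u))\<^sup>2 + 2 * (norm (y u))\<^sup>2"
      using zero_le_power2[of "norm (x u - y u)"] unfolding norm_add_sq norm_diff_sq by linarith
    then show "Re (cinner u ((adj (x + y) o\<^sub>L (x + y)) u)) \<le> Re (cinner u (?z u))"
      unfolding blinfun.add_left[of "2 *\<^sub>R _"] blinfun.scaleR_left cinner_add_right cinner_scaleR_right cinner_adj_compose[OF xy(1)]
        cinner_adj_compose[OF xy(2)] cinner_adj_compose[OF xy(3)]
      by (simp add: cinner_self blinfun.add_left del: of_real_power)
  qed (auto intro!: pos_adj_compose pos_scaleR pos_add xy p)
  also have "\<phi> ?z = ennreal 2 * \<phi> (adj x o\<^sub>L x) + ennreal 2 * \<phi> (adj y o\<^sub>L y)"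
    using weight p pos_scaleR[OF p(1), of 2] pos_scaleR[OF p(2), of 2] unfolding weight_def by simp
  also have "\<dots> < \<infinity>" using assms unfolding n_weight_def by (simp add: ennreal_mult_less_top)
  finally show ?thesis using xy unfolding n_weight_def by simp
qed

lemma n_scaleC: "x \<in> \<nn> \<Longrightarrow> c *\<^sub>B x \<in> \<nn>"
  using n_mult_left[OF M_scaleC[OF M_id], of x c]
  by (metis (no_types, lifting) blinfun_apply_blinfun_compose blinfun_eqI id_blinfun.rep_eq scaleC_op_apply)

lemma GNS_add: "x \<in> \<nn> \<Longrightarrow> y \<in> \<nn> \<Longrightarrow> \<Lambda> (x + y) = \<Lambda> x + \<Lambda> y"
  and GNS_scale: "x \<in> \<nn> \<Longrightarrow> \<Lambda> (c *\<^sub>B x) = c *\<^sub>C \<Lambda> x"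
  and GNS_mult: "a \<in> M \<Longrightarrow> x \<in> \<nn> \<Longrightarrow> \<Lambda> (a o\<^sub>L x) = a (\<Lambda> x)"
  and GNS_dense: "closure (\<Lambda> ` \<nn>) = UNIV"
  using gns unfolding gns_map_def clinear_on_def by auto

lemma norm_GNS_adj:
  assumes "x \<in> \<nn>"
  shows "norm (\<Lambda> (adj x)) = norm (\<Lambda> x)"
proof -
  have "ennreal ((norm (\<Lambda> (adj x)))\<^sup>2) = \<phi> (x o\<^sub>L adj x)"
    using gns n_adj[OF assms] unfolding gns_map_def by (simp add: adj_adj M_Bop n_M[OF assms])
  also have "\<dots> = \<phi> (adj x o\<^sub>L x)" using tracial n_M[OF assms] unfolding tracial_def by simp
  also have "\<dots> = ennreal ((norm (\<Lambda> x))\<^sup>2)" using gns assms unfolding gns_map_def by simp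
  finally show ?thesis by (simp add: power2_eq_iff_nonneg)
qed

text \<open>Polarisation of \<open>norm_GNS_adj\<close>: real parts come from sums, imaginary parts
  from inserting \<open>\<i>\<close>. In effect the involution is antiunitary on the GNS
  space.\<close>

lemma cinner_GNS_adj:
  assumes x: "x \<in> \<nn>" and y: "y \<in> \<nn>"
  shows "cinner (\<Lambda> x) (\<Lambda> y) = cinner (\<Lambda> (adj y)) (\<Lambda> (adj x))"
proof -
  have re: "Re (cinner (\<Lambda> x) (\<Lambda> z)) = Re (cinner (\<Lambda> (adj x)) (\<Lambda> (adj z)))" if z: "z \<in> \<nn>" for z
  proof -
    have "(norm (\<Lambda> x + \<Lambda> z))\<^sup>2 = (norm (\<Lambda> (adj x) + \<Lambda> (adj z)))\<^sup>2"
      using norm_GNS_adj[OF n_add[OF x z]] x z by (simp add: adj_add M_Bop n_M GNS_add n_adj)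
    then show ?thesis unfolding norm_add_sq using norm_GNS_adj[OF x] norm_GNS_adj[OF z] by simp
  qed
  have im: "Im (cinner (\<Lambda> x) (\<Lambda> y)) = - Im (cinner (\<Lambda> (adj x)) (\<Lambda> (adj y)))"
    using re[OF n_scaleC[OF y, of \<i>]] y
    by (simp add: GNS_scale adj_scaleC M_Bop n_M n_adj cinner_scaleC_right)
  show ?thesis
    using re[OF y] im cinner_commute[of "\<Lambda> (adj y)" "\<Lambda> (adj x)"] by (simp add: complex_eq_iff)
qed

lemma cinner_GNS_right:
  assumes x: "x \<in> \<nn>" and y: "y \<in> \<nn>" and b: "b \<in> M"
  shows "cinner (\<Lambda> x) (\<Lambda> (y o\<^sub>L b)) = cinner (\<Lambda> (x o\<^sub>L adj b)) (\<Lambda> y)"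
proof -
  have B: "x \<in> Bop" "y \<in> Bop" "b \<in> Bop" using assms by (auto intro: M_Bop n_M)
  have "cinner (\<Lambda> x) (\<Lambda> (y o\<^sub>L b)) = cinner (\<Lambda> (adj b o\<^sub>L adj y)) (\<Lambda> (adj x))"
    using cinner_GNS_adj[OF x n_mult_right[OF y b]] B by (simp add: adj_compose)
  also have "\<dots> = cinner (\<Lambda> (adj y)) (\<Lambda> (b o\<^sub>L adj x))"
    using assms B by (simp add: GNS_mult n_adj M_adj cinner_adj_left)
  also have "\<dots> = cinner (\<Lambda> (adj (b o\<^sub>L adj x))) (\<Lambda> y)"
    using cinner_GNS_adj[OF n_adj[OF y] n_mult_left[OF b n_adj[OF x]]] B by (simp add: adj_adj)
  finally show ?thesis using B by (simp add: adj_compose adj_adj)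
qed

text \<open>As \<open>x\<close> is central, left multiplication of its GNS vector by
  \<open>b\<close> is also right multiplication by \<open>b\<close>, and right multiplications move
  across the inner product by \<open>cinner_GNS_right\<close>.\<close>

lemma central_vector_trace:
  assumes x: "x \<in> \<nn>" "x \<in> center M" and a: "a \<in> M" and b: "b \<in> M"
  shows "cinner (\<Lambda> x) (a (b (\<Lambda> x))) = cinner (\<Lambda> x) (b (a (\<Lambda> x)))"
proof -
  have com: "c o\<^sub>L x = x o\<^sub>L c" if "c \<in> M" for c
    using x(2) that unfolding center_def commutant_def by auto
  have "a (b (\<Lambda> x)) = \<Lambda> ((a o\<^sub>L x) o\<^sub>L b)"
    using GNS_mult[OF M_compose[OF a b] x(1)] com[OF b] by (simp add: blinfun_compose_assoc)
  then have "cinner (\<Lambda> x) (a (b (\<Lambda> x))) = cinner (\<Lambda> (x o\<^sub>L adj b)) (\<Lambda> (a o\<^sub>L x))"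
    using cinner_GNS_right[OF x(1) n_mult_left[OF a x(1)] b] by simp
  also have "\<dots> = cinner (adj b (\<Lambda> x)) (a (\<Lambda> x))"
    using com[OF M_adj[OF b]] x a b by (simp add: GNS_mult M_adj flip: GNS_mult)
  finally show ?thesis using b by (simp add: cinner_adj_left M_Bop)
qed

text \<open>Right multiplication is bounded because the isometric involution turns it into left
  multiplication by \<open>adj b\<close>. It supplies the elements of the commutant against which
  the coproduct is tested in \<open>coproduct_adj_W\<close>.\<close>

lemma right_mult_exists:
  assumes b: "b \<in> M"
  obtains R where "R \<in> commutant M" "\<And>x. x \<in> \<nn> \<Longrightarrow> blinfun_apply R (\<Lambda> x) = \<Lambda> (x o\<^sub>L b)"
proof -
  let ?G = "(\<lambda>x. (\<Lambda> x, \<Lambda> (x o\<^sub>L b))) ` \<nn>"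
  have add: "(x + y) o\<^sub>L b = (x o\<^sub>L b) + (y o\<^sub>L b)" and sc: "(c *\<^sub>B x) o\<^sub>L b = c *\<^sub>B (x o\<^sub>L b)" for x y c
    by (rule blinfun_eqI, simp add: blinfun.add_left)+
  obtain R where R: "R \<in> Bop" "\<And>u v. (u, v) \<in> ?G \<Longrightarrow> blinfun_apply R u = v" "norm R \<le> norm b"
  proof (rule graph_op[of ?G "norm b"])
    obtain x where "x \<in> \<nn>" using GNS_dense by fastforce
    have z: "0 *\<^sub>B x = 0" by (rule blinfun_eqI) simp
    have "0 \<in> \<nn>" "\<Lambda> 0 = 0" using n_scaleC[OF \<open>x \<in> \<nn>\<close>, of 0] GNS_scale[OF \<open>x \<in> \<nn>\<close>, of 0] unfolding z by auto
    then show "(0, 0) \<in> ?G" by (auto simp: image_iff intro!: bexI[of _ 0])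
    show "(u + v, p + q) \<in> ?G" if "(u, p) \<in> ?G" "(v, q) \<in> ?G" for u v p q
    proof -
      obtain x y where xy: "x \<in> \<nn>" "y \<in> \<nn>" "u = \<Lambda> x" "p = \<Lambda> (x o\<^sub>L b)" "v = \<Lambda> y" "q = \<Lambda> (y o\<^sub>L b)"
        using \<open>(u, p) \<in> ?G\<close> \<open>(v, q) \<in> ?G\<close> by auto
      then have "(u + v, p + q) = (\<Lambda> (x + y), \<Lambda> ((x + y) o\<^sub>L b))"
        using b by (simp add: GNS_add n_mult_right add)
      then show ?thesis using n_add xy by blast
    qed
    show "(t *\<^sub>C u, t *\<^sub>C p) \<in> ?G" if "(u, p) \<in> ?G" for t u p
    proof -
      obtain x where x: "x \<in> \<nn>" "u = \<Lambda> x" "p = \<Lambda> (x o\<^sub>L b)" using \<open>(u, p) \<in> ?G\<close> by auto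
      then have "(t *\<^sub>C u, t *\<^sub>C p) = (\<Lambda> (t *\<^sub>B x), \<Lambda> ((t *\<^sub>B x) o\<^sub>L b))"
        using b by (simp add: GNS_scale n_mult_right sc)
      then show ?thesis using n_scaleC x by blast
    qed
    show "norm p \<le> norm b * norm u" if "(u, p) \<in> ?G" for u p
    proof -
      obtain x where x: "x \<in> \<nn>" "u = \<Lambda> x" "p = \<Lambda> (x o\<^sub>L b)" using \<open>(u, p) \<in> ?G\<close> by auto
      have "norm p = norm (\<Lambda> (adj b o\<^sub>L adj x))"
        using norm_GNS_adj[OF n_mult_right[OF x(1) b]] x b by (simp add: adj_compose M_Bop n_M)
      also have "\<dots> \<le> norm (adj b) * norm (\<Lambda> (adj x))"
        using x b by (simp add: GNS_mult n_adj M_adj norm_blinfun)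
      finally show ?thesis using x b by (simp add: norm_GNS_adj norm_adj M_Bop)
    qed
  qed (use GNS_dense in \<open>auto simp: image_image\<close>)
  have ap: "R (\<Lambda> x) = \<Lambda> (x o\<^sub>L b)" if "x \<in> \<nn>" for x using R(2) that by auto
  have "R (a u) = a (R u)" if a: "a \<in> M" for a u
  proof (rule dense_eq[OF GNS_dense, where f = "\<lambda>u. R (a u)" and g = "\<lambda>u. a (R u)"])
    fix u assume "u \<in> \<Lambda> ` \<nn>"
    then obtain x where x: "x \<in> \<nn>" "u = \<Lambda> x" by blast
    then show "R (a u) = a (R u)"
      using a b by (simp add: ap n_mult_left n_mult_right blinfun_compose_assoc flip: GNS_mult)
  qed (intro continuous_intros)+
  then have "R \<in> commutant M" unfolding commutant_def using R(1) by (auto simp: blinfun_eq_iff)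
  then show thesis using ap that by blast
qed

lemma GNS_total:
  assumes "\<And>x c. x \<in> \<nn> \<Longrightarrow> c \<in> \<nn> \<Longrightarrow> cinner u (x (\<Lambda> c)) = 0"
  shows "u = 0"
proof -
  have "cinner u (\<Lambda> c) = 0" if c: "c \<in> \<nn>" for c
  proof -
    have cont: "continuous_map sigma_weak euclidean (\<lambda>x. cinner u (blinfun_apply x (\<Lambda> c)))"
      by (rule continuous_map_vector)
    have "closedin sigma_weak {x \<in> topspace sigma_weak. cinner u (blinfun_apply x (\<Lambda> c)) \<in> {0}}"
      by (rule closedin_continuous_map_preimage[OF cont]) simp
    moreover have "\<nn> \<subseteq> {x \<in> topspace sigma_weak. cinner u (blinfun_apply x (\<Lambda> c)) \<in> {0}}"
      using assms c by (auto simp: topspace_sigma_weak M_Bop n_M)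
    ultimately have "sigma_weak closure_of \<nn> \<subseteq> {x \<in> topspace sigma_weak. cinner u (blinfun_apply x (\<Lambda> c)) \<in> {0}}"
      by (rule closure_of_minimal[rotated])
    then have "id_blinfun \<in> {x \<in> topspace sigma_weak. cinner u (blinfun_apply x (\<Lambda> c)) \<in> {0}}"
      using semifinite M_id unfolding semifinite_weight_def by blast
    then show ?thesis by simp
  qed
  note 1 = this
  have "cinner u v = 0" for v
    by (rule dense_eq[OF GNS_dense, where f = "\<lambda>v. cinner u v" and g = "\<lambda>_. 0"])
      (use 1 in \<open>auto intro!: continuous_on_cinner continuous_on_const continuous_on_id\<close>)
  then show ?thesis by (metis cinner_self_eq_0)
qed

lemma GNS_tensor_total:
  assumes *: "\<And>x c y d. x \<in> \<nn> \<Longrightarrow> c \<in> \<nn> \<Longrightarrow> y \<in> \<nn> \<Longrightarrow> d \<in> \<nn> \<Longrightarrow> cinner \<xi> (x (\<Lambda> c) \<otimes>\<^sub>h y (\<Lambda> d)) = 0"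
  shows "\<xi> = 0"
proof (rule htens_total)
  fix a b
  have 1: "cinner \<xi> (a \<otimes>\<^sub>h y (\<Lambda> d)) = 0" if "y \<in> \<nn>" "d \<in> \<nn>" for a y d
  proof -
    have eq: "cinner (lcontr (y (\<Lambda> d)) (flip \<xi>)) a = cinner \<xi> (a \<otimes>\<^sub>h y (\<Lambda> d))" for a
    proof -
      have "cinner (lcontr (y (\<Lambda> d)) (flip \<xi>)) a = cinner (flip \<xi>) (flip (a \<otimes>\<^sub>h y (\<Lambda> d)))"
        by (simp add: cinner_lcontr_left flip_htens)
      then show ?thesis unfolding cinner_flip .
    qed
    have "lcontr (y (\<Lambda> d)) (flip \<xi>) = 0"
      by (rule GNS_total) (simp add: eq * that)
    then show ?thesis using eq[of a] by simp
  qed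
  have "lcontr a \<xi> = 0"
    by (rule GNS_total) (simp add: cinner_lcontr_left 1)
  then show "cinner (a \<otimes>\<^sub>h b) \<xi> = 0" using cinner_lcontr[of b a \<xi>] by simp
qed

text \<open>For a pair in the graph, \<open>\<xi>\<close> stands for the GNS vector of
  \<open>X\<close>, and right multiplication by \<open>a\<close> and \<open>b\<close> is moved to
  the other side. On elementary tensors this is \<open>cinner_GNS_right\<close> in each leg; both
  sides are continuous in the pair, so the identity survives the closure.\<close>

lemma gns_tensor_graph_cinner:
  assumes g: "(X, \<xi>) \<in> gns_tensor_graph M \<phi> \<Lambda>" and n: "a \<in> \<nn>" "b \<in> \<nn>" "c \<in> \<nn>" "d \<in> \<nn>"
  shows "X \<in> Bop" "cinner (\<Lambda> c \<otimes>\<^sub>h \<Lambda> d) (X (\<Lambda> a \<otimes>\<^sub>h \<Lambda> b)) = cinner (\<Lambda> (c o\<^sub>L adj a) \<otimes>\<^sub>h \<Lambda> (d o\<^sub>L adj b)) \<xi>"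
proof -
  let ?p = "\<Lambda> c \<otimes>\<^sub>h \<Lambda> d" and ?q = "\<Lambda> a \<otimes>\<^sub>h \<Lambda> b" and ?r = "\<Lambda> (c o\<^sub>L adj a) \<otimes>\<^sub>h \<Lambda> (d o\<^sub>L adj b)"
  let ?T = "prod_topology sigma_weak (euclidean :: ('a, 'a) htensor topology)"
  define f where "f z = cinner ?p (blinfun_apply (fst z) ?q) - cinner ?r (snd z)"
    for z :: "(('a, 'a) htensor \<Rightarrow>\<^sub>L ('a, 'a) htensor) \<times> ('a, 'a) htensor"
  let ?S = "{(x \<otimes>\<^sub>o y, \<Lambda> x \<otimes>\<^sub>h \<Lambda> y) | x y. x \<in> \<nn> \<and> y \<in> \<nn>}"
  have cont: "continuous_map ?T euclidean f"
    unfolding f_def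
    by (intro continuous_map_diff continuous_map_compose[OF continuous_map_fst continuous_map_vector, unfolded comp_def]
        continuous_map_compose[OF continuous_map_snd, unfolded comp_def])
      (simp add: continuous_map_iff_continuous2 continuous_intros)
  have cl: "closedin ?T {z \<in> topspace ?T. f z \<in> {0}}"
    by (rule closedin_continuous_map_preimage[OF cont]) simp
  have "fst z \<in> Bop \<and> f z = 0" if "z \<in> span ?S" for z
    using that
  proof (rule span_induct)
    show "subspace {z. fst z \<in> Bop \<and> f z = 0}"
      by (auto simp: subspace_def f_def blinfun.add_left blinfun.scaleR_left cinner_add_right
          cinner_scaleR_right algebra_simps)
    fix z assume "z \<in> ?S"
    then obtain x y where z: "z = (x \<otimes>\<^sub>o y, \<Lambda> x \<otimes>\<^sub>h \<Lambda> y)" and xy: "x \<in> \<nn>" "y \<in> \<nn>" by blast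
    have "cinner (\<Lambda> c) (x (\<Lambda> a)) = cinner (\<Lambda> (c o\<^sub>L adj a)) (\<Lambda> x)"
      "cinner (\<Lambda> d) (y (\<Lambda> b)) = cinner (\<Lambda> (d o\<^sub>L adj b)) (\<Lambda> y)"
      using cinner_GNS_right[of c x a] cinner_GNS_right[of d y b] n xy by (simp_all add: GNS_mult n_M)
    then show "fst z \<in> Bop \<and> f z = 0"
      using xy unfolding z f_def by (auto simp: op_tensor_Bop op_tensor_apply M_Bop n_M cinner_htens)
  qed
  then have "span ?S \<subseteq> {z \<in> topspace ?T. f z \<in> {0}}" by (auto simp: topspace_sigma_weak)
  then have "?T closure_of span ?S \<subseteq> {z \<in> topspace ?T. f z \<in> {0}}" using cl by (rule closure_of_minimal)
  then have "(X, \<xi>) \<in> {z \<in> topspace ?T. f z \<in> {0}}" using g unfolding gns_tensor_graph_def by blast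
  then show "X \<in> Bop" "cinner ?p (X ?q) = cinner ?r \<xi>" by (auto simp: topspace_sigma_weak f_def)
qed

end

section \<open>The coproduct and the antipode\<close>

locale coprod_gns = tracial_gns M \<phi> \<Lambda>
  for M :: "('a::chilbert \<Rightarrow>\<^sub>L 'a) set" and \<phi> \<Lambda> +
  fixes \<Delta> :: "('a \<Rightarrow>\<^sub>L 'a) \<Rightarrow> ('a, 'a) htensor \<Rightarrow>\<^sub>L ('a, 'a) htensor"
    and W :: "('a, 'a) htensor \<Rightarrow>\<^sub>L ('a, 'a) htensor"
  assumes hom: "star_hom M (vn_tensor M M) \<Delta>" and fund: "fundamental_unitary M \<Delta> \<phi> \<Lambda> W"
begin

lemma W_Bop: "W \<in> Bop" and W_unitary: "adj W (W t) = t" "W (adj W t) = t"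
  using fund unfolding fundamental_unitary_def unitary_op_def
  by (auto simp: blinfun_eq_iff)

lemma cinner_W: "cinner (W s) (W t) = cinner s t"
  by (metis W_Bop W_unitary(1) cinner_adj_right)

lemma norm_W: "norm (W t) = norm t"
  by (simp add: norm_eq_sqrt_cinner cinner_W)

lemma coproduct_vn_tensor: "x \<in> M \<Longrightarrow> \<Delta> x \<in> vn_tensor M M"
  and coproduct_mult: "x \<in> M \<Longrightarrow> y \<in> M \<Longrightarrow> \<Delta> (x o\<^sub>L y) = \<Delta> x o\<^sub>L \<Delta> y"
  and coproduct_adj: "x \<in> M \<Longrightarrow> \<Delta> (adj x) = adj (\<Delta> x)"
  using hom unfolding star_hom_def by auto

text \<open>Formally, the GNS vector of \<open>\<Delta> (z o\<^sub>L y) o\<^sub>L (x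
  \<otimes>\<^sub>o id_blinfun)\<close> is \<open>\<Delta> z\<close> applied to that of
  \<open>\<Delta> y o\<^sub>L (x \<otimes>\<^sub>o id_blinfun)\<close>. As the graph is only a
  closure, this is verified weakly: tested with right multiplications \<open>R\<close> and
  \<open>S\<close>, a GNS vector becomes its operator applied to \<open>?q\<close>, and
  \<open>adj (\<Delta> z)\<close> commutes with \<open>R \<otimes>\<^sub>o S\<close>.\<close>

lemma coproduct_adj_W:
  assumes z: "z \<in> M" and x: "x \<in> \<nn>" and y: "y \<in> \<nn>"
  shows "\<Delta> z (adj W (\<Lambda> x \<otimes>\<^sub>h \<Lambda> y)) = adj W (\<Lambda> x \<otimes>\<^sub>h z (\<Lambda> y))"
proof -
  define \<xi> where "\<xi> = adj W (\<Lambda> x \<otimes>\<^sub>h \<Lambda> y)"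
  define \<xi>' where "\<xi>' = adj W (\<Lambda> x \<otimes>\<^sub>h z (\<Lambda> y))"
  define X where "X = \<Delta> y o\<^sub>L (x \<otimes>\<^sub>o id_blinfun)"
  have zy: "z o\<^sub>L y \<in> \<nn>" by (rule n_mult_left[OF z y])
  have g: "(X, \<xi>) \<in> gns_tensor_graph M \<phi> \<Lambda>"
    using fund x y unfolding fundamental_unitary_def X_def \<xi>_def by blast
  have "(\<Delta> (z o\<^sub>L y) o\<^sub>L (x \<otimes>\<^sub>o id_blinfun), adj W (\<Lambda> x \<otimes>\<^sub>h \<Lambda> (z o\<^sub>L y))) \<in> gns_tensor_graph M \<phi> \<Lambda>"
    using fund x zy unfolding fundamental_unitary_def by blast
  then have g': "(\<Delta> z o\<^sub>L X, \<xi>') \<in> gns_tensor_graph M \<phi> \<Lambda>"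
    unfolding X_def \<xi>'_def using z y by (simp add: coproduct_mult n_M GNS_mult blinfun_compose_assoc)
  have Dz: "\<Delta> z \<in> Bop" "adj (\<Delta> z) \<in> vn_tensor M M"
    using vn_tensor_Bop coproduct_vn_tensor[OF z] coproduct_vn_tensor[OF M_adj[OF z]] z
    by (auto simp: coproduct_adj)
  have "\<xi>' - \<Delta> z \<xi> = 0"
  proof (rule GNS_tensor_total)
    fix c a d b assume n: "c \<in> \<nn>" "a \<in> \<nn>" "d \<in> \<nn>" "b \<in> \<nn>"
    have n': "adj a \<in> \<nn>" "adj b \<in> \<nn>" using n n_adj by auto
    obtain R where R: "R \<in> commutant M" "\<And>x. x \<in> \<nn> \<Longrightarrow> blinfun_apply R (\<Lambda> x) = \<Lambda> (x o\<^sub>L a)"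
      using right_mult_exists[OF n_M[OF n(2)]] by blast
    obtain S where S: "S \<in> commutant M" "\<And>x. x \<in> \<nn> \<Longrightarrow> blinfun_apply S (\<Lambda> x) = \<Lambda> (x o\<^sub>L b)"
      using right_mult_exists[OF n_M[OF n(4)]] by blast
    have RS: "R \<in> Bop" "S \<in> Bop" using R(1) S(1) commutant_props(1) by auto
    let ?q = "\<Lambda> (adj a) \<otimes>\<^sub>h \<Lambda> (adj b)"
    \<comment> \<open>The identity is extended from the vectors
      \<open>\<Lambda> c \<otimes>\<^sub>h \<Lambda> d\<close> to all \<open>t\<close>, because it
      will be applied at \<open>adj (\<Delta> z) ?p\<close>.\<close>
    have key: "cinner ((R \<otimes>\<^sub>o S) t) \<xi> = cinner t (X ?q)" for t
    proof -
      have "(\<lambda>t. cnj (cinner ((R \<otimes>\<^sub>o S) t) \<xi>)) = (\<lambda>t. cnj (cinner t (X ?q)))"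
      proof (rule dense_eq_htens[OF GNS_dense GNS_dense])
        fix u v assume "u \<in> \<Lambda> ` \<nn>" "v \<in> \<Lambda> ` \<nn>"
        then obtain c d where cd: "c \<in> \<nn>" "u = \<Lambda> c" "d \<in> \<nn>" "v = \<Lambda> d" by blast
        show "cnj (cinner ((R \<otimes>\<^sub>o S) (u \<otimes>\<^sub>h v)) \<xi>) = cnj (cinner (u \<otimes>\<^sub>h v) (X ?q))"
          using gns_tensor_graph_cinner(2)[OF g n' cd(1,3)] cd RS n
          by (simp add: op_tensor_apply R(2) S(2) adj_adj M_Bop n_M)
      qed (auto simp: cinner_commute[symmetric] intro!: bounded_linear_cinner_right
          bounded_linear_compose[OF bounded_linear_cinner_right blinfun.bounded_linear_right])
      from fun_cong[OF this, of t] show ?thesis by simp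
    qed
    let ?p = "\<Lambda> c \<otimes>\<^sub>h \<Lambda> d"
    have "cinner ((R \<otimes>\<^sub>o S) ?p) \<xi>' = cinner ?p (\<Delta> z (X ?q))"
      using gns_tensor_graph_cinner(2)[OF g' n' n(1,3)] RS n
      by (simp add: op_tensor_apply R(2) S(2) adj_adj M_Bop n_M)
    also have "\<dots> = cinner (adj (\<Delta> z) ?p) (X ?q)" using Dz by (simp add: cinner_adj_left)
    also have "\<dots> = cinner ((R \<otimes>\<^sub>o S) (adj (\<Delta> z) ?p)) \<xi>" by (rule key[symmetric])
    also have "\<dots> = cinner (adj (\<Delta> z) ((R \<otimes>\<^sub>o S) ?p)) \<xi>"
      by (simp only: vn_tensor_commute[OF Dz(2) R(1) S(1)])
    also have "\<dots> = cinner ((R \<otimes>\<^sub>o S) ?p) (\<Delta> z \<xi>)" using Dz by (simp add: cinner_adj_left)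
    finally have "cinner ((R \<otimes>\<^sub>o S) ?p) (\<xi>' - \<Delta> z \<xi>) = 0" by (simp add: cinner_diff_right)
    moreover have "(R \<otimes>\<^sub>o S) ?p = c (\<Lambda> a) \<otimes>\<^sub>h d (\<Lambda> b)"
      using RS n by (simp add: op_tensor_apply R(2) S(2) GNS_mult n_M)
    ultimately show "cinner (\<xi>' - \<Delta> z \<xi>) (c (\<Lambda> a) \<otimes>\<^sub>h d (\<Lambda> b)) = 0"
      by (metis cinner_commute complex_cnj_zero)
  qed
  then show ?thesis unfolding \<xi>_def \<xi>'_def by simp
qed

lemma coproduct_eq:
  assumes z: "z \<in> M"
  shows "\<Delta> z t = adj W ((id_blinfun \<otimes>\<^sub>o z) (W t))"
proof -
  have "(\<lambda>t. \<Delta> z (adj W t)) = (\<lambda>t. adj W ((id_blinfun \<otimes>\<^sub>o z) t))"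
  proof (rule dense_eq_htens[OF GNS_dense GNS_dense])
    fix u v assume "u \<in> \<Lambda> ` \<nn>" "v \<in> \<Lambda> ` \<nn>"
    then show "\<Delta> z (adj W (u \<otimes>\<^sub>h v)) = adj W ((id_blinfun \<otimes>\<^sub>o z) (u \<otimes>\<^sub>h v))"
      using coproduct_adj_W[OF z] z by (auto simp: id_tensor_apply M_Bop)
  qed (intro bounded_linear_compose[OF blinfun.bounded_linear_right blinfun.bounded_linear_right])+
  from fun_cong[OF this, of "W t"] show ?thesis by (simp add: W_unitary)
qed

end

section \<open>A trivial scaling group reduces the antipode to the unitary antipode\<close>

lemma strip_constant:
  fixes g :: "complex \<Rightarrow> complex"
  assumes cont: "continuous_on {z. -1/2 \<le> Im z \<and> Im z \<le> 0} g"
    and hol: "g holomorphic_on {z. -1/2 < Im z \<and> Im z < 0}"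
    and const: "\<And>t. g (of_real t) = c"
  shows "g (- \<i> / 2) = c"
proof -
  \<comment> \<open>\<open>g - c\<close> vanishes on the real axis, so it can be continued by 0 to
    the upper half-plane. The pasted function is holomorphic across the axis and zero on an open
    set, hence zero.\<close>
  define h where "h z = (if - \<i> \<bullet> z \<le> 0 then 0 else g z - c)" for z
  let ?S = "{z. -1/2 < Im z}"
  have im: "- \<i> \<bullet> z = - Im z" for z by (simp add: inner_complex_def)
  have oS: "open ?S" by (rule open_halfspace_Im_gt)
  have cS: "convex ?S" by (rule convex_halfspace_Im_gt)
  have zero: "h z = 0" if "z \<in> ?S" for z
  proof (rule analytic_continuation_open[where s = "{z. 0 < Im z}" and s' = ?S and f = h and g = "\<lambda>_. 0"])
    show "h holomorphic_on ?S"
    proof (rule holomorphic_on_paste_across_line[OF oS, of "- \<i>" _ 0])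
      show "h holomorphic_on ?S \<inter> {z. - \<i> \<bullet> z < 0}"
        by (rule holomorphic_transform[of "\<lambda>_. 0"]) (auto simp: h_def)
      have "(\<lambda>z. g z - c) holomorphic_on ?S \<inter> {z. 0 < - \<i> \<bullet> z}"
        by (intro holomorphic_intros holomorphic_on_subset[OF hol]) (auto simp: im)
      then show "h holomorphic_on ?S \<inter> {z. 0 < - \<i> \<bullet> z}"
        by (rule holomorphic_transform) (auto simp: h_def)
      show "continuous_on ?S h"
        unfolding h_def
      proof (rule continuous_on_cases_le)
        show "continuous_on {z \<in> ?S. 0 \<le> - \<i> \<bullet> z} (\<lambda>z. g z - c)"
          by (intro continuous_intros continuous_on_subset[OF cont]) (auto simp: im)
        show "0 = g z - c" if "z \<in> ?S" "- \<i> \<bullet> z = 0" for z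
        proof -
          have "z = of_real (Re z)" using that by (simp add: im complex_eq_iff)
          then show ?thesis using const[of "Re z"] by simp
        qed
      qed (intro continuous_intros)+
    qed auto
    show "{z. 0 < Im z} \<noteq> {}" by (auto intro!: exI[of _ \<i>])
    show "h z = 0" if "z \<in> {z. 0 < Im z}" for z using that by (simp add: h_def im)
  qed (use that oS convex_connected[OF cS] in \<open>auto simp: open_halfspace_Im_gt\<close>)
  \<comment> \<open>These points stay inside the open strip, with imaginary part above -1/2 and at
    most -1/4; the boundary point is then reached by continuity.\<close>
  define a where "a n = - \<i> * of_real (1/2 - (1/4) * (1 / real (Suc n)))" for n :: nat
  have "(\<lambda>n. 1 / real (Suc n)) \<longlonglongrightarrow> 0" using LIMSEQ_inverse_real_of_nat by (simp add: inverse_eq_divide)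
  then have "(\<lambda>n. 1/2 - (1/4) * (1 / real (Suc n))) \<longlonglongrightarrow> 1/2 - (1/4) * 0" by (intro tendsto_intros)
  then have "a \<longlonglongrightarrow> - \<i> * of_real (1/2 - (1/4) * 0)" 
    unfolding a_def by (intro tendsto_mult tendsto_const tendsto_of_real)
  then have lim: "a \<longlonglongrightarrow> - \<i> / 2" by simp
  have frac: "0 < (1/4) * (1 / real (Suc n))" "(1/4) * (1 / real (Suc n)) \<le> 1/4" for n by (auto simp: field_simps)
  have ga: "g (a n) = c" for n
    using zero[of "a n"] frac[of n] unfolding h_def im a_def by (auto split: if_splits)
  have "(\<lambda>n. g (a n)) \<longlonglongrightarrow> g (- \<i> / 2)"
    by (rule continuous_on_tendsto_compose[OF cont lim]) (use frac in \<open>auto simp: a_def intro: order_trans[OF frac(2)]\<close>)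
  then show ?thesis unfolding ga by (simp add: LIMSEQ_const_iff)
qed

text \<open>The scalar functions \<open>cinner u (f z v)\<close> are constant on the real axis, so
  \<open>strip_constant\<close> fixes their values at \<open>- \<i> / 2\<close>. In the polar
  decomposition of the antipode this leaves only \<open>R\<close>.\<close>

lemma (in vna) analytic_ext_trivial:
  assumes xy: "(x, y) \<in> analytic_ext M \<tau>" and \<tau>: "\<And>t. \<tau> t x = x"
  shows "x \<in> M" "y = x"
proof -
  let ?S = "{z. -1/2 \<le> Im z \<and> Im z \<le> 0}"
  obtain f :: "complex \<Rightarrow> 'a \<Rightarrow>\<^sub>L 'a" where x: "x \<in> M" and fM: "f ` ?S \<subseteq> M"
    and fc: "continuous_map (top_of_set ?S) sigma_weak f"
    and fh: "\<forall>w\<in>predual M. (\<lambda>z. w (f z)) holomorphic_on {z. -1/2 < Im z \<and> Im z < 0}"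
    and ft: "\<forall>t. f (of_real t) = \<tau> t x" and fy: "f (- \<i> / 2) = y"
    using xy unfolding analytic_ext_def by blast
  show "x \<in> M" by (rule x)
  show "y = x"
  proof (rule cinner_ext_op)
    fix u v
    have "cinner u (f (- \<i> / 2) v) = cinner u (x v)"
    proof (rule strip_constant[where g = "\<lambda>z. cinner u (f z v)"])
      have "continuous_map (top_of_set ?S) euclidean ((\<lambda>x. cinner u (blinfun_apply x v)) \<circ> f)"
        by (rule continuous_map_compose[OF fc continuous_map_vector])
      then show "continuous_on ?S (\<lambda>z. cinner u (f z v))" by (simp add: comp_def)
      have "(\<lambda>z. vf u v (f z)) holomorphic_on {z. -1/2 < Im z \<and> Im z < 0}" using fh vf_predual by blast
      then show "(\<lambda>z. cinner u (f z v)) holomorphic_on {z. -1/2 < Im z \<and> Im z < 0}"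
        by (rule holomorphic_transform) (use fM in \<open>auto simp: vf_def image_subset_iff\<close>)
    qed (simp add: ft \<tau>)
    then show "cinner u (y v) = cinner u (x v)" unfolding fy .
  qed
qed

lemma predual_Bop_vector: "(\<lambda>x. if x \<in> Bop then cinner u (blinfun_apply x v) else 0) \<in> predual (Bop :: ('a::chilbert \<Rightarrow>\<^sub>L 'a) set)"
  unfolding predual_def
proof (intro CollectI conjI)
  show "continuous_map (subtopology sigma_weak Bop) euclidean (\<lambda>x. if x \<in> Bop then cinner u (blinfun_apply x v) else 0)"
    by (rule continuous_map_eq[OF continuous_map_from_subtopology[OF continuous_map_vector[of u v]]]) simp
qed (auto simp: clinear_on_def blinfun.add_left cinner_add_right cinner_scaleC_right)

lemma slice_right_vector:
  assumes X: "X \<in> Bop" and \<omega>: "\<And>a b. \<omega> (vslice_left a b X) = cinner u (vslice_left a b X v)"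
  shows "slice_right \<omega> X = vslice_right u v X"
  unfolding slice_right_def
proof (rule the_equality)
  show *: "vslice_right u v X \<in> Bop \<and> (\<forall>a b. cinner b (vslice_right u v X a) = \<omega> (vslice_left b a X))"
    using X by (simp add: vslice_right_Bop cinner_vslice_right cinner_vslice_left \<omega>)
  show "y = vslice_right u v X" if "y \<in> Bop \<and> (\<forall>a b. cinner b (blinfun_apply y a) = \<omega> (vslice_left b a X))" for y
    using that * by (intro cinner_ext_op) simp
qed

text \<open>Vector functionals turn elements of the defining core into pairs of vector slices. It is
  through these pairs that the antipode enters the estimates.\<close>

lemma antipode_vector_slice:
  assumes "W \<in> Bop"
  shows "(vslice_right u v W, adj (vslice_right v u W)) \<in> antipode W"
proof -
  let ?w = "\<lambda>x. if x \<in> Bop then cinner u (blinfun_apply x v) else 0"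
  let ?S = "{(slice_right w W, slice_right w (adj W)) | w. w \<in> predual Bop}"
  have eq: "slice_right ?w X = vslice_right u v X" if "X \<in> Bop" for X
    by (rule slice_right_vector[OF that]) (simp add: vslice_left_Bop that)
  have "(slice_right ?w W, slice_right ?w (adj W)) \<in> ?S" using predual_Bop_vector[of u v] by blast
  then have "(vslice_right u v W, adj (vslice_right v u W)) \<in> ?S"
    using assms by (simp add: eq vslice_right_adj)
  moreover have "(vslice_right u v W, adj (vslice_right v u W)) \<in> topspace (prod_topology sigma_weak sigma_weak)"
    using assms by (simp add: topspace_sigma_weak vslice_right_Bop)
  ultimately show ?thesis
    unfolding antipode_def by (meson IntI closure_of_subset_Int subsetD)
qed

lemma convolution_vf:
  assumes "vna M" and X: "\<And>x. x \<in> M \<Longrightarrow> \<Delta> x \<in> vn_tensor M M" and x: "x \<in> M"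
  shows "convolution M \<Delta> (vna.vf M a c) (vna.vf M b d) x = cinner (a \<otimes>\<^sub>h b) (\<Delta> x (c \<otimes>\<^sub>h d))"
proof -
  interpret vna M by fact
  note D = X[OF x]
  have "slice_right (vf b d) (\<Delta> x) = vslice_right b d (\<Delta> x)"
    by (rule slice_right_vector[OF vn_tensor_Bop[OF D]]) (simp add: vf_def vslice_left_M[OF D])
  then show ?thesis
    using x by (simp add: convolution_def vf_def vslice_right_M[OF D] cinner_vslice_right vn_tensor_Bop[OF D])
qed

text \<open>Trace functionals are written with sequences while a basis may be uncountable. Only
  countably many contractions of \<open>s\<close> and \<open>t\<close> are nonzero, by summability
  of their squared norms, and these are enumerated.\<close>

lemma id_tensor_sequences:
  fixes s t :: "('a::chilbert, 'b::chilbert) htensor"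
  obtains \<mu> \<nu> where "summable (\<lambda>n. (norm (\<mu> n))\<^sup>2)" "summable (\<lambda>n. (norm (\<nu> n))\<^sup>2)"
    "\<And>x. x \<in> Bop \<Longrightarrow> cinner s ((id_blinfun \<otimes>\<^sub>o x) t) = (\<Sum>n. cinner (\<mu> n) (blinfun_apply x (\<nu> n :: 'b) :: 'b))"
proof -
  define S where "S = {e \<in> onb. lcontr e s \<noteq> 0 \<or> lcontr e t \<noteq> 0}"
  have S_onb: "S \<subseteq> onb" unfolding S_def by blast
  have cnt: "countable S"
  proof -
    have "countable {e \<in> onb. (norm (lcontr e r))\<^sup>2 \<noteq> 0}" for r :: "('a, 'b) htensor"
      by (rule summable_countable_real[OF has_sum_imp_summable[OF has_sum_norm_lcontr]])
    then have "countable ({e \<in> onb. (norm (lcontr e s))\<^sup>2 \<noteq> 0} \<union> {e \<in> onb. (norm (lcontr e t))\<^sup>2 \<noteq> 0})"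
      by blast
    moreover have "S \<subseteq> {e \<in> onb. (norm (lcontr e s))\<^sup>2 \<noteq> 0} \<union> {e \<in> onb. (norm (lcontr e t))\<^sup>2 \<noteq> 0}"
      unfolding S_def by auto
    ultimately show ?thesis by (rule countable_subset[rotated])
  qed
  define i where "i = to_nat_on S"
  have inj: "inj_on i S" unfolding i_def by (rule inj_on_to_nat_on[OF cnt])
  \<comment> \<open>The value 0 at indices that enumerate nothing covers the case of a finite
    \<open>S\<close>.\<close>
  define pick where "pick r n = (if n \<in> i ` S then lcontr (inv_into S i n) r else 0)"
    for r :: "('a, 'b) htensor" and n
  have pick: "pick r (i e) = lcontr e r" if "e \<in> S" for r e
    unfolding pick_def using that inj by simp
  have transfer: "((\<lambda>n. F n) has_sum v) UNIV"
    if "((\<lambda>e. F (i e)) has_sum v) S" "\<And>n. n \<notin> i ` S \<Longrightarrow> F n = 0" for F :: "nat \<Rightarrow> 'c::{comm_monoid_add,topological_space}" and v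
  proof -
    have "(F has_sum v) (i ` S)" using that(1) unfolding has_sum_reindex[OF inj] comp_def .
    then show ?thesis using has_sum_cong_neutral[of UNIV "i ` S" F F v] that(2) by auto
  qed
  have sq: "summable (\<lambda>n. (norm (pick r n))\<^sup>2)" if "r = s \<or> r = t" for r
  proof -
    have "((\<lambda>e. (norm (lcontr e r))\<^sup>2) has_sum (norm r)\<^sup>2) S"
      using has_sum_norm_lcontr[of r] has_sum_cong_neutral[of onb S "\<lambda>e. (norm (lcontr e r))\<^sup>2" "\<lambda>e. (norm (lcontr e r))\<^sup>2"] that S_onb
      unfolding S_def by auto
    then have "((\<lambda>e. (norm (pick r (i e)))\<^sup>2) has_sum (norm r)\<^sup>2) S"
      by (rule has_sum_cong[THEN iffD1, rotated]) (simp add: pick)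
    then have "((\<lambda>n. (norm (pick r n))\<^sup>2) has_sum (norm r)\<^sup>2) UNIV"
      by (rule transfer) (simp add: pick_def)
    then show ?thesis by (meson has_sum_imp_sums sums_summable)
  qed
  have "cinner s ((id_blinfun \<otimes>\<^sub>o x) t) = (\<Sum>n. cinner (pick s n) (x (pick t n)))" if x: "x \<in> Bop" for x :: "'b \<Rightarrow>\<^sub>L 'b"
  proof -
    have "((\<lambda>e. cinner (lcontr e s) (x (lcontr e t))) has_sum cinner s ((id_blinfun \<otimes>\<^sub>o x) t)) S"
      using has_sum_id_tensor[OF x, of s t]
        has_sum_cong_neutral[of onb S "\<lambda>e. cinner (lcontr e s) (x (lcontr e t))" "\<lambda>e. cinner (lcontr e s) (x (lcontr e t))"] S_onb
      unfolding S_def by auto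
    then have "((\<lambda>e. cinner (pick s (i e)) (x (pick t (i e)))) has_sum cinner s ((id_blinfun \<otimes>\<^sub>o x) t)) S"
      by (rule has_sum_cong[THEN iffD1, rotated]) (simp add: pick)
    then have "((\<lambda>n. cinner (pick s n) (x (pick t n))) has_sum cinner s ((id_blinfun \<otimes>\<^sub>o x) t)) UNIV"
      by (rule transfer) (simp add: pick_def)
    then show ?thesis by (metis has_sum_imp_sums sums_unique)
  qed
  with sq[of s] sq[of t] that[of "pick s" "pick t"] show thesis by blast
qed

lemma kac_type_antipode:
  assumes "von_neumann_algebra M" "kac_type M \<phi> \<Lambda> W"
  obtains R where "\<And>x. x \<in> M \<Longrightarrow> R x \<in> M" "\<And>x y. x \<in> M \<Longrightarrow> y \<in> M \<Longrightarrow> R (x + y) = R x + R y"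
    "\<And>c x. x \<in> M \<Longrightarrow> R (c *\<^sub>B x) = c *\<^sub>B R x" "\<And>x y. x \<in> M \<Longrightarrow> y \<in> M \<Longrightarrow> R (x o\<^sub>L y) = R y o\<^sub>L R x"
    "\<And>x. x \<in> M \<Longrightarrow> R (adj x) = adj (R x)" "\<And>x. x \<in> M \<Longrightarrow> R (R x) = x"
    "\<And>x y. (x, y) \<in> antipode W \<Longrightarrow> x \<in> M \<and> y = R x"
proof -
  interpret vna M by standard fact
  obtain R \<tau> where pol: "antipode_polar M W R \<tau>" and \<tau>: "\<forall>t. \<forall>x\<in>M. \<tau> t x = x"
    using assms(2) unfolding kac_type_def by blast
  have ap: "x \<in> M \<and> y = R x" if xy: "(x, y) \<in> antipode W" for x y
  proof -
    obtain z where z: "(x, z) \<in> analytic_ext M \<tau>" "y = R z"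
      using pol xy unfolding antipode_polar_def by auto
    have x: "x \<in> M" using z(1) unfolding analytic_ext_def by blast
    have "z = x" by (rule analytic_ext_trivial(2)[OF z(1)]) (use \<tau> x in blast)
    with z x show ?thesis by simp
  qed
  have "R ` M \<subseteq> M \<and> clinear_on M (*\<^sub>B) R \<and> (\<forall>x\<in>M. \<forall>y\<in>M. R (x o\<^sub>L y) = R y o\<^sub>L R x) \<and>
      (\<forall>x\<in>M. R (adj x) = adj (R x)) \<and> (\<forall>x\<in>M. R (R x) = x)"
    using pol unfolding antipode_polar_def by blast
  with ap show thesis by (intro that[of R]) (auto simp: clinear_on_def image_subset_iff)
qed

section \<open>Slices of the fundamental unitary under the unitary antipode\<close>

locale kac = coprod_gns M \<phi> \<Lambda> \<Delta> W
  for M :: "('a::chilbert \<Rightarrow>\<^sub>L 'a) set" and \<phi> \<Lambda> \<Delta> W +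
  fixes R :: "('a \<Rightarrow>\<^sub>L 'a) \<Rightarrow> 'a \<Rightarrow>\<^sub>L 'a"
  assumes R_M: "x \<in> M \<Longrightarrow> R x \<in> M" and R_add: "x \<in> M \<Longrightarrow> y \<in> M \<Longrightarrow> R (x + y) = R x + R y"
    and R_scaleC: "x \<in> M \<Longrightarrow> R (c *\<^sub>B x) = c *\<^sub>B R x"
    and R_mult: "x \<in> M \<Longrightarrow> y \<in> M \<Longrightarrow> R (x o\<^sub>L y) = R y o\<^sub>L R x"
    and R_adj: "x \<in> M \<Longrightarrow> R (adj x) = adj (R x)" and R_R: "x \<in> M \<Longrightarrow> R (R x) = x"
    and antipode_R: "(x, y) \<in> antipode W \<Longrightarrow> x \<in> M \<and> y = R x"
begin

abbreviation Ws :: "'a \<Rightarrow> 'a \<Rightarrow> 'a \<Rightarrow>\<^sub>L 'a" where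
  "Ws u v \<equiv> vslice_right u v W"

lemma Ws_M: "Ws u v \<in> M" and R_Ws: "R (Ws u v) = adj (Ws v u)"
  using antipode_R[OF antipode_vector_slice[OF W_Bop]] by auto

lemmas Ws_Bop = vslice_right_Bop[OF W_Bop] and cinner_Ws = cinner_vslice_right[OF W_Bop]

lemma R_id: "R id_blinfun = id_blinfun"
proof -
  have "R id_blinfun = R (R (R id_blinfun o\<^sub>L id_blinfun))"
    by (simp add: blinfun_compose_id R_R R_M M_id)
  also have "\<dots> = R (R id_blinfun o\<^sub>L R (R id_blinfun))" using R_mult[OF R_M[OF M_id] M_id] by simp
  also have "\<dots> = R (R id_blinfun)" by (simp add: blinfun_compose_id R_R M_id)
  finally show ?thesis using R_R[OF M_id] by simp
qed

lemma R_scaleR: "x \<in> M \<Longrightarrow> R (r *\<^sub>R x) = r *\<^sub>R R x"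
proof -
  have "r *\<^sub>R y = of_real r *\<^sub>B y" for y :: "'a \<Rightarrow>\<^sub>L 'a" by (rule blinfun_eqI) (simp add: blinfun.scaleR_left scaleR_scaleC)
  then show "x \<in> M \<Longrightarrow> R (r *\<^sub>R x) = r *\<^sub>R R x" by (simp add: R_scaleC)
qed

lemma R_diff: "x \<in> M \<Longrightarrow> y \<in> M \<Longrightarrow> R (x - y) = R x - R y"
  using R_add[of "x - y" y] M_diff[of x y] by simp

lemma R_zero: "R 0 = 0"
  using R_diff[OF M_id M_id] by simp

lemma R_sum: "(\<And>i. i \<in> I \<Longrightarrow> f i \<in> M) \<Longrightarrow> R (sum f I) = (\<Sum>i\<in>I. R (f i))"
  by (induction I rule: infinite_finite_induct) (auto simp: R_zero R_add M_sum)

text \<open>\<open>R\<close> is given by algebraic properties. For every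
  \<open>\<epsilon> > 0\<close> the operator \<open>x + \<epsilon> *\<^sub>R id_blinfun\<close> is a
  positive multiple of the square of a self-adjoint \<open>B\<close> in \<open>M\<close>, and
  \<open>R\<close> maps it to the same multiple of the square of the self-adjoint
  \<open>R B\<close>.\<close>

lemma R_pos:
  assumes x: "x \<in> pos M"
  shows "R x \<in> pos M"
proof -
  have xM: "x \<in> M" and x': "\<And>u. Im (cinner u (x u)) = 0" "\<And>u. 0 \<le> Re (cinner u (x u))"
    using x unfolding pos_def by (auto simp: complex_nonneg_Reals_iff)
  have main: "Im (cinner u (R x u)) = 0" "- \<epsilon> * (norm u)\<^sup>2 \<le> Re (cinner u (R x u))" if \<epsilon>: "0 < \<epsilon>" for \<epsilon> u
  proof -
    define c where "c = norm x + \<epsilon>"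
    have c: "0 < c" "\<epsilon> \<le> c" unfolding c_def using \<epsilon> by (auto intro: add_nonneg_pos)
    \<comment> \<open>The shift by \<open>\<epsilon>\<close> and the scaling by
      \<open>c = norm x + \<epsilon>\<close> place \<open>X\<close> between 0 and
      \<open>1 - \<epsilon> / c\<close>, so that its norm is below 1.\<close>
    define X where "X = id_blinfun - (1 / c) *\<^sub>R (x + \<epsilon> *\<^sub>R id_blinfun)"
    have XM: "X \<in> M" unfolding X_def by (intro M_diff M_id M_scaleR M_add xM)
    have cX: "cinner u (X u) = of_real ((norm u)\<^sup>2) - of_real (1 / c) * (cinner u (x u) + of_real (\<epsilon> * (norm u)\<^sup>2))" for u
      unfolding X_def by (simp add: blinfun.diff_left blinfun.add_left blinfun.scaleR_left cinner_diff_right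
          cinner_add_right cinner_scaleR_right cinner_self)
    have rX: "Re (cinner u (X u)) = (norm u)\<^sup>2 - (1 / c) * (Re (cinner u (x u)) + \<epsilon> * (norm u)\<^sup>2)" for u
      unfolding cX by simp
    have iX: "Im (cinner u (X u)) = 0" for u unfolding cX using x'(1)[of u] by simp
    have le: "Re (cinner u (x u)) \<le> norm x * (norm u)\<^sup>2" for u
    proof -
      have "Re (cinner u (x u)) \<le> norm u * (norm x * norm u)"
        by (intro order_trans[OF complex_Re_le_cmod] order_trans[OF cmod_cinner_le] mult_left_mono norm_blinfun) auto
      then show ?thesis by (simp add: power2_eq_square mult_ac)
    qed
    have X_pos: "X \<in> pos Bop"
      unfolding pos_Bop_iff
    proof (intro conjI allI)
      show "X \<in> Bop" using XM by (rule M_Bop)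
      fix u
      show "Im (cinner u (X u)) = 0" by (rule iX)
      have "(1 / c) * (Re (cinner u (x u)) + \<epsilon> * (norm u)\<^sup>2) \<le> (1 / c) * (c * (norm u)\<^sup>2)"
        using le[of u] c by (intro mult_left_mono) (auto simp: c_def distrib_right)
      then show "0 \<le> Re (cinner u (X u))" unfolding rX using c by simp
    qed
    have "norm X \<le> 1 - \<epsilon> / c"
    proof (rule norm_pos_le[OF X_pos])
      show "0 \<le> 1 - \<epsilon> / c" using c by simp
      show "Re (cinner u (X u)) \<le> (1 - \<epsilon> / c) * (norm u)\<^sup>2" for u
        unfolding rX using x'(2)[of u] c by (simp add: field_simps)
    qed
    then have nX: "norm X < 1" using c \<epsilon> by (smt (verit) divide_pos_pos)
    obtain Y where Y: "Y \<in> M" "adj Y = Y" "(id_blinfun - Y) o\<^sub>L (id_blinfun - Y) = id_blinfun - X"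
      by (rule sqrt_one_minus[OF M_subset_Bop closed_M M_zero M_add M_scaleR M_compose XM adj_pos[OF X_pos] nX])
        auto
    define B where "B = id_blinfun - Y"
    have B: "B \<in> M" "adj B = B" unfolding B_def using Y by (auto intro: M_diff M_id simp: adj_diff M_Bop)
    have "x + \<epsilon> *\<^sub>R id_blinfun = c *\<^sub>R (B o\<^sub>L B)"
      using Y(3) c unfolding B_def X_def by simp
    then have "R (x + \<epsilon> *\<^sub>R id_blinfun) = c *\<^sub>R (R B o\<^sub>L R B)"
      using B by (simp add: R_scaleR M_compose R_mult)
    then have "R x + \<epsilon> *\<^sub>R id_blinfun = c *\<^sub>R (R B o\<^sub>L R B)"
      using xM by (simp add: R_add R_scaleR M_scaleR M_id R_id)
    then have "cinner u ((R x + \<epsilon> *\<^sub>R id_blinfun) u) = cinner u ((c *\<^sub>R (R B o\<^sub>L R B)) u)" by simp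
    moreover have "cinner u (R B (R B u)) = of_real ((norm (R B u))\<^sup>2)"
      using cinner_adj_left[of "R B" u "R B u"] R_adj[OF B(1)] B(2) M_Bop[OF R_M[OF B(1)]]
      by (simp add: cinner_self)
    ultimately have eq: "cinner u (R x u) = of_real (c * (norm (R B u))\<^sup>2 - \<epsilon> * (norm u)\<^sup>2)"
      by (simp add: blinfun.add_left blinfun.scaleR_left cinner_add_right cinner_scaleR_right cinner_self algebra_simps)
    show "Im (cinner u (R x u)) = 0" "- \<epsilon> * (norm u)\<^sup>2 \<le> Re (cinner u (R x u))"
      unfolding eq using c by auto
  qed
  have "0 \<le> Re (cinner u (R x u))" for u
  proof (rule ccontr)
    assume n: "\<not> 0 \<le> Re (cinner u (R x u))"
    \<comment> \<open>Chosen so that \<open>\<epsilon> * (norm u)\<^sup>2\<close> is at most half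
      the modulus of the supposedly negative value.\<close>
    define \<epsilon> where "\<epsilon> = - Re (cinner u (R x u)) / (2 * ((norm u)\<^sup>2 + 1))"
    have p: "0 < (norm u)\<^sup>2 + 1" by (rule add_nonneg_pos) auto
    then have \<epsilon>: "0 < \<epsilon>" unfolding \<epsilon>_def using n by (intro divide_pos_pos) auto
    have "\<epsilon> * (norm u)\<^sup>2 \<le> \<epsilon> * ((norm u)\<^sup>2 + 1)" using \<epsilon> by simp
    also have "\<dots> = - Re (cinner u (R x u)) / 2" unfolding \<epsilon>_def using p by (simp add: field_simps)
    finally show False using main(2)[OF \<epsilon>, of u] n by simp
  qed
  then show ?thesis using main(1)[of 1] R_M[OF xM] unfolding pos_def by (auto simp: complex_nonneg_Reals_iff)
qed

lemma Ws_lcontr: "Ws l \<eta> u = lcontr l (flip (W (u \<otimes>\<^sub>h \<eta>)))"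
proof (rule cinner_ext_right)
  fix a
  have "cinner a (lcontr l (flip (W (u \<otimes>\<^sub>h \<eta>)))) = cinner (flip (a \<otimes>\<^sub>h l)) (flip (W (u \<otimes>\<^sub>h \<eta>)))"
    by (simp add: cinner_lcontr flip_htens)
  then show "cinner a (Ws l \<eta> u) = cinner a (lcontr l (flip (W (u \<otimes>\<^sub>h \<eta>))))"
    by (simp add: cinner_flip cinner_Ws)
qed

text \<open>The vectors \<open>Ws l \<eta> u\<close> are the coordinates of
  \<open>W (u \<otimes>\<^sub>h \<eta>)\<close> along the second leg, and \<open>W\<close> is
  isometric.\<close>

lemma Ws_column_has_sum: "((\<lambda>l. (norm (Ws l \<eta> u))\<^sup>2) has_sum (norm u * norm \<eta>)\<^sup>2) onb"
  using has_sum_norm_lcontr[of "flip (W (u \<otimes>\<^sub>h \<eta>))"] by (simp add: Ws_lcontr norm_flip norm_W norm_htens)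

lemma Ws_column_le: "finite L \<Longrightarrow> L \<subseteq> onb \<Longrightarrow> (\<Sum>l\<in>L. (norm (Ws l \<eta> u))\<^sup>2) \<le> (norm u * norm \<eta>)\<^sup>2"
  by (rule finite_sum_le_has_sum[OF Ws_column_has_sum]) auto

text \<open>\<open>R\<close> maps \<open>Ws l \<eta>\<close> to \<open>adj (Ws \<eta> l)\<close> and
  reverses products, so columns of the matrix \<open>Ws\<close> become rows.\<close>

lemma R_column_Ws: "R (\<Sum>l\<in>L. adj (Ws l \<eta>) o\<^sub>L Ws l \<eta>) = (\<Sum>l\<in>L. adj (Ws \<eta> l) o\<^sub>L Ws \<eta> l)"
  by (subst R_sum) (auto intro!: sum.cong simp: M_compose M_adj Ws_M R_mult R_adj R_Ws adj_adj Ws_Bop)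

lemma cinner_sum_adj:
  "(\<And>l. l \<in> L \<Longrightarrow> Z l \<in> Bop) \<Longrightarrow>
    cinner u ((\<Sum>l\<in>L. adj (Z l) o\<^sub>L Z l) u) = of_real (\<Sum>l\<in>L. (norm (Z l u))\<^sup>2)"
  by (simp add: blinfun.sum_left cinner_sum_right cinner_adj_right cinner_self)

lemma posI:
  assumes "x \<in> M" "\<And>u. cinner u (x u) = of_real (r u)" "\<And>u. 0 \<le> r u"
  shows "x \<in> pos M"
  using assms unfolding pos_def by (auto simp: complex_nonneg_Reals_iff)

text \<open>The hypothesis bounds the sum of \<open>adj (Z k) o\<^sub>L Z k\<close> by
  \<open>B\<^sup>2\<close>. \<open>R\<close> preserves this order relation but reverses the
  products, so the adjoints end up on the right.\<close>

lemma R_adj_compose_pos: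
  assumes F: "finite F" and Z: "\<And>k. k \<in> F \<Longrightarrow> Z k \<in> M"
    and B: "\<And>v. (\<Sum>k\<in>F. (norm (Z k v))\<^sup>2) \<le> B\<^sup>2 * (norm v)\<^sup>2"
  shows "B\<^sup>2 *\<^sub>R id_blinfun - (\<Sum>k\<in>F. R (Z k) o\<^sub>L adj (R (Z k))) \<in> pos M"
proof -
  let ?S = "\<Sum>k\<in>F. adj (Z k) o\<^sub>L Z k"
  have S: "?S \<in> M" using Z by (intro M_sum M_compose M_adj) auto
  have "B\<^sup>2 *\<^sub>R id_blinfun - ?S \<in> pos M"
  proof (rule posI[where r = "\<lambda>u. B\<^sup>2 * (norm u)\<^sup>2 - (\<Sum>k\<in>F. (norm (Z k u))\<^sup>2)"])
    fix u
    have "cinner u (?S u) = of_real (\<Sum>k\<in>F. (norm (Z k u))\<^sup>2)"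
      by (rule cinner_sum_adj) (use Z M_Bop in blast)
    then show "cinner u ((B\<^sup>2 *\<^sub>R id_blinfun - ?S) u) = of_real (B\<^sup>2 * (norm u)\<^sup>2 - (\<Sum>k\<in>F. (norm (Z k u))\<^sup>2))"
      by (simp add: blinfun.diff_left blinfun.scaleR_left cinner_diff_right cinner_scaleR_right cinner_self)
  qed (use B S in \<open>auto intro: M_diff M_scaleR M_id\<close>)
  then have "R (B\<^sup>2 *\<^sub>R id_blinfun - ?S) \<in> pos M" by (rule R_pos)
  also have "R (B\<^sup>2 *\<^sub>R id_blinfun - ?S) = B\<^sup>2 *\<^sub>R id_blinfun - (\<Sum>k\<in>F. R (Z k) o\<^sub>L adj (R (Z k)))"
    using Z S by (simp add: R_diff M_scaleR M_id R_scaleR R_id R_sum M_compose M_adj R_mult R_adj)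
  finally show ?thesis .
qed

lemma Ws_row_le:
  assumes L: "finite L" "L \<subseteq> onb"
  shows "(\<Sum>l\<in>L. (norm (Ws \<eta> l u))\<^sup>2) \<le> (norm u * norm \<eta>)\<^sup>2"
proof -
  have "(norm \<eta>)\<^sup>2 *\<^sub>R id_blinfun - (\<Sum>l\<in>L. R (Ws l \<eta>) o\<^sub>L adj (R (Ws l \<eta>))) \<in> pos M"
    by (intro R_adj_compose_pos L Ws_M) (use Ws_column_le[OF L, of \<eta>] in \<open>simp add: power_mult_distrib mult.commute\<close>)
  also have "(\<Sum>l\<in>L. R (Ws l \<eta>) o\<^sub>L adj (R (Ws l \<eta>))) = (\<Sum>l\<in>L. adj (Ws \<eta> l) o\<^sub>L Ws \<eta> l)"
    by (simp add: R_Ws adj_adj Ws_Bop)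
  finally have "0 \<le> Re (cinner u (((norm \<eta>)\<^sup>2 *\<^sub>R id_blinfun - (\<Sum>l\<in>L. adj (Ws \<eta> l) o\<^sub>L Ws \<eta> l)) u))"
    unfolding pos_def by (auto simp: complex_nonneg_Reals_iff)
  moreover have "cinner u ((\<Sum>l\<in>L. adj (Ws \<eta> l) o\<^sub>L Ws \<eta> l) u) = of_real (\<Sum>l\<in>L. (norm (Ws \<eta> l u))\<^sup>2)"
    by (rule cinner_sum_adj) (rule Ws_Bop)
  ultimately show ?thesis
    by (simp add: blinfun.diff_left blinfun.scaleR_left cinner_diff_right cinner_scaleR_right cinner_self
        power_mult_distrib mult.commute del: of_real_sum)
qed

text \<open>Since \<open>R\<close> preserves order, it exchanges the suprema of the increasing families on both sides;
  this replaces an appeal to its normality.\<close>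

lemma Ws_row_has_sum: "((\<lambda>l. (norm (Ws \<eta> l u))\<^sup>2) has_sum (norm u * norm \<eta>)\<^sup>2) onb"
proof -
  have le: "(\<Sum>l\<in>L. (norm (Ws \<eta> l u))\<^sup>2) \<le> (norm \<eta> * norm u)\<^sup>2" if "finite L" "L \<subseteq> onb" for L u
    using Ws_row_le[OF that, of \<eta> u] by (simp add: mult.commute)
  note cs = cinner_sums_cauchy_schwarz[OF le le]
  have sm: "(\<lambda>l. cinner (Ws \<eta> l u) (Ws \<eta> l v)) summable_on onb"
    and bd: "cmod (\<Sum>\<^sub>\<infinity>l\<in>onb. cinner (Ws \<eta> l u) (Ws \<eta> l v)) \<le> (norm \<eta> * norm u) * (norm \<eta> * norm v)" for u v
    using cs[of onb u v] by auto
  \<comment> \<open>\<open>G\<close> is the sum of all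
    \<open>adj (Ws \<eta> l) o\<^sub>L Ws \<eta> l\<close>, built as a form and then shown to lie in
    \<open>M\<close>, so that \<open>R\<close> can be applied to it.\<close>
  obtain G where G: "G \<in> Bop" "\<And>u v. cinner u (blinfun_apply G v) = (\<Sum>\<^sub>\<infinity>l\<in>onb. cinner (Ws \<eta> l u) (Ws \<eta> l v))"
    by (rule bounded_form_op[of "\<lambda>u v. \<Sum>\<^sub>\<infinity>l\<in>onb. cinner (Ws \<eta> l u) (Ws \<eta> l v)" "norm \<eta> * norm \<eta>"])
      (use bd in \<open>auto simp: blinfun.add_right Bop_apply[OF Ws_Bop] cinner_add_left cinner_add_right
        cinner_scaleC_left cinner_scaleC_right infsum_add sm infsum_cmult_right mult_ac\<close>)
  have GM: "G \<in> M"
  proof (rule M_I[OF G(1)], rule cinner_ext_op)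
    fix y u v assume y: "y \<in> commutant M"
    then have yB: "y \<in> Bop" using commutant_props(1) by auto
    have "cinner u ((G o\<^sub>L y) v) = (\<Sum>\<^sub>\<infinity>l\<in>onb. cinner (Ws \<eta> l u) (Ws \<eta> l (y v)))" by (simp add: G(2))
    also have "\<dots> = (\<Sum>\<^sub>\<infinity>l\<in>onb. cinner (Ws \<eta> l (adj y u)) (Ws \<eta> l v))"
      by (rule infsum_cong) (simp add: commutant_M[OF y Ws_M, symmetric] commutant_M[OF commutant_adj[OF y] Ws_M, symmetric]
          cinner_adj_left yB)
    also have "\<dots> = cinner u ((y o\<^sub>L G) v)" by (simp add: G(2)[symmetric] cinner_adj_left yB)
    finally show "cinner u ((G o\<^sub>L y) v) = cinner u ((y o\<^sub>L G) v)" .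
  qed
  define r where "r u = (\<Sum>\<^sub>\<infinity>l\<in>onb. (norm (Ws \<eta> l u))\<^sup>2)" for u
  have "((\<lambda>l. cinner (Ws \<eta> l u) (Ws \<eta> l u)) has_sum cinner u (G u)) onb" for u
    unfolding G(2) by (rule has_sum_infsum[OF sm])
  from has_sum_Re[OF this] have hs: "((\<lambda>l. (norm (Ws \<eta> l u))\<^sup>2) has_sum Re (cinner u (G u))) onb" for u
    by (simp add: cinner_self del: of_real_power)
  then have rG: "r u = Re (cinner u (G u))" for u unfolding r_def by (rule infsumI)
  have Gr: "cinner u (G u) = of_real (r u)" for u
  proof -
    have "((\<lambda>l. complex_of_real ((norm (Ws \<eta> l u))\<^sup>2)) has_sum of_real (r u)) onb"
      using has_sum_bounded_linear[OF bounded_linear_of_real hs[of u]] unfolding rG .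
    then have "((\<lambda>l. cinner (Ws \<eta> l u) (Ws \<eta> l u)) has_sum of_real (r u)) onb" unfolding cinner_self .
    then show ?thesis unfolding G(2) by (rule infsumI)
  qed
  have RG: "(\<Sum>l\<in>L. (norm (Ws l \<eta> u))\<^sup>2) \<le> Re (cinner u (R G u)) \<and> Im (cinner u (R G u)) = 0"
    if L: "finite L" "L \<subseteq> onb" for L u
  proof -
    let ?E = "\<Sum>l\<in>L. adj (Ws \<eta> l) o\<^sub>L Ws \<eta> l"
    have EM: "?E \<in> M" by (intro M_sum M_compose M_adj Ws_M)
    have "G - ?E \<in> pos M"
    proof (rule posI[where r = "\<lambda>u. r u - (\<Sum>l\<in>L. (norm (Ws \<eta> l u))\<^sup>2)"])
      fix u
      have "cinner u (?E u) = of_real (\<Sum>l\<in>L. (norm (Ws \<eta> l u))\<^sup>2)" by (rule cinner_sum_adj) (rule Ws_Bop)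
      then show "cinner u ((G - ?E) u) = of_real (r u - (\<Sum>l\<in>L. (norm (Ws \<eta> l u))\<^sup>2))"
        by (simp add: blinfun.diff_left cinner_diff_right Gr)
      show "0 \<le> r u - (\<Sum>l\<in>L. (norm (Ws \<eta> l u))\<^sup>2)"
        using finite_sum_le_has_sum[OF hs[of u] L] rG by simp
    qed (intro M_diff GM EM)
    then have "R (G - ?E) \<in> pos M" by (rule R_pos)
    also have "R (G - ?E) = R G - (\<Sum>l\<in>L. adj (Ws l \<eta>) o\<^sub>L Ws l \<eta>)"
    proof -
      have "R ?E = (\<Sum>l\<in>L. adj (Ws l \<eta>) o\<^sub>L Ws l \<eta>)"
        using R_R[of "\<Sum>l\<in>L. adj (Ws l \<eta>) o\<^sub>L Ws l \<eta>"] R_column_Ws[of \<eta> L]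
        by (simp add: M_sum M_compose M_adj Ws_M)
      then show ?thesis using GM EM by (simp add: R_diff)
    qed
    finally have "cinner u ((R G - (\<Sum>l\<in>L. adj (Ws l \<eta>) o\<^sub>L Ws l \<eta>)) u) \<in> \<real>\<^sub>\<ge>\<^sub>0"
      unfolding pos_def by blast
    moreover have "cinner u ((\<Sum>l\<in>L. adj (Ws l \<eta>) o\<^sub>L Ws l \<eta>) u) = of_real (\<Sum>l\<in>L. (norm (Ws l \<eta> u))\<^sup>2)"
      by (rule cinner_sum_adj) (rule Ws_Bop)
    ultimately show ?thesis
      by (simp add: blinfun.diff_left cinner_diff_right complex_nonneg_Reals_iff del: of_real_sum)
  qed
  \<comment> \<open>\<open>R G\<close> dominates all finite column sums, whose supremum is
    \<open>(norm \<eta>)\<^sup>2\<close> because \<open>W\<close> is isometric. A second application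
    of \<open>R\<close> transports this lower bound back to \<open>G\<close>.\<close>
  have "R G - (norm \<eta>)\<^sup>2 *\<^sub>R id_blinfun \<in> pos M"
  proof (rule posI[where r = "\<lambda>u. Re (cinner u (R G u)) - (norm \<eta>)\<^sup>2 * (norm u)\<^sup>2"])
    fix u
    have "Im (cinner u (R G u)) = 0" using RG[of "{}" u] by simp
    then show "cinner u ((R G - (norm \<eta>)\<^sup>2 *\<^sub>R id_blinfun) u) = of_real (Re (cinner u (R G u)) - (norm \<eta>)\<^sup>2 * (norm u)\<^sup>2)"
      by (simp add: blinfun.diff_left blinfun.scaleR_left cinner_diff_right cinner_scaleR_right cinner_self complex_eq_iff
          del: of_real_mult of_real_power)
    have "(norm u * norm \<eta>)\<^sup>2 \<le> Re (cinner u (R G u))"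
      by (rule has_sum_le_finite_sums[OF Ws_column_has_sum]) (use RG in auto)
    then show "0 \<le> Re (cinner u (R G u)) - (norm \<eta>)\<^sup>2 * (norm u)\<^sup>2" by (simp add: power_mult_distrib mult.commute)
  qed (intro M_diff R_M GM M_scaleR M_id)
  then have "R (R G - (norm \<eta>)\<^sup>2 *\<^sub>R id_blinfun) \<in> pos M" by (rule R_pos)
  then have "G - (norm \<eta>)\<^sup>2 *\<^sub>R id_blinfun \<in> pos M"
    using GM by (simp add: R_diff R_M M_scaleR M_id R_scaleR R_id R_R)
  then have "cinner u ((G - (norm \<eta>)\<^sup>2 *\<^sub>R id_blinfun) u) \<in> \<real>\<^sub>\<ge>\<^sub>0" unfolding pos_def by blast
  then have "(norm u * norm \<eta>)\<^sup>2 \<le> r u"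
    by (simp add: blinfun.diff_left blinfun.scaleR_left cinner_diff_right cinner_scaleR_right cinner_self
        complex_nonneg_Reals_iff Gr power_mult_distrib mult.commute del: of_real_mult of_real_power)
  moreover have "r u \<le> (norm u * norm \<eta>)\<^sup>2"
    unfolding rG by (rule has_sum_le_finite_sums[OF hs]) (rule Ws_row_le)
  ultimately show ?thesis using hs[of u] unfolding rG[symmetric] by simp
qed

lemma Ws_linear_left: "Ws (u + u') v = Ws u v + Ws u' v" "Ws (c *\<^sub>C u) v = cnj c *\<^sub>B Ws u v"
  by (rule cinner_ext_op; simp add: cinner_Ws htens_bilinear blinfun.add_left cinner_add_left cinner_add_right
      cinner_scaleC_left cinner_scaleC_right)+

text \<open>Polarisation of \<open>Ws_row_has_sum\<close> in the first index. Isometry of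
  \<open>W\<close> concerns the columns of \<open>Ws\<close>; this says that the transposed matrix
  is isometric too.\<close>

lemma Ws_row_orthogonality:
  "((\<lambda>l. cinner (Ws \<kappa> l u) (Ws \<eta> l u)) has_sum cinner \<eta> \<kappa> * of_real ((norm u)\<^sup>2)) onb"
proof -
  have sm: "(\<lambda>l. cinner (Ws \<kappa> l u) (Ws \<eta> l u)) summable_on onb" for \<kappa> \<eta>
    by (rule cinner_sums_cauchy_schwarz(1)[OF Ws_row_le Ws_row_le]) auto
  define b where "b \<eta> \<kappa> = (\<Sum>\<^sub>\<infinity>l\<in>onb. cinner (Ws \<kappa> l u) (Ws \<eta> l u)) - cinner \<eta> \<kappa> * of_real ((norm u)\<^sup>2)" for \<eta> \<kappa>
  have "b \<eta> \<kappa> = 0"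
  proof (rule sesquilinear_zero)
    fix \<eta>
    have "((\<lambda>l. complex_of_real ((norm (Ws \<eta> l u))\<^sup>2)) has_sum of_real ((norm u * norm \<eta>)\<^sup>2)) onb"
      by (rule has_sum_bounded_linear[OF bounded_linear_of_real Ws_row_has_sum])
    then have "(\<Sum>\<^sub>\<infinity>l\<in>onb. cinner (Ws \<eta> l u) (Ws \<eta> l u)) = of_real ((norm u * norm \<eta>)\<^sup>2)"
      unfolding cinner_self by (rule infsumI)
    then show "b \<eta> \<eta> = 0" unfolding b_def by (simp add: cinner_self power_mult_distrib mult.commute)
  qed (auto simp: b_def Ws_linear_left blinfun.add_left cinner_add_left cinner_add_right cinner_scaleC_left
      cinner_scaleC_right infsum_add sm infsum_cmult_right algebra_simps)
  then show ?thesis using has_sum_infsum[OF sm, of \<kappa> \<eta>] unfolding b_def by simp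
qed

end

section \<open>The antipode axiom for a completely bounded representation\<close>

lemma id_tensor_sum_sq:
  assumes "finite F" and A: "\<And>k. k \<in> F \<Longrightarrow> A k \<in> Bop"
    and B: "\<And>\<xi>. (\<Sum>k\<in>F. (norm (blinfun_apply (A k) \<xi>))\<^sup>2) \<le> B\<^sup>2 * (norm (\<xi> :: 'b::chilbert))\<^sup>2"
  shows "(\<Sum>k\<in>F. (norm ((id_blinfun \<otimes>\<^sub>o A k) t :: ('a::chilbert, 'd::chilbert) htensor))\<^sup>2) \<le> B\<^sup>2 * (norm t)\<^sup>2"
proof -
  have "((\<lambda>e. (norm (A k (lcontr e t)))\<^sup>2) has_sum (norm ((id_blinfun \<otimes>\<^sub>o A k) t))\<^sup>2) onb" if "k \<in> F" for k
    using has_sum_norm_lcontr[of "(id_blinfun \<otimes>\<^sub>o A k) t"] A[OF that] by (simp add: lcontr_id_tensor)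
  then have "((\<lambda>e. \<Sum>k\<in>F. (norm (A k (lcontr e t)))\<^sup>2) has_sum (\<Sum>k\<in>F. (norm ((id_blinfun \<otimes>\<^sub>o A k) t))\<^sup>2)) onb"
    by (rule has_sum_finite_sum[OF assms(1)])
  moreover have "((\<lambda>e. B\<^sup>2 * (norm (lcontr e t))\<^sup>2) has_sum B\<^sup>2 * (norm t)\<^sup>2) onb"
    by (rule has_sum_cmult_right[OF has_sum_norm_lcontr])
  ultimately show ?thesis by (rule has_sum_mono) (rule B)
qed

text \<open>Dominated convergence in which \<open>b\<close> has only uniformly bounded square sums:
  a finite set carries all but a small part of the square sum of \<open>a\<close>, and on it the
  termwise limits suffice.\<close>

lemma tannery_cinner:
  fixes a :: "'i \<Rightarrow> 'a::chilbert"
  assumes a: "\<And>F. finite F \<Longrightarrow> F \<subseteq> S \<Longrightarrow> (\<Sum>k\<in>F. (norm (a k))\<^sup>2) \<le> A"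
    and b: "\<forall>\<^sub>F L in G. \<forall>F. finite F \<and> F \<subseteq> S \<longrightarrow> (\<Sum>k\<in>F. (norm (b L k))\<^sup>2) \<le> B\<^sup>2" and B: "0 \<le> B"
    and lim: "\<And>k. k \<in> S \<Longrightarrow> ((\<lambda>L. b L k) \<longlongrightarrow> 0) G"
  shows "((\<lambda>L. \<Sum>\<^sub>\<infinity>k\<in>S. cinner (a k) (b L k)) \<longlongrightarrow> 0) G"
proof (rule tendstoI)
  fix \<epsilon> :: real assume \<epsilon>: "0 < \<epsilon>"
  define \<delta> where "\<delta> = \<epsilon> / (2 * (B + 1))"
  have \<delta>: "0 < \<delta>" "\<delta> * B < \<epsilon> / 2"
    unfolding \<delta>_def using \<epsilon> B by (auto simp: field_simps add_nonneg_pos)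
  have sm: "(\<lambda>k. (norm (a k))\<^sup>2) summable_on S"
    by (rule nonneg_bdd_above_summable_on) (auto intro!: bdd_aboveI2 a)
  have "0 < \<delta>\<^sup>2" using \<delta> by simp
  then obtain F0 where F0: "finite F0" "F0 \<subseteq> S" "dist (\<Sum>k\<in>F0. (norm (a k))\<^sup>2) (\<Sum>\<^sub>\<infinity>k\<in>S. (norm (a k))\<^sup>2) \<le> \<delta>\<^sup>2"
    using has_sum_finite_approximation[OF has_sum_infsum[OF sm]] by metis
  have tail: "(\<Sum>k\<in>F. (norm (a k))\<^sup>2) \<le> \<delta>\<^sup>2" if F: "finite F" "F \<subseteq> S - F0" for F
  proof -
    have "(\<Sum>k\<in>F0 \<union> F. (norm (a k))\<^sup>2) \<le> (\<Sum>\<^sub>\<infinity>k\<in>S. (norm (a k))\<^sup>2)"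
      by (rule finite_sum_le_infsum[OF sm]) (use F F0 in auto)
    moreover have "(\<Sum>k\<in>F0 \<union> F. (norm (a k))\<^sup>2) = (\<Sum>k\<in>F0. (norm (a k))\<^sup>2) + (\<Sum>k\<in>F. (norm (a k))\<^sup>2)"
      by (rule sum.union_disjoint) (use F F0 in auto)
    ultimately show ?thesis using F0(3) unfolding dist_real_def by linarith
  qed
  have "((\<lambda>L. \<Sum>k\<in>F0. cinner (a k) (b L k)) \<longlongrightarrow> (\<Sum>k\<in>F0. cinner (a k) 0)) G"
    by (intro tendsto_sum tendsto_cinner tendsto_const lim) (use F0 in auto)
  then have "((\<lambda>L. \<Sum>k\<in>F0. cinner (a k) (b L k)) \<longlongrightarrow> 0) G" by simp
  then have "\<forall>\<^sub>F L in G. dist (\<Sum>k\<in>F0. cinner (a k) (b L k)) 0 < \<epsilon> / 2"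
    by (rule tendstoD) (use \<epsilon> in simp)
  then show "\<forall>\<^sub>F L in G. dist (\<Sum>\<^sub>\<infinity>k\<in>S. cinner (a k) (b L k)) 0 < \<epsilon>"
    using b
  proof eventually_elim
    case (elim L)
    have b': "(\<Sum>k\<in>F. (norm (b L k))\<^sup>2) \<le> B\<^sup>2" if "finite F" "F \<subseteq> S - F0" for F using elim(2) that by blast
    note cs = cinner_sums_cauchy_schwarz[of "S - F0" a \<delta> "b L" B, OF tail b']
    have s1: "(\<lambda>k. cinner (a k) (b L k)) summable_on (S - F0)"
      and n1: "cmod (\<Sum>\<^sub>\<infinity>k\<in>S - F0. cinner (a k) (b L k)) \<le> \<delta> * B"
      using cs \<delta> B by auto
    have "((\<lambda>k. cinner (a k) (b L k)) has_sum (\<Sum>k\<in>F0. cinner (a k) (b L k)) + (\<Sum>\<^sub>\<infinity>k\<in>S - F0. cinner (a k) (b L k))) (F0 \<union> (S - F0))"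
      by (rule has_sum_Un_disjoint[OF has_sum_finite[OF F0(1)] has_sum_infsum[OF s1]]) auto
    also have "F0 \<union> (S - F0) = S" using F0 by auto
    finally have "(\<Sum>\<^sub>\<infinity>k\<in>S. cinner (a k) (b L k)) = (\<Sum>k\<in>F0. cinner (a k) (b L k)) + (\<Sum>\<^sub>\<infinity>k\<in>S - F0. cinner (a k) (b L k))"
      by (rule infsumI)
    then show ?case
      using elim(1) n1 \<delta>(2) norm_triangle_ineq[of "\<Sum>k\<in>F0. cinner (a k) (b L k)" "\<Sum>\<^sub>\<infinity>k\<in>S - F0. cinner (a k) (b L k)"]
      by (simp add: dist_norm)
  qed
qed

locale kac_rep = kac M \<phi> \<Lambda> \<Delta> W R + cb_rep M \<Delta> \<pi> C
  for M :: "('a::chilbert \<Rightarrow>\<^sub>L 'a) set" and \<phi> \<Lambda> \<Delta> W R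
    and \<pi> :: "(('a \<Rightarrow>\<^sub>L 'a) \<Rightarrow> complex) \<Rightarrow> 'k::chilbert \<Rightarrow>\<^sub>L 'k" and C
begin

text \<open>By \<open>coproduct_eq\<close> the convolution of two vector functionals sends
  \<open>x\<close> to \<open>cinner (W (a \<otimes>\<^sub>h b)) ((id_blinfun \<otimes>\<^sub>o x) (W
  (c \<otimes>\<^sub>h d)))\<close>. This is a trace functional, on which \<open>\<pi>\<close> is
  expressed by \<open>V\<close>.\<close>

lemma pi_mult_vf:
  "cinner \<alpha> (\<pi> (vf a c) (\<pi> (vf b d) \<gamma>)) = cinner (W (a \<otimes>\<^sub>h b)) ((id_blinfun \<otimes>\<^sub>o V \<alpha> \<gamma>) (W (c \<otimes>\<^sub>h d)))"
proof -
  obtain \<mu> \<nu> where mn: "summable (\<lambda>n. (norm (\<mu> n))\<^sup>2)" "summable (\<lambda>n. (norm (\<nu> n))\<^sup>2)"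
    "\<And>x. x \<in> Bop \<Longrightarrow> cinner (W (a \<otimes>\<^sub>h b)) ((id_blinfun \<otimes>\<^sub>o x) (W (c \<otimes>\<^sub>h d))) = (\<Sum>n. cinner (\<mu> n) (blinfun_apply x (\<nu> n)))"
    using id_tensor_sequences by blast
  have "convolution M \<Delta> (vf a c) (vf b d) = tf \<mu> \<nu>"
  proof
    fix x
    show "convolution M \<Delta> (vf a c) (vf b d) x = tf \<mu> \<nu> x"
    proof (cases "x \<in> M")
      case True
      have "convolution M \<Delta> (vf a c) (vf b d) x = cinner (a \<otimes>\<^sub>h b) (\<Delta> x (c \<otimes>\<^sub>h d))"
        by (rule convolution_vf[OF vna_axioms coproduct_vn_tensor True])
      also have "\<dots> = cinner (W (a \<otimes>\<^sub>h b)) ((id_blinfun \<otimes>\<^sub>o x) (W (c \<otimes>\<^sub>h d)))"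
        by (simp add: coproduct_eq[OF True] cinner_adj_right W_Bop)
      finally show ?thesis using mn(3)[OF M_Bop[OF True]] True by (simp add: tf_def)
    qed (simp add: convolution_def tf_def)
  qed
  then have "\<pi> (vf a c) o\<^sub>L \<pi> (vf b d) = \<pi> (tf \<mu> \<nu>)"
    using pi_convolution[OF vf_predual vf_predual] by metis
  then have "cinner \<alpha> (\<pi> (vf a c) (\<pi> (vf b d) \<gamma>)) = cinner \<alpha> (\<pi> (tf \<mu> \<nu>) \<gamma>)"
    by (metis blinfun_apply_blinfun_compose)
  then show ?thesis unfolding V_tf_tendsto[OF mn(1,2)] mn(3)[OF V_Bop] .
qed

lemma V_column_id_tensor:
  assumes F: "finite F" "F \<subseteq> onb"
  shows "(\<Sum>k\<in>F. (norm ((id_blinfun \<otimes>\<^sub>o V k \<gamma>) t :: ('a, 'a) htensor))\<^sup>2) \<le> (C * norm \<gamma> * norm t)\<^sup>2"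
proof -
  have "(\<Sum>k\<in>F. (norm ((id_blinfun \<otimes>\<^sub>o V k \<gamma>) t :: ('a, 'a) htensor))\<^sup>2) \<le> (C * norm \<gamma>)\<^sup>2 * (norm t)\<^sup>2"
    using V_column[OF F] by (intro id_tensor_sum_sq F V_Bop) (simp add: power_mult_distrib)
  then show ?thesis by (simp add: power_mult_distrib)
qed

lemma V_row_id_tensor:
  assumes F: "finite F" "F \<subseteq> onb"
  shows "(\<Sum>k\<in>F. (norm ((id_blinfun \<otimes>\<^sub>o adj (V \<alpha> k)) t :: ('a, 'a) htensor))\<^sup>2) \<le> (C * norm \<alpha> * norm t)\<^sup>2"
proof -
  have "(\<Sum>k\<in>F. (norm ((id_blinfun \<otimes>\<^sub>o adj (V \<alpha> k)) t :: ('a, 'a) htensor))\<^sup>2) \<le> (C * norm \<alpha>)\<^sup>2 * (norm t)\<^sup>2"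
    using V_row[OF F] by (intro id_tensor_sum_sq F adj_Bop V_Bop) (simp add: power_mult_distrib)
  then show ?thesis by (simp add: power_mult_distrib)
qed

text \<open>The identity \<open>V\<^sub>1\<^sub>3 V\<^sub>2\<^sub>3 = W\<^sub>1\<^sub>2\<^sup>* V\<^sub>2\<^sub>3 W\<^sub>1\<^sub>2\<close>, expanded over an orthonormal basis of the representation space.\<close>

lemma corepresentation_has_sum:
  "((\<lambda>k. cinner (adj (V \<alpha> k) a \<otimes>\<^sub>h l) ((id_blinfun \<otimes>\<^sub>o V k \<gamma>) x)) has_sum
    cinner (W (a \<otimes>\<^sub>h l)) ((id_blinfun \<otimes>\<^sub>o V \<alpha> \<gamma>) (W x))) onb"
proof -
  define f where "f x = (\<Sum>\<^sub>\<infinity>k\<in>onb. cinner (adj (V \<alpha> k) a \<otimes>\<^sub>h l) ((id_blinfun \<otimes>\<^sub>o V k \<gamma>) x))" for x :: "('a, 'a) htensor"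
  let ?A = "C * norm \<alpha> * norm a * norm l"
  have A: "(\<Sum>k\<in>F. (norm (adj (V \<alpha> k) a \<otimes>\<^sub>h l))\<^sup>2) \<le> ?A\<^sup>2" if "finite F" "F \<subseteq> onb" for F
    using mult_right_mono[OF V_row[OF that, of \<alpha> a], of "(norm l)\<^sup>2"]
    by (simp add: norm_htens power_mult_distrib sum_distrib_right)
  note cs = cinner_sums_cauchy_schwarz[OF A V_column_id_tensor]
  have sm: "(\<lambda>k. cinner (adj (V \<alpha> k) a \<otimes>\<^sub>h l) ((id_blinfun \<otimes>\<^sub>o V k \<gamma>) x)) summable_on onb"
    and bd: "cmod (f x) \<le> ?A * (C * norm \<gamma> * norm x)" for x
    using cs[of onb \<gamma> x] C_nonneg unfolding f_def by auto
  have bl: "bounded_linear f"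
  proof (rule bounded_linear_intro[where K = "?A * C * norm \<gamma>"])
    show "f (x + y) = f x + f y" for x y
      unfolding f_def by (simp add: blinfun.add_right cinner_add_right infsum_add sm)
    show "f (r *\<^sub>R x) = r *\<^sub>R f x" for r x
      unfolding f_def by (simp add: blinfun.scaleR_right cinner_scaleR_right infsum_cmult_right sm scaleR_conv_of_real)
    show "norm (f x) \<le> norm x * (?A * C * norm \<gamma>)" for x using bd[of x] by (simp add: mult_ac)
  qed
  have "f = (\<lambda>x. cinner (W (a \<otimes>\<^sub>h l)) ((id_blinfun \<otimes>\<^sub>o V \<alpha> \<gamma>) (W x)))"
  proof (rule bounded_linear_eq_htens[OF bl])
    show "bounded_linear (\<lambda>x. cinner (W (a \<otimes>\<^sub>h l)) ((id_blinfun \<otimes>\<^sub>o V \<alpha> \<gamma>) (W x)))"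
      by (intro bounded_linear_compose[OF bounded_linear_cinner_right]
          bounded_linear_compose[OF blinfun.bounded_linear_right blinfun.bounded_linear_right])
    fix c d
    \<comment> \<open>At \<open>x = c \<otimes>\<^sub>h d\<close> the series is Parseval's identity
      in the space of \<open>\<pi>\<close>; boundedness of \<open>f\<close> carries the result to
      all tensors.\<close>
    have "((\<lambda>k. cnj (cinner k (adj (\<pi> (vf a c)) \<alpha>)) * cinner k (\<pi> (vf l d) \<gamma>)) has_sum
        cinner (adj (\<pi> (vf a c)) \<alpha>) (\<pi> (vf l d) \<gamma>)) onb"
      by (rule parseval[OF is_onb_onb])
    moreover have "cnj (cinner k (adj (\<pi> (vf a c)) \<alpha>)) * cinner k (\<pi> (vf l d) \<gamma>)
        = cinner (adj (V \<alpha> k) a \<otimes>\<^sub>h l) ((id_blinfun \<otimes>\<^sub>o V k \<gamma>) (c \<otimes>\<^sub>h d))" for k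
      using cinner_commute[of "adj (\<pi> (vf a c)) \<alpha>" k]
      by (simp add: id_tensor_apply V_Bop cinner_htens cinner_adj_left cinner_V pi_Bop vf_predual)
    ultimately have "f (c \<otimes>\<^sub>h d) = cinner (adj (\<pi> (vf a c)) \<alpha>) (\<pi> (vf l d) \<gamma>)"
      unfolding f_def by (simp add: infsumI)
    then show "f (c \<otimes>\<^sub>h d) = cinner (W (a \<otimes>\<^sub>h l)) ((id_blinfun \<otimes>\<^sub>o V \<alpha> \<gamma>) (W (c \<otimes>\<^sub>h d)))"
      by (simp add: cinner_adj_left pi_Bop vf_predual pi_mult_vf)
  qed
  then have "f x = cinner (W (a \<otimes>\<^sub>h l)) ((id_blinfun \<otimes>\<^sub>o V \<alpha> \<gamma>) (W x))" by (rule fun_cong)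
  then show ?thesis using has_sum_infsum[OF sm, of x] unfolding f_def by simp
qed

end

locale kac_rep_trace = kac_rep M \<phi> \<Lambda> \<Delta> W R \<pi> C
  for M :: "('a::chilbert \<Rightarrow>\<^sub>L 'a) set" and \<phi> \<Lambda> \<Delta> W R
    and \<pi> :: "(('a \<Rightarrow>\<^sub>L 'a) \<Rightarrow> complex) \<Rightarrow> 'k::chilbert \<Rightarrow>\<^sub>L 'k" and C +
  fixes \<xi> :: 'a
  assumes trace: "a \<in> M \<Longrightarrow> b \<in> M \<Longrightarrow> cinner \<xi> (a (b \<xi>)) = cinner \<xi> (b (a \<xi>))"
    and unit: "norm \<xi> = 1"
begin

text \<open>\<open>R_adj_compose_pos\<close> controls the sum of
  \<open>R (Z k) o\<^sub>L adj (R (Z k))\<close>, which would bound the adjoints at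
  \<open>\<xi>\<close>. The trace property of the vector state exchanges the factors and gives the
  square sum of \<open>R (Z k) \<xi>\<close>.\<close>

lemma R_vector_sum_sq:
  assumes F: "finite F" and Z: "\<And>k. k \<in> F \<Longrightarrow> Z k \<in> M"
    and B: "\<And>v. (\<Sum>k\<in>F. (norm (Z k v))\<^sup>2) \<le> B\<^sup>2 * (norm v)\<^sup>2"
  shows "(\<Sum>k\<in>F. (norm (R (Z k) \<xi>))\<^sup>2) \<le> B\<^sup>2"
proof -
  have "cinner \<xi> ((B\<^sup>2 *\<^sub>R id_blinfun - (\<Sum>k\<in>F. R (Z k) o\<^sub>L adj (R (Z k)))) \<xi>) \<in> \<real>\<^sub>\<ge>\<^sub>0"
    using R_adj_compose_pos[OF F Z B] unfolding pos_def by blast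
  moreover have "cinner \<xi> ((\<Sum>k\<in>F. R (Z k) o\<^sub>L adj (R (Z k))) \<xi>) = of_real (\<Sum>k\<in>F. (norm (R (Z k) \<xi>))\<^sup>2)"
  proof -
    have "cinner \<xi> (R (Z k) (adj (R (Z k)) \<xi>)) = of_real ((norm (R (Z k) \<xi>))\<^sup>2)" if "k \<in> F" for k
      using trace[of "R (Z k)" "adj (R (Z k))"] Z[OF that]
      by (simp add: R_M M_adj cinner_adj_right M_Bop cinner_self)
    then show ?thesis by (simp add: blinfun.sum_left cinner_sum_right)
  qed
  ultimately show ?thesis
    by (simp add: blinfun.diff_left blinfun.scaleR_left cinner_diff_right cinner_scaleR_right cinner_self unit
        complex_nonneg_Reals_iff del: of_real_sum)
qed

lemma R_V_sum_sq:
  assumes F: "finite F" "F \<subseteq> onb"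
  shows "(\<Sum>k\<in>F. (norm (R (V k \<beta>) \<xi>))\<^sup>2) \<le> (C * norm \<beta>)\<^sup>2"
  using V_column[OF F] by (intro R_vector_sum_sq F V_M) (simp add: power_mult_distrib)

lemma V_row_unit:
  assumes F: "finite F" "F \<subseteq> onb"
  shows "(\<Sum>k\<in>F. (norm (adj (V \<alpha> k) \<xi>))\<^sup>2) \<le> (C * norm \<alpha>)\<^sup>2"
  using V_row[OF F, of \<alpha> \<xi>] by (simp add: unit)

text \<open>Formally \<open>\<Sum>\<^sub>k V\<^bsub>\<alpha>k\<^esub> S(V\<^bsub>k\<beta>\<^esub>) = \<langle>\<alpha>, \<beta>\<rangle> 1\<close>, the antipode axiom. The second leg of \<open>V\<^bsub>k\<beta>\<^esub>\<close> is cut off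
  at a finite set \<open>L\<close> of basis vectors, where the identity can be computed exactly.\<close>

lemma antipode_pairing_vf:
  fixes \<eta> \<zeta> :: 'a and \<alpha> \<gamma> :: 'k
  defines "\<beta> \<equiv> \<pi> (vf \<eta> \<zeta>) \<gamma>"
  shows "(\<Sum>\<^sub>\<infinity>k\<in>onb. cinner (adj (V \<alpha> k) \<xi>) (R (V k \<beta>) \<xi>)) = cinner \<alpha> \<beta>"
proof -
  \<comment> \<open>By \<open>pi_mult_vf\<close> the coefficient \<open>V k \<beta>\<close> pairs
    \<open>W (u \<otimes>\<^sub>h \<eta>)\<close> with
    \<open>id_blinfun \<otimes>\<^sub>o V k \<gamma>\<close> applied to
    \<open>W (v \<otimes>\<^sub>h \<zeta>)\<close>. Expanding the first vector along its second leg
    gives a sum over all basis vectors \<open>l\<close>; \<open>X\<close> keeps those in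
    \<open>L\<close>, \<open>Y\<close> is the rest, and \<open>\<delta>\<close> is the part of the
    vector outside \<open>L\<close>.\<close>
  define X where "X L k = (\<Sum>l\<in>L. adj (Ws l \<eta>) o\<^sub>L Ws (adj (V k \<gamma>) l) \<zeta>)" for L k
  define Y where "Y L k = V k \<beta> - X L k" for L k
  define \<delta> where "\<delta> L u = W (u \<otimes>\<^sub>h \<eta>) - (\<Sum>l\<in>L. Ws l \<eta> u \<otimes>\<^sub>h l)" for L u
  have XM: "X L k \<in> M" for L k unfolding X_def by (intro M_sum M_compose M_adj Ws_M)
  have YM: "Y L k \<in> M" for L k unfolding Y_def by (intro M_diff V_M XM)
  have on: "orthonormal (onb :: 'a set)" using is_onb_onb unfolding is_onb_def by blast
  have cinner_Y: "cinner u (Y L k v) = cinner (\<delta> L u) ((id_blinfun \<otimes>\<^sub>o V k \<gamma>) (W (v \<otimes>\<^sub>h \<zeta>)))" for L k u v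
  proof -
    have 1: "cinner u (V k \<beta> v) = cinner (W (u \<otimes>\<^sub>h \<eta>)) ((id_blinfun \<otimes>\<^sub>o V k \<gamma>) (W (v \<otimes>\<^sub>h \<zeta>)))"
      unfolding cinner_V \<beta>_def by (rule pi_mult_vf)
    have 2: "cinner u ((adj (Ws l \<eta>) o\<^sub>L Ws (adj (V k \<gamma>) l) \<zeta>) v)
        = cinner (Ws l \<eta> u \<otimes>\<^sub>h l) ((id_blinfun \<otimes>\<^sub>o V k \<gamma>) (W (v \<otimes>\<^sub>h \<zeta>)))" for l
    proof -
      have "cinner u ((adj (Ws l \<eta>) o\<^sub>L Ws (adj (V k \<gamma>) l) \<zeta>) v) = cinner (Ws l \<eta> u \<otimes>\<^sub>h adj (V k \<gamma>) l) (W (v \<otimes>\<^sub>h \<zeta>))"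
        by (simp add: cinner_adj_right Ws_Bop cinner_Ws)
      also have "Ws l \<eta> u \<otimes>\<^sub>h adj (V k \<gamma>) l = adj (id_blinfun \<otimes>\<^sub>o V k \<gamma>) (Ws l \<eta> u \<otimes>\<^sub>h l)"
        by (simp add: adj_id_tensor id_tensor_apply V_Bop)
      finally show ?thesis by (simp add: cinner_adj_left id_tensor_Bop V_Bop)
    qed
    show ?thesis
      unfolding Y_def X_def \<delta>_def blinfun.diff_left cinner_diff_right cinner_diff_left blinfun.sum_left
        cinner_sum_right cinner_sum_left 1 2 ..
  qed
  have norm_\<delta>: "(norm (\<delta> L u))\<^sup>2 = (norm u * norm \<eta>)\<^sup>2 - (\<Sum>l\<in>L. (norm (Ws l \<eta> u))\<^sup>2)"
    if L: "finite L" "L \<subseteq> onb" for L u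
  proof -
    let ?p = "\<Sum>l\<in>L. Ws l \<eta> u \<otimes>\<^sub>h l" and ?s = "\<Sum>l\<in>L. (norm (Ws l \<eta> u))\<^sup>2"
    have o: "cinner l l' = (if l = l' then 1 else 0)" if "l \<in> L" "l' \<in> L" for l l'
      using on L(2) that unfolding orthonormal_def by blast
    have "cinner ?p ?p = (\<Sum>l\<in>L. \<Sum>l'\<in>L. if l = l' then cinner (Ws l \<eta> u) (Ws l' \<eta> u) else 0)"
      unfolding cinner_sum_right cinner_sum_left cinner_htens
      by (subst sum.swap) (intro sum.cong refl, auto simp: o)
    also have "\<dots> = of_real ?s" using L(1) by (simp add: cinner_self)
    finally have pp: "(norm ?p)\<^sup>2 = ?s" unfolding cinner_self of_real_eq_iff .
    have "cinner ?p (W (u \<otimes>\<^sub>h \<eta>)) = of_real ?s"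
      unfolding cinner_sum_left by (simp add: cinner_self flip: cinner_Ws)
    then have "Re (cinner (W (u \<otimes>\<^sub>h \<eta>)) ?p) = ?s"
      using cinner_commute[of "W (u \<otimes>\<^sub>h \<eta>)" ?p] by simp
    then show ?thesis unfolding \<delta>_def norm_diff_sq pp norm_W norm_htens by simp
  qed
  have \<delta>_le: "norm (\<delta> L u) \<le> norm u * norm \<eta>" if L: "finite L" "L \<subseteq> onb" for L u
  proof (rule power2_le_imp_le)
    show "(norm (\<delta> L u))\<^sup>2 \<le> (norm u * norm \<eta>)\<^sup>2" unfolding norm_\<delta>[OF L] by (simp add: sum_nonneg)
  qed simp
  define B where "B = C * norm \<gamma> * norm \<zeta> * norm \<eta>"
  have B: "0 \<le> B" unfolding B_def using C_nonneg by simp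
  \<comment> \<open>A bound uniform in \<open>L\<close>, the domination required by
    \<open>tannery_cinner\<close>; cutting off does not lengthen vectors, by
    \<open>\<delta>_le\<close>.\<close>
  have RY_sum: "(\<Sum>k\<in>F. (norm (R (Y L k) \<xi>))\<^sup>2) \<le> B\<^sup>2"
    if L: "finite L" "L \<subseteq> onb" and F: "finite F" "F \<subseteq> onb" for L F
  proof (rule R_vector_sum_sq[OF F(1) YM])
    fix v
    have le: "norm (Y L k v) \<le> norm \<eta> * norm ((id_blinfun \<otimes>\<^sub>o V k \<gamma>) (W (v \<otimes>\<^sub>h \<zeta>)))" for k
    proof (rule norm_le_cinner)
      fix u
      have "cmod (cinner u (Y L k v)) \<le> norm (\<delta> L u) * norm ((id_blinfun \<otimes>\<^sub>o V k \<gamma>) (W (v \<otimes>\<^sub>h \<zeta>)))"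
        unfolding cinner_Y by (rule cmod_cinner_le)
      also have "\<dots> \<le> (norm u * norm \<eta>) * norm ((id_blinfun \<otimes>\<^sub>o V k \<gamma>) (W (v \<otimes>\<^sub>h \<zeta>)))"
        by (rule mult_right_mono[OF \<delta>_le[OF L]]) simp
      finally show "cmod (cinner u (Y L k v)) \<le> norm \<eta> * norm ((id_blinfun \<otimes>\<^sub>o V k \<gamma>) (W (v \<otimes>\<^sub>h \<zeta>))) * norm u"
        by (simp add: mult_ac)
    qed simp
    have "(\<Sum>k\<in>F. (norm (Y L k v))\<^sup>2) \<le> (\<Sum>k\<in>F. (norm \<eta>)\<^sup>2 * (norm ((id_blinfun \<otimes>\<^sub>o V k \<gamma>) (W (v \<otimes>\<^sub>h \<zeta>))))\<^sup>2)"
      unfolding power_mult_distrib[symmetric] by (intro sum_mono power_mono le) auto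
    also have "\<dots> \<le> (norm \<eta>)\<^sup>2 * (C * norm \<gamma> * norm (W (v \<otimes>\<^sub>h \<zeta>)))\<^sup>2"
      unfolding sum_distrib_left[symmetric] by (intro mult_left_mono V_column_id_tensor F) auto
    finally show "(\<Sum>k\<in>F. (norm (Y L k v))\<^sup>2) \<le> B\<^sup>2 * (norm v)\<^sup>2"
      by (simp add: B_def norm_W norm_htens power_mult_distrib mult_ac)
  qed
  \<comment> \<open>Convergence for fixed \<open>k\<close>:
    \<open>Y L k o\<^sub>L adj (Y L k)\<close> lies below a multiple of the defect of the column sum
    over \<open>L\<close>. Here the reversal of products helps: \<open>R\<close> turns this into a
    bound of \<open>adj (R (Y L k)) o\<^sub>L R (Y L k)\<close> by the defect of the row sum, which
    tends to 0 by \<open>Ws_row_has_sum\<close>.\<close>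
  have RY_le: "(norm (R (Y L k) \<xi>))\<^sup>2 \<le> (norm (V k \<gamma>) * norm \<zeta>)\<^sup>2 * ((norm \<eta>)\<^sup>2 - (\<Sum>l\<in>L. (norm (Ws \<eta> l \<xi>))\<^sup>2))"
    if L: "finite L" "L \<subseteq> onb" for L k
  proof -
    let ?c = "(norm (V k \<gamma>) * norm \<zeta>)\<^sup>2"
    let ?D = "\<Sum>l\<in>L. adj (Ws l \<eta>) o\<^sub>L Ws l \<eta>" and ?E = "\<Sum>l\<in>L. adj (Ws \<eta> l) o\<^sub>L Ws \<eta> l"
    let ?P = "?c *\<^sub>R ((norm \<eta>)\<^sup>2 *\<^sub>R id_blinfun - ?D) - (Y L k o\<^sub>L adj (Y L k))"
    have DM: "?D \<in> M" by (intro M_sum M_compose M_adj Ws_M)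
    have YB: "Y L k \<in> Bop" by (rule M_Bop[OF YM])
    have adjY: "norm (adj (Y L k) u) \<le> norm (V k \<gamma>) * norm \<zeta> * norm (\<delta> L u)" for u
    proof (rule norm_le_cinner)
      fix v
      have "cmod (cinner v (adj (Y L k) u)) = cmod (cinner u (Y L k v))"
        using YB by (simp add: cinner_adj_right) (metis cinner_commute complex_mod_cnj)
      also have "\<dots> \<le> norm (\<delta> L u) * norm ((id_blinfun \<otimes>\<^sub>o V k \<gamma>) (W (v \<otimes>\<^sub>h \<zeta>)))"
        unfolding cinner_Y by (rule cmod_cinner_le)
      also have "\<dots> \<le> norm (\<delta> L u) * (norm (V k \<gamma>) * norm (W (v \<otimes>\<^sub>h \<zeta>)))"
        by (intro mult_left_mono order_trans[OF norm_blinfun] mult_right_mono norm_id_tensor V_Bop) auto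
      finally show "cmod (cinner v (adj (Y L k) u)) \<le> norm (V k \<gamma>) * norm \<zeta> * norm (\<delta> L u) * norm v"
        by (simp add: norm_W norm_htens mult_ac)
    qed simp
    have "?P \<in> pos M"
    proof (rule posI[where r = "\<lambda>u. ?c * (norm (\<delta> L u))\<^sup>2 - (norm (adj (Y L k) u))\<^sup>2"])
      show "?P \<in> M" by (intro M_diff M_scaleR M_id DM M_compose YM M_adj)
      fix u
      have "cinner u (?D u) = of_real (\<Sum>l\<in>L. (norm (Ws l \<eta> u))\<^sup>2)" by (rule cinner_sum_adj) (rule Ws_Bop)
      moreover have "cinner u (Y L k (adj (Y L k) u)) = of_real ((norm (adj (Y L k) u))\<^sup>2)"
        using cinner_adj_left[OF YB, of u "adj (Y L k) u"] by (simp add: cinner_self)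
      ultimately show "cinner u (?P u) = of_real (?c * (norm (\<delta> L u))\<^sup>2 - (norm (adj (Y L k) u))\<^sup>2)"
        unfolding norm_\<delta>[OF L]
        by (simp add: blinfun.diff_left blinfun.scaleR_left cinner_diff_right cinner_scaleR_right cinner_self
            power_mult_distrib mult_ac del: of_real_sum)
      have "(norm (adj (Y L k) u))\<^sup>2 \<le> (norm (V k \<gamma>) * norm \<zeta> * norm (\<delta> L u))\<^sup>2"
        by (rule power_mono[OF adjY]) simp
      then show "0 \<le> ?c * (norm (\<delta> L u))\<^sup>2 - (norm (adj (Y L k) u))\<^sup>2" by (simp add: power_mult_distrib)
    qed
    then have "R ?P \<in> pos M" by (rule R_pos)
    also have "R ?P = ?c *\<^sub>R ((norm \<eta>)\<^sup>2 *\<^sub>R id_blinfun - ?E) - (adj (R (Y L k)) o\<^sub>L R (Y L k))"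
      using R_column_Ws[of \<eta> L] by (simp add: R_diff R_scaleR R_id R_mult R_adj M_diff M_scaleR M_id DM M_compose YM M_adj)
    finally have "cinner \<xi> ((?c *\<^sub>R ((norm \<eta>)\<^sup>2 *\<^sub>R id_blinfun - ?E) - (adj (R (Y L k)) o\<^sub>L R (Y L k))) \<xi>) \<in> \<real>\<^sub>\<ge>\<^sub>0"
      unfolding pos_def by blast
    moreover have "cinner \<xi> (?E \<xi>) = of_real (\<Sum>l\<in>L. (norm (Ws \<eta> l \<xi>))\<^sup>2)" by (rule cinner_sum_adj) (rule Ws_Bop)
    ultimately show ?thesis
      by (simp add: blinfun.diff_left blinfun.scaleR_left cinner_diff_right cinner_scaleR_right cinner_self
          cinner_adj_right M_Bop R_M YM unit complex_nonneg_Reals_iff del: of_real_sum)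
  qed
  \<comment> \<open>For each \<open>l\<close> the sum over \<open>k\<close> is the corepresentation
    identity at \<open>adj W (?b \<otimes>\<^sub>h \<zeta>)\<close>, where the inner
    \<open>W\<close> cancels and an exact value remains.\<close>
  have RX_sum: "((\<lambda>k. cinner (adj (V \<alpha> k) \<xi>) (R (X L k) \<xi>)) has_sum (\<Sum>l\<in>L. cinner (Ws (V \<alpha> \<gamma> \<zeta>) l \<xi>) (Ws \<eta> l \<xi>))) onb"
    if L: "finite L" for L
  proof -
    have 1: "((\<lambda>k. cinner (adj (V \<alpha> k) \<xi>) (adj (Ws \<zeta> (adj (V k \<gamma>) l)) (Ws \<eta> l \<xi>))) has_sum
        cinner (Ws (V \<alpha> \<gamma> \<zeta>) l \<xi>) (Ws \<eta> l \<xi>)) onb" for l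
    proof -
      let ?b = "Ws \<eta> l \<xi>"
      have "((\<lambda>k. cinner (adj (V \<alpha> k) \<xi> \<otimes>\<^sub>h l) ((id_blinfun \<otimes>\<^sub>o V k \<gamma>) (adj W (?b \<otimes>\<^sub>h \<zeta>)))) has_sum
          cinner (W (\<xi> \<otimes>\<^sub>h l)) ((id_blinfun \<otimes>\<^sub>o V \<alpha> \<gamma>) (W (adj W (?b \<otimes>\<^sub>h \<zeta>))))) onb"
        by (rule corepresentation_has_sum)
      also have "(\<lambda>k. cinner (adj (V \<alpha> k) \<xi> \<otimes>\<^sub>h l) ((id_blinfun \<otimes>\<^sub>o V k \<gamma>) (adj W (?b \<otimes>\<^sub>h \<zeta>))))
          = (\<lambda>k. cinner (adj (V \<alpha> k) \<xi>) (adj (Ws \<zeta> (adj (V k \<gamma>) l)) ?b))"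
      proof
        fix k
        have "cinner (adj (V \<alpha> k) \<xi> \<otimes>\<^sub>h l) ((id_blinfun \<otimes>\<^sub>o V k \<gamma>) (adj W (?b \<otimes>\<^sub>h \<zeta>)))
            = cinner (adj (id_blinfun \<otimes>\<^sub>o V k \<gamma>) (adj (V \<alpha> k) \<xi> \<otimes>\<^sub>h l)) (adj W (?b \<otimes>\<^sub>h \<zeta>))"
          by (simp add: cinner_adj_left id_tensor_Bop V_Bop)
        also have "\<dots> = cinner (W (adj (V \<alpha> k) \<xi> \<otimes>\<^sub>h adj (V k \<gamma>) l)) (?b \<otimes>\<^sub>h \<zeta>)"
          by (simp add: adj_id_tensor id_tensor_apply V_Bop cinner_adj_right W_Bop)
        also have "\<dots> = cnj (cinner ?b (Ws \<zeta> (adj (V k \<gamma>) l) (adj (V \<alpha> k) \<xi>)))"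
          unfolding cinner_Ws by (rule cinner_commute)
        also have "\<dots> = cinner (adj (V \<alpha> k) \<xi>) (adj (Ws \<zeta> (adj (V k \<gamma>) l)) ?b)"
          by (simp add: cinner_adj_right Ws_Bop flip: cinner_commute)
        finally show "cinner (adj (V \<alpha> k) \<xi> \<otimes>\<^sub>h l) ((id_blinfun \<otimes>\<^sub>o V k \<gamma>) (adj W (?b \<otimes>\<^sub>h \<zeta>)))
            = cinner (adj (V \<alpha> k) \<xi>) (adj (Ws \<zeta> (adj (V k \<gamma>) l)) ?b)" .
      qed
      also have "cinner (W (\<xi> \<otimes>\<^sub>h l)) ((id_blinfun \<otimes>\<^sub>o V \<alpha> \<gamma>) (W (adj W (?b \<otimes>\<^sub>h \<zeta>)))) = cinner (Ws (V \<alpha> \<gamma> \<zeta>) l \<xi>) ?b"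
      proof -
        have "cinner (W (\<xi> \<otimes>\<^sub>h l)) (?b \<otimes>\<^sub>h V \<alpha> \<gamma> \<zeta>) = cnj (cinner ?b (Ws (V \<alpha> \<gamma> \<zeta>) l \<xi>))"
          unfolding cinner_Ws by (rule cinner_commute)
        then show ?thesis by (simp add: W_unitary id_tensor_apply V_Bop flip: cinner_commute)
      qed
      finally show ?thesis .
    qed
    have RX: "R (X L k) \<xi> = (\<Sum>l\<in>L. adj (Ws \<zeta> (adj (V k \<gamma>) l)) (Ws \<eta> l \<xi>))" for k
      unfolding X_def
      by (subst R_sum) (auto simp: M_compose M_adj Ws_M R_mult R_adj R_Ws adj_adj Ws_Bop blinfun.sum_left)
    show ?thesis unfolding RX cinner_sum_right using L
      by (induction L rule: finite_induct) (auto intro!: has_sum_add 1 has_sum_0)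
  qed
  let ?G = "finite_subsets_at_top (onb :: 'a set)"
  have ev: "\<forall>\<^sub>F L in ?G. finite L \<and> L \<subseteq> onb" by (rule eventually_finite_subsets_at_top_weakI) auto
  let ?err = "\<lambda>L. \<Sum>\<^sub>\<infinity>k\<in>onb. cinner (adj (V \<alpha> k) \<xi>) (R (Y L k) \<xi>)"
  have err: "(?err \<longlongrightarrow> 0) ?G"
  proof (rule tannery_cinner[where B = B])
    show "\<forall>\<^sub>F L in ?G. \<forall>F. finite F \<and> F \<subseteq> onb \<longrightarrow> (\<Sum>k\<in>F. (norm (R (Y L k) \<xi>))\<^sup>2) \<le> B\<^sup>2"
      using ev by eventually_elim (use RY_sum in blast)
    fix k
    let ?r = "\<lambda>L. (norm (V k \<gamma>) * norm \<zeta>)\<^sup>2 * ((norm \<eta>)\<^sup>2 - (\<Sum>l\<in>L. (norm (Ws \<eta> l \<xi>))\<^sup>2))"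
    have "(sum (\<lambda>l. (norm (Ws \<eta> l \<xi>))\<^sup>2) \<longlongrightarrow> (norm \<eta>)\<^sup>2) ?G"
      using Ws_row_has_sum[of \<eta> \<xi>] unfolding has_sum_def by (simp add: unit)
    then have "((\<lambda>L. sqrt (?r L)) \<longlongrightarrow> sqrt ((norm (V k \<gamma>) * norm \<zeta>)\<^sup>2 * ((norm \<eta>)\<^sup>2 - (norm \<eta>)\<^sup>2))) ?G"
      by (intro tendsto_real_sqrt tendsto_mult tendsto_diff tendsto_const)
    then have z: "((\<lambda>L. sqrt (?r L)) \<longlongrightarrow> 0) ?G" by simp
    show "((\<lambda>L. R (Y L k) \<xi>) \<longlongrightarrow> 0) ?G"
    proof (rule Lim_null_comparison[OF _ z])
      show "\<forall>\<^sub>F L in ?G. norm (R (Y L k) \<xi>) \<le> sqrt (?r L)"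
        using ev by eventually_elim (use RY_le real_le_rsqrt in blast)
    qed
  qed (use V_row_unit B in auto)
  let ?T = "\<Sum>\<^sub>\<infinity>k\<in>onb. cinner (adj (V \<alpha> k) \<xi>) (R (V k \<beta>) \<xi>)"
  let ?S = "\<lambda>L. \<Sum>l\<in>L. cinner (Ws (V \<alpha> \<gamma> \<zeta>) l \<xi>) (Ws \<eta> l \<xi>)"
  \<comment> \<open>For every finite \<open>L\<close> the full series splits exactly into truncated
    part and error, so its value can be read off in the limit, where
    \<open>Ws_row_orthogonality\<close> evaluates the truncated part.\<close>
  have "\<forall>\<^sub>F L in ?G. ?S L + ?err L = ?T"
    using ev
  proof eventually_elim
    case (elim L)
    have "(\<lambda>k. cinner (adj (V \<alpha> k) \<xi>) (R (Y L k) \<xi>)) summable_on onb"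
      by (rule cinner_sums_cauchy_schwarz(1)[OF V_row_unit RY_sum]) (use elim B C_nonneg in auto)
    then have "((\<lambda>k. cinner (adj (V \<alpha> k) \<xi>) (R (X L k) \<xi>) + cinner (adj (V \<alpha> k) \<xi>) (R (Y L k) \<xi>)) has_sum ?S L + ?err L) onb"
      using elim by (intro has_sum_add RX_sum has_sum_infsum) auto
    moreover have "cinner (adj (V \<alpha> k) \<xi>) (R (X L k) \<xi>) + cinner (adj (V \<alpha> k) \<xi>) (R (Y L k) \<xi>)
        = cinner (adj (V \<alpha> k) \<xi>) (R (V k \<beta>) \<xi>)" for k
      using XM[of L k] by (simp add: Y_def R_diff V_M blinfun.diff_left cinner_diff_right)
    ultimately show "?S L + ?err L = ?T" by (simp add: infsumI)
  qed
  then have "((\<lambda>L. ?S L + ?err L) \<longlongrightarrow> ?T) ?G" by (rule tendsto_eventually)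
  moreover have "((\<lambda>L. ?S L + ?err L) \<longlongrightarrow> cinner \<eta> (V \<alpha> \<gamma> \<zeta>) + 0) ?G"
    using Ws_row_orthogonality[of "V \<alpha> \<gamma> \<zeta>" \<xi> \<eta>] unfolding has_sum_def
    by (intro tendsto_add err) (simp add: unit)
  ultimately have "?T = cinner \<eta> (V \<alpha> \<gamma> \<zeta>) + 0"
    by (rule tendsto_unique[OF finite_subsets_at_top_neq_bot])
  then show ?thesis by (simp add: cinner_V \<beta>_def)
qed

end

section \<open>The averaged form\<close>

context kac_rep
begin

text \<open>The hypothesis on \<open>v\<close> says that all \<open>V v \<gamma>\<close> vanish, and
  these coefficients determine \<open>cinner v (\<pi> w \<gamma>)\<close> for every \<open>w\<close>
  of the predual.\<close>

lemma nondegenerate_vf: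
  assumes nd: "nondegenerate M \<pi>" and v: "\<And>\<eta> \<zeta> \<gamma>. cinner v (\<pi> (vf \<eta> \<zeta>) \<gamma>) = 0"
  shows "v = 0"
proof -
  have V0: "V v \<gamma> = 0" for \<gamma> by (rule cinner_ext_op) (simp add: cinner_V v)
  have w0: "cinner v (\<pi> w \<gamma>) = 0" if "w \<in> predual M" for w \<gamma>
  proof (rule predual_finite_sum[OF that])
    fix n c \<mu> \<nu>
    assume sm: "\<And>i. summable (\<lambda>k. (norm (\<mu> i k :: 'a))\<^sup>2)" "\<And>i. summable (\<lambda>k. (norm (\<nu> i k :: 'a))\<^sup>2)"
      and w: "w = (\<lambda>x. \<Sum>i<n::nat. c i * tf (\<mu> i) (\<nu> i) x)"
    have tfp: "tf (\<mu> i) (\<nu> i) \<in> predual M" for i by (rule tf_predual[OF sm])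
    have "\<pi> w = (\<Sum>i<n. c i *\<^sub>B \<pi> (tf (\<mu> i) (\<nu> i)))"
      unfolding w using tfp by (subst pi_sum) (auto simp: pi_scale predual_scale)
    then show ?thesis
      by (simp add: blinfun.sum_left cinner_sum_right cinner_scaleC_right V_tf_tendsto[OF sm] V0)
  qed
  have "cinner v x = 0" if "x \<in> span {\<pi> w \<xi> | w \<xi>. w \<in> predual M}" for x
    using that
  proof (rule span_induct)
    show "subspace {x. cinner v x = 0}" by (auto simp: subspace_def cinner_add_right cinner_scaleR_right)
  qed (use w0 in auto)
  note span0 = this
  have "cinner v x = 0" for x
    by (rule dense_eq[where D = "span {\<pi> w \<xi> | w \<xi>. w \<in> predual M}" and f = "\<lambda>x. cinner v x" and g = "\<lambda>_. 0"])
      (use nd span0 in \<open>auto simp: nondegenerate_def intro!: continuous_on_cinner continuous_on_const continuous_on_id\<close>)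
  then show ?thesis by (metis cinner_self_eq_0)
qed

definition q :: "'a \<Rightarrow> 'k \<Rightarrow> 'k \<Rightarrow> complex" where
  "q \<xi> \<alpha> \<beta> = (\<Sum>\<^sub>\<infinity>k\<in>onb. cinner (adj (V \<alpha> k) \<xi>) (adj (V \<beta> k) \<xi>))"

lemma adj_V_linear: "adj (V (\<alpha> + \<beta>) k) = adj (V \<alpha> k) + adj (V \<beta> k)" "adj (V (c *\<^sub>C \<alpha>) k) = c *\<^sub>B adj (V \<alpha> k)"
  by (simp_all add: V_linear adj_add adj_scaleC V_Bop)

lemma q_summable: "(\<lambda>k. cinner (adj (V \<alpha> k) \<xi>) (adj (V \<beta> k) \<xi>)) summable_on onb"
  and q_bound: "cmod (q \<xi> \<alpha> \<beta>) \<le> (C * norm \<alpha> * norm \<xi>) * (C * norm \<beta> * norm \<xi>)"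
  using cinner_sums_cauchy_schwarz[OF V_row V_row, of onb \<alpha> \<xi> \<beta> \<xi>] C_nonneg unfolding q_def by auto

lemma q_sesquilinear:
  "q \<xi> (\<alpha> + \<alpha>') \<beta> = q \<xi> \<alpha> \<beta> + q \<xi> \<alpha>' \<beta>" "q \<xi> (c *\<^sub>C \<alpha>) \<beta> = cnj c * q \<xi> \<alpha> \<beta>"
  "q \<xi> \<alpha> (\<beta> + \<beta>') = q \<xi> \<alpha> \<beta> + q \<xi> \<alpha> \<beta>'" "q \<xi> \<alpha> (c *\<^sub>C \<beta>) = c * q \<xi> \<alpha> \<beta>"
  unfolding q_def by (simp_all add: adj_V_linear blinfun.add_left cinner_add_left cinner_add_right
      cinner_scaleC_left cinner_scaleC_right infsum_add q_summable infsum_cmult_right)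

lemma q_hermitian: "q \<xi> \<beta> \<alpha> = cnj (q \<xi> \<alpha> \<beta>)"
  unfolding q_def infsum_cnj[symmetric] by (simp flip: cinner_commute)

lemma q_self_has_sum: "((\<lambda>k. (norm (adj (V \<alpha> k) \<xi>))\<^sup>2) has_sum Re (q \<xi> \<alpha> \<alpha>)) onb"
  using has_sum_Re[OF has_sum_infsum[OF q_summable[of \<alpha> \<xi> \<alpha>]]]
  by (simp add: q_def cinner_self del: of_real_power)

text \<open>With \<open>\<lambda>(w) = (w \<otimes> id)(W)\<close> the summands are \<open>\<langle>V\<^bsub>\<alpha>k\<^esub>\<^sup>*\<xi>, \<lambda>(w) V\<^bsub>\<beta>k\<^esub>\<^sup>*\<xi>\<rangle>\<close>.\<close>

definition q_twisted :: "(('a \<Rightarrow>\<^sub>L 'a) \<Rightarrow> complex) \<Rightarrow> 'a \<Rightarrow> 'k \<Rightarrow> 'k \<Rightarrow> complex" where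
  "q_twisted w \<xi> \<alpha> \<beta> = (\<Sum>\<^sub>\<infinity>k\<in>onb. w (Ws (adj (V \<alpha> k) \<xi>) (adj (V \<beta> k) \<xi>)))"

lemma
  assumes K: "0 \<le> K" "\<And>x. x \<in> M \<Longrightarrow> cmod (w x) \<le> K * norm x"
  shows q_twisted_summable: "(\<lambda>k. w (Ws (adj (V \<alpha> k) \<xi>) (adj (V \<beta> k) \<xi>))) summable_on onb"
    and q_twisted_bound: "cmod (q_twisted w \<xi> \<alpha> \<beta>) \<le> K * ((C * norm \<alpha> * norm \<xi>) * (C * norm \<beta> * norm \<xi>))"
proof -
  have nW: "norm W \<le> 1" by (rule norm_blinfun_bound) (auto simp: norm_W)
  have "cmod (w (Ws a b)) \<le> K * (norm a * norm b)" for a b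
  proof -
    have "cmod (w (Ws a b)) \<le> K * norm (Ws a b)" by (rule K(2)[OF Ws_M])
    also have "\<dots> \<le> K * (norm W * norm a * norm b)" by (intro mult_left_mono norm_vslice_right W_Bop K)
    also have "\<dots> \<le> K * (1 * norm a * norm b)" by (intro mult_left_mono mult_right_mono nW K) auto
    finally show ?thesis by simp
  qed
  from sums_cauchy_schwarz[OF this K(1) V_row V_row, of onb \<alpha> \<xi> \<beta> \<xi>] C_nonneg
  show "(\<lambda>k. w (Ws (adj (V \<alpha> k) \<xi>) (adj (V \<beta> k) \<xi>))) summable_on onb"
    "cmod (q_twisted w \<xi> \<alpha> \<beta>) \<le> K * ((C * norm \<alpha> * norm \<xi>) * (C * norm \<beta> * norm \<xi>))"
    unfolding q_twisted_def by auto
qed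

lemma vf_bound: "x \<in> M \<Longrightarrow> cmod (vf u v x) \<le> (norm u * norm v) * norm x"
  unfolding vf_def using order_trans[OF cmod_cinner_le mult_left_mono[OF norm_blinfun[of x v], of "norm u"]]
  by (simp add: mult_ac)

text \<open>By \<open>pi_mult_vf\<close> the first form is a sum of pairings of
  \<open>W (\<eta> \<otimes>\<^sub>h \<xi>)\<close>, moved by the row
  \<open>adj (V \<alpha> k)\<close>, with \<open>W (\<zeta> \<otimes>\<^sub>h ?z k)\<close>. The
  twisted form is the same sum with \<open>\<eta> \<otimes>\<^sub>h \<xi>\<close> in place of
  \<open>W (\<eta> \<otimes>\<^sub>h \<xi>)\<close>, so the difference is governed by how far
  \<open>\<xi>\<close> is from being invariant.\<close>

lemma q_intertwine_vf:
  assumes unit: "norm \<xi> = 1"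
  shows "cmod (q \<xi> (adj (\<pi> (vf \<eta> \<zeta>)) \<alpha>) \<beta> - q_twisted (vf \<eta> \<zeta>) \<xi> \<alpha> \<beta>)
    \<le> (C * norm \<alpha> * norm (W (\<eta> \<otimes>\<^sub>h \<xi>) - \<eta> \<otimes>\<^sub>h \<xi>)) * (C * norm \<beta> * norm \<zeta>)"
proof -
  let ?\<delta> = "W (\<eta> \<otimes>\<^sub>h \<xi>) - \<eta> \<otimes>\<^sub>h \<xi>" and ?\<alpha> = "adj (\<pi> (vf \<eta> \<zeta>)) \<alpha>"
  let ?z = "\<lambda>k. adj (V \<beta> k) \<xi>"
  have 1: "cinner (adj (V ?\<alpha> k) \<xi>) z = cinner ((id_blinfun \<otimes>\<^sub>o adj (V \<alpha> k)) (W (\<eta> \<otimes>\<^sub>h \<xi>))) (W (\<zeta> \<otimes>\<^sub>h z))" for k z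
  proof -
    have "cinner (adj (V ?\<alpha> k) \<xi>) z = cinner \<alpha> (\<pi> (vf \<eta> \<zeta>) (\<pi> (vf \<xi> z) k))"
      by (simp add: cinner_adj_left V_Bop cinner_V pi_Bop vf_predual)
    also have "\<dots> = cinner (adj (id_blinfun \<otimes>\<^sub>o V \<alpha> k) (W (\<eta> \<otimes>\<^sub>h \<xi>))) (W (\<zeta> \<otimes>\<^sub>h z))"
      by (simp add: pi_mult_vf cinner_adj_left id_tensor_Bop V_Bop)
    finally show ?thesis by (simp add: adj_id_tensor V_Bop)
  qed
  have 2: "vf \<eta> \<zeta> (Ws (adj (V \<alpha> k) \<xi>) z) = cinner ((id_blinfun \<otimes>\<^sub>o adj (V \<alpha> k)) (\<eta> \<otimes>\<^sub>h \<xi>)) (W (\<zeta> \<otimes>\<^sub>h z))" for k z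
    by (simp add: vf_def Ws_M cinner_Ws id_tensor_apply V_Bop)
  have "q \<xi> ?\<alpha> \<beta> - q_twisted (vf \<eta> \<zeta>) \<xi> \<alpha> \<beta>
      = (\<Sum>\<^sub>\<infinity>k\<in>onb. cinner (adj (V ?\<alpha> k) \<xi>) (?z k) - vf \<eta> \<zeta> (Ws (adj (V \<alpha> k) \<xi>) (?z k)))"
    using has_sum_add[OF has_sum_infsum[OF q_summable] has_sum_uminusI[OF has_sum_infsum[OF q_twisted_summable[OF _ vf_bound]]]]
    unfolding q_def q_twisted_def by (intro infsumI[symmetric]) simp
  also have "\<dots> = (\<Sum>\<^sub>\<infinity>k\<in>onb. cinner ((id_blinfun \<otimes>\<^sub>o adj (V \<alpha> k)) ?\<delta>) (W (\<zeta> \<otimes>\<^sub>h ?z k)))"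
    unfolding 1 2 by (simp add: blinfun.diff_right cinner_diff_left)
  also have "cmod \<dots> \<le> (C * norm \<alpha> * norm ?\<delta>) * (C * norm \<beta> * norm \<zeta>)"
  proof (rule cinner_sums_cauchy_schwarz(2)[OF V_row_id_tensor])
    fix F :: "'k set" assume F: "finite F" "F \<subseteq> onb"
    have "(\<Sum>k\<in>F. (norm (W (\<zeta> \<otimes>\<^sub>h ?z k)))\<^sup>2) = (\<Sum>k\<in>F. (norm (?z k))\<^sup>2) * (norm \<zeta>)\<^sup>2"
      unfolding sum_distrib_right by (simp add: norm_W norm_htens power_mult_distrib mult.commute)
    also have "\<dots> \<le> (C * norm \<beta> * norm \<xi>)\<^sup>2 * (norm \<zeta>)\<^sup>2" by (intro mult_right_mono V_row F) simp
    finally show "(\<Sum>k\<in>F. (norm (W (\<zeta> \<otimes>\<^sub>h ?z k)))\<^sup>2) \<le> (C * norm \<beta> * norm \<zeta>)\<^sup>2"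
      by (simp add: unit power_mult_distrib)
  qed (use C_nonneg in auto)
  finally show ?thesis .
qed

end

context kac_rep_trace
begin

text \<open>\<open>D\<close> collects the \<open>\<beta>\<close> that satisfy the antipode identity;
  it contains the vectors of \<open>antipode_pairing_vf\<close> and is dense by nondegeneracy.
  Cauchy-Schwarz gives the inequality on \<open>D\<close>, and an inequality, unlike the series,
  passes to the closure at once.\<close>

lemma antipode_pairing_bound:
  assumes nd: "nondegenerate M \<pi>"
  shows "cmod (cinner \<alpha> \<beta>) \<le> sqrt (Re (q \<xi> \<alpha> \<alpha>)) * (C * norm \<beta>)"
proof -
  let ?t = "\<lambda>\<alpha> \<beta> k. cinner (adj (V \<alpha> k) \<xi>) (R (V k \<beta>) \<xi>)"
  define D where "D = {\<beta>. \<forall>\<alpha>. (\<Sum>\<^sub>\<infinity>k\<in>onb. ?t \<alpha> \<beta> k) = cinner \<alpha> \<beta>}"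
  have sm: "?t \<alpha> \<beta> summable_on onb" for \<alpha> \<beta>
    by (rule cinner_sums_cauchy_schwarz(1)[OF V_row_unit R_V_sum_sq]) (use C_nonneg in auto)
  have dense: "closure D = UNIV"
  proof (rule dense_if_orthogonal_zero)
    have "R (V k 0) = 0" for k by (simp add: V_linear R_zero)
    then show "0 \<in> D" unfolding D_def by simp
    show "\<beta> + \<beta>' \<in> D" if "\<beta> \<in> D" "\<beta>' \<in> D" for \<beta> \<beta>'
      using that unfolding D_def
      by (simp add: V_linear R_add V_M blinfun.add_left cinner_add_right infsum_add sm)
    show "c *\<^sub>C \<beta> \<in> D" if "\<beta> \<in> D" for c \<beta>
      using that unfolding D_def
      by (simp add: V_linear R_scaleC V_M cinner_scaleC_right infsum_cmult_right sm)
    fix v assume v: "\<And>d. d \<in> D \<Longrightarrow> cinner v d = 0"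
    show "v = 0"
      by (rule nondegenerate_vf[OF nd], rule v) (simp add: D_def antipode_pairing_vf)
  qed
  have q: "(\<Sum>k\<in>F. (norm (adj (V \<alpha> k) \<xi>))\<^sup>2) \<le> (sqrt (Re (q \<xi> \<alpha> \<alpha>)))\<^sup>2" if "finite F" "F \<subseteq> onb" for F
  proof -
    have "(\<Sum>k\<in>F. (norm (adj (V \<alpha> k) \<xi>))\<^sup>2) \<le> Re (q \<xi> \<alpha> \<alpha>)"
      by (rule finite_sum_le_has_sum[OF q_self_has_sum that]) simp
    moreover have "0 \<le> (\<Sum>k\<in>F. (norm (adj (V \<alpha> k) \<xi>))\<^sup>2)" by (rule sum_nonneg) simp
    ultimately show ?thesis by simp
  qed
  have q0: "0 \<le> Re (q \<xi> \<alpha> \<alpha>)" by (rule has_sum_nonneg[OF q_self_has_sum]) simp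
  have "cmod (cinner \<alpha> \<beta>) \<le> sqrt (Re (q \<xi> \<alpha> \<alpha>)) * (C * norm \<beta>)" if "\<beta> \<in> D" for \<beta>
    using cinner_sums_cauchy_schwarz(2)[OF q R_V_sum_sq, of onb \<beta>] that q0 C_nonneg unfolding D_def by auto
  moreover have "closed {\<beta>. cmod (cinner \<alpha> \<beta>) \<le> sqrt (Re (q \<xi> \<alpha> \<alpha>)) * (C * norm \<beta>)}"
    by (intro closed_Collect_le continuous_intros)
  ultimately have "closure D \<subseteq> {\<beta>. cmod (cinner \<alpha> \<beta>) \<le> sqrt (Re (q \<xi> \<alpha> \<alpha>)) * (C * norm \<beta>)}"
    by (intro closure_minimal) auto
  then show ?thesis unfolding dense by blast
qed

lemma q_lower:
  assumes "nondegenerate M \<pi>"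
  shows "(norm \<alpha>)\<^sup>2 \<le> C\<^sup>2 * Re (q \<xi> \<alpha> \<alpha>)"
proof (cases "\<alpha> = 0")
  case False
  have q0: "0 \<le> Re (q \<xi> \<alpha> \<alpha>)" by (rule has_sum_nonneg[OF q_self_has_sum]) simp
  have "norm \<alpha> * norm \<alpha> \<le> (C * sqrt (Re (q \<xi> \<alpha> \<alpha>))) * norm \<alpha>"
    using antipode_pairing_bound[OF assms, of \<alpha> \<alpha>] by (simp add: cinner_self norm_mult power2_eq_square mult_ac)
  then have "norm \<alpha> \<le> C * sqrt (Re (q \<xi> \<alpha> \<alpha>))" using False by simp
  then have "(norm \<alpha>)\<^sup>2 \<le> (C * sqrt (Re (q \<xi> \<alpha> \<alpha>)))\<^sup>2" by (rule power_mono) simp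
  then show ?thesis using q0 by (simp add: power_mult_distrib)
qed (use has_sum_nonneg[OF q_self_has_sum] in auto)

end

section \<open>Passing to the limit along the net\<close>

lemma pointwise_cluster_filter:
  fixes f :: "'j \<Rightarrow> 'i \<Rightarrow> complex"
  assumes F: "F \<noteq> bot" and bd: "\<And>j i. cmod (f j i) \<le> B i"
  obtains F' g where "F' \<le> F" "F' \<noteq> bot" "\<And>i. ((\<lambda>j. f j i) \<longlongrightarrow> g i) F'"
proof -
  \<comment> \<open>Tychonoff: all values together lie in a product of discs, which is compact, so
    the whole family has a cluster point.\<close>
  define U where "U = PiE UNIV (\<lambda>i. cball (0 :: complex) (B i))"
  have "compactin (product_topology (\<lambda>_. euclidean) UNIV) U"
    unfolding U_def compactin_PiE by (simp add: compactin_euclidean_iff)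
  then have "compact U" by (simp add: euclidean_product_topology compactin_euclidean_iff)
  moreover have "filtermap f F \<noteq> bot" using F by (simp add: filtermap_bot_iff)
  moreover have "eventually (\<lambda>x. x \<in> U) (filtermap f F)"
    unfolding eventually_filtermap U_def PiE_UNIV_domain using bd by (intro always_eventually) auto
  ultimately obtain g where g: "inf (nhds g) (filtermap f F) \<noteq> bot" unfolding compact_filter by blast
  \<comment> \<open>\<open>F\<close> refined by the preimages of the neighbourhoods of
    \<open>g\<close>: it converges to \<open>g\<close> and keeps whatever holds eventually along
    \<open>F\<close>.\<close>
  define F' where "F' = inf (filtercomap f (nhds g)) F"
  have "F' \<noteq> bot"
  proof
    assume "F' = bot"
    then have "eventually (\<lambda>_. False) (inf (filtercomap f (nhds g)) F)" unfolding F'_def by simp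
    then obtain P Q where PQ: "eventually P (filtercomap f (nhds g))" "eventually Q F" "\<And>x. P x \<Longrightarrow> Q x \<Longrightarrow> False"
      unfolding eventually_inf by blast
    then obtain P' where P': "eventually P' (nhds g)" "\<And>x. P' (f x) \<Longrightarrow> P x"
      unfolding eventually_filtercomap by blast
    have "eventually (\<lambda>y. \<not> P' y) (filtermap f F)"
      unfolding eventually_filtermap using PQ(2) by eventually_elim (use PQ(3) P'(2) in blast)
    then have "eventually (\<lambda>_. False) (inf (nhds g) (filtermap f F))"
      using P'(1) unfolding eventually_inf by blast
    then show False using g by (simp add: trivial_limit_def)
  qed
  have lim: "(f \<longlongrightarrow> g) F'"
    unfolding F'_def by (rule tendsto_mono[OF inf_le1]) (rule filterlim_filtercomap)
  have "((\<lambda>j. f j i) \<longlongrightarrow> g i) F'" for i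
    by (rule continuous_on_tendsto_compose[OF continuous_on_product_coordinates[of i] lim]) auto
  moreover have "F' \<le> F" unfolding F'_def by simp
  ultimately show thesis using \<open>F' \<noteq> bot\<close> that by blast
qed

locale kac_rep_net = kac_rep M \<phi> \<Lambda> \<Delta> W R \<pi> C
  for M :: "('a::chilbert \<Rightarrow>\<^sub>L 'a) set" and \<phi> \<Lambda> \<Delta> W R
    and \<pi> :: "(('a \<Rightarrow>\<^sub>L 'a) \<Rightarrow> complex) \<Rightarrow> 'k::chilbert \<Rightarrow>\<^sub>L 'k" and C +
  fixes \<xi> :: "'j \<Rightarrow> 'a" and F :: "'j filter"
  assumes F: "F \<noteq> bot" and unit: "norm (\<xi> j) = 1"
    and trace: "a \<in> M \<Longrightarrow> b \<in> M \<Longrightarrow> cinner (\<xi> j) (a (b (\<xi> j))) = cinner (\<xi> j) (b (a (\<xi> j)))"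
    and invariant: "((\<lambda>j. norm (W (\<eta> \<otimes>\<^sub>h \<xi> j) - \<eta> \<otimes>\<^sub>h \<xi> j)) \<longlongrightarrow> 0) F"
    and nd: "nondegenerate M \<pi>"
begin

lemma q_bound_unit: "cmod (q (\<xi> j) \<alpha> \<beta>) \<le> C\<^sup>2 * norm \<alpha> * norm \<beta>"
  using q_bound[of "\<xi> j" \<alpha> \<beta>] by (simp add: unit power2_eq_square mult_ac)

lemma q_lower_unit: "(norm \<alpha>)\<^sup>2 \<le> C\<^sup>2 * Re (q (\<xi> j) \<alpha> \<alpha>)"
proof -
  interpret kac_rep_trace M \<phi> \<Lambda> \<Delta> W R \<pi> C "\<xi> j"
    by standard (use trace unit in auto)
  show ?thesis by (rule q_lower[OF nd])
qed

text \<open>The property is made to be linear in \<open>w\<close>. The bound by \<open>K\<close>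
  belongs to it because the twisted series of a sum of functionals can be split only if both parts
  converge.\<close>

definition intertwined :: "(('a \<Rightarrow>\<^sub>L 'a) \<Rightarrow> complex) \<Rightarrow> bool" where
  "intertwined w \<longleftrightarrow> w \<in> predual M \<and> (\<exists>K\<ge>0. \<forall>x\<in>M. cmod (w x) \<le> K * norm x) \<and>
    (\<forall>\<alpha> \<beta>. ((\<lambda>j. q (\<xi> j) (adj (\<pi> w) \<alpha>) \<beta> - q_twisted w (\<xi> j) \<alpha> \<beta>) \<longlongrightarrow> 0) F)"

lemma intertwined_vf: "intertwined (vf \<eta> \<zeta>)"
  unfolding intertwined_def
proof (intro conjI allI)
  show "\<exists>K\<ge>0. \<forall>x\<in>M. cmod (vf \<eta> \<zeta> x) \<le> K * norm x"
    using vf_bound by (intro exI[of _ "norm \<eta> * norm \<zeta>"]) auto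
  fix \<alpha> \<beta> :: 'k
  have "((\<lambda>j. (C * norm \<alpha> * norm (W (\<eta> \<otimes>\<^sub>h \<xi> j) - \<eta> \<otimes>\<^sub>h \<xi> j)) * (C * norm \<beta> * norm \<zeta>)) \<longlongrightarrow> (C * norm \<alpha> * 0) * (C * norm \<beta> * norm \<zeta>)) F"
    by (intro tendsto_mult tendsto_const invariant)
  then have lim: "((\<lambda>j. (C * norm \<alpha> * norm (W (\<eta> \<otimes>\<^sub>h \<xi> j) - \<eta> \<otimes>\<^sub>h \<xi> j)) * (C * norm \<beta> * norm \<zeta>)) \<longlongrightarrow> 0) F"
    by simp
  show "((\<lambda>j. q (\<xi> j) (adj (\<pi> (vf \<eta> \<zeta>)) \<alpha>) \<beta> - q_twisted (vf \<eta> \<zeta>) (\<xi> j) \<alpha> \<beta>) \<longlongrightarrow> 0) F"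
    by (rule Lim_null_comparison[OF _ lim]) (intro always_eventually allI q_intertwine_vf unit)
qed (rule vf_predual)

lemma intertwined_add:
  assumes w: "intertwined w" and w': "intertwined w'"
  shows "intertwined (\<lambda>x. w x + w' x)"
proof -
  obtain K K' where K: "0 \<le> K" "\<And>x. x \<in> M \<Longrightarrow> cmod (w x) \<le> K * norm x"
    "0 \<le> K'" "\<And>x. x \<in> M \<Longrightarrow> cmod (w' x) \<le> K' * norm x"
    using w w' unfolding intertwined_def by blast
  have p: "w \<in> predual M" "w' \<in> predual M" using w w' unfolding intertwined_def by auto
  have "cmod (w x + w' x) \<le> (K + K') * norm x" if "x \<in> M" for x
    using norm_triangle_ineq[of "w x" "w' x"] K(2,4)[OF that] by (simp add: distrib_right)
  then have "\<exists>K\<ge>0. \<forall>x\<in>M. cmod (w x + w' x) \<le> K * norm x" using K(1,3) by (intro exI[of _ "K + K'"]) auto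
  moreover have "q (\<xi> j) (adj (\<pi> (\<lambda>x. w x + w' x)) \<alpha>) \<beta> - q_twisted (\<lambda>x. w x + w' x) (\<xi> j) \<alpha> \<beta>
      = (q (\<xi> j) (adj (\<pi> w) \<alpha>) \<beta> - q_twisted w (\<xi> j) \<alpha> \<beta>) + (q (\<xi> j) (adj (\<pi> w') \<alpha>) \<beta> - q_twisted w' (\<xi> j) \<alpha> \<beta>)" for j \<alpha> \<beta>
    unfolding q_twisted_def
    by (simp add: pi_add p adj_add pi_Bop blinfun.add_left q_sesquilinear
        infsum_add[OF q_twisted_summable[OF K(1,2)] q_twisted_summable[OF K(3,4)]])
  moreover have "((\<lambda>j. (q (\<xi> j) (adj (\<pi> w) \<alpha>) \<beta> - q_twisted w (\<xi> j) \<alpha> \<beta>) + (q (\<xi> j) (adj (\<pi> w') \<alpha>) \<beta> - q_twisted w' (\<xi> j) \<alpha> \<beta>)) \<longlongrightarrow> 0) F" for \<alpha> \<beta>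
    using w w' unfolding intertwined_def by (intro tendsto_add_zero) auto
  ultimately show ?thesis unfolding intertwined_def using predual_add[OF p] by simp
qed

lemma intertwined_scale:
  assumes w: "intertwined w"
  shows "intertwined (\<lambda>x. c * w x)"
proof -
  obtain K where K: "0 \<le> K" "\<And>x. x \<in> M \<Longrightarrow> cmod (w x) \<le> K * norm x"
    using w unfolding intertwined_def by blast
  have p: "w \<in> predual M" using w unfolding intertwined_def by auto
  have "cmod (c * w x) \<le> (cmod c * K) * norm x" if "x \<in> M" for x
    using mult_left_mono[OF K(2)[OF that], of "cmod c"] by (simp add: norm_mult mult.assoc)
  then have "\<exists>K\<ge>0. \<forall>x\<in>M. cmod (c * w x) \<le> K * norm x" using K(1) by (intro exI[of _ "cmod c * K"]) auto
  moreover have "q (\<xi> j) (adj (\<pi> (\<lambda>x. c * w x)) \<alpha>) \<beta> - q_twisted (\<lambda>x. c * w x) (\<xi> j) \<alpha> \<beta>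
      = c * (q (\<xi> j) (adj (\<pi> w) \<alpha>) \<beta> - q_twisted w (\<xi> j) \<alpha> \<beta>)" for j \<alpha> \<beta>
    unfolding q_twisted_def
    by (simp add: pi_scale p adj_scaleC pi_Bop q_sesquilinear infsum_cmult_right q_twisted_summable[OF K] right_diff_distrib)
  moreover have "((\<lambda>j. c * (q (\<xi> j) (adj (\<pi> w) \<alpha>) \<beta> - q_twisted w (\<xi> j) \<alpha> \<beta>)) \<longlongrightarrow> 0) F" for \<alpha> \<beta>
    using w unfolding intertwined_def by (intro tendsto_mult_right_zero) auto
  ultimately show ?thesis unfolding intertwined_def using predual_scale[OF p] by simp
qed

lemma intertwined_sum:
  assumes "finite I" "\<And>i. i \<in> I \<Longrightarrow> intertwined (f i)"
  shows "intertwined (\<lambda>x. \<Sum>i\<in>I. f i x)"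
  using assms
proof (induction I rule: finite_induct)
  case empty
  show ?case using intertwined_scale[OF intertwined_vf, of 0] by simp
qed (auto intro: intertwined_add)

lemma intertwined_tf:
  assumes \<mu>: "summable (\<lambda>n. (norm (\<mu> n))\<^sup>2)" and \<nu>: "summable (\<lambda>n. (norm (\<nu> n))\<^sup>2)"
  shows "intertwined (tf \<mu> \<nu>)"
  unfolding intertwined_def
proof (intro conjI allI)
  show "tf \<mu> \<nu> \<in> predual M" by (rule tf_predual[OF \<mu> \<nu>])
  have bd: "cmod (tf \<mu> \<nu> x) \<le> (sqrt (\<Sum>n. (norm (\<mu> n))\<^sup>2) * sqrt (\<Sum>n. (norm (\<nu> n))\<^sup>2)) * norm x"
    if "x \<in> M" "summable (\<lambda>n. (norm (\<mu> n))\<^sup>2)" "summable (\<lambda>n. (norm (\<nu> n))\<^sup>2)" for x \<mu> \<nu>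
    using trace_sum_bound[OF that(2,3), of x] that(1) by (simp add: tf_def mult.commute)
  show "\<exists>K\<ge>0. \<forall>x\<in>M. cmod (tf \<mu> \<nu> x) \<le> K * norm x"
    using bd[OF _ \<mu> \<nu>] \<mu> \<nu> by (intro exI[of _ "sqrt (\<Sum>n. (norm (\<mu> n))\<^sup>2) * sqrt (\<Sum>n. (norm (\<nu> n))\<^sup>2)"])
      (auto intro!: mult_nonneg_nonneg suminf_nonneg)
  fix \<alpha> \<beta>
  let ?t = "\<lambda>N. tf (\<lambda>n. \<mu> (n + N)) (\<lambda>n. \<nu> (n + N))" and ?w = "\<lambda>N x. \<Sum>n<N. vf (\<mu> n) (\<nu> n) x"
  let ?d = "\<lambda>w j. q (\<xi> j) (adj (\<pi> w) \<alpha>) \<beta> - q_twisted w (\<xi> j) \<alpha> \<beta>"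
  have sm: "summable (\<lambda>n. (norm (\<mu> (n + N)))\<^sup>2)" "summable (\<lambda>n. (norm (\<nu> (n + N)))\<^sup>2)" for N
    using \<mu> \<nu> by (auto intro: summable_ignore_initial_segment)
  define K where "K N = sqrt (\<Sum>n. (norm (\<mu> (n + N)))\<^sup>2) * sqrt (\<Sum>n. (norm (\<nu> (n + N)))\<^sup>2)" for N
  have K0: "0 \<le> K N" for N unfolding K_def using sm by (auto intro!: mult_nonneg_nonneg suminf_nonneg)
  have "K \<longlonglongrightarrow> sqrt 0 * sqrt 0" unfolding K_def by (intro tendsto_intros tail_tendsto_0 \<mu> \<nu>)
  then have K_lim: "(\<lambda>N. (C ^ 3 + C\<^sup>2) * norm \<alpha> * norm \<beta> * K N) \<longlonglongrightarrow> 0"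
    by (intro tendsto_mult_right_zero) simp
  have wN: "intertwined (?w N)" for N by (intro intertwined_sum intertwined_vf) simp
  have split: "?d (tf \<mu> \<nu>) j = ?d (?w N) j + ?d (?t N) j" for N j
  proof -
    obtain K' where K': "0 \<le> K'" "\<And>x. x \<in> M \<Longrightarrow> cmod (?w N x) \<le> K' * norm x"
      using wN[of N] unfolding intertwined_def by blast
    have tb: "x \<in> M \<Longrightarrow> cmod (?t N x) \<le> K N * norm x" for x unfolding K_def by (rule bd[OF _ sm])
    have wp: "?w N \<in> predual M" using wN unfolding intertwined_def by blast
    show ?thesis
      unfolding q_twisted_def
      by (subst (1 2) tf_split[OF \<mu> \<nu>, of N])
        (simp add: pi_add wp tf_predual[OF sm] adj_add pi_Bop blinfun.add_left q_sesquilinear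
          infsum_add[OF q_twisted_summable[OF K'] q_twisted_summable[OF K0 tb]])
  qed
  \<comment> \<open>\<open>C ^ 3\<close> is \<open>C\<^sup>2\<close> for the form times
    \<open>C\<close> for \<open>\<pi>\<close> of the tail, and \<open>C\<^sup>2\<close> comes from
    the twisted form. The estimate is uniform in \<open>j\<close>, so the tail can be fixed before
    passing along the net.\<close>
  have small: "cmod (?d (?t N) j) \<le> (C ^ 3 + C\<^sup>2) * norm \<alpha> * norm \<beta> * K N" for N j
  proof -
    have "cmod (q (\<xi> j) (adj (\<pi> (?t N)) \<alpha>) \<beta>) \<le> C\<^sup>2 * (norm (adj (\<pi> (?t N)) \<alpha>)) * norm \<beta>" by (rule q_bound_unit)
    also have "\<dots> \<le> C\<^sup>2 * ((C * K N) * norm \<alpha>) * norm \<beta>"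
      using norm_pi_tf[OF sm, of N N] norm_adj[OF pi_Bop[OF tf_predual[OF sm, of N N]]]
      by (intro mult_right_mono mult_left_mono order_trans[OF norm_blinfun]) (auto simp: K_def)
    finally have 1: "cmod (q (\<xi> j) (adj (\<pi> (?t N)) \<alpha>) \<beta>) \<le> C ^ 3 * norm \<alpha> * norm \<beta> * K N"
      by (simp add: power3_eq_cube power2_eq_square mult_ac)
    have "cmod (q_twisted (?t N) (\<xi> j) \<alpha> \<beta>) \<le> K N * ((C * norm \<alpha> * norm (\<xi> j)) * (C * norm \<beta> * norm (\<xi> j)))"
      by (rule q_twisted_bound[OF K0]) (unfold K_def, rule bd[OF _ sm])
    then have 2: "cmod (q_twisted (?t N) (\<xi> j) \<alpha> \<beta>) \<le> C\<^sup>2 * norm \<alpha> * norm \<beta> * K N"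
      by (simp add: unit power2_eq_square mult_ac)
    have "cmod (?d (?t N) j) \<le> cmod (q (\<xi> j) (adj (\<pi> (?t N)) \<alpha>) \<beta>) + cmod (q_twisted (?t N) (\<xi> j) \<alpha> \<beta>)"
      by (rule norm_triangle_ineq4)
    then show ?thesis using 1 2 by (simp add: distrib_right)
  qed
  show "(?d (tf \<mu> \<nu>) \<longlongrightarrow> 0) F"
  proof (rule tendstoI)
    fix \<epsilon> :: real assume "0 < \<epsilon>"
    then have "0 < \<epsilon> / 2" by simp
    from order_tendstoD(2)[OF K_lim this] obtain N where N: "(C ^ 3 + C\<^sup>2) * norm \<alpha> * norm \<beta> * K N < \<epsilon> / 2"
      unfolding eventually_sequentially by blast
    have "(?d (?w N) \<longlongrightarrow> 0) F" using wN[of N] unfolding intertwined_def by blast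
    from tendstoD[OF this \<open>0 < \<epsilon> / 2\<close>] show "\<forall>\<^sub>F j in F. dist (?d (tf \<mu> \<nu>) j) 0 < \<epsilon>"
    proof eventually_elim
      case (elim j)
      have "cmod (?d (tf \<mu> \<nu>) j) \<le> cmod (?d (?w N) j) + cmod (?d (?t N) j)"
        unfolding split[where N = N] by (rule norm_triangle_ineq)
      then show ?case using elim small[where N = N and j = j] N by simp
    qed
  qed
qed

lemma intertwined_predual:
  assumes "w \<in> predual M"
  shows "intertwined w"
proof (rule predual_finite_sum[OF assms])
  fix n c \<mu> \<nu>
  assume sm: "\<And>i. summable (\<lambda>k. (norm (\<mu> i k :: 'a))\<^sup>2)" "\<And>i. summable (\<lambda>k. (norm (\<nu> i k :: 'a))\<^sup>2)"
    and w: "w = (\<lambda>x. \<Sum>i<n::nat. c i * tf (\<mu> i) (\<nu> i) x)"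
  show ?thesis unfolding w by (intro intertwined_sum intertwined_scale intertwined_tf sm) simp
qed

end

context kac_rep_net
begin

text \<open>At the pairs of \<open>antipode_vector_slice\<close> the two adjoints in the definition
  of sharp cancel, and what remains is an exchange of the indices of \<open>Ws\<close>.\<close>

lemma q_twisted_sharp:
  assumes "is_sharp M W w w'"
  shows "q_twisted w' \<zeta> \<beta> \<alpha> = cnj (q_twisted w \<zeta> \<alpha> \<beta>)"
proof -
  have "w' (Ws u v) = cnj (w (Ws v u))" for u v
    using assms antipode_vector_slice[OF W_Bop, of u v] unfolding is_sharp_def by (auto simp: adj_adj Ws_Bop)
  then show ?thesis unfolding q_twisted_def infsum_cnj[symmetric] by simp
qed

lemma intertwiner:
  obtains Q where "Q \<in> pos Bop" "\<And>\<alpha>. Re (cinner \<alpha> (blinfun_apply Q \<alpha>)) \<le> C\<^sup>2 * (norm \<alpha>)\<^sup>2"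
    "\<And>\<alpha>. (norm \<alpha>)\<^sup>2 \<le> C\<^sup>2 * Re (cinner \<alpha> (blinfun_apply Q \<alpha>))"
    "\<And>w w'. is_sharp M W w w' \<Longrightarrow> \<pi> w o\<^sub>L Q = Q o\<^sub>L adj (\<pi> w')"
proof -
  have "cmod (q (\<xi> j) (fst p) (snd p)) \<le> C\<^sup>2 * norm (fst p) * norm (snd p)" for j p by (rule q_bound_unit)
  \<comment> \<open>The index is a pair of vectors, so that one finer filter serves all arguments of
    the form.\<close>
  from pointwise_cluster_filter[OF F, of "\<lambda>j p. q (\<xi> j) (fst p) (snd p)", OF this]
  obtain F' g where F': "F' \<le> F" "F' \<noteq> bot" and g: "\<And>p. ((\<lambda>j. q (\<xi> j) (fst p) (snd p)) \<longlongrightarrow> g p) F'"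
    by blast
  define b where "b \<alpha> \<beta> = g (\<alpha>, \<beta>)" for \<alpha> \<beta>
  have lim: "((\<lambda>j. q (\<xi> j) \<alpha> \<beta>) \<longlongrightarrow> b \<alpha> \<beta>) F'" for \<alpha> \<beta> using g[of "(\<alpha>, \<beta>)"] by (simp add: b_def)
  note uniq = tendsto_unique[OF F'(2)]
  have bd: "cmod (b \<alpha> \<beta>) \<le> C\<^sup>2 * norm \<alpha> * norm \<beta>" for \<alpha> \<beta>
    by (rule tendsto_upperbound[OF tendsto_norm[OF lim] _ F'(2)]) (intro always_eventually allI q_bound_unit)
  have herm: "b \<beta> \<alpha> = cnj (b \<alpha> \<beta>)" for \<alpha> \<beta>
    by (rule uniq[OF lim]) (use tendsto_cnj[OF lim[of \<alpha> \<beta>]] in \<open>simp add: q_hermitian[of _ \<beta> \<alpha>]\<close>)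
  have lin: "b (\<alpha> + \<alpha>') \<beta> = b \<alpha> \<beta> + b \<alpha>' \<beta>" "b (c *\<^sub>C \<alpha>) \<beta> = cnj c * b \<alpha> \<beta>"
    "b \<alpha> (\<beta> + \<beta>') = b \<alpha> \<beta> + b \<alpha> \<beta>'" "b \<alpha> (c *\<^sub>C \<beta>) = c * b \<alpha> \<beta>" for \<alpha> \<alpha>' \<beta> \<beta>' c
    by (rule uniq[OF lim], use tendsto_add[OF lim[of \<alpha> \<beta>] lim[of \<alpha>' \<beta>]] in \<open>simp add: q_sesquilinear\<close>,
        rule uniq[OF lim], use tendsto_mult_left[OF lim[of \<alpha> \<beta>], of "cnj c"] in \<open>simp add: q_sesquilinear\<close>,
        rule uniq[OF lim], use tendsto_add[OF lim[of \<alpha> \<beta>] lim[of \<alpha> \<beta>']] in \<open>simp add: q_sesquilinear\<close>,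
        rule uniq[OF lim], use tendsto_mult_left[OF lim[of \<alpha> \<beta>], of c] in \<open>simp add: q_sesquilinear\<close>)
  obtain Q where Q: "Q \<in> Bop" "\<And>\<alpha> \<beta>. cinner \<alpha> (blinfun_apply Q \<beta>) = b \<alpha> \<beta>"
    by (rule bounded_form_op[of b "C\<^sup>2"]) (use lin bd in auto)
  have up: "Re (b \<alpha> \<alpha>) \<le> C\<^sup>2 * (norm \<alpha>)\<^sup>2" for \<alpha>
    using order_trans[OF complex_Re_le_cmod bd[of \<alpha> \<alpha>]] by (simp add: power2_eq_square mult_ac)
  have low: "(norm \<alpha>)\<^sup>2 \<le> C\<^sup>2 * Re (b \<alpha> \<alpha>)" for \<alpha>
    by (rule tendsto_lowerbound[OF tendsto_mult_left[OF tendsto_Re[OF lim]] _ F'(2)])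
      (intro always_eventually allI q_lower_unit)
  have nonneg: "0 \<le> Re (b \<alpha> \<alpha>)" for \<alpha>
    by (rule tendsto_lowerbound[OF tendsto_Re[OF lim] _ F'(2)])
      (intro always_eventually allI has_sum_nonneg[OF q_self_has_sum], simp)
  have "Im (b \<alpha> \<alpha>) = 0" for \<alpha> using herm[of \<alpha> \<alpha>] by (simp add: complex_eq_iff)
  then have Qpos: "Q \<in> pos Bop" unfolding pos_Bop_iff using Q nonneg by simp
  have "\<pi> w o\<^sub>L Q = Q o\<^sub>L adj (\<pi> w')" if sharp: "is_sharp M W w w'" for w w'
  proof (rule cinner_ext_op)
    fix \<alpha> \<beta>
    have p: "w \<in> predual M" "w' \<in> predual M" using sharp unfolding is_sharp_def by auto
    \<comment> \<open>Along the finer filter the twisted form has the limit of \<open>q\<close> with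
      \<open>adj (\<pi> w)\<close> in its first argument. For a sharp pair the two twisted forms are
      conjugate, and comparing their limits gives the intertwining relation.\<close>
    have twisted: "((\<lambda>j. q_twisted w (\<xi> j) \<alpha> \<beta>) \<longlongrightarrow> b (adj (\<pi> w) \<alpha>) \<beta>) F'"
      if "w \<in> predual M" for w \<alpha> \<beta>
    proof -
      have "((\<lambda>j. q (\<xi> j) (adj (\<pi> w) \<alpha>) \<beta> - q_twisted w (\<xi> j) \<alpha> \<beta>) \<longlongrightarrow> 0) F'"
        using intertwined_predual[OF that] F'(1) unfolding intertwined_def by (blast intro: tendsto_mono)
      from tendsto_diff[OF lim[of "adj (\<pi> w) \<alpha>" \<beta>] this] show ?thesis by simp
    qed
    have "((\<lambda>j. q_twisted w' (\<xi> j) \<beta> \<alpha>) \<longlongrightarrow> cnj (b (adj (\<pi> w) \<alpha>) \<beta>)) F'"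
      unfolding q_twisted_sharp[OF sharp] by (rule tendsto_cnj[OF twisted[OF p(1)]])
    from uniq[OF twisted[OF p(2)] this] have "b (adj (\<pi> w') \<beta>) \<alpha> = cnj (b (adj (\<pi> w) \<alpha>) \<beta>)" .
    then have "b \<alpha> (adj (\<pi> w') \<beta>) = b (adj (\<pi> w) \<alpha>) \<beta>" using herm[of "adj (\<pi> w') \<beta>" \<alpha>] by simp
    then show "cinner \<alpha> ((\<pi> w o\<^sub>L Q) \<beta>) = cinner \<alpha> ((Q o\<^sub>L adj (\<pi> w')) \<beta>)"
      using p by (simp add: Q(2)[symmetric] cinner_adj_left pi_Bop)
  qed
  then show thesis using that[OF Qpos] up low by (simp add: Q(2))
qed

end

section \<open>Square root of the intertwiner and conclusion\<close>

lemma pos_sqrt: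
  fixes Q :: "'k::chilbert \<Rightarrow>\<^sub>L 'k"
  assumes Q: "Q \<in> pos Bop" and C: "0 < C" and up: "\<And>\<alpha>. Re (cinner \<alpha> (Q \<alpha>)) \<le> C\<^sup>2 * (norm \<alpha>)\<^sup>2"
    and low: "\<And>\<alpha>. (norm \<alpha>)\<^sup>2 \<le> C\<^sup>2 * Re (cinner \<alpha> (Q \<alpha>))"
  obtains S T where "S \<in> Bop" "T \<in> Bop" "adj S = S" "adj T = T" "S o\<^sub>L S = Q"
    "S o\<^sub>L T = id_blinfun" "T o\<^sub>L S = id_blinfun" "norm S \<le> C" "norm T \<le> C"
proof -
  \<comment> \<open>As \<open>Q\<close> lies between \<open>C^(-2)\<close> and \<open>C^2\<close>,
    on a nonzero space \<open>X\<close> lies between 0 and \<open>1 - 1 / C^4\<close>. So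
    \<open>X\<close> has norm below 1 and \<open>sqrt_one_minus\<close> applies to it.\<close>
  define X where "X = id_blinfun - (1 / C\<^sup>2) *\<^sub>R Q"
  have QB: "Q \<in> Bop" using Q unfolding pos_def by simp
  have rX: "Re (cinner u (X u)) = (norm u)\<^sup>2 - Re (cinner u (Q u)) / C\<^sup>2" for u
    unfolding X_def by (simp add: blinfun.diff_left blinfun.scaleR_left cinner_diff_right cinner_scaleR_right cinner_self)
  have iX: "Im (cinner u (X u)) = 0" for u
    using Q unfolding X_def pos_Bop_iff
    by (simp add: blinfun.diff_left blinfun.scaleR_left cinner_diff_right cinner_scaleR_right cinner_self)
  have Xpos: "X \<in> pos Bop"
    unfolding pos_Bop_iff using iX QB up C by (auto simp: rX X_def[symmetric] field_simps) (auto simp: X_def)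
  have "norm X < 1"
  proof (cases "\<exists>\<alpha> :: 'k. \<alpha> \<noteq> 0")
    case True
    then obtain \<alpha> :: 'k where "\<alpha> \<noteq> 0" by blast
    have "(norm \<alpha>)\<^sup>2 \<le> C\<^sup>2 * (C\<^sup>2 * (norm \<alpha>)\<^sup>2)"
      by (rule order_trans[OF low mult_left_mono[OF up]]) simp
    \<comment> \<open>A nonzero vector is compatible with the two bounds on \<open>Q\<close> only if
      the fourth power of \<open>C\<close> is at least 1.\<close>
    then have C1: "1 \<le> C\<^sup>2 * C\<^sup>2" using \<open>\<alpha> \<noteq> 0\<close> by (simp add: mult.assoc[symmetric])
    have "norm X \<le> 1 - 1 / (C\<^sup>2 * C\<^sup>2)"
    proof (rule norm_pos_le[OF Xpos])
      show "0 \<le> 1 - 1 / (C\<^sup>2 * C\<^sup>2)" using C1 C by simp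
      fix u
      have "(norm u)\<^sup>2 / (C\<^sup>2 * C\<^sup>2) \<le> Re (cinner u (Q u)) / C\<^sup>2"
        using low[of u] C by (simp add: field_simps power2_eq_square)
      then show "Re (cinner u (X u)) \<le> (1 - 1 / (C\<^sup>2 * C\<^sup>2)) * (norm u)\<^sup>2"
        unfolding rX by (simp add: left_diff_distrib)
    qed
    moreover have "0 < 1 / (C\<^sup>2 * C\<^sup>2)" using C by simp
    ultimately show ?thesis by linarith
  next
    case False
    then have "X = 0" by (intro blinfun_eqI) auto
    then show ?thesis by simp
  qed
  then obtain Y where Y: "Y \<in> Bop" "adj Y = Y" "(id_blinfun - Y) o\<^sub>L (id_blinfun - Y) = id_blinfun - X"
    using sqrt_one_minus[of Bop X] closed_Bop adj_pos[OF Xpos] Xpos by (auto simp: pos_def)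
  define S where "S = C *\<^sub>R (id_blinfun - Y)"
  have S: "S \<in> Bop" "adj S = S" unfolding S_def using Y by (auto simp: adj_scaleR adj_diff)
  have SS: "S o\<^sub>L S = Q"
  proof -
    have "S o\<^sub>L S = C\<^sup>2 *\<^sub>R ((id_blinfun - Y) o\<^sub>L (id_blinfun - Y))"
      unfolding S_def by (rule blinfun_eqI) (simp add: blinfun.scaleR_left blinfun.scaleR_right power2_eq_square)
    then show ?thesis unfolding Y(3) X_def using C by simp
  qed
  have norm_S: "(norm (S u))\<^sup>2 = Re (cinner u (Q u))" for u
  proof -
    have "cinner (S u) (S u) = cinner u (Q u)"
      using cinner_adj_left[OF S(1), of u "S u"] S(2) SS by (metis blinfun_apply_blinfun_compose)
    then show ?thesis by (metis Re_complex_of_real cinner_self)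
  qed
  have S_le: "norm (S u) \<le> C * norm u" for u
  proof (rule power2_le_imp_le)
    show "(norm (S u))\<^sup>2 \<le> (C * norm u)\<^sup>2" unfolding norm_S using up[of u] by (simp add: power_mult_distrib)
  qed (use C in simp)
  have S_ge: "norm u \<le> C * norm (S u)" for u
  proof (rule power2_le_imp_le)
    show "(norm u)\<^sup>2 \<le> (C * norm (S u))\<^sup>2" using low[of u] by (simp add: power_mult_distrib norm_S)
  qed (use C in simp)
  have dense: "closure (range S) = UNIV"
  proof (rule dense_if_orthogonal_zero)
    show "0 \<in> range S" by (metis blinfun.zero_right rangeI)
    show "x + y \<in> range S" if "x \<in> range S" "y \<in> range S" for x y
      using that by (auto simp flip: blinfun.add_right)
    show "c *\<^sub>C x \<in> range S" if "x \<in> range S" for c x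
      using that by (auto simp flip: Bop_apply[OF S(1)])
    fix v assume v: "\<And>d. d \<in> range S \<Longrightarrow> cinner v d = 0"
    have "cinner (S v) (S v) = 0"
      using v[of "S (S v)"] cinner_adj_left[OF S(1), of v "S v"] S(2) by simp
    then have "S v = 0" by (simp add: cinner_self_eq_0)
    then show "v = 0" using S_ge[of v] by simp
  qed
  \<comment> \<open>The inverse is given on the range of \<open>S\<close>, which is dense because
    \<open>S\<close> is self-adjoint and injective; its norm bound is the lower bound of
    \<open>S\<close>.\<close>
  obtain T where T: "T \<in> Bop" "\<And>u b. (u, b) \<in> range (\<lambda>a. (S a, a)) \<Longrightarrow> blinfun_apply T u = b" "norm T \<le> C"
  proof (rule graph_op[of "range (\<lambda>a. (S a, a))" C])
    show "(0, 0) \<in> range (\<lambda>a. (S a, a))" by (auto simp: image_iff blinfun.zero_right)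
    show "closure (fst ` range (\<lambda>a. (S a, a))) = UNIV" using dense by (simp add: image_image)
  qed (use S_ge C in \<open>auto simp: image_iff blinfun.add_right Bop_apply[OF S(1)]\<close>)
  have TS: "T o\<^sub>L S = id_blinfun" by (rule blinfun_eqI) (use T(2) in auto)
  then have TSa: "T (S a) = a" for a by (metis blinfun_apply_blinfun_compose id_blinfun.rep_eq)
  have "S (T y) = y" for y
    by (rule dense_eq[OF dense, where f = "\<lambda>y. S (T y)" and g = "\<lambda>y. y"]) (auto simp: TSa intro!: continuous_intros)
  then have ST: "S o\<^sub>L T = id_blinfun" by (intro blinfun_eqI) simp
  have "adj T = T"
  proof -
    have "S o\<^sub>L adj T = id_blinfun"
      using adj_compose[OF T(1) S(1)] S(2) TS by simp
    then have "T o\<^sub>L (S o\<^sub>L adj T) = T" by (simp add: blinfun_compose_id)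
    then show ?thesis by (simp add: TS blinfun_compose_id flip: blinfun_compose_assoc)
  qed
  moreover have "norm S \<le> C" by (rule norm_blinfun_bound) (use S_le C in auto)
  ultimately show thesis using that S T SS ST TS by blast
qed

lemma L1_representation_conjugate:
  assumes rep: "L1_representation M \<Delta> \<pi>" and B: "T \<in> Bop" "T' \<in> Bop" "T' o\<^sub>L T = id_blinfun"
  shows "L1_representation M \<Delta> (\<lambda>w. T o\<^sub>L \<pi> w o\<^sub>L T')"
proof -
  have T: "T' (T x) = x" for x using B(3) by (metis blinfun_apply_blinfun_compose id_blinfun.rep_eq)
  show ?thesis
    using rep B(1,2) unfolding L1_representation_def
    by (auto simp: blinfun_eq_iff blinfun.add_left blinfun.add_right Bop_apply T)
qed

lemma (in kac_rep_net) similar_star_representation: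
  "\<exists>T T' :: 'k \<Rightarrow>\<^sub>L 'k. T \<in> Bop \<and> T' \<in> Bop \<and> T o\<^sub>L T' = id_blinfun \<and> T' o\<^sub>L T = id_blinfun \<and>
     star_representation M \<Delta> W (\<lambda>w. T o\<^sub>L \<pi> w o\<^sub>L T') \<and> norm T * norm T' \<le> C ^ 4"
proof (rule intertwiner)
  fix Q assume Q: "Q \<in> pos Bop" "\<And>\<alpha>. Re (cinner \<alpha> (blinfun_apply Q \<alpha>)) \<le> C\<^sup>2 * (norm \<alpha>)\<^sup>2"
    "\<And>\<alpha>. (norm \<alpha>)\<^sup>2 \<le> C\<^sup>2 * Re (cinner \<alpha> (blinfun_apply Q \<alpha>))"
    and inter: "\<And>w w'. is_sharp M W w w' \<Longrightarrow> \<pi> w o\<^sub>L Q = Q o\<^sub>L adj (\<pi> w')"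
  have QB: "Q \<in> Bop" using Q(1) unfolding pos_def by simp
  show ?thesis
  proof (cases "\<exists>\<alpha> :: 'k. \<alpha> \<noteq> 0")
    case True
    then obtain \<alpha> :: 'k where \<alpha>: "\<alpha> \<noteq> 0" by blast
    have "C \<noteq> 0" using Q(3)[of \<alpha>] \<alpha> by auto
    then have C: "0 < C" using C_nonneg by simp
    obtain S T where ST: "S \<in> Bop" "T \<in> Bop" "adj S = S" "adj T = T" "S o\<^sub>L S = Q"
      "S o\<^sub>L T = id_blinfun" "T o\<^sub>L S = id_blinfun" "norm S \<le> C" "norm T \<le> C"
      by (rule pos_sqrt[OF Q(1) C Q(2,3)])
    have "(norm \<alpha>)\<^sup>2 \<le> C\<^sup>2 * (C\<^sup>2 * (norm \<alpha>)\<^sup>2)"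
      by (rule order_trans[OF Q(3) mult_left_mono[OF Q(2)]]) simp
    then have "1 \<le> C\<^sup>2 * C\<^sup>2" using \<alpha> by (simp add: mult.assoc[symmetric])
    then have "1 \<le> C ^ 4" by (simp flip: power_add)
    then have "1 \<le> C" using C power_less_one_iff[of C 4] by (simp add: not_less[symmetric])
    have "norm T * norm S \<le> C * C" using ST C by (intro mult_mono) auto
    also have "C * C \<le> C ^ 4" using power_increasing[OF _ \<open>1 \<le> C\<close>, of 2 4] by (simp add: power2_eq_square)
    finally have le: "norm T * norm S \<le> C ^ 4" .
    have "star_representation M \<Delta> W (\<lambda>w. T o\<^sub>L \<pi> w o\<^sub>L S)"
      unfolding star_representation_def
    proof (intro conjI allI impI)
      show "L1_representation M \<Delta> (\<lambda>w. T o\<^sub>L \<pi> w o\<^sub>L S)"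
        by (rule L1_representation_conjugate[OF rep ST(2,1,6)])
      fix w w' assume sharp: "is_sharp M W w w'"
      then have p: "\<pi> w \<in> Bop" "\<pi> w' \<in> Bop" using pi_Bop unfolding is_sharp_def by auto
      have "adj (\<pi> w o\<^sub>L Q) = adj (Q o\<^sub>L adj (\<pi> w'))" using inter[OF sharp] by simp
      \<comment> \<open>Taking adjoints exchanges the roles of \<open>w\<close> and
        \<open>w'\<close>. Multiplied by \<open>T\<close> on both sides, the relation says that
        conjugation by \<open>T\<close> and \<open>S\<close> sends the sharp operation to the
        adjoint.\<close>
      then have i: "Q o\<^sub>L adj (\<pi> w) = \<pi> w' o\<^sub>L Q"
        using p QB by (simp add: adj_compose adj_adj adj_pos[OF Q(1)])
      have QT: "Q o\<^sub>L T = S" unfolding ST(5)[symmetric] by (simp add: blinfun_compose_assoc ST(6) blinfun_compose_id)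
      have TQ: "T o\<^sub>L Q = S" unfolding ST(5)[symmetric] by (simp add: ST(7) blinfun_compose_id flip: blinfun_compose_assoc)
      have "T o\<^sub>L \<pi> w' o\<^sub>L S = T o\<^sub>L ((\<pi> w' o\<^sub>L Q) o\<^sub>L T)"
        by (simp add: blinfun_compose_assoc QT)
      also have "\<dots> = (T o\<^sub>L Q) o\<^sub>L (adj (\<pi> w) o\<^sub>L T)" by (simp add: blinfun_compose_assoc flip: i)
      also have "\<dots> = adj (T o\<^sub>L \<pi> w o\<^sub>L S)"
        using p ST by (simp add: TQ adj_compose blinfun_compose_assoc)
      finally show "T o\<^sub>L \<pi> w' o\<^sub>L S = adj (T o\<^sub>L \<pi> w o\<^sub>L S)" .
    qed
    then show ?thesis using ST le by blast
  next
    case False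
    \<comment> \<open>On the zero space all operators coincide, so the identity serves;
      \<open>1 \<le> C\<close> may fail there.\<close>
    then have z: "A = B" for A B :: "'k \<Rightarrow>\<^sub>L 'k" by (intro blinfun_eqI) metis
    have star: "star_representation M \<Delta> W (\<lambda>w. id_blinfun o\<^sub>L \<pi> w o\<^sub>L id_blinfun)"
      unfolding star_representation_def
      using L1_representation_conjugate[OF rep, of id_blinfun id_blinfun] z by (auto simp: blinfun_compose_id)
    have "norm (id_blinfun :: 'k \<Rightarrow>\<^sub>L 'k) = 0" using z[of id_blinfun 0] by simp
    then have "norm (id_blinfun :: 'k \<Rightarrow>\<^sub>L 'k) * norm (id_blinfun :: 'k \<Rightarrow>\<^sub>L 'k) \<le> C ^ 4" using C_nonneg by simp
    with star show ?thesis using Bop_intros(1) blinfun_compose_id(1)[of id_blinfun] by blast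
  qed
qed

text \<open>The inequalities that define \<open>cb_bounds\<close> are closed conditions on the
  constant, so the infimum satisfies them and can itself play the role of \<open>C\<close>.\<close>

lemma cb_norm_attained:
  assumes "completely_bounded M \<pi>"
  shows "cb_norm M \<pi> \<in> cb_bounds M \<pi>"
  unfolding cb_norm_def
proof (rule closed_contains_Inf)
  show "cb_bounds M \<pi> \<noteq> {}" using assms unfolding completely_bounded_def .
  show "bdd_below (cb_bounds M \<pi>)" unfolding cb_bounds_def by (auto intro!: bdd_belowI[of _ 0])
  show "closed (cb_bounds M \<pi>)"
    unfolding cb_bounds_def
    by (intro closed_Collect_conj closed_Collect_all closed_Collect_imp open_Collect_const closed_Collect_le continuous_intros)
qed

text \<open>The flip and \<open>W\<close> are isometric, so the condition on the net becomes that
  \<open>W\<close> nearly fixes \<open>\<eta> \<otimes>\<^sub>h \<xi> j\<close>, the quantity that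
  appears in \<open>q_intertwine_vf\<close>.\<close>

lemma norm_dual_unitary:
  assumes "unitary_op W"
  shows "norm (dual_unitary W (a \<otimes>\<^sub>h b) - a \<otimes>\<^sub>h b) = norm (W (b \<otimes>\<^sub>h a) - b \<otimes>\<^sub>h a)"
proof -
  have W: "W \<in> Bop" "\<And>t. adj W (W t) = t" "\<And>t. W (adj W t) = t"
    using assms unfolding unitary_op_def by (auto simp: blinfun_eq_iff)
  have iso: "norm (W t) = norm t" for t
    using cinner_adj_right[OF W(1), of t "W t"] W(2) by (simp add: norm_eq_sqrt_cinner)
  have "dual_unitary W (a \<otimes>\<^sub>h b) - a \<otimes>\<^sub>h b = flip (adj W (b \<otimes>\<^sub>h a) - b \<otimes>\<^sub>h a)"
    unfolding dual_unitary_def by (simp add: flip_htens blinfun.diff_right)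
  then have "norm (dual_unitary W (a \<otimes>\<^sub>h b) - a \<otimes>\<^sub>h b) = norm (W (adj W (b \<otimes>\<^sub>h a) - b \<otimes>\<^sub>h a))"
    by (simp add: norm_flip iso)
  also have "\<dots> = norm (b \<otimes>\<^sub>h a - W (b \<otimes>\<^sub>h a))" by (simp add: blinfun.diff_right W)
  finally show ?thesis by (simp add: norm_minus_commute)
qed

theorem theorem4p1:
  fixes M :: "('h::chilbert \<Rightarrow>\<^sub>L 'h) set"
    and \<Delta> :: "('h \<Rightarrow>\<^sub>L 'h) \<Rightarrow> ('h, 'h) htensor \<Rightarrow>\<^sub>L ('h, 'h) htensor"
    and \<phi> \<psi> :: "('h \<Rightarrow>\<^sub>L 'h) \<Rightarrow> ennreal"
    and \<Lambda> :: "('h \<Rightarrow>\<^sub>L 'h) \<Rightarrow> 'h"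
    and W :: "('h, 'h) htensor \<Rightarrow>\<^sub>L ('h, 'h) htensor"
    and \<xi> :: "'j \<Rightarrow> 'h" and F :: "'j filter"
    and \<pi> :: "(('h \<Rightarrow>\<^sub>L 'h) \<Rightarrow> complex) \<Rightarrow> 'k::chilbert \<Rightarrow>\<^sub>L 'k"
  assumes "lc_quantum_group M \<Delta> \<phi> \<psi>"
    and "gns_map M \<phi> \<Lambda>"
    and "fundamental_unitary M \<Delta> \<phi> \<Lambda> W"
    and "kac_type M \<phi> \<Lambda> W"
    and "dual_coamenable W"
    and "tracial M \<phi>"
    and "F \<noteq> bot"
    and "\<And>j. norm (\<xi> j) = 1"
    and "\<And>\<eta>. ((\<lambda>j. norm (dual_unitary W (\<xi> j \<otimes>\<^sub>h \<eta>) - \<xi> j \<otimes>\<^sub>h \<eta>)) \<longlongrightarrow> 0) F"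
    and "\<And>j. \<xi> j \<in> \<Lambda> ` (n_weight M \<phi> \<inter> center M)"
    and "L1_representation M \<Delta> \<pi>"
    and "nondegenerate M \<pi>"
    and "completely_bounded M \<pi>"
  shows "\<exists>T T' :: 'k \<Rightarrow>\<^sub>L 'k. T \<in> Bop \<and> T' \<in> Bop \<and> T o\<^sub>L T' = id_blinfun \<and> T' o\<^sub>L T = id_blinfun \<and>
           star_representation M \<Delta> W (\<lambda>w. T o\<^sub>L \<pi> w o\<^sub>L T') \<and>
           norm T * norm T' \<le> cb_norm M \<pi> ^ 4"
proof -
  have vN: "von_neumann_algebra M" and hom: "star_hom M (vn_tensor M M) \<Delta>" and nsf: "nsf_weight M \<phi>"
    using assms(1) unfolding lc_quantum_group_def by auto
  interpret coprod_gns M \<phi> \<Lambda> \<Delta> W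
    by standard (use vN hom nsf assms in \<open>auto simp: nsf_weight_def\<close>)
  obtain R where R: "\<And>x. x \<in> M \<Longrightarrow> R x \<in> M" "\<And>x y. x \<in> M \<Longrightarrow> y \<in> M \<Longrightarrow> R (x + y) = R x + R y"
    "\<And>c x. x \<in> M \<Longrightarrow> R (c *\<^sub>B x) = c *\<^sub>B R x" "\<And>x y. x \<in> M \<Longrightarrow> y \<in> M \<Longrightarrow> R (x o\<^sub>L y) = R y o\<^sub>L R x"
    "\<And>x. x \<in> M \<Longrightarrow> R (adj x) = adj (R x)" "\<And>x. x \<in> M \<Longrightarrow> R (R x) = x"
    "\<And>x y. (x, y) \<in> antipode W \<Longrightarrow> x \<in> M \<and> y = R x"
    by (rule kac_type_antipode[OF vN assms(4)]) (rule that; blast)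
  have unitary: "unitary_op W" using assms(3) unfolding fundamental_unitary_def by blast
  interpret kac_rep_net M \<phi> \<Lambda> \<Delta> W R \<pi> "cb_norm M \<pi>" \<xi> F
  proof unfold_locales
    show "cb_norm M \<pi> \<in> cb_bounds M \<pi>" by (rule cb_norm_attained[OF assms(13)])
    show "cinner (\<xi> j) (a (b (\<xi> j))) = cinner (\<xi> j) (b (a (\<xi> j)))" if ab: "a \<in> M" "b \<in> M" for a b j
    proof -
      obtain x where "x \<in> n_weight M \<phi>" "x \<in> center M" "\<xi> j = \<Lambda> x" using assms(10)[of j] by blast
      then show ?thesis using central_vector_trace ab by simp
    qed
    show "((\<lambda>j. norm (W (\<eta> \<otimes>\<^sub>h \<xi> j) - \<eta> \<otimes>\<^sub>h \<xi> j)) \<longlongrightarrow> 0) F" for \<eta>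
      using assms(9)[of \<eta>] unfolding norm_dual_unitary[OF unitary] .
  qed (fact R assms)+
  show ?thesis by (rule similar_star_representation)
qed

end
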